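(* Let $F=\mathbb{Q}_p$ and $e=1$. Let $\mathcal{F}$ be an $NT$-equivariant homological coefficient system of $\Lambda$-modules on $X$ satisfying (Hyp 1), (Hyp 2), (Hyp 3) (with $e=1$), where $\Lambda$ is an Artinian quotient of $\mathfrak{o}$, and suppose that the $k$-vector space $\mathcal{F}(x_+)^{N^{(1)}_0,\,p=0}$ has finite dimension $n$. Then $\mathbf{D}(\mathcal{F})=\mathcal{O}^{(1)}_{\mathcal{E}}\otimes_{\mathcal{L}(N^{(1)}_0)}D(\mathcal{F})$ can be generated as an $\mathcal{O}^{(1)}_{\mathcal{E}}$-module by $n$ elements.
   Context: $F=\mathbb{Q}_p$, $G=\mathrm{GL}_2(\mathbb{Q}_p)$. $X$: Bruhat–Tits tree of $\mathrm{PGL}_2(\mathbb{Q}_p)$ (vertices $X^0$, edges $X^1$ as 2-element vertex sets, distance $d$), with $G$ acting. $\mathfrak{o}$: ring of integers of a finite extension $L/\mathbb{Q}_p$, uniformizer $p_L$, residue field $k$. Homological coefficient system $\mathcal{F}$: modules $\mathcal{F}(\tau)$ for vertices/edges, maps $r^\tau_x:\mathcal{F}(\tau)\to\mathcal{F}(x)$ for $x\in\tau$; $H$-equivariance as usual; $H_0(Y,\mathcal{F})$ for a subcomplex $Y$ is the cokernel of $\bigoplus_{\text{edges of }Y}\mathcal{F}(\tau)\to\bigoplus_{\text{vertices of }Y}\mathcal{F}(x)$, $f\mapsto\sum_{x\in\tau}r^\tau_xf$. $N=\{\begin{pmatrix}1&b\\0&1\end{pmatrix}:b\in\mathbb{Q}_p\}$,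 $N^{(1)}_0$ its subgroup with $b\in\mathbb{Z}_p$, $T=\{\mathrm{diag}(a,1):a\in\mathbb{Q}_p^\times\}$, $t=\mathrm{diag}(p,1)$, $P^{(1)}_\star=\{\begin{pmatrix}a&b\\0&1\end{pmatrix}:a\in\mathbb{Z}_p\setminus\{0\},b\in\mathbb{Z}_p\}$. $x_+$: vertex with $K_{x_+}=\mathrm{GL}_2(\mathbb{Z}_p)$. $\alpha_0$: end given by $(t^{-m}x_+)_{m\ge0}$; $[\alpha_0,z]$: ray from $z$ containing almost all $t^{-m}x_+$; $Z^{(e')}_+(x)=\{z:d(x,z)\le e',x\in[\alpha_0,z]\}$; for $\mu\in X^1$, $x^\mu_+$ the vertex of $\mu$ whose partner lies on $[\alpha_0,x^\mu_+]$; $N^{(1)}_x\subset N$: pointwise stabilizer of $Z^{(0)}_+(x)=\{x\}$. (Hyp 1): all $r^\eta_x$ injective. (Hyp 2): $\mathcal{F}(x^\mu_+)=\sum_{\eta:\mu\cap\eta=\{x^\mu_+\}}\mathrm{im}(r^\eta_{x^\mu_+})$. (Hyp 3): $\mathrm{im}(r^\mu_{x^\mu_+})=\mathcal{F}(x^\mu_+)^{N^{(1)}_{x^\mu_+}}$. $\mathcal{F}(x_+)^{N^{(1)}_0,p=0}$: $N^{(1)}_0$-invariants killed by $p$. $X^0_+=P^{(1)}_\star x_+$, $X_+$ the full subcomplex of $X$ with vertex set $X^0_+$; $N^{(1)}_0$ preserves $X_+$ and acts on $H_0(X_+,\mathcal{F})$. $\mathcal{L}(N^{(1)}_0)=\mathfrak{o}[[N^{(1)}_0]]$;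 $D(\mathcal{F})=\mathrm{Hom}^{\mathrm{ct}}_{\mathfrak{o}}(H_0(X_+,\mathcal{F}),L/\mathfrak{o})$, an $\mathcal{L}(N^{(1)}_0)$-module. $\mathcal{O}^{(1)}_{\mathcal{E}}$: $p$-adic completion of the localization of $\mathcal{L}(N^{(1)}_0)$ at the complement of $p_L\mathcal{L}(N^{(1)}_0)$. *)

theory Defs
  imports
    "HOL-Analysis.Analysis"
    "HOL-Algebra.QuotRing"
    "HOL-Algebra.Free_Abelian_Groups"
    "Jordan_Normal_Form.Missing_VectorSpace"
begin

section \<open>Generalities on rings and modules\<close>

definition artinian_ring :: "('a, 'c) ring_scheme \<Rightarrow> bool" where
  "artinian_ring R \<longleftrightarrow> ring R \<and>
     (\<forall>J :: nat \<Rightarrow> 'a set. (\<forall>i. ideal (J i) R \<and> J (Suc i) \<subseteq> J i) \<longrightarrow> (\<exists>n. \<forall>i\<ge>n. J i = J n))"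

text \<open>The fields \<open>mult\<close> and \<open>one\<close> of a module record are not part of the module structure and are
  left \<open>undefined\<close> throughout.\<close>

definition quot_module :: "('a, 'm, 'c) module_scheme \<Rightarrow> 'm set \<Rightarrow> ('a, 'm set) module" where
  "quot_module M K =
    \<lparr>carrier = a_rcosets\<^bsub>M\<^esub> K, monoid.mult = undefined, monoid.one = undefined,
     ring.zero = K, ring.add = set_add M,
     smult = (\<lambda>r S. \<Union>v\<in>S. K +>\<^bsub>M\<^esub> (r \<odot>\<^bsub>M\<^esub> v))\<rparr>"

definition dsum_module :: "'i set \<Rightarrow> ('i \<Rightarrow> ('a, 'm, 'c) module_scheme) \<Rightarrow> ('a, 'i \<Rightarrow> 'm) module" where
  "dsum_module A M =
    \<lparr>carrier = {f \<in> (\<Pi>\<^sub>E i\<in>A. carrier (M i)). finite {i \<in> A. f i \<noteq> \<zero>\<^bsub>M i\<^esub>}},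
     monoid.mult = undefined, monoid.one = undefined,
     ring.zero = (\<lambda>i\<in>A. \<zero>\<^bsub>M i\<^esub>),
     ring.add = (\<lambda>f g. \<lambda>i\<in>A. f i \<oplus>\<^bsub>M i\<^esub> g i),
     smult = (\<lambda>r f. \<lambda>i\<in>A. r \<odot>\<^bsub>M i\<^esub> f i)\<rparr>"

definition restrict_scalars :: "('r \<Rightarrow> 'a) \<Rightarrow> ('a, 'm, 'c) module_scheme \<Rightarrow> ('r, 'm) module" where
  "restrict_scalars h M =
    \<lparr>carrier = carrier M, monoid.mult = undefined, monoid.one = undefined,
     ring.zero = \<zero>\<^bsub>M\<^esub>, ring.add = ring.add M, smult = (\<lambda>r v. h r \<odot>\<^bsub>M\<^esub> v)\<rparr>"

subsection \<open>Localization and adic completion of commutative rings\<close>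

definition loc_frac :: "('a, 'c) ring_scheme \<Rightarrow> 'a set \<Rightarrow> 'a \<Rightarrow> 'a \<Rightarrow> ('a \<times> 'a) set" where
  "loc_frac R S r s =
     {(r', s') \<in> carrier R \<times> S.
        \<exists>u\<in>S. u \<otimes>\<^bsub>R\<^esub> (r \<otimes>\<^bsub>R\<^esub> s' \<ominus>\<^bsub>R\<^esub> r' \<otimes>\<^bsub>R\<^esub> s) = \<zero>\<^bsub>R\<^esub>}"

definition localization :: "('a, 'c) ring_scheme \<Rightarrow> 'a set \<Rightarrow> ('a \<times> 'a) set ring" where
  "localization R S =
    \<lparr>carrier = {loc_frac R S r s | r s. r \<in> carrier R \<and> s \<in> S},
     monoid.mult = (\<lambda>V W. \<Union>(r, s)\<in>V. \<Union>(r', s')\<in>W. loc_frac R S (r \<otimes>\<^bsub>R\<^esub> r') (s \<otimes>\<^bsub>R\<^esub> s')),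
     monoid.one = loc_frac R S \<one>\<^bsub>R\<^esub> \<one>\<^bsub>R\<^esub>,
     ring.zero = loc_frac R S \<zero>\<^bsub>R\<^esub> \<one>\<^bsub>R\<^esub>,
     ring.add = (\<lambda>V W. \<Union>(r, s)\<in>V. \<Union>(r', s')\<in>W.
             loc_frac R S (r \<otimes>\<^bsub>R\<^esub> s' \<oplus>\<^bsub>R\<^esub> r' \<otimes>\<^bsub>R\<^esub> s) (s \<otimes>\<^bsub>R\<^esub> s'))\<rparr>"

text \<open>The completion is \<open>lim R/a^n R\<close>. For cosets of the nested ideals \<open>a^(n+1) R\<close> and \<open>a^n R\<close>, being
  related by the transition map means inclusion.\<close>

definition adic_quot :: "('a, 'c) ring_scheme \<Rightarrow> 'a \<Rightarrow> nat \<Rightarrow> 'a set ring" where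
  "adic_quot R a n = R Quot (PIdl\<^bsub>R\<^esub> (a [^]\<^bsub>R\<^esub> n))"

definition adic_completion :: "('a, 'c) ring_scheme \<Rightarrow> 'a \<Rightarrow> (nat \<Rightarrow> 'a set) ring" where
  "adic_completion R a =
    \<lparr>carrier = {s. (\<forall>n. s n \<in> carrier (adic_quot R a n)) \<and> (\<forall>n. s (Suc n) \<subseteq> s n)},
     monoid.mult = (\<lambda>s s' n. s n \<otimes>\<^bsub>adic_quot R a n\<^esub> s' n),
     monoid.one = (\<lambda>n. \<one>\<^bsub>adic_quot R a n\<^esub>),
     ring.zero = (\<lambda>n. \<zero>\<^bsub>adic_quot R a n\<^esub>),
     ring.add = (\<lambda>s s' n. s n \<oplus>\<^bsub>adic_quot R a n\<^esub> s' n)\<rparr>"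

definition to_completion :: "('a, 'c) ring_scheme \<Rightarrow> 'a \<Rightarrow> 'a \<Rightarrow> nat \<Rightarrow> 'a set" where
  "to_completion R a r = (\<lambda>n. PIdl\<^bsub>R\<^esub> (a [^]\<^bsub>R\<^esub> n) +>\<^bsub>R\<^esub> r)"

subsection \<open>Base change of a module along a homomorphism of commutative rings\<close>

text \<open>\<open>A \<otimes>\<^sub>R M\<close> for \<open>h : R \<rightarrow> A\<close>: the free abelian group on \<open>A \<times> M\<close> modulo the usual relations, with
  \<open>A\<close> acting through the first factor.\<close>

definition tensor_relations ::
  "('a, 'c) ring_scheme \<Rightarrow> ('r, 'd) ring_scheme \<Rightarrow> ('r \<Rightarrow> 'a) \<Rightarrow> ('r, 'm, 'e) module_scheme \<Rightarrow> ('a \<times> 'm \<Rightarrow>\<^sub>0 int) set" where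
  "tensor_relations A R h M =
     {frag_of (a \<oplus>\<^bsub>A\<^esub> a', m) - frag_of (a, m) - frag_of (a', m) | a a' m.
        a \<in> carrier A \<and> a' \<in> carrier A \<and> m \<in> carrier M} \<union>
     {frag_of (a, m \<oplus>\<^bsub>M\<^esub> m') - frag_of (a, m) - frag_of (a, m') | a m m'.
        a \<in> carrier A \<and> m \<in> carrier M \<and> m' \<in> carrier M} \<union>
     {frag_of (a \<otimes>\<^bsub>A\<^esub> h r, m) - frag_of (a, r \<odot>\<^bsub>M\<^esub> m) | a r m.
        a \<in> carrier A \<and> r \<in> carrier R \<and> m \<in> carrier M}"

definition base_change ::
  "('a, 'c) ring_scheme \<Rightarrow> ('r, 'd) ring_scheme \<Rightarrow> ('r \<Rightarrow> 'a) \<Rightarrow> ('r, 'm, 'e) module_scheme \<Rightarrow>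
     ('a, ('a \<times> 'm \<Rightarrow>\<^sub>0 int) set) module" where
  "base_change A R h M =
    (let Fr = free_Abelian_group (carrier A \<times> carrier M);
         K = generate Fr (tensor_relations A R h M)
     in \<lparr>carrier = carrier (Fr Mod K), monoid.mult = undefined, monoid.one = undefined,
         ring.zero = \<one>\<^bsub>Fr Mod K\<^esub>,
         ring.add = monoid.mult (Fr Mod K),
         smult = (\<lambda>a S. \<Union>z\<in>S. K #>\<^bsub>Fr\<^esub> frag_extend (\<lambda>(b, m). frag_of (a \<otimes>\<^bsub>A\<^esub> b, m)) z)\<rparr>)"

subsection \<open>Group rings and completed group rings\<close>

definition group_ring :: "('a, 'c) ring_scheme \<Rightarrow> ('g, 'd) monoid_scheme \<Rightarrow> ('g \<Rightarrow> 'a) ring" where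
  "group_ring R G =
    \<lparr>carrier = {f \<in> carrier G \<rightarrow>\<^sub>E carrier R. finite {g \<in> carrier G. f g \<noteq> \<zero>\<^bsub>R\<^esub>}},
     monoid.mult = (\<lambda>f h. \<lambda>x\<in>carrier G.
        \<Oplus>\<^bsub>R\<^esub>y\<in>{y \<in> carrier G. f y \<noteq> \<zero>\<^bsub>R\<^esub>}. f y \<otimes>\<^bsub>R\<^esub> h (inv\<^bsub>G\<^esub> y \<otimes>\<^bsub>G\<^esub> x)),
     monoid.one = (\<lambda>x\<in>carrier G. if x = \<one>\<^bsub>G\<^esub> then \<one>\<^bsub>R\<^esub> else \<zero>\<^bsub>R\<^esub>),
     ring.zero = (\<lambda>x\<in>carrier G. \<zero>\<^bsub>R\<^esub>),
     ring.add = (\<lambda>f h. \<lambda>x\<in>carrier G. f x \<oplus>\<^bsub>R\<^esub> h x)\<rparr>"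

text \<open>\<open>R[[G]] = lim R[G/U m]\<close> for a decreasing sequence of normal subgroups \<open>U m\<close> of finite index; the
  transition maps sum the coefficients over the cosets of \<open>U (m+1)\<close> inside a coset of \<open>U m\<close>.\<close>

definition completed_group_ring ::
  "('a, 'c) ring_scheme \<Rightarrow> ('g, 'd) monoid_scheme \<Rightarrow> (nat \<Rightarrow> 'g set) \<Rightarrow> (nat \<Rightarrow> 'g set \<Rightarrow> 'a) ring" where
  "completed_group_ring R G U =
    \<lparr>carrier = {l. (\<forall>m. l m \<in> carrier (group_ring R (G Mod U m))) \<and>
                   (\<forall>m. \<forall>C\<in>carrier (G Mod U m).
                      l m C = (\<Oplus>\<^bsub>R\<^esub>C'\<in>{C' \<in> carrier (G Mod U (Suc m)). C' \<subseteq> C}. l (Suc m) C'))},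
     monoid.mult = (\<lambda>l l' m. l m \<otimes>\<^bsub>group_ring R (G Mod U m)\<^esub> l' m),
     monoid.one = (\<lambda>m. \<one>\<^bsub>group_ring R (G Mod U m)\<^esub>),
     ring.zero = (\<lambda>m. \<zero>\<^bsub>group_ring R (G Mod U m)\<^esub>),
     ring.add = (\<lambda>l l' m. l m \<oplus>\<^bsub>group_ring R (G Mod U m)\<^esub> l' m)\<rparr>"

definition cgr_scalar ::
  "('a, 'c) ring_scheme \<Rightarrow> ('g, 'd) monoid_scheme \<Rightarrow> (nat \<Rightarrow> 'g set) \<Rightarrow> 'a \<Rightarrow> nat \<Rightarrow> 'g set \<Rightarrow> 'a" where
  "cgr_scalar R G U c = (\<lambda>m. \<lambda>C\<in>carrier (G Mod U m). if C = \<one>\<^bsub>G Mod U m\<^esub> then c else \<zero>\<^bsub>R\<^esub>)"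


section \<open>The field of \<open>p\<close>-adic numbers and its finite extensions\<close>

text \<open>\<open>\<rat>\<^sub>p\<close> is the completion of \<open>\<rat>\<close> for the \<open>p\<close>-adic absolute value: a complete field in which \<open>\<rat>\<close> is
  dense, with an absolute value extending the \<open>p\<close>-adic one.\<close>

definition is_Qp :: "nat \<Rightarrow> ('q::field_char_0 \<Rightarrow> real) \<Rightarrow> bool" where
  "is_Qp p nrm \<longleftrightarrow> Factorial_Ring.prime p \<and>
     (\<forall>x. 0 \<le> nrm x) \<and> (\<forall>x. nrm x = 0 \<longleftrightarrow> x = 0) \<and>
     (\<forall>x y. nrm (x * y) = nrm x * nrm y) \<and>
     (\<forall>x y. nrm (x + y) \<le> max (nrm x) (nrm y)) \<and>
     (\<forall>a::int. a \<noteq> 0 \<longrightarrow> nrm (of_int a) = (1 / real p) ^ multiplicity (int p) a) \<and>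
     (\<forall>x. \<forall>e>0. \<exists>r::rat. nrm (x - of_rat r) < e) \<and>
     (\<forall>s::nat \<Rightarrow> 'q. (\<forall>e>0. \<exists>M. \<forall>i\<ge>M. \<forall>j\<ge>M. nrm (s i - s j) < e) \<longrightarrow>
        (\<exists>x. \<forall>e>0. \<exists>M. \<forall>i\<ge>M. nrm (s i - x) < e))"

definition Zp :: "('q \<Rightarrow> real) \<Rightarrow> 'q::field_char_0 set" where
  "Zp nrm = {x. nrm x \<le> 1}"

definition finite_extension :: "('q::field \<Rightarrow> 'l::field) \<Rightarrow> bool" where
  "finite_extension emb \<longleftrightarrow> emb 1 = 1 \<and>
     (\<forall>x y. emb (x + y) = emb x + emb y) \<and> (\<forall>x y. emb (x * y) = emb x * emb y) \<and>
     (\<exists>B. finite B \<and> (\<forall>y. \<exists>c. y = (\<Sum>b\<in>B. emb (c b) * b)))"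

definition field_ring :: "'l::field ring" where
  "field_ring = \<lparr>carrier = UNIV, monoid.mult = (*), monoid.one = 1, ring.zero = 0, ring.add = (+)\<rparr>"

text \<open>\<open>\<oo>\<close>: the integral closure of \<open>\<int>\<^sub>p\<close> in \<open>L\<close>.\<close>

definition int_ring :: "('q::field_char_0 \<Rightarrow> real) \<Rightarrow> ('q \<Rightarrow> 'l::field) \<Rightarrow> 'l ring" where
  "int_ring nrm emb = field_ring\<lparr>carrier :=
     {y. \<exists>f :: 'q poly. lead_coeff f = 1 \<and> (\<forall>i. Polynomial.coeff f i \<in> Zp nrm) \<and> poly (map_poly emb f) y = 0}\<rparr>"

definition is_uniformizer :: "('a, 'c) ring_scheme \<Rightarrow> 'a \<Rightarrow> bool" where
  "is_uniformizer R a \<longleftrightarrow> a \<in> carrier R \<and> maximalideal (PIdl\<^bsub>R\<^esub> a) R"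

definition L_mod_o :: "('l::field, 'c) ring_scheme \<Rightarrow> ('l, 'l set) module" where
  "L_mod_o R = quot_module
     \<lparr>carrier = UNIV, monoid.mult = (*), monoid.one = 1, ring.zero = 0, ring.add = (+), smult = (*)\<rparr> (carrier R)"


section \<open>The Bruhat--Tits tree of \<open>PGL\<^sub>2(\<rat>\<^sub>p)\<close>\<close>

text \<open>Vertices are homothety classes of lattices in \<open>\<rat>\<^sub>p\<^sup>2\<close>; matrices act on column vectors. Simplices
  are sets of vertices, so a vertex \<open>x\<close> is the simplex \<open>{x}\<close>.\<close>

type_synonym 'q vertex = "('q ^ 2) set set"
type_synonym 'q tree_simplex = "'q vertex set"

definition is_lattice :: "('q::field_char_0 \<Rightarrow> real) \<Rightarrow> ('q ^ 2) set \<Rightarrow> bool" where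
  "is_lattice nrm A \<longleftrightarrow> (\<exists>u v. (\<forall>a b. a *s u + b *s v = 0 \<longrightarrow> a = 0 \<and> b = 0) \<and>
      A = {a *s u + b *s v | a b. a \<in> Zp nrm \<and> b \<in> Zp nrm})"

definition homothety_class :: "('q::field ^ 2) set \<Rightarrow> 'q vertex" where
  "homothety_class A = {(\<lambda>v. c *s v) ` A | c. c \<noteq> 0}"

definition X0 :: "('q::field_char_0 \<Rightarrow> real) \<Rightarrow> 'q vertex set" where
  "X0 nrm = {homothety_class A | A. is_lattice nrm A}"

definition X1 :: "nat \<Rightarrow> ('q::field_char_0 \<Rightarrow> real) \<Rightarrow> 'q tree_simplex set" where
  "X1 p nrm = {{homothety_class A, homothety_class B} | A B.
     is_lattice nrm A \<and> is_lattice nrm B \<and> (\<lambda>v. of_nat p *s v) ` A \<subset> B \<and> B \<subset> A}"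

definition simplices :: "nat \<Rightarrow> ('q::field_char_0 \<Rightarrow> real) \<Rightarrow> 'q tree_simplex set" where
  "simplices p nrm = (\<lambda>x. {x}) ` X0 nrm \<union> X1 p nrm"

definition tree_dist :: "nat \<Rightarrow> ('q::field_char_0 \<Rightarrow> real) \<Rightarrow> 'q vertex \<Rightarrow> 'q vertex \<Rightarrow> nat" where
  "tree_dist p nrm x y = (LEAST n. (x, y) \<in> {(z, w). {z, w} \<in> X1 p nrm} ^^ n)"

definition mat2 :: "'q::field \<Rightarrow> 'q \<Rightarrow> 'q \<Rightarrow> 'q \<Rightarrow> 'q ^ 2 ^ 2" where
  "mat2 a b c d = vector [vector [a, b], vector [c, d]]"

definition vact :: "'q::field ^ 2 ^ 2 \<Rightarrow> 'q vertex \<Rightarrow> 'q vertex" where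
  "vact g x = (\<lambda>A. (\<lambda>v. g *v v) ` A) ` x"

definition sact :: "'q::field ^ 2 ^ 2 \<Rightarrow> 'q tree_simplex \<Rightarrow> 'q tree_simplex" where
  "sact g s = vact g ` s"

definition Ngrp :: "('q::field ^ 2 ^ 2) set" where
  "Ngrp = {mat2 1 b 0 1 | b. True}"

definition Tgrp :: "('q::field ^ 2 ^ 2) set" where
  "Tgrp = {mat2 a 0 0 1 | a. a \<noteq> 0}"

definition NTgrp :: "('q::field ^ 2 ^ 2) set" where
  "NTgrp = {n ** t | n t. n \<in> Ngrp \<and> t \<in> Tgrp}"

text \<open>\<open>N\<^sub>0\<close> and its subgroups \<open>N\<^sub>0^(p^m)\<close>, a neighbourhood basis of the identity.\<close>

definition N0 :: "('q::field_char_0 \<Rightarrow> real) \<Rightarrow> ('q ^ 2 ^ 2) set" where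
  "N0 nrm = {mat2 1 b 0 1 | b. b \<in> Zp nrm}"

definition N0_grp :: "('q::field_char_0 \<Rightarrow> real) \<Rightarrow> ('q ^ 2 ^ 2) monoid" where
  "N0_grp nrm = \<lparr>carrier = N0 nrm, monoid.mult = (**), monoid.one = mat 1\<rparr>"

definition N0_sub :: "nat \<Rightarrow> ('q::field_char_0 \<Rightarrow> real) \<Rightarrow> nat \<Rightarrow> ('q ^ 2 ^ 2) set" where
  "N0_sub p nrm m = {mat2 1 (of_nat p ^ m * b) 0 1 | b. b \<in> Zp nrm}"

definition Pstar :: "('q::field_char_0 \<Rightarrow> real) \<Rightarrow> ('q ^ 2 ^ 2) set" where
  "Pstar nrm = {mat2 a b 0 1 | a b. a \<in> Zp nrm - {0} \<and> b \<in> Zp nrm}"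

definition xplus :: "('q::field_char_0 \<Rightarrow> real) \<Rightarrow> 'q vertex" where
  "xplus nrm = homothety_class {v. \<forall>i. v $ i \<in> Zp nrm}"

definition X0plus :: "('q::field_char_0 \<Rightarrow> real) \<Rightarrow> 'q vertex set" where
  "X0plus nrm = (\<lambda>g. vact g (xplus nrm)) ` Pstar nrm"

text \<open>The sequence \<open>t^(-m) x\<^sub>+\<close> defining the end \<open>\<alpha>\<^sub>0\<close>, and \<open>[\<alpha>\<^sub>0, z]\<close> as the vertex set of the
  half-line without backtracking that starts in \<open>z\<close> and contains almost all of that sequence.\<close>

definition end_seq :: "nat \<Rightarrow> ('q::field_char_0 \<Rightarrow> real) \<Rightarrow> nat \<Rightarrow> 'q vertex" where
  "end_seq p nrm m = (vact (matrix_inv (mat2 (of_nat p) 0 0 1)) ^^ m) (xplus nrm)"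

definition end_ray :: "nat \<Rightarrow> ('q::field_char_0 \<Rightarrow> real) \<Rightarrow> 'q vertex \<Rightarrow> 'q vertex set" where
  "end_ray p nrm z = \<Union> {range r | r :: nat \<Rightarrow> 'q vertex. r 0 = z \<and> inj r \<and>
      (\<forall>i. {r i, r (Suc i)} \<in> X1 p nrm) \<and> finite {m. end_seq p nrm m \<notin> range r}}"

definition Zplus :: "nat \<Rightarrow> ('q::field_char_0 \<Rightarrow> real) \<Rightarrow> nat \<Rightarrow> 'q vertex \<Rightarrow> 'q vertex set" where
  "Zplus p nrm e' x = {z \<in> X0 nrm. tree_dist p nrm x z \<le> e' \<and> x \<in> end_ray p nrm z}"

definition Nstab :: "nat \<Rightarrow> ('q::field_char_0 \<Rightarrow> real) \<Rightarrow> 'q vertex \<Rightarrow> ('q ^ 2 ^ 2) set" where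
  "Nstab p nrm x = {g \<in> Ngrp. \<forall>z\<in>Zplus p nrm 0 x. vact g z = z}"

definition edge_plus :: "nat \<Rightarrow> ('q::field_char_0 \<Rightarrow> real) \<Rightarrow> 'q tree_simplex \<Rightarrow> 'q vertex" where
  "edge_plus p nrm s = (THE x. x \<in> s \<and> (\<exists>y. y \<noteq> x \<and> s = {x, y} \<and> y \<in> end_ray p nrm x))"


section \<open>Equivariant coefficient systems and their homology\<close>

record ('q, 'a, 'm) coeff_sys =
  sec :: "'q tree_simplex \<Rightarrow> ('a, 'm) module"
  res :: "'q tree_simplex \<Rightarrow> 'q vertex \<Rightarrow> 'm \<Rightarrow> 'm"
  act :: "'q ^ 2 ^ 2 \<Rightarrow> 'q tree_simplex \<Rightarrow> 'm \<Rightarrow> 'm"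

definition coefficient_system ::
  "nat \<Rightarrow> ('q::field_char_0 \<Rightarrow> real) \<Rightarrow> ('a, 'c) ring_scheme \<Rightarrow> ('q, 'a, 'm) coeff_sys \<Rightarrow> bool" where
  "coefficient_system p nrm R F \<longleftrightarrow>
     (\<forall>s\<in>simplices p nrm. Module.module R (sec F s)) \<and>
     (\<forall>s\<in>X1 p nrm. \<forall>x\<in>s. res F s x \<in> module_hom R (sec F s) (sec F {x}))"

definition equivariant_coefficient_system ::
  "nat \<Rightarrow> ('q::field_char_0 \<Rightarrow> real) \<Rightarrow> ('q ^ 2 ^ 2) set \<Rightarrow> ('a, 'c) ring_scheme \<Rightarrow> ('q, 'a, 'm) coeff_sys \<Rightarrow> bool" where
  "equivariant_coefficient_system p nrm H R F \<longleftrightarrow> coefficient_system p nrm R F \<and>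
     (\<forall>g\<in>H. \<forall>s\<in>simplices p nrm. act F g s \<in> module_hom R (sec F s) (sec F (sact g s))) \<and>
     (\<forall>s\<in>simplices p nrm. \<forall>f\<in>carrier (sec F s). act F (mat 1) s f = f) \<and>
     (\<forall>g\<in>H. \<forall>h\<in>H. \<forall>s\<in>simplices p nrm. \<forall>f\<in>carrier (sec F s).
        act F g (sact h s) (act F h s f) = act F (g ** h) s f) \<and>
     (\<forall>g\<in>H. \<forall>s\<in>X1 p nrm. \<forall>x\<in>s. \<forall>f\<in>carrier (sec F s).
        act F g {x} (res F s x f) = res F (sact g s) (vact g x) (act F g s f))"

definition Hyp1 :: "nat \<Rightarrow> ('q::field_char_0 \<Rightarrow> real) \<Rightarrow> ('q, 'a, 'm) coeff_sys \<Rightarrow> bool" where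
  "Hyp1 p nrm F \<longleftrightarrow> (\<forall>s\<in>X1 p nrm. \<forall>x\<in>s. inj_on (res F s x) (carrier (sec F s)))"

definition Hyp2 :: "nat \<Rightarrow> ('q::field_char_0 \<Rightarrow> real) \<Rightarrow> ('q, 'a, 'm) coeff_sys \<Rightarrow> bool" where
  "Hyp2 p nrm F \<longleftrightarrow> (\<forall>s\<in>X1 p nrm. let x = edge_plus p nrm s; E = {s' \<in> X1 p nrm. s \<inter> s' = {x}} in
     carrier (sec F {x}) =
       {\<Oplus>\<^bsub>sec F {x}\<^esub>s'\<in>A. v s' | A v. finite A \<and> A \<subseteq> E \<and> (\<forall>s'\<in>A. v s' \<in> res F s' x ` carrier (sec F s'))})"

definition Hyp3 :: "nat \<Rightarrow> ('q::field_char_0 \<Rightarrow> real) \<Rightarrow> ('q, 'a, 'm) coeff_sys \<Rightarrow> bool" where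
  "Hyp3 p nrm F \<longleftrightarrow> (\<forall>s\<in>X1 p nrm. let x = edge_plus p nrm s in
     res F s x ` carrier (sec F s) = {v \<in> carrier (sec F {x}). \<forall>g\<in>Nstab p nrm x. act F g {x} v = v})"

text \<open>\<open>H\<^sub>0(Y, F)\<close> for the full subcomplex \<open>Y\<close> with vertex set \<open>Y0\<close>. In the boundary map the edges where
  the chain vanishes are left out only in order to have a finite index set.\<close>

definition edges_on :: "nat \<Rightarrow> ('q::field_char_0 \<Rightarrow> real) \<Rightarrow> 'q vertex set \<Rightarrow> 'q tree_simplex set" where
  "edges_on p nrm Y0 = {s \<in> X1 p nrm. s \<subseteq> Y0}"

definition boundary ::
  "nat \<Rightarrow> ('q::field_char_0 \<Rightarrow> real) \<Rightarrow> ('q, 'a, 'm) coeff_sys \<Rightarrow> 'q vertex set \<Rightarrow> ('q tree_simplex \<Rightarrow> 'm) \<Rightarrow> 'q vertex \<Rightarrow> 'm" where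
  "boundary p nrm F Y0 f = (\<lambda>x\<in>Y0.
     \<Oplus>\<^bsub>sec F {x}\<^esub>s\<in>{s \<in> edges_on p nrm Y0. x \<in> s \<and> f s \<noteq> \<zero>\<^bsub>sec F s\<^esub>}. res F s x (f s))"

definition H0 ::
  "nat \<Rightarrow> ('q::field_char_0 \<Rightarrow> real) \<Rightarrow> ('q, 'a, 'm) coeff_sys \<Rightarrow> 'q vertex set \<Rightarrow> ('a, ('q vertex \<Rightarrow> 'm) set) module" where
  "H0 p nrm F Y0 = quot_module (dsum_module Y0 (\<lambda>x. sec F {x}))
     (boundary p nrm F Y0 ` carrier (dsum_module (edges_on p nrm Y0) (sec F)))"

definition H0_act ::
  "('q, 'a, 'm) coeff_sys \<Rightarrow> 'q::field vertex set \<Rightarrow> 'q ^ 2 ^ 2 \<Rightarrow> ('q vertex \<Rightarrow> 'm) set \<Rightarrow> ('q vertex \<Rightarrow> 'm) set" where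
  "H0_act F Y0 g = image (\<lambda>c. \<lambda>y\<in>Y0. let y' = vact (matrix_inv g) y in act F g {y'} (c y'))"


section \<open>The module \<open>D(F)\<close> over \<open>\<oo>[[N\<^sub>0]]\<close> and its base change\<close>

definition iwasawa ::
  "nat \<Rightarrow> ('q::field_char_0 \<Rightarrow> real) \<Rightarrow> ('q \<Rightarrow> 'l::field) \<Rightarrow> (nat \<Rightarrow> ('q ^ 2 ^ 2) set \<Rightarrow> 'l) ring" where
  "iwasawa p nrm emb = completed_group_ring (int_ring nrm emb) (N0_grp nrm) (N0_sub p nrm)"

text \<open>The modules over \<open>\<oo>/J\<close> are regarded as \<open>\<oo>\<close>-modules. \<open>H\<^sub>0\<close> carries the discrete topology, so every
  homomorphism to \<open>L/\<oo>\<close> is continuous. The group acts on \<open>D(F)\<close> by \<open>(g f)(v) = f (g\<inverse> v)\<close>. An element \<open>l\<close>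
  of \<open>\<oo>[[N\<^sub>0]]\<close> acts by the continuous \<open>\<oo>\<close>-linear extension: \<open>(l f)(v)\<close> is the sum of
  \<open>l\<^sub>m(g U\<^sub>m) f (g\<inverse> v)\<close> over \<open>N\<^sub>0/U\<^sub>m\<close> for any \<open>m\<close> such that \<open>U\<^sub>m = N\<^sub>0^(p^m)\<close> fixes \<open>v\<close>.\<close>

definition Ddual ::
  "nat \<Rightarrow> ('q::field_char_0 \<Rightarrow> real) \<Rightarrow> ('q \<Rightarrow> 'l::field) \<Rightarrow> 'l set \<Rightarrow> ('q, 'l set, 'm) coeff_sys \<Rightarrow>
     (nat \<Rightarrow> ('q ^ 2 ^ 2) set \<Rightarrow> 'l, ('q vertex \<Rightarrow> 'm) set \<Rightarrow> 'l set) module" where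
  "Ddual p nrm emb J F =
    (let \<O> = int_ring nrm emb;
         H = restrict_scalars (\<lambda>c. J +>\<^bsub>\<O>\<^esub> c) (H0 p nrm F (X0plus nrm));
         Q = L_mod_o \<O>
     in \<lparr>carrier = module_hom \<O> H Q \<inter> extensional (carrier H),
         monoid.mult = undefined, monoid.one = undefined,
         ring.zero = (\<lambda>v\<in>carrier H. \<zero>\<^bsub>Q\<^esub>),
         ring.add = (\<lambda>f f'. \<lambda>v\<in>carrier H. f v \<oplus>\<^bsub>Q\<^esub> f' v),
         smult = (\<lambda>l f. \<lambda>v\<in>carrier H.
           let m = (LEAST m. \<forall>u\<in>N0_sub p nrm m. H0_act F (X0plus nrm) u v = v)
           in \<Oplus>\<^bsub>Q\<^esub>C\<in>carrier (N0_grp nrm Mod N0_sub p nrm m).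
                l m C \<odot>\<^bsub>Q\<^esub> f (H0_act F (X0plus nrm) (matrix_inv (SOME g. g \<in> C)) v))\<rparr>)"

definition OE_loc ::
  "nat \<Rightarrow> ('q::field_char_0 \<Rightarrow> real) \<Rightarrow> ('q \<Rightarrow> 'l::field) \<Rightarrow> 'l \<Rightarrow> (nat \<Rightarrow> ('q ^ 2 ^ 2) set \<Rightarrow> 'l) set" where
  "OE_loc p nrm emb pL = carrier (iwasawa p nrm emb) -
     PIdl\<^bsub>iwasawa p nrm emb\<^esub> (cgr_scalar (int_ring nrm emb) (N0_grp nrm) (N0_sub p nrm) pL)"

definition OE ::
  "nat \<Rightarrow> ('q::field_char_0 \<Rightarrow> real) \<Rightarrow> ('q \<Rightarrow> 'l::field) \<Rightarrow> 'l \<Rightarrow>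
     (nat \<Rightarrow> ((nat \<Rightarrow> ('q ^ 2 ^ 2) set \<Rightarrow> 'l) \<times> (nat \<Rightarrow> ('q ^ 2 ^ 2) set \<Rightarrow> 'l)) set set) ring" where
  "OE p nrm emb pL =
    (let R = localization (iwasawa p nrm emb) (OE_loc p nrm emb pL)
     in adic_completion R ([p] \<cdot>\<^bsub>R\<^esub> \<one>\<^bsub>R\<^esub>))"

definition to_OE ::
  "nat \<Rightarrow> ('q::field_char_0 \<Rightarrow> real) \<Rightarrow> ('q \<Rightarrow> 'l::field) \<Rightarrow> 'l \<Rightarrow> (nat \<Rightarrow> ('q ^ 2 ^ 2) set \<Rightarrow> 'l) \<Rightarrow>
     nat \<Rightarrow> ((nat \<Rightarrow> ('q ^ 2 ^ 2) set \<Rightarrow> 'l) \<times> (nat \<Rightarrow> ('q ^ 2 ^ 2) set \<Rightarrow> 'l)) set set" where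
  "to_OE p nrm emb pL l =
    (let R = localization (iwasawa p nrm emb) (OE_loc p nrm emb pL)
     in to_completion R ([p] \<cdot>\<^bsub>R\<^esub> \<one>\<^bsub>R\<^esub>)
          (loc_frac (iwasawa p nrm emb) (OE_loc p nrm emb pL) l \<one>\<^bsub>iwasawa p nrm emb\<^esub>))"

definition DD where
  "DD p nrm emb pL J F =
     base_change (OE p nrm emb pL) (iwasawa p nrm emb) (to_OE p nrm emb pL) (Ddual p nrm emb J F)"

text \<open>The \<open>N\<^sub>0\<close>-invariants of \<open>F(x\<^sub>+)\<close> killed by the uniformizer, as a vector space over the field
  \<open>k = \<oo>/p\<^sub>L\<close>: this is the part of the \<open>p\<close>-torsion on which \<open>k\<close> acts, and whenever the whole \<open>p\<close>-torsion
  of the invariants is a \<open>k\<close>-vector space (e.g. for \<open>L\<close> unramified), it is all of it.\<close>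

definition residue_field :: "('a, 'c) ring_scheme \<Rightarrow> 'a \<Rightarrow> 'a set ring" where
  "residue_field R a = R Quot (PIdl\<^bsub>R\<^esub> a)"

definition inv_space ::
  "('q::field_char_0 \<Rightarrow> real) \<Rightarrow> ('q \<Rightarrow> 'l::field) \<Rightarrow> 'l \<Rightarrow> 'l set \<Rightarrow> ('q, 'l set, 'm) coeff_sys \<Rightarrow> ('l set, 'm) module" where
  "inv_space nrm emb pL J F =
    (let \<O> = int_ring nrm emb; x = xplus nrm; M = sec F {x}
     in \<lparr>carrier = {v \<in> carrier M. (\<forall>g\<in>N0 nrm. act F g {x} v = v) \<and>
                                  (J +>\<^bsub>\<O>\<^esub> pL) \<odot>\<^bsub>M\<^esub> v = \<zero>\<^bsub>M\<^esub>},
         monoid.mult = undefined, monoid.one = undefined, ring.zero = \<zero>\<^bsub>M\<^esub>, ring.add = ring.add M,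
         smult = (\<lambda>\<kappa> v. (J +>\<^bsub>\<O>\<^esub> (SOME c. c \<in> \<kappa>)) \<odot>\<^bsub>M\<^esub> v)\<rparr>)"

end

theory Submission
  imports Defs
begin

text \<open>Call \<open>S = \<oo>[[N\<^sub>0]] - (p\<^sub>L)\<close>. Elements of \<open>S\<close> become units in \<open>\<O>\<^sub>E\<close>, so it suffices to find \<open>n\<close> elements of \<open>D = D(F)\<close>
  such that each element of \<open>D\<close> has a multiple by an element of \<open>S\<close> in their span. Since \<open>D\<close> is killed by \<open>s p\<^sub>L^k\<close>
  with a unit \<open>s\<close>, a devissage along powers of \<open>p\<^sub>L\<close> reduces this to the \<open>p\<^sub>L\<close>-torsion of \<open>D\<close>: any \<open>n + 1\<close> of its
  elements have to satisfy a relation over \<open>\<oo>[[N\<^sub>0]]\<close> with some coefficient in \<open>S\<close>. The same devissage over \<open>\<oo>\<close> bounds by \<open>n\<close>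
  the number of generators of \<open>V\<close>, the \<open>N\<^sub>0\<close>-invariants of \<open>F(x\<^sub>+)\<close>.

  By (Hyp 2) and (Hyp 3) the module \<open>H\<^sub>0(X\<^sub>+, F)\<close> is the increasing union of the submodules \<open>G m\<close> generated over \<open>N\<^sub>0\<close> by the
  classes of \<open>t^m v\<close> at the vertices \<open>t^m x\<^sub>+\<close>, \<open>v \<in> V\<close>. On \<open>G m\<close> the group \<open>N\<^sub>0\<close> acts through the cyclic group of order
  \<open>q = p^m\<close>, and an element of \<open>D\<close> killed by \<open>p\<^sub>L\<close> restricts to an \<open>n\<close>-tuple of \<open>q\<close>-periodic functions \<open>\<int> \<rightarrow> k\<close>. These form
  a module over \<open>k[T]/(T - 1)^q\<close> which is uniserial in each coordinate, whence \<open>n + 1\<close> tuples are dependent; a compactness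
  argument produces a relation that is valid for all \<open>m\<close>.\<close>

section \<open>Localization, completion and base change\<close>

text \<open>Write R for \<open>\<oo>[[N\<^sub>0]]\<close>. In the localization of R at S every
  non-unit is a multiple of p_L, as in a discrete valuation ring, and the residue field is k((X))
  with X = T - 1. For a module killed by a power of p_L the dimension of the p_L-torsion then bounds
  the number of generators. Localized modules are never formed: the closure \<open>cl G\<close>, the
  elements with an S-multiple in the span of G, has the exchange property on the torsion and so
  carries the dimension theory. Over \<oo> the elements outside (p_L) play the part of the units.
  The obstacle is the passage to all m: a nontrivial relation on \<open>G m\<close> may become
  trivial when its coefficients are reduced to a lower level. Relations are therefore normalised so
  that some coefficient does not vanish at T = 1 modulo p_L; since T^q - 1 vanishes at T = 1, this
  survives every reduction. Compactness needs k to be finite, and this is obtained by lifting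
  independent elements of k to L.\<close>

lemma (in abelian_group) minus_eq_zero_iff:
  "\<lbrakk>x \<in> carrier G; y \<in> carrier G\<rbrakk> \<Longrightarrow> x \<ominus> y = \<zero> \<longleftrightarrow> x = y"
  by (metis add.inv_closed add.inv_solve_right' add.l_one add.one_closed minus_eq)

text \<open>The operations of \<open>localization\<close> are unions over all pairs of
  representatives. Such a union collapses to its common value once independence of the
  representatives is known.\<close>

lemma UN_pairs_const:
  assumes "(a, b) \<in> A" "(a', b') \<in> B"
    and "\<And>a b a' b'. \<lbrakk>(a, b) \<in> A; (a', b') \<in> B\<rbrakk> \<Longrightarrow> f a b a' b' = c"
  shows "(\<Union>(a, b)\<in>A. \<Union>(a', b')\<in>B. f a b a' b') = c"
proof -
  have "(\<Union>(a', b')\<in>B. f a b a' b') = c" if "(a, b) \<in> A" for a b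
  proof -
    have "(case x of (a', b') \<Rightarrow> f a b a' b') = c" if "x \<in> B" for x
      using assms(3)[OF \<open>(a, b) \<in> A\<close>] that by (cases x) simp
    then show ?thesis using assms(2) by auto
  qed
  then have "(case x of (a, b) \<Rightarrow> \<Union>(a', b')\<in>B. f a b a' b') = c" if "x \<in> A" for x
    using that by (cases x) simp
  then show ?thesis using assms(1) by auto
qed

section \<open>Localization of a commutative ring at a multiplicative set\<close>

locale mult_subset = cring R for R :: "('a, 'c) ring_scheme" (structure) +
  fixes S :: "'a set"
  assumes S_subset: "S \<subseteq> carrier R"
    and one_S [simp]: "\<one> \<in> S"
    and S_mult [simp]: "\<lbrakk>s \<in> S; t \<in> S\<rbrakk> \<Longrightarrow> s \<otimes> t \<in> S"
begin

lemma S_carrier [simp]: "s \<in> S \<Longrightarrow> s \<in> carrier R"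
  using S_subset by auto

abbreviation frac where "frac \<equiv> loc_frac R S"
abbreviation Rloc where "Rloc \<equiv> localization R S"

lemma mem_frac:
  assumes "r \<in> carrier R" "s \<in> S"
  shows "(r', s') \<in> frac r s \<longleftrightarrow> r' \<in> carrier R \<and> s' \<in> S \<and> (\<exists>u\<in>S. u \<otimes> (r \<otimes> s') = u \<otimes> (r' \<otimes> s))"
proof -
  have "u \<otimes> (r \<otimes> s' \<ominus> r' \<otimes> s) = \<zero> \<longleftrightarrow> u \<otimes> (r \<otimes> s') = u \<otimes> (r' \<otimes> s)"
    if "u \<in> S" "r' \<in> carrier R" "s' \<in> S" for u
  proof -
    have "u \<otimes> (r \<otimes> s' \<ominus> r' \<otimes> s) = u \<otimes> (r \<otimes> s') \<ominus> u \<otimes> (r' \<otimes> s)"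
      using that assms by (simp add: minus_eq r_distr r_minus)
    then show ?thesis using that assms by (simp add: minus_eq_zero_iff)
  qed
  then show ?thesis unfolding loc_frac_def by auto
qed

lemma frac_memE:
  assumes "(r', s') \<in> frac r s" "r \<in> carrier R" "s \<in> S"
  obtains u where "u \<in> S" "u \<otimes> (r \<otimes> s') = u \<otimes> (r' \<otimes> s)" "r' \<in> carrier R" "s' \<in> S"
  using assms by (auto simp: mem_frac)

lemma frac_memI:
  assumes "u \<in> S" "u \<otimes> (r \<otimes> s') = u \<otimes> (r' \<otimes> s)" "r' \<in> carrier R" "s' \<in> S" "r \<in> carrier R" "s \<in> S"
  shows "(r', s') \<in> frac r s"
  using assms by (auto simp: mem_frac)

lemma frac_self: "\<lbrakk>r \<in> carrier R; s \<in> S\<rbrakk> \<Longrightarrow> (r, s) \<in> frac r s"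
  by (auto intro!: frac_memI[of \<one>])

lemma frac_sym_aux:
  assumes "r \<in> carrier R" "s \<in> S" "(r', s') \<in> frac r s"
  shows "(r, s) \<in> frac r' s'"
  using assms by (metis frac_memE frac_memI)

lemma frac_trans_aux:
  assumes "r \<in> carrier R" "s \<in> S" "(r', s') \<in> frac r s" "(r'', s'') \<in> frac r' s'"
  shows "(r'', s'') \<in> frac r s"
proof -
  from assms obtain u where u: "u \<in> S" "u \<otimes> (r \<otimes> s') = u \<otimes> (r' \<otimes> s)" "r' \<in> carrier R" "s' \<in> S"
    by (auto elim: frac_memE)
  from u assms obtain v where v: "v \<in> S" "v \<otimes> (r' \<otimes> s'') = v \<otimes> (r'' \<otimes> s')" "r'' \<in> carrier R" "s'' \<in> S"
    by (auto elim: frac_memE)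
  \<comment> \<open>In the presence of zero divisors u and v alone do not suffice: the factor s'
    clears the denominator of the intermediate fraction.\<close>
  have "(u \<otimes> v \<otimes> s') \<otimes> (r \<otimes> s'') = v \<otimes> s'' \<otimes> (u \<otimes> (r \<otimes> s'))"
    using u(1,3,4) v(1,3,4) assms(1,2) by (simp add: m_ac)
  also have "\<dots> = u \<otimes> s \<otimes> (v \<otimes> (r' \<otimes> s''))"
    unfolding u(2) using u(1,3,4) v(1,3,4) assms(1,2) by (simp add: m_ac)
  also have "\<dots> = (u \<otimes> v \<otimes> s') \<otimes> (r'' \<otimes> s)"
    unfolding v(2) using u(1,3,4) v(1,3,4) assms(1,2) by (simp add: m_ac)
  finally show ?thesis using u v assms by (intro frac_memI[of "u \<otimes> v \<otimes> s'"]) auto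
qed

lemma frac_eq_iff:
  assumes "r \<in> carrier R" "s \<in> S" "r' \<in> carrier R" "s' \<in> S"
  shows "frac r s = frac r' s' \<longleftrightarrow> (r', s') \<in> frac r s"
proof
  assume "frac r s = frac r' s'" then show "(r', s') \<in> frac r s" using frac_self assms by auto
next
  assume *: "(r', s') \<in> frac r s"
  then have **: "(r, s) \<in> frac r' s'" using frac_sym_aux assms by auto
  have "(a, b) \<in> frac r s \<longleftrightarrow> (a, b) \<in> frac r' s'" for a b
    using * ** frac_trans_aux assms by blast
  then show "frac r s = frac r' s'" by auto
qed

lemma frac_eqI:
  assumes "r \<in> carrier R" "s \<in> S" "r' \<in> carrier R" "s' \<in> S" "r \<otimes> s' = r' \<otimes> s"
  shows "frac r s = frac r' s'"
  using assms by (subst frac_eq_iff) (auto intro!: frac_memI[of \<one>])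

lemma loc_carrier: "carrier Rloc = {frac r s | r s. r \<in> carrier R \<and> s \<in> S}"
  by (simp add: localization_def)

lemma frac_closed [simp]: "\<lbrakk>r \<in> carrier R; s \<in> S\<rbrakk> \<Longrightarrow> frac r s \<in> carrier Rloc"
  by (auto simp: loc_carrier)

lemma loc_cases:
  assumes "x \<in> carrier Rloc" obtains r s where "x = frac r s" "r \<in> carrier R" "s \<in> S"
  using assms by (auto simp: loc_carrier)

lemma loc_mult:
  assumes "r \<in> carrier R" "s \<in> S" "r' \<in> carrier R" "s' \<in> S"
  shows "frac r s \<otimes>\<^bsub>Rloc\<^esub> frac r' s' = frac (r \<otimes> r') (s \<otimes> s')"
proof -
  have "frac (a \<otimes> a') (b \<otimes> b') = frac (r \<otimes> r') (s \<otimes> s')"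
    if "(a, b) \<in> frac r s" "(a', b') \<in> frac r' s'" for a b a' b'
  proof -
    from that assms obtain u v where u: "u \<in> S" "u \<otimes> (r \<otimes> b) = u \<otimes> (a \<otimes> s)" "a \<in> carrier R" "b \<in> S"
      and v: "v \<in> S" "v \<otimes> (r' \<otimes> b') = v \<otimes> (a' \<otimes> s')" "a' \<in> carrier R" "b' \<in> S"
      by (metis frac_memE)
    have "(u \<otimes> v) \<otimes> ((r \<otimes> r') \<otimes> (b \<otimes> b')) = (u \<otimes> (r \<otimes> b)) \<otimes> (v \<otimes> (r' \<otimes> b'))"
      using u(1,3,4) v(1,3,4) assms by (simp add: m_ac)
    also have "\<dots> = (u \<otimes> v) \<otimes> ((a \<otimes> a') \<otimes> (s \<otimes> s'))"
      unfolding u(2) v(2) using u(1,3,4) v(1,3,4) assms by (simp add: m_ac)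
    finally have "(a \<otimes> a', b \<otimes> b') \<in> frac (r \<otimes> r') (s \<otimes> s')"
      using u v assms by (intro frac_memI[of "u \<otimes> v"]) auto
    then show ?thesis using u v assms by (subst eq_commute, subst frac_eq_iff) auto
  qed
  then have "(\<Union>(r, s)\<in>frac r s. \<Union>(r', s')\<in>frac r' s'. frac (r \<otimes> r') (s \<otimes> s')) = frac (r \<otimes> r') (s \<otimes> s')"
    by (intro UN_pairs_const[OF frac_self frac_self]) (use assms in auto)
  then show ?thesis unfolding localization_def monoid.simps .
qed

lemma loc_add:
  assumes "r \<in> carrier R" "s \<in> S" "r' \<in> carrier R" "s' \<in> S"
  shows "frac r s \<oplus>\<^bsub>Rloc\<^esub> frac r' s' = frac (r \<otimes> s' \<oplus> r' \<otimes> s) (s \<otimes> s')"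
proof -
  have "frac (a \<otimes> b' \<oplus> a' \<otimes> b) (b \<otimes> b') = frac (r \<otimes> s' \<oplus> r' \<otimes> s) (s \<otimes> s')"
    if "(a, b) \<in> frac r s" "(a', b') \<in> frac r' s'" for a b a' b'
  proof -
    from that assms obtain u v where u: "u \<in> S" "u \<otimes> (r \<otimes> b) = u \<otimes> (a \<otimes> s)" "a \<in> carrier R" "b \<in> S"
      and v: "v \<in> S" "v \<otimes> (r' \<otimes> b') = v \<otimes> (a' \<otimes> s')" "a' \<in> carrier R" "b' \<in> S"
      by (metis frac_memE)
    have "(u \<otimes> v) \<otimes> ((r \<otimes> s' \<oplus> r' \<otimes> s) \<otimes> (b \<otimes> b')) =
       v \<otimes> s' \<otimes> b' \<otimes> (u \<otimes> (r \<otimes> b)) \<oplus> u \<otimes> b \<otimes> s \<otimes> (v \<otimes> (r' \<otimes> b'))"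
      using u(1,3,4) v(1,3,4) assms by (simp add: m_ac l_distr r_distr)
    also have "\<dots> = (u \<otimes> v) \<otimes> ((a \<otimes> b' \<oplus> a' \<otimes> b) \<otimes> (s \<otimes> s'))"
      unfolding u(2) v(2) using u(1,3,4) v(1,3,4) assms by (simp add: m_ac l_distr r_distr)
    finally have "(a \<otimes> b' \<oplus> a' \<otimes> b, b \<otimes> b') \<in> frac (r \<otimes> s' \<oplus> r' \<otimes> s) (s \<otimes> s')"
      using u v assms by (intro frac_memI[of "u \<otimes> v"]) auto
    then show ?thesis using u v assms by (subst eq_commute, subst frac_eq_iff) auto
  qed
  then have "(\<Union>(r, s)\<in>frac r s. \<Union>(r', s')\<in>frac r' s'. frac (r \<otimes> s' \<oplus> r' \<otimes> s) (s \<otimes> s')) =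
      frac (r \<otimes> s' \<oplus> r' \<otimes> s) (s \<otimes> s')"
    by (intro UN_pairs_const[OF frac_self frac_self]) (use assms in auto)
  then show ?thesis unfolding localization_def ring.simps .
qed

lemma loc_one: "\<one>\<^bsub>Rloc\<^esub> = frac \<one> \<one>" and loc_zero: "\<zero>\<^bsub>Rloc\<^esub> = frac \<zero> \<one>"
  by (simp_all add: localization_def)

lemma cring_localization: "cring Rloc"
proof (intro cringI abelian_groupI comm_monoidI, goal_cases)
  case (1 x y) then show ?case by (elim loc_cases) (auto simp: loc_add)
next
  case 2 then show ?case by (simp add: loc_zero)
next
  case (3 x y z)
  then obtain a b c d e f where *: "a \<in> carrier R" "b \<in> S" "c \<in> carrier R" "d \<in> S" "e \<in> carrier R" "f \<in> S"
    and "x = frac a b" "y = frac c d" "z = frac e f" by (elim loc_cases)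
  moreover have "(a \<otimes> d \<oplus> c \<otimes> b) \<otimes> f \<oplus> e \<otimes> (b \<otimes> d) = a \<otimes> (d \<otimes> f) \<oplus> (c \<otimes> f \<oplus> e \<otimes> d) \<otimes> b"
    using * by (simp add: m_ac a_ac l_distr r_distr)
  ultimately show ?case by (simp add: loc_add m_assoc)
next
  case (4 x y)
  then obtain a b c d where *: "a \<in> carrier R" "b \<in> S" "c \<in> carrier R" "d \<in> S"
    and "x = frac a b" "y = frac c d" by (elim loc_cases)
  then show ?case by (simp add: loc_add m_comm a_comm)
next
  case (5 x)
  then obtain a b where *: "a \<in> carrier R" "b \<in> S" and "x = frac a b" by (elim loc_cases)
  then show ?case by (simp add: loc_add loc_zero)
next
  case (6 x)
  then obtain a b where *: "a \<in> carrier R" "b \<in> S" and "x = frac a b" by (elim loc_cases)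
  moreover have "frac (\<ominus> a \<otimes> b \<oplus> a \<otimes> b) (b \<otimes> b) = frac \<zero> \<one>"
    using * by (intro frac_eqI) (auto simp: l_minus l_neg)
  ultimately show ?case by (intro bexI[of _ "frac (\<ominus> a) b"]) (auto simp: loc_add loc_zero)
next
  case (7 x y) then show ?case by (elim loc_cases) (auto simp: loc_mult)
next
  case 8 then show ?case by (simp add: loc_one)
next
  case (9 x y z)
  then obtain a b c d e f where *: "a \<in> carrier R" "b \<in> S" "c \<in> carrier R" "d \<in> S" "e \<in> carrier R" "f \<in> S"
    and "x = frac a b" "y = frac c d" "z = frac e f" by (elim loc_cases)
  then show ?case by (simp add: loc_mult m_assoc)
next
  case (10 x)
  then obtain a b where *: "a \<in> carrier R" "b \<in> S" and "x = frac a b" by (elim loc_cases)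
  then show ?case by (simp add: loc_mult loc_one)
next
  case (11 x y)
  then obtain a b c d where *: "a \<in> carrier R" "b \<in> S" "c \<in> carrier R" "d \<in> S"
    and "x = frac a b" "y = frac c d" by (elim loc_cases)
  then show ?case by (simp add: loc_mult m_comm)
next
  case (12 x y z)
  then obtain a b c d e f where *: "a \<in> carrier R" "b \<in> S" "c \<in> carrier R" "d \<in> S" "e \<in> carrier R" "f \<in> S"
    and **: "x = frac a b" "y = frac c d" "z = frac e f" by (elim loc_cases)
  have "frac ((a \<otimes> d \<oplus> c \<otimes> b) \<otimes> e) (b \<otimes> d \<otimes> f) =
     frac (a \<otimes> e \<otimes> (d \<otimes> f) \<oplus> c \<otimes> e \<otimes> (b \<otimes> f)) (b \<otimes> f \<otimes> (d \<otimes> f))"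
  proof (rule frac_eqI)
    show "(a \<otimes> d \<oplus> c \<otimes> b) \<otimes> e \<otimes> (b \<otimes> f \<otimes> (d \<otimes> f)) = (a \<otimes> e \<otimes> (d \<otimes> f) \<oplus> c \<otimes> e \<otimes> (b \<otimes> f)) \<otimes> (b \<otimes> d \<otimes> f)"
      using * by (simp add: m_ac a_ac l_distr r_distr)
  qed (use * in auto)
  then show ?case using * ** by (simp add: loc_mult loc_add)
qed

text \<open>This is what the localization contributes in the end: through the completion it makes
  the image of each element of S a unit of \<O>_E.\<close>

lemma frac_unit: "s \<in> S \<Longrightarrow> frac s \<one> \<otimes>\<^bsub>Rloc\<^esub> frac \<one> s = \<one>\<^bsub>Rloc\<^esub>"
  by (simp add: loc_mult loc_one) (intro frac_eqI; simp)

end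

section \<open>The adic completion as a ring of coherent sequences of cosets\<close>

context cring
begin

context
  fixes a assumes a: "a \<in> carrier R"
begin

abbreviation (input) In where "In n \<equiv> PIdl (a [^] (n::nat))"

lemma ideal_In: "ideal (In n) R"
  using a by (simp add: cgenideal_ideal)

lemma In_Suc: "In (Suc n) \<subseteq> In n"
proof
  fix x assume "x \<in> In (Suc n)"
  then obtain y where "y \<in> carrier R" "x = y \<otimes> (a [^] n \<otimes> a)" by (auto simp: cgenideal_def)
  then show "x \<in> In n" using a by (auto simp: cgenideal_def m_ac intro!: exI[of _ "a \<otimes> y"])
qed

lemma adic_quot_simps:
  assumes "x \<in> carrier R" "y \<in> carrier R"
  shows "(In n +> x) \<oplus>\<^bsub>adic_quot R a n\<^esub> (In n +> y) = In n +> (x \<oplus> y)"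
    "(In n +> x) \<otimes>\<^bsub>adic_quot R a n\<^esub> (In n +> y) = In n +> (x \<otimes> y)"
    "\<one>\<^bsub>adic_quot R a n\<^esub> = In n +> \<one>" "\<zero>\<^bsub>adic_quot R a n\<^esub> = In n +> \<zero>"
    "In n +> x \<in> carrier (adic_quot R a n)"
  using assms ideal.rcoset_mult_add[OF ideal_In] ideal.a_rcos_sum[OF ideal_In]
  by (auto simp: adic_quot_def FactRing_def A_RCOSETS_def' 
      a_coset_add_zero[OF additive_subgroup.a_subset[OF ideal.axioms(1)[OF ideal_In]]])

lemma adic_quot_cases:
  assumes "X \<in> carrier (adic_quot R a n)" obtains x where "x \<in> carrier R" "X = In n +> x"
  using assms by (auto simp: adic_quot_def FactRing_def A_RCOSETS_def')

text \<open>The completion expresses coherence by inclusion of cosets; this turns it into a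
  congruence between representatives, in which form it can be checked for sums and products.\<close>

lemma adic_coset_subset_iff:
  assumes "x \<in> carrier R" "y \<in> carrier R"
  shows "In (Suc n) +> x \<subseteq> In n +> y \<longleftrightarrow> x \<ominus> y \<in> In n"
proof -
  interpret I: ideal "In n" R by (rule ideal_In)
  interpret I': ideal "In (Suc n)" R by (rule ideal_In)
  have 1: "x \<in> In (Suc n) +> x" using assms by (metis I'.a_rcos_self)
  have 2: "In (Suc n) +> x \<subseteq> In n +> x" using In_Suc by (auto simp: a_r_coset_def')
  have 3: "x \<in> In n +> y \<longleftrightarrow> x \<ominus> y \<in> In n"
    using assms by (simp add: I.a_rcos_module_minus[OF ring_axioms])
  show ?thesis
  proof
    assume "In (Suc n) +> x \<subseteq> In n +> y" then show "x \<ominus> y \<in> In n" using 1 3 by auto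
  next
    assume "x \<ominus> y \<in> In n"
    then have "x \<in> In n +> y" using 3 by simp
    then have "In n +> y = In n +> x" using assms I.a_repr_independence' by auto
    then show "In (Suc n) +> x \<subseteq> In n +> y" using 2 by simp
  qed
qed

abbreviation (input) Comp where "Comp \<equiv> adic_completion R a"

text \<open>Representatives are chosen separately for each n, so consecutive ones agree only modulo
  a^n.\<close>

lemma comp_cases:
  assumes "s \<in> carrier Comp"
  obtains x where "\<And>n. x n \<in> carrier R" "s = (\<lambda>n. In n +> x n)" "\<And>n. x (Suc n) \<ominus> x n \<in> In n"
proof -
  have s: "s n \<in> carrier (adic_quot R a n)" "s (Suc n) \<subseteq> s n" for n
    using assms by (auto simp: adic_completion_def)
  define x where "x n = (SOME x. x \<in> carrier R \<and> s n = In n +> x)" for n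
  have x: "x n \<in> carrier R \<and> s n = In n +> x n" for n
  proof -
    have "\<exists>x. x \<in> carrier R \<and> s n = In n +> x"
      using adic_quot_cases[OF s(1)] by metis
    then show ?thesis unfolding x_def by (rule someI_ex)
  qed
  have "In (Suc n) +> x (Suc n) \<subseteq> In n +> x n" for n
    using s(2)[of n] x by metis
  then have "x (Suc n) \<ominus> x n \<in> In n" for n
    using adic_coset_subset_iff[of "x (Suc n)" "x n" n] x by blast
  then show thesis using that[of x] x by blast
qed

lemma comp_memI:
  assumes "\<And>n. x n \<in> carrier R" "\<And>n. x (Suc n) \<ominus> x n \<in> In n"
  shows "(\<lambda>n. In n +> x n) \<in> carrier Comp"
proof -
  have "In (Suc n) +> x (Suc n) \<subseteq> In n +> x n" for n
    using assms by (simp only: adic_coset_subset_iff)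
  moreover have "In n +> x n \<in> carrier (adic_quot R a n)" for n
    using adic_quot_simps(5)[OF assms(1) assms(1)] .
  ultimately show ?thesis by (simp add: adic_completion_def)
qed

lemma comp_add:
  assumes "\<And>n. x n \<in> carrier R" "\<And>n. y n \<in> carrier R"
  shows "(\<lambda>n. In n +> x n) \<oplus>\<^bsub>Comp\<^esub> (\<lambda>n. In n +> y n) = (\<lambda>n. In n +> (x n \<oplus> y n))"
  using assms by (simp add: adic_completion_def adic_quot_simps)

lemma comp_mult:
  assumes "\<And>n. x n \<in> carrier R" "\<And>n. y n \<in> carrier R"
  shows "(\<lambda>n. In n +> x n) \<otimes>\<^bsub>Comp\<^esub> (\<lambda>n. In n +> y n) = (\<lambda>n. In n +> (x n \<otimes> y n))"
  using assms by (simp add: adic_completion_def adic_quot_simps)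

lemma comp_one: "\<one>\<^bsub>Comp\<^esub> = (\<lambda>n. In n +> \<one>)" and comp_zero: "\<zero>\<^bsub>Comp\<^esub> = (\<lambda>n. In n +> \<zero>)"
  by (simp_all add: adic_completion_def adic_quot_simps[OF zero_closed zero_closed])

lemma In_add: "\<lbrakk>x \<in> In n; y \<in> In n\<rbrakk> \<Longrightarrow> x \<oplus> y \<in> In n"
  by (meson additive_subgroup.a_closed ideal.axioms(1) ideal_In)
lemma In_mult: "\<lbrakk>x \<in> In n; y \<in> carrier R\<rbrakk> \<Longrightarrow> x \<otimes> y \<in> In n"
  by (meson ideal.I_r_closed ideal_In)
lemma In_minus: "\<lbrakk>x \<in> In n\<rbrakk> \<Longrightarrow> \<ominus> x \<in> In n"
  by (meson additive_subgroup.a_inv_closed ideal.axioms(1) ideal_In)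
lemma In_zero: "\<zero> \<in> In n"
  by (meson additive_subgroup.zero_closed ideal.axioms(1) ideal_In)

lemma comp_add_closed:
  assumes x: "\<And>n. x n \<in> carrier R" "\<And>n. x (Suc n) \<ominus> x n \<in> In n"
    and y: "\<And>n. y n \<in> carrier R" "\<And>n. y (Suc n) \<ominus> y n \<in> In n"
  shows "(\<lambda>n. In n +> (x n \<oplus> y n)) \<in> carrier Comp"
proof (rule comp_memI)
  fix n
  have "x (Suc n) \<oplus> y (Suc n) \<ominus> (x n \<oplus> y n) = (x (Suc n) \<ominus> x n) \<oplus> (y (Suc n) \<ominus> y n)"
    using x(1)[of n] y(1)[of n] x(1)[of "Suc n"] y(1)[of "Suc n"] by algebra
  then show "x (Suc n) \<oplus> y (Suc n) \<ominus> (x n \<oplus> y n) \<in> In n" using x y In_add by simp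
qed (use x y in auto)

lemma comp_mult_closed:
  assumes x: "\<And>n. x n \<in> carrier R" "\<And>n. x (Suc n) \<ominus> x n \<in> In n"
    and y: "\<And>n. y n \<in> carrier R" "\<And>n. y (Suc n) \<ominus> y n \<in> In n"
  shows "(\<lambda>n. In n +> (x n \<otimes> y n)) \<in> carrier Comp"
proof (rule comp_memI)
  fix n
  have "x (Suc n) \<otimes> y (Suc n) \<ominus> (x n \<otimes> y n) = (x (Suc n) \<ominus> x n) \<otimes> y (Suc n) \<oplus> (y (Suc n) \<ominus> y n) \<otimes> x n"
    using x(1)[of n] y(1)[of n] x(1)[of "Suc n"] y(1)[of "Suc n"] by algebra
  then show "x (Suc n) \<otimes> y (Suc n) \<ominus> (x n \<otimes> y n) \<in> In n" using x y In_add In_mult by simp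
qed (use x y in auto)

lemma const_In: "c \<in> carrier R \<Longrightarrow> c \<ominus> c \<in> In n"
  using In_zero minus_eq_zero_iff by metis

lemma cring_adic_completion: "cring Comp"
proof (intro cringI abelian_groupI comm_monoidI, goal_cases)
  case (1 x y) then show ?case by (elim comp_cases) (auto simp: comp_add comp_add_closed)
next
  case 2 then show ?case by (auto simp: comp_zero const_In intro!: comp_memI)
next
  case (3 x y z) then show ?case by (elim comp_cases) (simp add: comp_add a_assoc)
next
  case (4 x y) then show ?case by (elim comp_cases) (simp add: comp_add a_comm)
next
  case (5 x) then show ?case by (elim comp_cases) (simp add: comp_add comp_zero)
next
  case (6 s)
  then obtain x where x: "\<And>n. x n \<in> carrier R" "s = (\<lambda>n. In n +> x n)" "\<And>n. x (Suc n) \<ominus> x n \<in> In n"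
    by (elim comp_cases) (rule that; assumption)
  have "(\<lambda>n. In n +> \<ominus> x n) \<in> carrier Comp"
  proof (rule comp_memI)
    fix n
    have "\<ominus> x (Suc n) \<ominus> \<ominus> x n = \<ominus> (x (Suc n) \<ominus> x n)" using x(1)[of n] x(1)[of "Suc n"] by algebra
    then show "\<ominus> x (Suc n) \<ominus> \<ominus> x n \<in> In n" using In_minus x(3) by simp
  qed (use x in auto)
  then show ?case using x by (intro bexI) (auto simp: comp_add comp_zero l_neg)
next
  case (7 x y) then show ?case by (elim comp_cases) (auto simp: comp_mult comp_mult_closed)
next
  case 8 then show ?case by (auto simp: comp_one const_In intro!: comp_memI)
next
  case (9 x y z) then show ?case by (elim comp_cases) (simp add: comp_mult m_assoc)
next
  case (10 x) then show ?case by (elim comp_cases) (simp add: comp_mult comp_one)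
next
  case (11 x y) then show ?case by (elim comp_cases) (simp add: comp_mult m_comm)
next
  case (12 x y z) then show ?case by (elim comp_cases) (simp add: comp_mult comp_add l_distr)
qed

lemma to_completion_closed: "x \<in> carrier R \<Longrightarrow> to_completion R a x \<in> carrier Comp"
  unfolding to_completion_def by (rule comp_memI) (auto simp: const_In)

lemma to_completion_mult:
  "\<lbrakk>x \<in> carrier R; y \<in> carrier R\<rbrakk> \<Longrightarrow>
    to_completion R a x \<otimes>\<^bsub>Comp\<^esub> to_completion R a y = to_completion R a (x \<otimes> y)"
  unfolding to_completion_def by (simp add: comp_mult)

lemma to_completion_one: "to_completion R a \<one> = \<one>\<^bsub>Comp\<^esub>"
  unfolding to_completion_def comp_one ..

end
end

text \<open>Spans are generated inductively instead of by finite sums, so that every closure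
  argument below is a rule induction.\<close>

inductive_set rspan :: "('a, 'c) ring_scheme \<Rightarrow> ('a, 'm, 'd) module_scheme \<Rightarrow> 'm set \<Rightarrow> 'm set"
  for R :: "('a, 'c) ring_scheme" and M :: "('a, 'm, 'd) module_scheme" and G where
  zero: "\<zero>\<^bsub>M\<^esub> \<in> rspan R M G"
| incl: "g \<in> G \<Longrightarrow> g \<in> rspan R M G"
| add: "\<lbrakk>x \<in> rspan R M G; y \<in> rspan R M G\<rbrakk> \<Longrightarrow> x \<oplus>\<^bsub>M\<^esub> y \<in> rspan R M G"
| smult: "\<lbrakk>r \<in> carrier R; x \<in> rspan R M G\<rbrakk> \<Longrightarrow> r \<odot>\<^bsub>M\<^esub> x \<in> rspan R M G"

lemma (in module) rspan_closed: "\<lbrakk>G \<subseteq> carrier M; x \<in> rspan R M G\<rbrakk> \<Longrightarrow> x \<in> carrier M"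
  by (rotate_tac, induction rule: rspan.induct) auto

lemma rspan_mono: "\<lbrakk>x \<in> rspan R M G; G \<subseteq> G'\<rbrakk> \<Longrightarrow> x \<in> rspan R M G'"
  by (induction rule: rspan.induct) (auto intro: rspan.intros)

section \<open>Base change of a module as a quotient of a free abelian group\<close>

locale tensor = A: cring A + M: module R M
  for A :: "('a, 'c) ring_scheme" and R :: "('r, 'd) ring_scheme" and M :: "('r, 'm, 'e) module_scheme" +
  fixes h :: "'r \<Rightarrow> 'a"
  assumes h_closed [simp]: "r \<in> carrier R \<Longrightarrow> h r \<in> carrier A"
begin

declare carrier_free_Abelian_group_iff [simp del]

abbreviation Fr where "Fr \<equiv> free_Abelian_group (carrier A \<times> carrier M)"
definition K where "K = generate Fr (tensor_relations A R h M)"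
abbreviation BC where "BC \<equiv> base_change A R h M"
definition cls where "cls z = K #>\<^bsub>Fr\<^esub> z"
definition \<mu> where "\<mu> a = frag_extend (\<lambda>(b, m). frag_of (a \<otimes>\<^bsub>A\<^esub> b, m))"

sublocale Fr: comm_group Fr by (rule abelian_free_Abelian_group)

lemma Fr_simps [simp]: "monoid.mult Fr x y = x + y" "\<one>\<^bsub>Fr\<^esub> = 0"
  by (auto simp: free_Abelian_group_def)

lemma Fr_mem: "x \<in> carrier Fr \<longleftrightarrow> Poly_Mapping.keys x \<subseteq> carrier A \<times> carrier M"
  by (auto simp: free_Abelian_group_def)

lemma Fr_zero [simp]: "0 \<in> carrier Fr"
  by (simp add: Fr_mem)

lemma Fr_diff: "\<lbrakk>x \<in> carrier Fr; y \<in> carrier Fr\<rbrakk> \<Longrightarrow> x - y \<in> carrier Fr"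
  using keys_diff[of x y] by (auto simp: Fr_mem)

lemma Fr_of: "\<lbrakk>a \<in> carrier A; m \<in> carrier M\<rbrakk> \<Longrightarrow> frag_of (a, m) \<in> carrier Fr"
  by (auto simp: Fr_mem)

lemma rels_Fr: "tensor_relations A R h M \<subseteq> carrier Fr"
  unfolding tensor_relations_def using Fr_of Fr_diff by auto

lemma K_subgroup: "subgroup K Fr"
  unfolding K_def using rels_Fr by (rule Fr.generate_is_subgroup)

sublocale K: normal K Fr
  using K_subgroup Fr.subgroup_imp_normal by simp

lemma K_zero: "0 \<in> K" using K.one_closed by simp
lemma K_add: "\<lbrakk>x \<in> K; y \<in> K\<rbrakk> \<Longrightarrow> x + y \<in> K" using K.m_closed by simp
lemma K_uminus: "x \<in> K \<Longrightarrow> - x \<in> K"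
proof -
  assume x: "x \<in> K"
  then have "inv\<^bsub>Fr\<^esub> x = - x" using K.mem_carrier Fr_mem by (intro inv_free_Abelian_group) blast
  then show "- x \<in> K" using K.m_inv_closed[OF x] by metis
qed
lemma K_diff: "\<lbrakk>x \<in> K; y \<in> K\<rbrakk> \<Longrightarrow> x - y \<in> K" using K_add[OF _ K_uminus] by simp
lemma K_rel: "x \<in> tensor_relations A R h M \<Longrightarrow> x \<in> K" unfolding K_def by (rule generate.incl)

lemma K_rel_left: "\<lbrakk>a \<in> carrier A; a' \<in> carrier A; m \<in> carrier M\<rbrakk> \<Longrightarrow>
    frag_of (a \<oplus>\<^bsub>A\<^esub> a', m) - frag_of (a, m) - frag_of (a', m) \<in> K"
  by (rule K_rel, unfold tensor_relations_def, rule UnI1, rule UnI1)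
    (rule CollectI, rule exI[of _ a], rule exI[of _ a'], rule exI[of _ m], simp)

lemma K_rel_right: "\<lbrakk>a \<in> carrier A; m \<in> carrier M; m' \<in> carrier M\<rbrakk> \<Longrightarrow>
    frag_of (a, m \<oplus>\<^bsub>M\<^esub> m') - frag_of (a, m) - frag_of (a, m') \<in> K"
  by (rule K_rel, unfold tensor_relations_def, rule UnI1, rule UnI2)
    (rule CollectI, rule exI[of _ a], rule exI[of _ m], rule exI[of _ m'], simp)

lemma K_rel_smult: "\<lbrakk>a \<in> carrier A; r \<in> carrier R; m \<in> carrier M\<rbrakk> \<Longrightarrow>
    frag_of (a \<otimes>\<^bsub>A\<^esub> h r, m) - frag_of (a, r \<odot>\<^bsub>M\<^esub> m) \<in> K"
  by (rule K_rel, unfold tensor_relations_def, rule UnI2)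
    (rule CollectI, rule exI[of _ a], rule exI[of _ r], rule exI[of _ m], simp)

lemma mem_cls: "x \<in> cls z \<longleftrightarrow> x - z \<in> K"
  unfolding cls_def r_coset_def by (auto intro!: bexI[of _ "x - z"])

lemma cls_eq_iff: "cls z = cls z' \<longleftrightarrow> z - z' \<in> K"
proof
  assume "cls z = cls z'" then show "z - z' \<in> K" using mem_cls[of z z] mem_cls[of z z'] K_zero by simp
next
  assume *: "z - z' \<in> K"
  have "x - z \<in> K \<longleftrightarrow> x - z' \<in> K" for x
    using K_add[OF _ *, of "x - z"] K_diff[OF _ *, of "x - z'"] by auto
  then show "cls z = cls z'" using mem_cls by blast
qed

lemma BC_carrier: "carrier BC = cls ` carrier Fr"
  by (auto simp: base_change_def Let_def FactGroup_def RCOSETS_def cls_def K_def)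

lemma cls_BC [intro]: "z \<in> carrier Fr \<Longrightarrow> cls z \<in> carrier BC"
  by (simp add: BC_carrier)

lemma BC_add: "\<lbrakk>z \<in> carrier Fr; z' \<in> carrier Fr\<rbrakk> \<Longrightarrow> cls z \<oplus>\<^bsub>BC\<^esub> cls z' = cls (z + z')"
  using K.rcos_sum[of z z'] by (simp add: base_change_def Let_def FactGroup_def cls_def K_def)

lemma BC_zero: "\<zero>\<^bsub>BC\<^esub> = cls 0"
proof -
  have "\<zero>\<^bsub>BC\<^esub> = K" by (simp add: base_change_def Let_def FactGroup_def K_def)
  then show ?thesis using mem_cls[of _ 0] by auto
qed

lemma \<mu>_of [simp]: "\<mu> a (frag_of (b, m)) = frag_of (a \<otimes>\<^bsub>A\<^esub> b, m)"
  by (simp add: \<mu>_def)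
lemma \<mu>_diff: "\<mu> a (x - y) = \<mu> a x - \<mu> a y" and \<mu>_add: "\<mu> a (x + y) = \<mu> a x + \<mu> a y"
  and \<mu>_zero [simp]: "\<mu> a 0 = 0" and \<mu>_minus: "\<mu> a (- x) = - \<mu> a x"
  by (simp_all add: \<mu>_def frag_extend_diff frag_extend_add frag_extend_minus)

lemma Fr_induct [consumes 1, case_names zero of diff]:
  assumes "z \<in> carrier Fr" "P 0" "\<And>a m. \<lbrakk>a \<in> carrier A; m \<in> carrier M\<rbrakk> \<Longrightarrow> P (frag_of (a, m))"
    "\<And>x y. \<lbrakk>P x; P y\<rbrakk> \<Longrightarrow> P (x - y)"
  shows "P z"
  using assms by (intro frag_induction[of z "carrier A \<times> carrier M" P]) (auto simp: Fr_mem)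

lemma \<mu>_Fr: "\<lbrakk>a \<in> carrier A; z \<in> carrier Fr\<rbrakk> \<Longrightarrow> \<mu> a z \<in> carrier Fr"
proof -
  assume a: "a \<in> carrier A"
  show "z \<in> carrier Fr \<Longrightarrow> \<mu> a z \<in> carrier Fr"
  proof (induction rule: Fr_induct)
    case zero then show ?case by simp
  next
    case (of b m) then show ?case using a Fr_of by (simp)
  next
    case (diff x y) then show ?case unfolding \<mu>_diff by (rule Fr_diff)
  qed
qed

text \<open>Left multiplication sends each defining relation to one of the same type, by
  distributivity and associativity in A. Hence it preserves the subgroup \<open>K\<close> and
  descends to the quotient.\<close>

lemma \<mu>_rel:
  assumes a: "a \<in> carrier A" and x: "x \<in> tensor_relations A R h M"
  shows "\<mu> a x \<in> tensor_relations A R h M"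
  using x unfolding tensor_relations_def
proof (elim UnE CollectE exE conjE, goal_cases)
  case (1 b b' m)
  then show ?case using a
    by (intro UnI1, simp add: \<mu>_diff A.r_distr, intro exI[of _ "a \<otimes>\<^bsub>A\<^esub> b"] exI[of _ "a \<otimes>\<^bsub>A\<^esub> b'"]) auto
next
  case (2 b m m')
  then show ?case using a
    by (rule_tac UnI1, rule_tac UnI2)
      (simp add: \<mu>_diff, intro exI[of _ "a \<otimes>\<^bsub>A\<^esub> b"] exI[of _ m] exI[of _ m'], simp)
next
  case (3 b r m)
  then show ?case using a
    by (intro UnI2)
      (simp add: \<mu>_diff A.m_assoc[symmetric], intro exI[of _ "a \<otimes>\<^bsub>A\<^esub> b"] exI[of _ r] exI[of _ m], simp)
qed

lemma \<mu>_K: "\<lbrakk>a \<in> carrier A; x \<in> K\<rbrakk> \<Longrightarrow> \<mu> a x \<in> K"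
proof -
  assume a: "a \<in> carrier A"
  have "x \<in> generate Fr (tensor_relations A R h M) \<Longrightarrow> \<mu> a x \<in> K"
  proof (induction rule: generate.induct)
    case one then show ?case using K_zero by simp
  next
    case (incl x) then show ?case using K_rel \<mu>_rel a by simp
  next
    case (inv x)
    then have "inv\<^bsub>Fr\<^esub> x = - x" using rels_Fr using Fr_mem by (intro inv_free_Abelian_group) auto
    then show ?case using inv K_rel \<mu>_rel a K_uminus by (simp add: \<mu>_minus)
  next
    case (eng x y) then show ?case using K_add by (simp add: \<mu>_add)
  qed
  then show "x \<in> K \<Longrightarrow> \<mu> a x \<in> K" by (simp add: K_def)
qed

text \<open>Scalar multiplication is a union over the whole coset; it collapses because \<mu> a maps
  differences of representatives, which lie in \<open>K\<close>, into \<open>K\<close>.\<close>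

lemma BC_smult:
  assumes "a \<in> carrier A" "z \<in> carrier Fr"
  shows "a \<odot>\<^bsub>BC\<^esub> cls z = cls (\<mu> a z)"
proof -
  have "a \<odot>\<^bsub>BC\<^esub> cls z = (\<Union>y\<in>cls z. cls (\<mu> a y))"
    by (simp add: base_change_def Let_def cls_def \<mu>_def K_def)
  also have "\<dots> = cls (\<mu> a z)"
  proof -
    have "cls (\<mu> a y) = cls (\<mu> a z)" if "y \<in> cls z" for y
      using that \<mu>_K[OF assms(1), of "y - z"] by (simp add: cls_eq_iff mem_cls \<mu>_diff)
    moreover have "z \<in> cls z" using K_zero by (simp add: mem_cls)
    ultimately show ?thesis by blast
  qed
  finally show ?thesis .
qed

text \<open>In contrast to multiplicativity, additivity in the scalar fails in the free group and
  holds only modulo the first type of relations.\<close>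

lemma \<mu>_add_left: "\<lbrakk>a \<in> carrier A; b \<in> carrier A; z \<in> carrier Fr\<rbrakk> \<Longrightarrow> \<mu> (a \<oplus>\<^bsub>A\<^esub> b) z - (\<mu> a z + \<mu> b z) \<in> K"
proof -
  assume ab: "a \<in> carrier A" "b \<in> carrier A"
  show "z \<in> carrier Fr \<Longrightarrow> \<mu> (a \<oplus>\<^bsub>A\<^esub> b) z - (\<mu> a z + \<mu> b z) \<in> K"
  proof (induction rule: Fr_induct)
    case zero then show ?case using K_zero by simp
  next
    case (of c m)
    have "frag_of (a \<otimes>\<^bsub>A\<^esub> c \<oplus>\<^bsub>A\<^esub> b \<otimes>\<^bsub>A\<^esub> c, m) - frag_of (a \<otimes>\<^bsub>A\<^esub> c, m) - frag_of (b \<otimes>\<^bsub>A\<^esub> c, m) \<in> K"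
      using of ab by (intro K_rel_left K_rel_right K_rel_smult) auto
    then show ?case using of ab by (simp add: A.l_distr diff_diff_eq)
  next
    case (diff x y)
    from K_diff[OF this] show ?case by (simp add: \<mu>_diff algebra_simps)
  qed
qed

lemma \<mu>_mult_left: "\<lbrakk>a \<in> carrier A; b \<in> carrier A; z \<in> carrier Fr\<rbrakk> \<Longrightarrow> \<mu> (a \<otimes>\<^bsub>A\<^esub> b) z = \<mu> a (\<mu> b z)"
proof -
  assume ab: "a \<in> carrier A" "b \<in> carrier A"
  show "z \<in> carrier Fr \<Longrightarrow> \<mu> (a \<otimes>\<^bsub>A\<^esub> b) z = \<mu> a (\<mu> b z)"
    by (induction rule: Fr_induct) (auto simp: \<mu>_diff A.m_assoc ab)
qed

lemma \<mu>_one: "z \<in> carrier Fr \<Longrightarrow> \<mu> \<one>\<^bsub>A\<^esub> z = z"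
  by (induction rule: Fr_induct) (auto simp: \<mu>_diff)

lemma Fr_add: "\<lbrakk>x \<in> carrier Fr; y \<in> carrier Fr\<rbrakk> \<Longrightarrow> x + y \<in> carrier Fr"
  using Fr.m_closed[of x y] by simp

lemma module_BC: "module A BC"
proof (rule module_criteria, goal_cases)
  case 1 show ?case by (rule A.is_cring)
next
  case 2 show ?case unfolding BC_zero by (intro cls_BC) simp
next
  case 3 then show ?case using Fr_add by (auto simp: BC_carrier BC_add)
next
  case 4
  show ?case
  proof
    fix v assume "v \<in> carrier BC"
    then obtain z where z: "z \<in> carrier Fr" "v = cls z" by (auto simp: BC_carrier)
    then show "\<exists>neg_v\<in>carrier BC. v \<oplus>\<^bsub>BC\<^esub> neg_v = \<zero>\<^bsub>BC\<^esub>"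
      using Fr_diff[of 0 z] by (intro bexI[of _ "cls (- z)"]) (auto simp: BC_add BC_zero)
  qed
next
  case 5 then show ?case using \<mu>_Fr by (auto simp: BC_carrier BC_smult)
next
  case 6 then show ?case by (auto simp: BC_carrier BC_add add.commute)
next
  case 7 then show ?case using Fr_add by (auto simp: BC_carrier BC_add add.assoc)
next
  case 8 have "0 \<in> carrier Fr" by simp
  then show ?case by (auto simp: BC_carrier BC_add BC_zero)
next
  case 9 then show ?case using \<mu>_Fr by (auto simp: BC_carrier BC_smult \<mu>_mult_left)
next
  case 10 then show ?case by (auto simp: BC_carrier BC_smult \<mu>_one)
next
  case 11
  then show ?case using \<mu>_Fr \<mu>_add_left cls_eq_iff by (fastforce simp: BC_carrier BC_smult BC_add)
next
  case 12
  then show ?case using \<mu>_Fr Fr_add by (auto simp: BC_carrier BC_smult BC_add \<mu>_add)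
qed

sublocale BC: module A BC by (rule module_BC)

definition ten where "ten a m = cls (frag_of (a, m))"

lemma ten_closed [simp]: "\<lbrakk>a \<in> carrier A; m \<in> carrier M\<rbrakk> \<Longrightarrow> ten a m \<in> carrier BC"
  unfolding ten_def using Fr_of by (intro cls_BC)

lemma smult_ten: "\<lbrakk>a \<in> carrier A; b \<in> carrier A; m \<in> carrier M\<rbrakk> \<Longrightarrow> a \<odot>\<^bsub>BC\<^esub> ten b m = ten (a \<otimes>\<^bsub>A\<^esub> b) m"
  unfolding ten_def using Fr_of by (simp add: BC_smult)

lemma ten_add: "\<lbrakk>a \<in> carrier A; m \<in> carrier M; m' \<in> carrier M\<rbrakk> \<Longrightarrow> ten a (m \<oplus>\<^bsub>M\<^esub> m') = ten a m \<oplus>\<^bsub>BC\<^esub> ten a m'"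
proof -
  assume *: "a \<in> carrier A" "m \<in> carrier M" "m' \<in> carrier M"
  then have "frag_of (a, m \<oplus>\<^bsub>M\<^esub> m') - frag_of (a, m) - frag_of (a, m') \<in> K"
    by (intro K_rel_left K_rel_right K_rel_smult) auto
  then show ?thesis unfolding ten_def using * Fr_of by (simp add: BC_add cls_eq_iff diff_diff_eq)
qed

lemma ten_smult: "\<lbrakk>a \<in> carrier A; m \<in> carrier M; r \<in> carrier R\<rbrakk> \<Longrightarrow> ten (a \<otimes>\<^bsub>A\<^esub> h r) m = ten a (r \<odot>\<^bsub>M\<^esub> m)"
proof -
  assume *: "a \<in> carrier A" "m \<in> carrier M" "r \<in> carrier R"
  then have "frag_of (a \<otimes>\<^bsub>A\<^esub> h r, m) - frag_of (a, r \<odot>\<^bsub>M\<^esub> m) \<in> K"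
    by (intro K_rel_left K_rel_right K_rel_smult) auto
  then show ?thesis unfolding ten_def by (simp add: cls_eq_iff)
qed

lemma ten_zero: "a \<in> carrier A \<Longrightarrow> ten a \<zero>\<^bsub>M\<^esub> = \<zero>\<^bsub>BC\<^esub>"
  using ten_add[of a "\<zero>\<^bsub>M\<^esub>" "\<zero>\<^bsub>M\<^esub>"] BC.M.add.l_cancel_one'[of "ten a \<zero>\<^bsub>M\<^esub>" "ten a \<zero>\<^bsub>M\<^esub>"] by auto

text \<open>The free group is generated by its basis elements, whose classes are the pure tensors.
  Differences are rewritten with the scalar -1, so closure under sums and scalars is all that a
  submodule has to provide.\<close>

lemma submodule_eq_carrier:
  assumes N: "N \<subseteq> carrier BC" "\<zero>\<^bsub>BC\<^esub> \<in> N" "\<And>x y. \<lbrakk>x \<in> N; y \<in> N\<rbrakk> \<Longrightarrow> x \<oplus>\<^bsub>BC\<^esub> y \<in> N"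
      "\<And>a x. \<lbrakk>a \<in> carrier A; x \<in> N\<rbrakk> \<Longrightarrow> a \<odot>\<^bsub>BC\<^esub> x \<in> N"
    and ten: "\<And>a m. \<lbrakk>a \<in> carrier A; m \<in> carrier M\<rbrakk> \<Longrightarrow> ten a m \<in> N"
  shows "N = carrier BC"
proof
  show "N \<subseteq> carrier BC" by fact
  have diff': "cls (x - y) = cls x \<oplus>\<^bsub>BC\<^esub> \<ominus>\<^bsub>A\<^esub> \<one>\<^bsub>A\<^esub> \<odot>\<^bsub>BC\<^esub> cls y" if "x \<in> carrier Fr" "y \<in> carrier Fr" for x y
  proof -
    have "cls (x - y) \<oplus>\<^bsub>BC\<^esub> cls y = cls x" using that Fr_diff[OF that] by (simp add: BC_add)
    moreover have "cls x \<in> carrier BC" "cls y \<in> carrier BC" "cls (x - y) \<in> carrier BC" using that Fr_diff by blast+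
    ultimately show ?thesis
      by (metis BC.M.minus_eq BC.smult_minus_1 BC.M.add.inv_solve_right)
  qed
  have "z \<in> carrier Fr \<and> cls z \<in> N" if "z \<in> carrier Fr" for z
    using that
  proof (induction rule: Fr_induct)
    case zero then show ?case using N(2) by (auto simp: BC_zero)
  next
    case (of a m) then show ?case using ten Fr_of by (auto simp: ten_def)
  next
    case (diff x y)
    then show ?case using Fr_diff N(3,4) by (simp add: diff')
  qed
  then show "carrier BC \<subseteq> N" by (auto simp: BC_carrier)
qed

text \<open>If s m lies in the span of G and u inverts \<open>h s\<close>, then a \<otimes> m = (a
  u) (1 \<otimes> s m). So elements generating M up to multipliers that become units generate the
  whole base change.\<close>

theorem base_change_span:
  assumes G: "finite G" "G \<subseteq> carrier M"
    and dense: "\<And>m. m \<in> carrier M \<Longrightarrow> \<exists>s\<in>carrier R. (\<exists>u\<in>carrier A. h s \<otimes>\<^bsub>A\<^esub> u = \<one>\<^bsub>A\<^esub>) \<and> s \<odot>\<^bsub>M\<^esub> m \<in> rspan R M G"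
  shows "\<exists>S. S \<subseteq> carrier BC \<and> finite S \<and> card S \<le> card G \<and> LinearCombinations.module.span A BC S = carrier BC"
proof (intro exI conjI)
  let ?S = "ten \<one>\<^bsub>A\<^esub> ` G"
  show S: "?S \<subseteq> carrier BC" using G by auto
  show "finite ?S" "card ?S \<le> card G" using G card_image_le by auto
  note N = BC.span_is_submodule[OF S]
  have N0: "\<zero>\<^bsub>BC\<^esub> \<in> BC.span ?S"
    and N_add: "\<And>x y. \<lbrakk>x \<in> BC.span ?S; y \<in> BC.span ?S\<rbrakk> \<Longrightarrow> x \<oplus>\<^bsub>BC\<^esub> y \<in> BC.span ?S"
    and N_smult: "\<And>a x. \<lbrakk>a \<in> carrier A; x \<in> BC.span ?S\<rbrakk> \<Longrightarrow> a \<odot>\<^bsub>BC\<^esub> x \<in> BC.span ?S"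
    and N_sub: "BC.span ?S \<subseteq> carrier BC"
    using N by (auto simp: submodule_def)
  have one: "ten \<one>\<^bsub>A\<^esub> m \<in> BC.span ?S \<and> m \<in> carrier M" if "m \<in> rspan R M G" for m
    using that
  proof (induction rule: rspan.induct)
    case zero then show ?case using N0 by (simp add: ten_zero)
  next
    case (incl g) then show ?case using BC.in_own_span[OF S] G by auto
  next
    case (add x y) then show ?case using N_add by (auto simp: ten_add)
  next
    case (smult r x)
    then have "ten \<one>\<^bsub>A\<^esub> (r \<odot>\<^bsub>M\<^esub> x) = h r \<odot>\<^bsub>BC\<^esub> ten \<one>\<^bsub>A\<^esub> x"
      by (simp add: smult_ten ten_smult[symmetric])
    then show ?case using smult N_smult by auto
  qed
  show "BC.span ?S = carrier BC"
  proof (rule submodule_eq_carrier)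
    fix a m assume a: "a \<in> carrier A" and m: "m \<in> carrier M"
    obtain s u where s: "s \<in> carrier R" "u \<in> carrier A" "h s \<otimes>\<^bsub>A\<^esub> u = \<one>\<^bsub>A\<^esub>" "s \<odot>\<^bsub>M\<^esub> m \<in> rspan R M G"
      using dense[OF m] by auto
    have "ten a m = ten (a \<otimes>\<^bsub>A\<^esub> u \<otimes>\<^bsub>A\<^esub> h s) m" using s a A.m_comm[of u "h s"] by (simp add: A.m_assoc)
    also have "\<dots> = ten (a \<otimes>\<^bsub>A\<^esub> u) (s \<odot>\<^bsub>M\<^esub> m)" using s a m by (simp add: ten_smult)
    also have "\<dots> = (a \<otimes>\<^bsub>A\<^esub> u) \<odot>\<^bsub>BC\<^esub> ten \<one>\<^bsub>A\<^esub> (s \<odot>\<^bsub>M\<^esub> m)" using s a m by (simp add: smult_ten)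
    also have "\<dots> \<in> BC.span ?S" using one[OF s(4)] s a by (intro N_smult) auto
    finally show "ten a m \<in> BC.span ?S" .
  qed (use N0 N_add N_smult N_sub in auto)
qed

end

section \<open>Generators up to a multiplicative set\<close>

text \<open>The hypothesis \<open>cover\<close> says that the complement of S lies in the ideal
  (\<pi>). There are two instances: the Iwasawa algebra acting on the dual, with
  \<open>\<pi> = sc pL\<close>, and \<oo> acting on the invariants, with
  \<open>S = Ou\<close>.\<close>

locale module_sat = module R M + mult_subset R S
  for R :: "('a, 'c) ring_scheme" (structure) and M :: "('a, 'm, 'd) module_scheme" and S +
  fixes \<pi>
  assumes pi_closed [simp]: "\<pi> \<in> carrier R"
    and cover: "r \<in> carrier R \<Longrightarrow> r \<notin> S \<Longrightarrow> \<exists>r'\<in>carrier R. r = r' \<otimes> \<pi>"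
begin

abbreviation sp where "sp \<equiv> rspan R M"
text \<open>This is the preimage of the span of G under the map from M to its localization at
  S.\<close>

definition cl where "cl G = {m \<in> carrier M. \<exists>s\<in>S. s \<odot>\<^bsub>M\<^esub> m \<in> sp G}"
definition tors where "tors = {m \<in> carrier M. \<pi> \<odot>\<^bsub>M\<^esub> m = \<zero>\<^bsub>M\<^esub>}"

lemma tors_carrier: "tors \<subseteq> carrier M" by (auto simp: tors_def)

lemma smult_swap: "\<lbrakk>r \<in> carrier R; s \<in> carrier R; m \<in> carrier M\<rbrakk> \<Longrightarrow> r \<odot>\<^bsub>M\<^esub> (s \<odot>\<^bsub>M\<^esub> m) = s \<odot>\<^bsub>M\<^esub> (r \<odot>\<^bsub>M\<^esub> m)"
  by (metis smult_assoc1 R.m_comm)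

lemma cl_I: "\<lbrakk>m \<in> carrier M; s \<in> S; s \<odot>\<^bsub>M\<^esub> m \<in> sp G\<rbrakk> \<Longrightarrow> m \<in> cl G"
  by (auto simp: cl_def)

lemma sp_cl: "\<lbrakk>m \<in> carrier M; m \<in> sp G\<rbrakk> \<Longrightarrow> m \<in> cl G"
  by (rule cl_I[of _ \<one>]) auto

lemma cl_incl: "\<lbrakk>G \<subseteq> carrier M; g \<in> G\<rbrakk> \<Longrightarrow> g \<in> cl G"
  by (rule sp_cl) (auto intro: rspan.incl)

lemma cl_zero: "\<zero>\<^bsub>M\<^esub> \<in> cl G"
  by (rule sp_cl) (auto intro: rspan.zero)

lemma cl_smult: "\<lbrakk>r \<in> carrier R; x \<in> cl G\<rbrakk> \<Longrightarrow> r \<odot>\<^bsub>M\<^esub> x \<in> cl G"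
proof -
  assume r: "r \<in> carrier R" and "x \<in> cl G"
  then obtain s where s: "s \<in> S" "s \<odot>\<^bsub>M\<^esub> x \<in> sp G" "x \<in> carrier M" by (auto simp: cl_def)
  then have "s \<odot>\<^bsub>M\<^esub> (r \<odot>\<^bsub>M\<^esub> x) \<in> sp G" using r by (auto simp: smult_swap[of s r] intro: rspan.smult)
  then show ?thesis using s r by (intro cl_I[of _ s]) auto
qed

lemma cl_add: "\<lbrakk>x \<in> cl G; y \<in> cl G\<rbrakk> \<Longrightarrow> x \<oplus>\<^bsub>M\<^esub> y \<in> cl G"
proof -
  assume "x \<in> cl G" "y \<in> cl G"
  then obtain s t where s: "s \<in> S" "s \<odot>\<^bsub>M\<^esub> x \<in> sp G" "x \<in> carrier M"
    and t: "t \<in> S" "t \<odot>\<^bsub>M\<^esub> y \<in> sp G" "y \<in> carrier M" by (auto simp: cl_def)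
  have "(s \<otimes> t) \<odot>\<^bsub>M\<^esub> (x \<oplus>\<^bsub>M\<^esub> y) = t \<odot>\<^bsub>M\<^esub> (s \<odot>\<^bsub>M\<^esub> x) \<oplus>\<^bsub>M\<^esub> s \<odot>\<^bsub>M\<^esub> (t \<odot>\<^bsub>M\<^esub> y)"
    using s t by (simp add: smult_r_distr smult_assoc1 smult_swap[of s t])
  also have "\<dots> \<in> sp G" by (rule rspan.add; rule rspan.smult) (use s t in auto)
  finally show ?thesis using s t by (intro cl_I[of _ "s \<otimes> t"]) auto
qed

lemma cl_sat: "\<lbrakk>s \<in> S; m \<in> carrier M; s \<odot>\<^bsub>M\<^esub> m \<in> cl G\<rbrakk> \<Longrightarrow> m \<in> cl G"
proof -
  assume s: "s \<in> S" "m \<in> carrier M" and "s \<odot>\<^bsub>M\<^esub> m \<in> cl G"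
  then obtain t where "t \<in> S" "t \<odot>\<^bsub>M\<^esub> (s \<odot>\<^bsub>M\<^esub> m) \<in> sp G" by (auto simp: cl_def)
  then show ?thesis using s by (intro cl_I[of _ "t \<otimes> s"]) (auto simp: smult_assoc1)
qed

lemma sp_subset_cl:
  assumes "G \<subseteq> cl G'" "x \<in> sp G" shows "x \<in> cl G'"
  using assms(2) by (induction rule: rspan.induct) (use assms(1) cl_zero cl_add cl_smult in auto)

text \<open>Idempotence of the closure. Together with \<open>exchange\<close> it makes
  \<open>cl\<close> a matroid closure on the \<pi>-torsion.\<close>

lemma cl_subset: "\<lbrakk>G \<subseteq> cl G'; x \<in> cl G\<rbrakk> \<Longrightarrow> x \<in> cl G'"
  using sp_subset_cl cl_sat by (fastforce simp: cl_def[of G])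

lemma cl_mono: "\<lbrakk>x \<in> cl G; G \<subseteq> G'\<rbrakk> \<Longrightarrow> x \<in> cl G'"
  by (auto simp: cl_def intro: rspan_mono)

lemma sp_insert:
  assumes y: "y \<in> carrier M" and G: "G \<subseteq> carrier M" and x: "x \<in> sp (insert y G)"
  shows "\<exists>r\<in>carrier R. \<exists>g\<in>sp G. x = g \<oplus>\<^bsub>M\<^esub> r \<odot>\<^bsub>M\<^esub> y"
  using x
proof (induction rule: rspan.induct)
  case zero
  show ?case using y by (intro bexI[of _ \<zero>] bexI[of _ "\<zero>\<^bsub>M\<^esub>"]) (auto intro: rspan.zero)
next
  case (incl g)
  show ?case
  proof (cases "g = y")
    case True
    then show ?thesis using y by (intro bexI[of _ \<one>] bexI[of _ "\<zero>\<^bsub>M\<^esub>"]) (auto intro: rspan.zero)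
  next
    case False
    then show ?thesis using incl y G by (intro bexI[of _ \<zero>] bexI[of _ g]) (auto intro: rspan.incl)
  qed
next
  case (add x z)
  then obtain r g r' g' where *: "r \<in> carrier R" "g \<in> sp G" "x = g \<oplus>\<^bsub>M\<^esub> r \<odot>\<^bsub>M\<^esub> y"
    "r' \<in> carrier R" "g' \<in> sp G" "z = g' \<oplus>\<^bsub>M\<^esub> r' \<odot>\<^bsub>M\<^esub> y" by blast
  have "g \<in> carrier M" "g' \<in> carrier M" using * rspan_closed[OF G] by auto
  then have "x \<oplus>\<^bsub>M\<^esub> z = (g \<oplus>\<^bsub>M\<^esub> g') \<oplus>\<^bsub>M\<^esub> (r \<oplus> r') \<odot>\<^bsub>M\<^esub> y"
    using * y by (simp add: smult_l_distr M.a_ac)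
  then show ?case using * by (intro bexI[of _ "r \<oplus> r'"] bexI[of _ "g \<oplus>\<^bsub>M\<^esub> g'"]) (auto intro: rspan.add)
next
  case (smult s x)
  then obtain r g where *: "r \<in> carrier R" "g \<in> sp G" "x = g \<oplus>\<^bsub>M\<^esub> r \<odot>\<^bsub>M\<^esub> y" by blast
  have "g \<in> carrier M" using * rspan_closed[OF G] by auto
  then have "s \<odot>\<^bsub>M\<^esub> x = (s \<odot>\<^bsub>M\<^esub> g) \<oplus>\<^bsub>M\<^esub> (s \<otimes> r) \<odot>\<^bsub>M\<^esub> y"
    using * y smult by (simp add: smult_r_distr smult_assoc1)
  then show ?case using * smult by (intro bexI[of _ "s \<otimes> r"] bexI[of _ "s \<odot>\<^bsub>M\<^esub> g"]) (auto intro: rspan.smult)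
qed

text \<open>Write s x = g + r y. If r were outside S it would be a multiple of \<pi> and kill y,
  putting x into the closure of G. So r lies in S, and r y = s x - g shows that y depends on x and
  G.\<close>

lemma exchange:
  assumes G: "G \<subseteq> carrier M" and y: "y \<in> tors" and x: "x \<in> cl (insert y G)" "x \<notin> cl G"
  shows "y \<in> cl (insert x G)"
proof -
  have y': "y \<in> carrier M" "\<pi> \<odot>\<^bsub>M\<^esub> y = \<zero>\<^bsub>M\<^esub>" using y by (auto simp: tors_def)
  from x obtain s where s: "s \<in> S" "s \<odot>\<^bsub>M\<^esub> x \<in> sp (insert y G)" and xM: "x \<in> carrier M" by (auto simp: cl_def)
  from sp_insert[OF y'(1) G s(2)] obtain r g where r: "r \<in> carrier R" "g \<in> sp G" "s \<odot>\<^bsub>M\<^esub> x = g \<oplus>\<^bsub>M\<^esub> r \<odot>\<^bsub>M\<^esub> y" by blast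
  have gM: "g \<in> carrier M" using r G rspan_closed by auto
  have "r \<in> S"
  proof (rule ccontr)
    assume "r \<notin> S"
    with cover[OF r(1)] obtain r' where "r' \<in> carrier R" "r = r' \<otimes> \<pi>" by blast
    then have "r \<odot>\<^bsub>M\<^esub> y = \<zero>\<^bsub>M\<^esub>" using y' by (simp add: smult_assoc1)
    then have "s \<odot>\<^bsub>M\<^esub> x = g" using r gM by simp
    then show False using x(2) s r xM by (auto simp: cl_def)
  qed
  have "r \<odot>\<^bsub>M\<^esub> y = s \<odot>\<^bsub>M\<^esub> x \<oplus>\<^bsub>M\<^esub> \<ominus> \<one> \<odot>\<^bsub>M\<^esub> g"
    using r(1,3) gM y' xM s by (simp add: smult_minus_1 M.a_ac M.l_neg M.r_neg M.r_neg1 M.r_neg2)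
  also have "\<dots> \<in> sp (insert x G)"
    by (rule rspan.add; rule rspan.smult) (use s r xM rspan_mono[of g R M G] in \<open>auto intro: rspan.incl\<close>)
  finally show ?thesis using \<open>r \<in> S\<close> y' by (intro cl_I[of _ r]) auto
qed

definition indep where "indep A \<longleftrightarrow> A \<subseteq> tors \<and> finite A \<and> (\<forall>a\<in>A. a \<notin> cl (A - {a}))"

lemma indep_subset: "\<lbrakk>indep A; B \<subseteq> A\<rbrakk> \<Longrightarrow> indep B"
  unfolding indep_def by (meson Diff_mono cl_mono finite_subset order_refl subset_iff)

text \<open>If some a of A became dependent after adding x, \<open>exchange\<close> would express x
  through a and the rest of A.\<close>

lemma indep_insert:
  assumes A: "indep A" and x: "x \<in> tors" "x \<notin> cl A"
  shows "indep (insert x A)"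
  unfolding indep_def
proof (intro conjI ballI)
  show "insert x A \<subseteq> tors" "finite (insert x A)" using A x by (auto simp: indep_def)
  have AM: "A \<subseteq> carrier M" using A tors_carrier by (auto simp: indep_def)
  fix a assume a: "a \<in> insert x A"
  show "a \<notin> cl (insert x A - {a})"
  proof (cases "a = x")
    case True then show ?thesis using x cl_mono[of x "insert x A - {x}" A] by auto
  next
    case False
    then have aA: "a \<in> A" using a by simp
    show ?thesis
    proof
      assume "a \<in> cl (insert x A - {a})"
      moreover have "insert x A - {a} = insert x (A - {a})" using False by auto
      ultimately have 1: "a \<in> cl (insert x (A - {a}))" by metis
      have 2: "a \<notin> cl (A - {a})" using A aA by (auto simp: indep_def)
      have 3: "A - {a} \<subseteq> carrier M" using AM by auto
      have "x \<in> cl (insert a (A - {a}))" by (rule exchange[OF 3 x(1) 1 2])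
      then show False using x aA by (simp add: insert_absorb)
    qed
  qed
qed

text \<open>Adding the elements of F one at a time, a enters the closure at a definite moment; the
  element e added at that moment is the one that can be traded for a.\<close>

lemma first_entry:
  assumes "finite F" "a \<notin> cl A" "a \<in> cl (A \<union> F)"
  shows "\<exists>e F'. e \<in> F \<and> F' \<subseteq> F - {e} \<and> a \<notin> cl (A \<union> F') \<and> a \<in> cl (insert e (A \<union> F'))"
  using assms
proof (induction F rule: finite_induct)
  case empty then show ?case by simp
next
  case (insert f F)
  show ?case
  proof (cases "a \<in> cl (A \<union> F)")
    case True then show ?thesis using insert by blast
  next
    case False
    then show ?thesis using insert by (intro exI[of _ f] exI[of _ F]) auto
  qed
qed

text \<open>Each element of A replaces one element of E. The surviving part E' serves twice: it
  bounds independent sets by \<open>card E\<close>, and it completes a partial basis with control of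
  the cardinality.\<close>

lemma steinitz:
  assumes E: "finite E" "E \<subseteq> tors" and A: "indep A" "A \<subseteq> cl E"
  shows "\<exists>E'\<subseteq>E. card A + card E' \<le> card E \<and> E \<subseteq> cl (A \<union> E')"
proof -
  have "finite A" using A by (auto simp: indep_def)
  then show ?thesis using A
  proof (induction A rule: finite_induct)
    case empty
    have "E \<subseteq> carrier M" using E tors_carrier by auto
    then show ?case using cl_incl by (intro exI[of _ E]) auto
  next
    case (insert a A)
    have iA: "indep A" using insert indep_subset by blast
    then obtain E' where E': "E' \<subseteq> E" "card A + card E' \<le> card E" "E \<subseteq> cl (A \<union> E')"
      using insert by auto
    have aM: "insert a A \<subseteq> carrier M" "a \<in> tors" using insert tors_carrier by (auto simp: indep_def)
    have "a \<in> cl (A \<union> E')" using cl_subset[OF E'(3)] insert by auto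
    moreover have "a \<notin> cl A" using insert by (auto simp: indep_def)
    ultimately obtain e F where eF: "e \<in> E'" "F \<subseteq> E' - {e}" "a \<notin> cl (A \<union> F)" "a \<in> cl (insert e (A \<union> F))"
      using first_entry[of E' a A] finite_subset[OF E'(1) E(1)] by blast
    have EM: "E' \<subseteq> carrier M" using E' E tors_carrier by auto
    have 1: "A \<union> F \<subseteq> carrier M" using eF(2) EM aM by blast
    have 2: "e \<in> tors" using eF(1) E' E by blast
    have "e \<in> cl (insert a (A \<union> F))" by (rule exchange[OF 1 2 eF(4,3)])
    then have e: "e \<in> cl (insert a A \<union> (E' - {e}))"
      by (rule cl_mono) (use eF in auto)
    have "A \<union> E' \<subseteq> cl (insert a A \<union> (E' - {e}))"
    proof
      fix x assume x: "x \<in> A \<union> E'"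
      show "x \<in> cl (insert a A \<union> (E' - {e}))"
      proof (cases "x = e")
        case True then show ?thesis using e by simp
      next
        case False then show ?thesis using x aM EM by (intro cl_incl) auto
      qed
    qed
    then have "E \<subseteq> cl (insert a A \<union> (E' - {e}))" using E'(3) cl_subset by blast
    moreover have "card (E' - {e}) + 1 = card E'"
      using eF finite_subset[OF E'(1) E(1)] by (metis Suc_eq_plus1 card_Suc_Diff1)
    ultimately show ?case using E' insert by (intro exI[of _ "E' - {e}"]) auto
  qed
qed

text \<open>By \<open>steinitz\<close> independent subsets of P have at most \<open>card E\<close>
  elements, so there is a largest one; \<open>indep_insert\<close> shows that P lies in its closure.
  The point is that the basis is found inside P although E need not be.\<close>

lemma basis_exists:
  assumes E: "finite E" "E \<subseteq> tors" and P: "P \<subseteq> tors" "P \<subseteq> cl E"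
  shows "\<exists>A\<subseteq>P. indep A \<and> P \<subseteq> cl A \<and> card A \<le> card E"
proof -
  define Q where "Q k \<longleftrightarrow> (\<exists>A\<subseteq>P. indep A \<and> card A = k)" for k
  have bound: "card A \<le> card E" if "A \<subseteq> P" "indep A" for A
    using steinitz[OF E that(2)] that P by fastforce
  have "Q 0" unfolding Q_def by (intro exI[of _ "{}"]) (auto simp: indep_def)
  moreover have "\<forall>k. Q k \<longrightarrow> k \<le> card E" using bound by (auto simp: Q_def)
  ultimately obtain k where k: "Q k" "\<And>j. Q j \<Longrightarrow> j \<le> k"
    using GreatestI_nat[of Q 0 "card E"] Greatest_le_nat[of Q _ "card E"] by blast
  then obtain A where A: "A \<subseteq> P" "indep A" "card A = k" by (auto simp: Q_def)
  have "P \<subseteq> cl A"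
  proof (rule subsetI, rule ccontr)
    fix x assume x: "x \<in> P" "x \<notin> cl A"
    then have "indep (insert x A)" using A P by (intro indep_insert) auto
    moreover have "x \<notin> A" using x A cl_incl[of A x] tors_carrier by (auto simp: indep_def)
    ultimately have "Q (Suc k)" using A x by (auto simp: Q_def indep_def intro!: exI[of _ "insert x A"])
    then show False using k(2) by fastforce
  qed
  then show ?thesis using A bound by blast
qed

definition submod where "submod N \<longleftrightarrow> N \<subseteq> carrier M \<and> \<zero>\<^bsub>M\<^esub> \<in> N \<and>
  (\<forall>x\<in>N. \<forall>y\<in>N. x \<oplus>\<^bsub>M\<^esub> y \<in> N) \<and> (\<forall>r\<in>carrier R. \<forall>x\<in>N. r \<odot>\<^bsub>M\<^esub> x \<in> N)"

lemma sp_submod: "\<lbrakk>submod N; G \<subseteq> N; x \<in> sp G\<rbrakk> \<Longrightarrow> x \<in> N"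
  by (rotate_tac 2, induction rule: rspan.induct) (auto simp: submod_def)

text \<open>Allows a linear combination of multiples \<pi> h to be divided by \<pi> without changing
  the coefficients.\<close>

lemma sp_image_pi:
  assumes "H \<subseteq> carrier M" "x \<in> sp ((\<odot>\<^bsub>M\<^esub>) \<pi> ` H)"
  shows "\<exists>g\<in>sp H. x = \<pi> \<odot>\<^bsub>M\<^esub> g"
  using assms(2)
proof (induction rule: rspan.induct)
  case zero then show ?case by (intro bexI[of _ "\<zero>\<^bsub>M\<^esub>"]) (auto intro: rspan.zero)
next
  case (incl g) then show ?case by (auto intro: rspan.incl)
next
  case (add x y)
  then obtain g g' where "g \<in> sp H" "g' \<in> sp H" "x = \<pi> \<odot>\<^bsub>M\<^esub> g" "y = \<pi> \<odot>\<^bsub>M\<^esub> g'" by blast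
  then show ?case using rspan_closed[OF assms(1)]
    by (intro bexI[of _ "g \<oplus>\<^bsub>M\<^esub> g'"]) (auto intro: rspan.add simp: smult_r_distr)
next
  case (smult r x)
  then obtain g where "g \<in> sp H" "x = \<pi> \<odot>\<^bsub>M\<^esub> g" by blast
  then show ?case using rspan_closed[OF assms(1)] smult
    by (intro bexI[of _ "r \<odot>\<^bsub>M\<^esub> g"]) (auto intro: rspan.smult simp: smult_swap)
qed

text \<open>The induction on \<open>k\<close> passes from \<open>N\<close> to \<open>\<pi>N\<close>. A basis of the \<open>\<pi>\<close>-torsion of \<open>\<pi>N\<close> is completed
  to one of the \<open>\<pi>\<close>-torsion of \<open>N\<close>, and the added elements together with \<open>\<pi>\<close>-divisions of
  generators of \<open>\<pi>N\<close> generate \<open>N\<close>.\<close>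

theorem generators_from_torsion:
  assumes "submod N" "s0 \<in> S" "\<And>m. m \<in> N \<Longrightarrow> s0 \<odot>\<^bsub>M\<^esub> ((\<pi> [^] (k::nat)) \<odot>\<^bsub>M\<^esub> m) = \<zero>\<^bsub>M\<^esub>"
    and "finite E" "E \<subseteq> tors" "N \<inter> tors \<subseteq> cl E"
  shows "\<exists>G\<subseteq>N. finite G \<and> card G \<le> card E \<and> N \<subseteq> cl G"
  using assms(1,3-6)
proof (induction k arbitrary: N E)
  case 0
  have "N \<subseteq> cl {}"
  proof
    fix m assume m: "m \<in> N"
    then have mM: "m \<in> carrier M" using 0 by (auto simp: submod_def)
    then have "s0 \<odot>\<^bsub>M\<^esub> m = \<zero>\<^bsub>M\<^esub>" using 0(2)[OF m] by simp
    then have "s0 \<odot>\<^bsub>M\<^esub> m \<in> cl {}" using cl_zero by simp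
    then show "m \<in> cl {}" by (rule cl_sat[OF assms(2) mM])
  qed
  then show ?case by (intro exI[of _ "{}"]) auto
next
  case (Suc k)
  have NM: "N \<subseteq> carrier M" using Suc by (auto simp: submod_def)
  \<comment> \<open>The given E need not lie in N, so it is first replaced by a basis of the torsion
    of N.\<close>
  obtain B where B: "B \<subseteq> N \<inter> tors" "indep B" "N \<inter> tors \<subseteq> cl B" "card B \<le> card E"
    using basis_exists[OF Suc.prems(3,4), of "N \<inter> tors"] Suc.prems(5) by auto
  define N' where "N' = (\<odot>\<^bsub>M\<^esub>) \<pi> ` N"
  have N'N: "N' \<subseteq> N" using Suc.prems(1) by (auto simp: N'_def submod_def)
  have finB: "finite B" using B by (auto simp: indep_def)
  \<comment> \<open>The induction hypothesis is applied to \<pi>N with this basis of its torsion, so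
    that the bound is \<open>card A\<close> and leaves room for further generators.\<close>
  obtain A where A: "A \<subseteq> N' \<inter> tors" "indep A" "N' \<inter> tors \<subseteq> cl A"
    using basis_exists[of B "N' \<inter> tors"] finB B N'N by auto
  have "submod N'"
    unfolding submod_def
  proof (intro conjI ballI)
    show "N' \<subseteq> carrier M" using N'N NM by auto
    show "\<zero>\<^bsub>M\<^esub> \<in> N'" using Suc.prems(1) by (auto simp: N'_def submod_def image_iff intro!: bexI[of _ "\<zero>\<^bsub>M\<^esub>"])
  next
    fix x y assume "x \<in> N'" "y \<in> N'"
    then obtain x' y' where "x' \<in> N" "y' \<in> N" "x = \<pi> \<odot>\<^bsub>M\<^esub> x'" "y = \<pi> \<odot>\<^bsub>M\<^esub> y'" by (auto simp: N'_def)
    then show "x \<oplus>\<^bsub>M\<^esub> y \<in> N'" unfolding N'_def using Suc.prems(1) NM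
      by (intro image_eqI[of _ _ "x' \<oplus>\<^bsub>M\<^esub> y'"]) (auto simp: submod_def smult_r_distr subset_iff)
  next
    fix r x assume "r \<in> carrier R" "x \<in> N'"
    then obtain x' where "x' \<in> N" "x = \<pi> \<odot>\<^bsub>M\<^esub> x'" by (auto simp: N'_def)
    then show "r \<odot>\<^bsub>M\<^esub> x \<in> N'" unfolding N'_def using Suc.prems(1) NM \<open>r \<in> carrier R\<close>
      by (intro image_eqI[of _ _ "r \<odot>\<^bsub>M\<^esub> x'"]) (auto simp: submod_def smult_swap subset_iff)
  qed
  moreover have "s0 \<odot>\<^bsub>M\<^esub> ((\<pi> [^] k) \<odot>\<^bsub>M\<^esub> m) = \<zero>\<^bsub>M\<^esub>" if "m \<in> N'" for m
  proof -
    from that obtain m' where m': "m' \<in> N" "m = \<pi> \<odot>\<^bsub>M\<^esub> m'" by (auto simp: N'_def)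
    then have "(\<pi> [^] k) \<odot>\<^bsub>M\<^esub> m = (\<pi> [^] Suc k) \<odot>\<^bsub>M\<^esub> m'" using NM by (auto simp: smult_assoc1[symmetric] subset_iff)
    then show ?thesis using Suc.prems(2)[OF m'(1)] by simp
  qed
  moreover have "A \<subseteq> tors" "finite A" using A by (auto simp: indep_def)
  ultimately obtain G' where G': "G' \<subseteq> N'" "finite G'" "card G' \<le> card A" "N' \<subseteq> cl G'"
    using Suc.IH[of N' A] A(3) by blast
  \<comment> \<open>One division by \<pi> for each generator of \<pi>N.\<close>
  obtain H where H: "H \<subseteq> N" "finite H" "card H = card G'" "G' = (\<odot>\<^bsub>M\<^esub>) \<pi> ` H"
    using subset_image_inj[of G' "(\<odot>\<^bsub>M\<^esub>) \<pi>" N] G' unfolding N'_def by (metis card_image finite_imageD)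
  have HM: "H \<subseteq> carrier M" using H NM by auto
  have "A \<subseteq> cl B" using A(1) N'N B(3) by blast
  then obtain E' where E': "E' \<subseteq> B" "card A + card E' \<le> card B" "B \<subseteq> cl (A \<union> E')"
    using steinitz[of B A] finB A B by auto
  let ?G = "H \<union> E'"
  have GN: "?G \<subseteq> N" using H E' B by auto
  then have GM: "?G \<subseteq> carrier M" using NM by auto
  have "finite ?G" using H E' finB finite_subset by auto
  moreover have "card ?G \<le> card E" using card_Un_le[of H E'] H G' E' B by linarith
  moreover have "N \<subseteq> cl ?G"
  proof
    fix m assume m: "m \<in> N"
    then have mM: "m \<in> carrier M" using NM by auto
    have G'G: "G' \<subseteq> cl ?G" using H cl_incl[OF GM] cl_smult by fastforce
    have AE: "A \<union> E' \<subseteq> cl ?G" using A G'(4) cl_subset[OF G'G] cl_incl[OF GM] by blast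
    have "\<pi> \<odot>\<^bsub>M\<^esub> m \<in> cl G'" using m G'(4) by (auto simp: N'_def)
    then obtain s where s: "s \<in> S" "s \<odot>\<^bsub>M\<^esub> (\<pi> \<odot>\<^bsub>M\<^esub> m) \<in> sp G'" by (auto simp: cl_def)
    then obtain g where g: "g \<in> sp H" "s \<odot>\<^bsub>M\<^esub> (\<pi> \<odot>\<^bsub>M\<^esub> m) = \<pi> \<odot>\<^bsub>M\<^esub> g"
      using sp_image_pi[OF HM] H by auto
    have gM: "g \<in> carrier M" using g rspan_closed[OF HM] by auto
    \<comment> \<open>Since s \<pi> m = \<pi> g, the difference t = s m - g is \<pi>-torsion and
      hence covered by B. So s m = t + g lies in the closure.\<close>
    define t where "t = s \<odot>\<^bsub>M\<^esub> m \<oplus>\<^bsub>M\<^esub> (\<ominus> \<one>) \<odot>\<^bsub>M\<^esub> g"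
    have tM: "t \<in> carrier M" using s mM gM by (auto simp: t_def)
    have "t \<in> N" using Suc.prems(1) m s sp_submod[OF Suc.prems(1) H(1) g(1)] by (auto simp: t_def submod_def)
    moreover have "\<pi> \<odot>\<^bsub>M\<^esub> t = \<zero>\<^bsub>M\<^esub>"
      using s mM gM g by (simp add: t_def smult_r_distr smult_swap[of \<pi>] smult_minus_1 smult_r_minus M.r_neg)
    ultimately have "t \<in> cl B" using B tM by (auto simp: tors_def)
    then have "t \<in> cl ?G" using cl_subset E'(3) AE by (meson subset_iff)
    moreover have "g \<in> cl ?G" using g gM by (intro sp_cl, simp, rule_tac rspan_mono[of g R M H]) auto
    moreover have "s \<odot>\<^bsub>M\<^esub> m = t \<oplus>\<^bsub>M\<^esub> g"
      using s mM gM by (simp add: t_def smult_minus_1 M.a_assoc M.l_neg)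
    ultimately have "s \<odot>\<^bsub>M\<^esub> m \<in> cl ?G" using cl_add by simp
    then show "m \<in> cl ?G" using cl_sat s mM by blast
  qed
  ultimately show ?case using GN by blast
qed

end

section \<open>The ring of integers of a finite extension of \<open>\<rat>\<^sub>p\<close>\<close>

locale qp =
  fixes p :: nat and nrm :: "'q::field_char_0 \<Rightarrow> real"
  assumes is_Qp: "is_Qp p nrm"
begin

lemma p_prime: "prime p" using is_Qp by (simp add: is_Qp_def)
lemma p_gt_1: "p > 1" using p_prime prime_gt_1_nat by auto
lemma nrm_nonneg [simp]: "0 \<le> nrm x" using is_Qp by (simp add: is_Qp_def)
lemma nrm_zero_iff [simp]: "nrm x = 0 \<longleftrightarrow> x = 0" using is_Qp by (simp add: is_Qp_def)
lemma nrm_0 [simp]: "nrm 0 = 0" by simp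
lemma nrm_mult: "nrm (x * y) = nrm x * nrm y" using is_Qp by (simp add: is_Qp_def)
lemma nrm_ultra: "nrm (x + y) \<le> max (nrm x) (nrm y)" using is_Qp by (simp add: is_Qp_def)
lemma nrm_of_int: "a \<noteq> 0 \<Longrightarrow> nrm (of_int a) = (1 / real p) ^ multiplicity (int p) a"
  using is_Qp by (simp add: is_Qp_def)
lemma nrm_dense: "e > 0 \<Longrightarrow> \<exists>r::rat. nrm (x - of_rat r) < e" using is_Qp by (simp add: is_Qp_def)

lemma nrm_pos [simp]: "x \<noteq> 0 \<Longrightarrow> nrm x > 0"
  using nrm_nonneg[of x] nrm_zero_iff[of x] by linarith

lemma nrm_one [simp]: "nrm 1 = 1"
  using nrm_mult[of 1 1] by simp

lemma nrm_neg_one: "nrm (-1) = 1"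
proof -
  have "nrm (-1) * nrm (-1) = 1" using nrm_mult[of "-1" "-1"] by simp
  then show ?thesis using nrm_nonneg[of "-1"] by (metis abs_of_nonneg abs_square_eq_1 power2_eq_square)
qed

lemma nrm_minus [simp]: "nrm (- x) = nrm x"
  using nrm_mult[of "-1" x] nrm_neg_one by simp

lemma nrm_minus_commute: "nrm (x - y) = nrm (y - x)"
  by (metis minus_diff_eq nrm_minus)

lemma nrm_diff: "nrm (x - y) \<le> max (nrm x) (nrm y)"
  using nrm_ultra[of x "- y"] by simp

lemma nrm_power: "nrm (x ^ n) = nrm x ^ n"
  by (induction n) (auto simp: nrm_mult)

lemma nrm_inverse: "nrm (inverse x) = inverse (nrm x)"
proof (cases "x = 0")
  case False
  then have "nrm x * nrm (inverse x) = 1" by (simp flip: nrm_mult)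
  then show ?thesis by (metis inverse_unique)
qed simp

lemma nrm_divide: "nrm (x / y) = nrm x / nrm y"
  by (simp add: divide_inverse nrm_mult nrm_inverse)

lemma nrm_of_int_le_one: "nrm (of_int a) \<le> 1"
  using p_gt_1 by (cases "a = 0") (auto simp: nrm_of_int power_le_one)

lemma nrm_of_int_le_iff: "nrm (of_int a) \<le> (1 / real p) ^ m \<longleftrightarrow> int p ^ m dvd a"
proof (cases "a = 0")
  case False
  have "nrm (of_int a) \<le> (1 / real p) ^ m \<longleftrightarrow> m \<le> multiplicity (int p) a"
    unfolding nrm_of_int[OF False] using p_gt_1 by (intro power_decreasing_iff) auto
  also have "\<dots> \<longleftrightarrow> int p ^ m dvd a"
    using False p_gt_1 by (intro power_dvd_iff_le_multiplicity[symmetric]) auto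
  finally show ?thesis .
qed simp

lemma nrm_p: "nrm (of_nat p) = 1 / real p"
proof -
  have "nrm (of_int (int p)) = (1 / real p) ^ multiplicity (int p) (int p)"
    using p_gt_1 by (intro nrm_of_int) auto
  also have "multiplicity (int p) (int p) = 1"
    using p_gt_1 by (intro multiplicity_self) auto
  finally show ?thesis by simp
qed

lemma nrm_p_power: "nrm (of_nat p ^ m) = (1 / real p) ^ m"
  by (simp add: nrm_power nrm_p)

lemma Zp_iff: "x \<in> Zp nrm \<longleftrightarrow> nrm x \<le> 1" by (simp add: Zp_def)

lemma Zp_closed [simp]:
  "0 \<in> Zp nrm" "1 \<in> Zp nrm"
  "\<lbrakk>x \<in> Zp nrm; y \<in> Zp nrm\<rbrakk> \<Longrightarrow> x + y \<in> Zp nrm"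
  "\<lbrakk>x \<in> Zp nrm; y \<in> Zp nrm\<rbrakk> \<Longrightarrow> x - y \<in> Zp nrm"
  "\<lbrakk>x \<in> Zp nrm; y \<in> Zp nrm\<rbrakk> \<Longrightarrow> x * y \<in> Zp nrm"
  "- x \<in> Zp nrm \<longleftrightarrow> x \<in> Zp nrm"
  "of_int i \<in> Zp nrm" "of_nat n \<in> Zp nrm"
proof -
  show "0 \<in> Zp nrm" "1 \<in> Zp nrm" "- x \<in> Zp nrm \<longleftrightarrow> x \<in> Zp nrm" by (simp_all add: Zp_iff)
  show "\<lbrakk>x \<in> Zp nrm; y \<in> Zp nrm\<rbrakk> \<Longrightarrow> x + y \<in> Zp nrm" using nrm_ultra[of x y] by (simp add: Zp_iff)
  show "\<lbrakk>x \<in> Zp nrm; y \<in> Zp nrm\<rbrakk> \<Longrightarrow> x - y \<in> Zp nrm" using nrm_diff[of x y] by (simp add: Zp_iff)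
  show "\<lbrakk>x \<in> Zp nrm; y \<in> Zp nrm\<rbrakk> \<Longrightarrow> x * y \<in> Zp nrm" by (simp add: Zp_iff nrm_mult mult_le_one)
  show "of_int i \<in> Zp nrm" using nrm_of_int_le_one by (simp add: Zp_iff)
  show "of_nat n \<in> Zp nrm" using nrm_of_int_le_one[of "int n"] by (simp add: Zp_iff)
qed

lemma ball_iff: "nrm x \<le> (1 / real p) ^ m \<longleftrightarrow> (\<exists>z\<in>Zp nrm. x = of_nat p ^ m * z)"
proof
  assume *: "nrm x \<le> (1 / real p) ^ m"
  have "nrm (x / of_nat p ^ m) \<le> 1"
    unfolding nrm_divide nrm_p_power using * p_gt_1 by (subst divide_le_eq_1) auto
  then show "\<exists>z\<in>Zp nrm. x = of_nat p ^ m * z"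
    using p_gt_1 by (intro bexI[of _ "x / of_nat p ^ m"]) (auto simp: Zp_iff)
next
  assume "\<exists>z\<in>Zp nrm. x = of_nat p ^ m * z"
  then obtain z where z: "nrm z \<le> 1" "x = of_nat p ^ m * z" by (auto simp: Zp_iff)
  have "nrm x = (1 / real p) ^ m * nrm z" unfolding z(2) nrm_mult nrm_p_power ..
  also have "\<dots> \<le> (1 / real p) ^ m * 1" using z(1) by (intro mult_left_mono) auto
  finally show "nrm x \<le> (1 / real p) ^ m" by simp
qed

lemma rat_quot: "\<exists>a b. b > 0 \<and> coprime a b \<and> of_rat r = (of_int a / of_int b :: 'a::field_char_0)"
proof -
  obtain a b where ab: "quotient_of r = (a, b)" by force
  then have "b > 0" "coprime a b" "r = of_int a / of_int b"
    using quotient_of_denom_pos quotient_of_coprime quotient_of_div by auto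
  then show ?thesis by (intro exI[of _ a] exI[of _ b]) (simp add: of_rat_divide)
qed

text \<open>Density gives a rational a/b near x; as x is integral, b is prime to p, so a/b is
  congruent modulo p^m to an integer, which may be taken in the range from 0 to p^m - 1.\<close>

lemma Zp_approx:
  assumes "x \<in> Zp nrm"
  shows "\<exists>i<p ^ m. nrm (x - of_nat i) \<le> (1 / real p) ^ m"
proof -
  have pos: "(1 / real p) ^ m > 0" "(1 / real p) ^ m \<le> 1" using p_gt_1 by (auto simp: power_le_one)
  obtain r where r: "nrm (x - of_rat r) < (1 / real p) ^ m" using nrm_dense[OF pos(1)] by blast
  obtain a b where ab: "b > 0" "coprime a b" "(of_rat r :: 'q) = of_int a / of_int b" using rat_quot by blast
  have "nrm (of_rat r) \<le> max (nrm x) (nrm (x - of_rat r))"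
    using nrm_diff[of x "x - of_rat r"] by simp
  then have r1: "nrm (of_rat r) \<le> 1" using r pos assms by (auto simp: Zp_iff)
  \<comment> \<open>A reduced fraction with p in its denominator has norm greater than 1.\<close>
  have "\<not> int p dvd b"
  proof
    assume pb: "int p dvd b"
    then have "\<not> int p dvd a" using ab(2) p_prime by (metis coprime_common_divisor prime_nat_int_transfer not_prime_unit)
    then have "nrm (of_int a) = 1"
      using nrm_of_int_le_one[of a] nrm_of_int[of a] by (cases "a = 0") (auto simp: not_dvd_imp_multiplicity_0)
    moreover have "nrm (of_int b) < 1"
    proof -
      have "nrm (of_int b) \<le> 1 / real p" using pb nrm_of_int_le_iff[of b 1] by simp
      also have "\<dots> < 1" using p_gt_1 by simp
      finally show ?thesis .
    qed
    ultimately have "nrm (of_rat r) > 1" using ab(1,3) by (simp add: nrm_divide)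
    then show False using r1 by simp
  qed
  then have "coprime b (int p ^ m)"
    using p_prime by (metis coprime_commute coprime_power_left_iff prime_imp_coprime prime_nat_int_transfer)
  then obtain c v where c: "c * b + v * int p ^ m = 1"
    using bezout_int[of b "int p ^ m"] by (auto simp: coprime_iff_gcd_eq_1)
  have nb: "nrm (of_int b) = 1"
    using \<open>\<not> int p dvd b\<close> ab(1) by (simp add: nrm_of_int not_dvd_imp_multiplicity_0)
  define i where "i = nat ((a * c) mod (int p ^ m))"
  have i: "int i = (a * c) mod (int p ^ m)" using p_gt_1 by (simp add: i_def)
  have "i < p ^ m"
  proof -
    have "int i < int p ^ m" unfolding i using p_gt_1 by (intro pos_mod_bound) simp
    then show ?thesis by (metis of_nat_less_iff of_nat_power)
  qed
  have "int p ^ m dvd a - b * int i"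
  proof -
    obtain q where q: "a * c = int p ^ m * q + int i" unfolding i by (metis mult_div_mod_eq)
    have "b * int i = b * (a * c) - b * (int p ^ m * q)" unfolding q by (simp add: algebra_simps)
    also have "b * (a * c) = a * (c * b)" by simp
    also have "c * b = 1 - v * int p ^ m" using c by simp
    finally have "a - b * int i = int p ^ m * (a * v + b * q)"
      by (simp add: algebra_simps)
    then show ?thesis by simp
  qed
  then have "nrm (of_int (a - b * int i)) \<le> (1 / real p) ^ m" unfolding nrm_of_int_le_iff .
  moreover have "of_rat r - of_nat i = (of_int (a - b * int i) :: 'q) / of_int b"
    using ab(1,3) by (simp add: field_simps)
  ultimately have "nrm (of_rat r - of_nat i) \<le> (1 / real p) ^ m" by (simp add: nrm_divide nb)
  then have "nrm (x - of_nat i) \<le> (1 / real p) ^ m"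
    using nrm_ultra[of "x - of_rat r" "of_rat r - of_nat i"] r by simp
  then show ?thesis using \<open>i < p ^ m\<close> by blast
qed

text \<open>By the ultrametric inequality x has the same norm as any rational closer to x than its
  own norm.\<close>

lemma nrm_value:
  assumes "x \<noteq> 0" shows "\<exists>k::int. nrm x = real p powi k"
proof -
  obtain r where r: "nrm (x - of_rat r) < nrm x" using nrm_dense[of "nrm x" x] assms by auto
  have "nrm x \<le> max (nrm (of_rat r)) (nrm (x - of_rat r))"
    using nrm_ultra[of "of_rat r" "x - of_rat r"] by simp
  moreover have "nrm (of_rat r) \<le> max (nrm x) (nrm (x - of_rat r))"
    using nrm_diff[of x "x - of_rat r"] by simp
  ultimately have *: "nrm x = nrm (of_rat r)" using r by linarith
  obtain a b where ab: "b > 0" "coprime a b" "(of_rat r :: 'q) = of_int a / of_int b" using rat_quot by blast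
  have "a \<noteq> 0" using * ab assms by auto
  then have "nrm x = (1 / real p) ^ multiplicity (int p) a / (1 / real p) ^ multiplicity (int p) b"
    unfolding * ab(3) nrm_divide using ab(1) by (simp add: nrm_of_int)
  also have "\<dots> = real p powi (int (multiplicity (int p) b) - int (multiplicity (int p) a))"
    using p_gt_1 by (simp add: power_int_diff field_simps)
  finally show ?thesis by blast
qed

end

lemma int_ring_simps [simp]:
  "monoid.mult (int_ring nrm emb) x y = x * y" "\<one>\<^bsub>int_ring nrm emb\<^esub> = 1"
  "\<zero>\<^bsub>int_ring nrm emb\<^esub> = 0" "ring.add (int_ring nrm emb) x y = x + y"
  by (simp_all add: int_ring_def field_ring_def)

locale int_ext = qp p nrm for p :: nat and nrm :: "'q::field_char_0 \<Rightarrow> real" +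
  fixes emb :: "'q \<Rightarrow> 'l::field" and pL :: 'l
  assumes fin_ext: "finite_extension emb" and unif: "is_uniformizer (int_ring nrm emb) pL"
begin

abbreviation \<O> where "\<O> \<equiv> int_ring nrm emb"
abbreviation Oc where "Oc \<equiv> carrier \<O>"

lemma emb_hom [simp]: "emb 1 = 1" "emb (x + y) = emb x + emb y" "emb (x * y) = emb x * emb y"
  using fin_ext by (auto simp: finite_extension_def)

lemma emb_0 [simp]: "emb 0 = 0"
  using emb_hom(2)[of 0 0] by (metis add_cancel_right_right add_0_right)

lemma emb_minus [simp]: "emb (- x) = - emb x"
  using emb_hom(2)[of x "- x"] by (simp add: add_eq_0_iff)

lemma emb_diff [simp]: "emb (x - y) = emb x - emb y"
  using emb_hom(2)[of x "- y"] by simp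

lemma emb_of_nat [simp]: "emb (of_nat n) = of_nat n" by (induction n) auto
lemma emb_power [simp]: "emb (x ^ n) = emb x ^ n" by (induction n) auto
lemma emb_eq_0 [simp]: "emb x = 0 \<longleftrightarrow> x = 0"
proof
  assume *: "emb x = 0"
  show "x = 0"
  proof (rule ccontr)
    assume "x \<noteq> 0"
    then have "emb x * emb (inverse x) = 1" by (simp flip: emb_hom)
    with * show False by simp
  qed
qed simp

lemma p_nz_L: "(of_nat p :: 'l) \<noteq> 0"
  using emb_eq_0[of "of_nat p"] p_gt_1 by (simp del: emb_eq_0)

lemma ring_O: "ring \<O>" and pL_O [simp]: "pL \<in> Oc" and max_pL: "maximalideal (PIdl\<^bsub>\<O>\<^esub> pL) \<O>"
  using unif by (auto simp: is_uniformizer_def dest: maximalideal.axioms(1) ideal.axioms(2))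

lemma O_zero [simp]: "0 \<in> Oc" and O_one [simp]: "1 \<in> Oc"
  using ring.ring_simprules(2,6)[OF ring_O] by auto
lemma O_add [simp]: "\<lbrakk>x \<in> Oc; y \<in> Oc\<rbrakk> \<Longrightarrow> x + y \<in> Oc"
  using ring.ring_simprules(1)[OF ring_O, of x y] by simp
lemma O_mult [simp]: "\<lbrakk>x \<in> Oc; y \<in> Oc\<rbrakk> \<Longrightarrow> x * y \<in> Oc"
  using ring.ring_simprules(5)[OF ring_O, of x y] by simp
lemma O_a_inv: "x \<in> Oc \<Longrightarrow> \<ominus>\<^bsub>\<O>\<^esub> x = - x"
  using ring.ring_simprules(9)[OF ring_O, of x] by (simp add: eq_neg_iff_add_eq_0)
lemma O_uminus [simp]: "x \<in> Oc \<Longrightarrow> - x \<in> Oc"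
  using ring.ring_simprules(3)[OF ring_O, of x] by (simp add: O_a_inv)
lemma O_diff [simp]: "\<lbrakk>x \<in> Oc; y \<in> Oc\<rbrakk> \<Longrightarrow> x - y \<in> Oc"
  using O_add[of x "- y"] by simp
lemma O_power [simp]: "x \<in> Oc \<Longrightarrow> x ^ n \<in> Oc" by (induction n) auto
lemma O_sum [simp]: "(\<And>x. x \<in> A \<Longrightarrow> f x \<in> Oc) \<Longrightarrow> sum f A \<in> Oc"
  by (induction A rule: infinite_finite_induct) auto
lemma O_of_nat [simp]: "of_nat n \<in> Oc" by (induction n) auto
lemma O_of_int [simp]: "of_int n \<in> Oc" by (cases n) (auto simp del: of_nat_Suc)
lemma O_minus: "\<lbrakk>x \<in> Oc; y \<in> Oc\<rbrakk> \<Longrightarrow> x \<ominus>\<^bsub>\<O>\<^esub> y = x - y"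
  using ring_O by (simp add: a_minus_def O_a_inv)

lemma cring_O: "cring \<O>"
  using ring_O by (intro cring.intro comm_monoid.intro comm_monoid_axioms.intro)
    (auto simp: ring_def)

lemma O_pow: "x [^]\<^bsub>\<O>\<^esub> (n::nat) = x ^ n"
  by (induction n) (auto simp: nat_pow_def)

lemma O_iff: "y \<in> Oc \<longleftrightarrow> (\<exists>f :: 'q poly. lead_coeff f = 1 \<and> (\<forall>i. coeff f i \<in> Zp nrm) \<and> poly (map_poly emb f) y = 0)"
  by (simp add: int_ring_def)

lemma emb_Zp [simp]: "z \<in> Zp nrm \<Longrightarrow> emb z \<in> Oc"
  unfolding O_iff by (intro exI[of _ "[:-z, 1:]"]) (auto simp: coeff_pCons map_poly_pCons split: nat.splits)

text \<open>Congruence to 0 modulo p_L. The linear algebra over k is carried out with lifts to \<oo>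
  and this predicate.\<close>

definition mm where "mm x \<longleftrightarrow> (\<exists>c\<in>Oc. x = pL * c)"

lemma mm_O: "mm x \<Longrightarrow> x \<in> Oc" by (auto simp: mm_def)
lemma mm_0 [simp]: "mm 0" unfolding mm_def by (intro bexI[of _ 0]) auto
lemma mm_pL [simp]: "c \<in> Oc \<Longrightarrow> mm (pL * c)" by (auto simp: mm_def)
lemma mm_add: "\<lbrakk>mm x; mm y\<rbrakk> \<Longrightarrow> mm (x + y)"
  unfolding mm_def by (metis O_add distrib_left)
lemma mm_mult: "\<lbrakk>mm x; y \<in> Oc\<rbrakk> \<Longrightarrow> mm (x * y)"
  unfolding mm_def by (metis O_mult mult.assoc)
lemma mm_mult2: "\<lbrakk>mm x; y \<in> Oc\<rbrakk> \<Longrightarrow> mm (y * x)"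
  using mm_mult by (simp add: mult.commute)
lemma mm_uminus: "mm x \<Longrightarrow> mm (- x)"
  using mm_mult[of x "-1"] by simp
lemma mm_diff: "\<lbrakk>mm x; mm y\<rbrakk> \<Longrightarrow> mm (x - y)"
  using mm_add[of x "- y"] mm_uminus by simp
lemma mm_sum: "(\<And>x. x \<in> A \<Longrightarrow> mm (f x)) \<Longrightarrow> mm (sum f A)"
  by (induction A rule: infinite_finite_induct) (auto intro: mm_add)

lemma PIdl_mm: "PIdl\<^bsub>\<O>\<^esub> pL = Collect mm"
  by (auto simp: cgenideal_def mm_def mult.commute)

lemma mm_one: "\<not> mm 1"
proof
  assume "mm 1"
  then have "x \<in> Oc \<Longrightarrow> mm x" for x using mm_mult[of 1 x] by simp
  then have "Collect mm = Oc" using mm_O by auto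
  then show False using maximalideal.I_notcarr[OF max_pL] by (simp add: PIdl_mm)
qed

text \<open>The ideal generated by p_L and x properly contains a maximal ideal, so it contains 1;
  thus x is invertible modulo p_L.\<close>

lemma mm_maximal:
  assumes "x \<in> Oc" "\<not> mm x" shows "\<exists>y\<in>Oc. mm (x * y - 1)"
proof -
  interpret cring \<O> by (rule cring_O)
  let ?J = "PIdl\<^bsub>\<O>\<^esub> pL <+>\<^bsub>\<O>\<^esub> PIdl\<^bsub>\<O>\<^esub> x"
  have I: "ideal ?J \<O>" using assms by (intro add_ideals cgenideal_ideal) auto
  have J: "z \<in> ?J \<longleftrightarrow> (\<exists>u y. mm u \<and> y \<in> Oc \<and> z = u + x * y)" for z
    unfolding set_add_def' PIdl_mm using assms
    by (auto simp: cgenideal_def) (metis mult.commute)+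
  have "Collect mm \<subseteq> ?J" unfolding J subset_iff by (metis O_zero add_0_right mem_Collect_eq mult_zero_right)
  moreover have "?J \<subseteq> Oc" using J mm_O assms by auto
  ultimately have "?J = Collect mm \<or> ?J = Oc"
    using maximalideal.I_maximal[OF max_pL I] by (simp add: PIdl_mm)
  moreover have "x \<in> ?J" unfolding J by (intro exI[of _ 0] exI[of _ 1]) auto
  ultimately have "?J = Oc" using assms(2) by (metis mem_Collect_eq)
  then have "1 \<in> ?J" using O_one by metis
  then obtain u y where u: "mm u" "y \<in> Oc" "1 = u + x * y" unfolding J by auto
  have "x * y - 1 = - u" unfolding u(3) by simp
  then show ?thesis using mm_uminus[OF u(1)] u(2) by metis
qed

lemma mm_prime:
  assumes "x \<in> Oc" "y \<in> Oc" "mm (x * y)" shows "mm x \<or> mm y"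
proof (rule ccontr)
  assume *: "\<not> (mm x \<or> mm y)"
  then obtain z where z: "z \<in> Oc" "mm (x * z - 1)" using mm_maximal assms by auto
  have "mm (x * y * z - y * (x * z - 1))"
    using mm_diff[OF mm_mult[OF assms(3) z(1)] mm_mult2[OF z(2) assms(2)]] .
  then show False using * by (simp add: algebra_simps)
qed

lemma mm_power: "\<lbrakk>x \<in> Oc; mm (x ^ n)\<rbrakk> \<Longrightarrow> mm x"
proof (induction n)
  case (Suc n) then show ?case using mm_prime[of x "x ^ n"] by auto
qed (use mm_one in simp)

lemma poly_map_emb: "poly (map_poly emb f) (emb x) = emb (poly f x)"
  by (induction f) (auto simp: map_poly_pCons)

text \<open>In a monic equation over \<open>Zp\<close> for 1/p the leading term has strictly larger
  norm than the sum of the others, which is impossible.\<close>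

lemma inv_p_not_O: "c \<in> Oc \<Longrightarrow> of_nat p * c \<noteq> 1"
proof
  assume "c \<in> Oc" and pc: "of_nat p * c = 1"
  then obtain f where f: "lead_coeff f = 1" "\<And>i. coeff f i \<in> Zp nrm" "poly (map_poly emb f) c = 0"
    unfolding O_iff by auto
  let ?d = "degree f"
  have d: "poly f (inverse (of_nat p)) = 0"
  proof -
    have "c = emb (inverse (of_nat p))"
    proof -
      have "of_nat p * emb (inverse (of_nat p)) = 1"
        using p_gt_1 by (simp flip: emb_of_nat emb_hom)
      then show ?thesis using pc p_nz_L by (metis mult_left_cancel)
    qed
    then show ?thesis using f poly_map_emb[of f] by simp
  qed
  define x where "x = (inverse (of_nat p) :: 'q)"
  have nx: "nrm x = real p" by (simp add: x_def nrm_inverse nrm_p)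
  have "(\<Sum>i\<le>?d. coeff f i * x ^ i) = 0" using d by (simp add: poly_altdef x_def)
  then have eq: "x ^ ?d = - (\<Sum>i<?d. coeff f i * x ^ i)"
    using f(1) by (simp add: lessThan_Suc_atMost[symmetric] add_eq_0_iff)
  have "nrm (\<Sum>i<k. coeff f i * x ^ i) < real p ^ k" for k
  proof (induction k)
    case (Suc k)
    have "nrm (coeff f k * x ^ k) \<le> 1 * real p ^ k"
      unfolding nrm_mult nrm_power nx using f(2)[of k] by (intro mult_right_mono) (auto simp: Zp_iff)
    then have "nrm (\<Sum>i<Suc k. coeff f i * x ^ i) \<le> real p ^ k"
      using nrm_ultra[of "\<Sum>i<k. coeff f i * x ^ i" "coeff f k * x ^ k"] Suc by simp
    also have "\<dots> < real p ^ Suc k" using p_gt_1 by simp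
    finally show ?case .
  qed simp
  from this[of ?d] show False using eq by (metis nrm_minus nrm_power nx order_less_irrefl)
qed

text \<open>A monic equation of least degree for p_L has nonzero constant term a, and a is divisible
  by p_L. As a is p^v times a unit of \<open>Zp\<close>, p_L divides p^v, and (p_L) is
  prime.\<close>

lemma mm_p: "mm (of_nat p)"
proof (cases "pL = 0")
  \<comment> \<open>With p_L = 0 the zero ideal would be maximal, and p would have an inverse in
    \<oo>.\<close>
  case True
  show ?thesis
  proof (rule ccontr)
    assume "\<not> mm (of_nat p)"
    from mm_maximal[OF _ this] obtain y where y: "y \<in> Oc" "mm (of_nat p * y - 1)" by auto
    then obtain c where "of_nat p * y - 1 = pL * c" unfolding mm_def by blast
    then show False using inv_p_not_O[OF y(1)] True by simp
  qed
next
  case False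
  define Q where "Q f \<longleftrightarrow> lead_coeff f = 1 \<and> (\<forall>i. coeff f i \<in> Zp nrm) \<and> poly (map_poly emb f) pL = 0" for f
  have "\<exists>f. Q f" using pL_O unfolding O_iff Q_def .
  then obtain f where f: "Q f" "\<And>g. Q g \<Longrightarrow> degree f \<le> degree g"
    using ex_has_least_nat[of Q _ degree] by blast
  obtain a g where fa: "f = pCons a g" by (cases f)
  have "g \<noteq> 0"
  proof
    assume "g = 0" then show False using f(1) unfolding Q_def fa by (auto simp: map_poly_pCons)
  qed
  \<comment> \<open>Otherwise the equation could be divided by its variable, as p_L is nonzero here,
    contradicting the minimal degree.\<close>
  have "a \<noteq> 0"
  proof
    assume a: "a = 0"
    have "Q g"
      unfolding Q_def
    proof (intro conjI allI)
      show "lead_coeff g = 1" using f(1) \<open>g \<noteq> 0\<close> by (simp add: Q_def fa)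
      show "coeff g i \<in> Zp nrm" for i using f(1) by (auto simp: Q_def fa dest: spec[of _ "Suc i"])
      show "poly (map_poly emb g) pL = 0" using f(1) False by (simp add: Q_def fa a map_poly_pCons)
    qed
    then show False using f(2)[of g] \<open>g \<noteq> 0\<close> by (simp add: fa)
  qed
  have gO: "poly (map_poly emb g) pL \<in> Oc"
  proof -
    have "coeff g i \<in> Zp nrm" for i using f(1) by (auto simp: Q_def fa dest: spec[of _ "Suc i"])
    then show ?thesis unfolding poly_altdef by (intro O_sum O_mult O_power) (auto simp: coeff_map_poly)
  qed
  have "emb a + pL * poly (map_poly emb g) pL = 0" using f(1) by (simp add: Q_def fa map_poly_pCons)
  then have "emb a = pL * (- poly (map_poly emb g) pL)" by (simp add: eq_neg_iff_add_eq_0)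
  then have ma: "mm (emb a)" using gO by (metis O_uminus mm_pL)
  have aZ: "a \<in> Zp nrm" using f(1) by (auto simp: Q_def fa dest: spec[of _ 0])
  obtain k where k: "nrm a = real p powi k" using nrm_value \<open>a \<noteq> 0\<close> by blast
  have "k \<le> 0" using aZ k p_gt_1 by (metis Zp_iff less_numeral_extra(4) linorder_not_le of_nat_1 of_nat_less_iff one_less_power_int)
  define v where "v = nat (- k)"
  have "nrm a = (1 / real p) ^ v"
    unfolding k v_def using \<open>k \<le> 0\<close> by (simp add: power_int_def inverse_eq_divide)
  \<comment> \<open>Multiplication by the integral element p^v/a turns divisibility of a into
    divisibility of p^v.\<close>
  then have "nrm (of_nat p ^ v / a) = 1" using p_gt_1 by (simp add: nrm_divide nrm_p_power)
  then have "mm (emb a * emb (of_nat p ^ v / a))" using ma by (intro mm_mult emb_Zp) (auto simp: Zp_iff)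
  then have "mm (of_nat p ^ v)" using \<open>a \<noteq> 0\<close> by (simp flip: emb_hom(3))
  then show ?thesis using mm_power by auto
qed

lemma pL_nz: "pL \<noteq> 0"
  using mm_p p_nz_L by (auto simp: mm_def)

end

section \<open>Linear algebra over the truncated polynomial rings \<open>k[T]/(T^q - 1)\<close>\<close>

text \<open>An inverse limit of nonempty finite sets is nonempty. The sequence is built upwards
  through elements that have preimages at all higher levels.\<close>

lemma koenig:
  fixes A :: "nat \<Rightarrow> 'a set" and tr :: "nat \<Rightarrow> 'a \<Rightarrow> 'a"
  assumes fin: "\<And>m. finite (A m)" and ne: "\<And>m. A m \<noteq> {}"
    and tr: "\<And>m x. x \<in> A (Suc m) \<Longrightarrow> tr m x \<in> A m"
  shows "\<exists>s. \<forall>m. s m \<in> A m \<and> tr m (s (Suc m)) = s m"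
proof -
  define D where "D m k = fold (\<lambda>j f. f \<circ> tr j) [m..<m + k] id" for m k
  have D0 [simp]: "D m 0 = id" for m by (simp add: D_def)
  have DS: "D m (Suc k) = D m k \<circ> tr (m + k)" for m k by (simp add: D_def)
  have DA: "y \<in> A (m + k) \<Longrightarrow> D m k y \<in> A m" for m k y
    by (induction k arbitrary: y) (auto simp: DS tr)
  have DS': "D m (Suc k) = tr m \<circ> D (Suc m) k" for m k
    by (induction k) (auto simp: DS[of _ "Suc _"] DS[of "Suc m"] comp_assoc, auto simp: DS)
  have mono: "\<exists>z\<in>A (m + k). D m k z = D m k' y" if "k \<le> k'" "y \<in> A (m + k')" for m k k' y
    using that
  proof (induction k' arbitrary: y)
    case (Suc k')
    show ?case
    proof (cases "k = Suc k'")
      case False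
      then show ?thesis using Suc.IH[of "tr (m + k') y"] Suc.prems tr[of y "m + k'"] by (auto simp: DS)
    qed (use Suc in auto)
  qed auto
  define P where "P m x \<longleftrightarrow> x \<in> A m \<and> (\<forall>k. \<exists>y\<in>A (m + k). D m k y = x)" for m x
  \<comment> \<open>If every element of the finite set C were missed from some level on, then beyond
    the largest of these levels no image could meet C, since the images decrease.\<close>
  have key: "\<exists>x\<in>C. P m x" if C: "C \<subseteq> A m" "\<And>k. \<exists>y\<in>A (m + k). D m k y \<in> C" for m C
  proof (rule ccontr)
    assume "\<not> (\<exists>x\<in>C. P m x)"
    then have "\<forall>x\<in>C. \<exists>k. \<forall>y\<in>A (m + k). D m k y \<noteq> x" using C by (fastforce simp: P_def)
    then obtain K where K: "\<And>x y. x \<in> C \<Longrightarrow> y \<in> A (m + K x) \<Longrightarrow> D m (K x) y \<noteq> x" by metis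
    have finC: "finite C" using C fin finite_subset by blast
    obtain y where y: "y \<in> A (m + Max (K ` C))" "D m (Max (K ` C)) y \<in> C" using C by blast
    have "K (D m (Max (K ` C)) y) \<le> Max (K ` C)" using finC y by auto
    from mono[OF this y(1)] K[OF y(2)] show False by blast
  qed
  have "\<exists>x. P 0 x"
  proof -
    have "\<exists>y\<in>A (0 + k). D 0 k y \<in> A 0" for k using ne[of k] DA[of _ 0 k] by auto
    then show ?thesis using key[of "A 0" 0] by auto
  qed
  moreover have "\<exists>x'. P (Suc m) x' \<and> tr m x' = x" if "P m x" for m x
  proof -
    have "\<exists>y\<in>A (Suc m + k). D (Suc m) k y \<in> {x' \<in> A (Suc m). tr m x' = x}" for k
    proof -
      have "\<exists>y\<in>A (m + Suc k). D m (Suc k) y = x" using \<open>P m x\<close> unfolding P_def by blast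
      then obtain y where "y \<in> A (m + Suc k)" "D m (Suc k) y = x" by blast
      then show ?thesis using DA[of y "Suc m" k] by (intro bexI[of _ y]) (auto simp: DS')
    qed
    then show ?thesis using key[of "{x' \<in> A (Suc m). tr m x' = x}" "Suc m"] by auto
  qed
  ultimately obtain s where "\<And>m. P m (s m)" "\<And>m. tr m (s (Suc m)) = s m"
    using dependent_nat_choice[of "P" "\<lambda>m x x'. tr m x' = x"] by blast
  then show ?thesis unfolding P_def by blast
qed

text \<open>A polynomial in \<open>T\<close> acts on functions on \<open>\<int>\<close>, \<open>T\<close> being the shift \<open>w \<mapsto> w(_ - 1)\<close>.\<close>

definition pact :: "'l::field poly \<Rightarrow> (int \<Rightarrow> 'l) \<Rightarrow> int \<Rightarrow> 'l" where
  "pact f w i = (\<Sum>e\<le>degree f. coeff f e * w (i - int e))"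

lemma pact_alt: "degree f \<le> n \<Longrightarrow> pact f w i = (\<Sum>e\<le>n. coeff f e * w (i - int e))"
  unfolding pact_def by (intro sum.mono_neutral_left) (auto simp: coeff_eq_0)

lemma pact_pCons: "pact (pCons a f) w i = a * w i + pact f w (i - 1)"
proof -
  have "pact (pCons a f) w i = (\<Sum>e\<le>Suc (degree f). coeff (pCons a f) e * w (i - int e))"
    by (intro pact_alt) (simp add: degree_pCons_le)
  also have "\<dots> = a * w i + (\<Sum>e\<le>degree f. coeff f e * w (i - int (Suc e)))"
    by (subst sum.atMost_Suc_shift) simp
  also have "(\<Sum>e\<le>degree f. coeff f e * w (i - int (Suc e))) = pact f w (i - 1)"
    unfolding pact_def by (intro sum.cong) (auto simp: algebra_simps)
  finally show ?thesis .
qed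

lemma pact_0 [simp]: "pact 0 w i = 0" by (simp add: pact_def)
lemma pact_1 [simp]: "pact 1 w i = w i" by (simp add: pact_def)

lemma pact_add: "pact (f + g) w i = pact f w i + pact g w i"
proof -
  let ?n = "max (degree f) (degree g)"
  have "pact (f + g) w i = (\<Sum>e\<le>?n. coeff (f + g) e * w (i - int e))"
    by (intro pact_alt degree_add_le) auto
  also have "\<dots> = pact f w i + pact g w i"
    by (simp add: pact_alt[of f ?n] pact_alt[of g ?n] sum.distrib algebra_simps)
  finally show ?thesis .
qed

lemma pact_smult: "pact (Polynomial.smult c f) w i = c * pact f w i"
  by (subst pact_alt[of _ "degree f"]) (auto simp: pact_def sum_distrib_left mult.assoc degree_smult_le)

lemma pact_minus: "pact (- f) w i = - pact f w i"
  using pact_smult[of "-1" f w i] by simp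

lemma pact_diff: "pact (f - g) w i = pact f w i - pact g w i"
  using pact_add[of f "- g" w i] by (simp add: pact_minus)

lemma pact_sum: "pact (\<Sum>j\<in>A. f j) w i = (\<Sum>j\<in>A. pact (f j) w i)"
  by (induction A rule: infinite_finite_induct) (auto simp: pact_add)

lemma pact_mult: "pact (f * g) w i = pact f (pact g w) i"
  by (induction f arbitrary: i) (auto simp: pact_pCons pact_add pact_smult)

lemma pact_fun_diff: "pact f (\<lambda>i. w i - v i) i = pact f w i - pact f v i"
  by (simp add: pact_def sum_subtractf algebra_simps)
lemma pact_fun_add: "pact f (\<lambda>i. w i + v i) i = pact f w i + pact f v i"
  by (simp add: pact_def sum.distrib algebra_simps)
lemma pact_fun_mult: "pact f (\<lambda>i. c * w i) i = c * pact f w i"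
  by (simp add: pact_def sum_distrib_left algebra_simps)
lemma pact_shift: "pact f (\<lambda>i. w (i + k)) i = pact f w (i + k)"
  by (simp add: pact_def algebra_simps)
lemma pact_monom: "pact (monom 1 n) w i = w (i - int n)"
  by (subst pact_alt[of _ n]) (auto simp: degree_monom_le if_distrib[of "\<lambda>x. x * _"] sum.delta cong: if_cong)

definition Tq :: "nat \<Rightarrow> 'l::field poly" where "Tq q = monom 1 q - 1"
text \<open>This is X = T - 1, the variable of k[[X]] = k[[N0]].\<close>

definition XX :: "'l::field poly" where "XX = [:-1, 1:]"

lemma pact_Tq: "pact (Tq q) w i = w (i - int q) - w i"
  by (simp add: Tq_def pact_diff pact_monom)
lemma pact_XX: "pact XX w i = w (i - 1) - w i"
  by (simp add: XX_def pact_pCons)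

lemma degree_Tq: "q > 0 \<Longrightarrow> degree (Tq q :: 'l::field poly) = q"
proof -
  assume "q > 0"
  then have "degree (monom 1 q + - 1 :: 'l poly) = degree (monom 1 q :: 'l poly)"
    by (intro degree_add_eq_left) (auto simp: degree_monom_eq)
  then show ?thesis by (simp add: Tq_def degree_monom_eq)
qed

lemma Tq_nz: "q > 0 \<Longrightarrow> (Tq q :: 'l::field poly) \<noteq> 0"
  by (metis degree_0 degree_Tq less_irrefl)

lemma coeff_Tq: "q > 0 \<Longrightarrow> coeff (Tq q) i = (if i = q then 1 else if i = 0 then -1 else 0)"
  by (auto simp: Tq_def coeff_monom)

text \<open>Division by T^q - 1 only adds and subtracts coefficients, as this polynomial is monic
  with lower coefficients 0 and -1. So it preserves any additive group of coefficients; both \<oo>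
  and (p_L) are used for I.\<close>

lemma divmod_Tq_coeffs:
  fixes f :: "'l::field poly"
  assumes q: "q > 0" and I: "0 \<in> I" "\<And>x y. \<lbrakk>x \<in> I; y \<in> I\<rbrakk> \<Longrightarrow> x - y \<in> I"
    and f: "\<And>i. coeff f i \<in> I"
  shows "coeff (f div Tq q) i \<in> I" "coeff (f mod Tq q) i \<in> I"
proof -
  have neg: "- x \<in> I" if "x \<in> I" for x using I(2)[OF I(1) that] by simp
  have add: "x + y \<in> I" if "x \<in> I" "y \<in> I" for x y using I(2)[OF that(1) neg[OF that(2)]] by simp
  have "\<exists>g r. f = Tq q * g + r \<and> degree r < q \<and> (\<forall>i. coeff g i \<in> I) \<and> (\<forall>i. coeff r i \<in> I)"
    using f
  proof (induction f)
    case 0 then show ?case using I q by (intro exI[of _ 0]) auto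
  next
    case (pCons a f)
    have a: "a \<in> I" using pCons.prems[of 0] by simp
    have "coeff f i \<in> I" for i using pCons.prems[of "Suc i"] by simp
    then obtain g r where gr: "f = Tq q * g + r" "degree r < q" "\<And>i. coeff g i \<in> I" "\<And>i. coeff r i \<in> I"
      using pCons.IH by blast
    \<comment> \<open>After multiplication by T the top coefficient of r moves to degree q;
      subtracting c (T^q - 1) removes it.\<close>
    define c where "c = coeff r (q - 1)"
    define g' where "g' = pCons c g"
    define r' where "r' = pCons a r - Polynomial.smult c (Tq q)"
    have "pCons a f = Tq q * g' + r'"
      unfolding gr(1) g'_def r'_def by simp
    moreover have "degree r' < q"
    proof -
      have "degree r' \<le> q" unfolding r'_def using gr(2) q
        by (intro degree_diff_le) (auto intro: le_trans[OF degree_pCons_le] le_trans[OF degree_smult_le] simp: degree_Tq)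
      moreover have "coeff r' q = 0" using q by (cases q) (auto simp: r'_def coeff_Tq c_def)
      ultimately show ?thesis using q by (metis eq_zero_or_degree_less degree_0)
    qed
    moreover have "coeff g' i \<in> I" for i using gr by (auto simp: g'_def coeff_pCons c_def split: nat.splits)
    moreover have "coeff r' i \<in> I" for i
      unfolding r'_def using gr a q neg I add
      by (auto simp: coeff_pCons coeff_Tq c_def split: nat.splits)
    ultimately show ?case by blast
  qed
  then obtain g r where gr: "f = Tq q * g + r" "degree r < q" "\<And>i. coeff g i \<in> I" "\<And>i. coeff r i \<in> I" by blast
  have dr: "degree r < degree (Tq q :: 'l poly)" using gr(2) degree_Tq[OF q, where 'l='l] by simp
  have "f div Tq q = g + r div Tq q"
    unfolding gr(1) by (rule div_mult_self4[OF Tq_nz[OF q]])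
  then have "f div Tq q = g" using div_poly_less[OF dr] by simp
  moreover have "f mod Tq q = r" unfolding gr(1) mod_mult_self4 by (rule mod_poly_less[OF dr])
  ultimately show "coeff (f div Tq q) i \<in> I" "coeff (f mod Tq q) i \<in> I" using gr by auto
qed

lemma degree_mod_Tq: "q > 0 \<Longrightarrow> degree (f mod Tq q) < q"
  using degree_mod_less'[of "Tq q" f] Tq_nz[of q] degree_Tq[of q, where 'l='a] by (cases "f mod Tq q = 0") auto

section \<open>Polynomials over \<oo> modulo p_L and the order in X = T - 1\<close>

context int_ext begin

definition oP where "oP f \<longleftrightarrow> (\<forall>i. coeff f i \<in> Oc)"
definition mP where "mP f \<longleftrightarrow> (\<forall>i. mm (coeff f i))"

lemma oP_simps [simp]: "oP 0" "oP 1" "oP (monom 1 n)" "oP (Tq q)" "oP XX"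
  "\<lbrakk>oP f; oP g\<rbrakk> \<Longrightarrow> oP (f + g)" "\<lbrakk>oP f; oP g\<rbrakk> \<Longrightarrow> oP (f - g)" "oP f \<Longrightarrow> oP (- f)"
  "\<lbrakk>c \<in> Oc; oP f\<rbrakk> \<Longrightarrow> oP (Polynomial.smult c f)" "\<lbrakk>oP f; oP g\<rbrakk> \<Longrightarrow> oP (f * g)"
  by (auto simp: oP_def coeff_monom coeff_mult Tq_def XX_def coeff_pCons split: nat.splits)
lemma oP_pow [simp]: "oP f \<Longrightarrow> oP (f ^ n)" by (induction n) auto
lemma oP_sum [simp]: "(\<And>x. x \<in> A \<Longrightarrow> oP (f x)) \<Longrightarrow> oP (sum f A)"
  by (induction A rule: infinite_finite_induct) auto
lemma mP_0 [simp]: "mP 0" by (auto simp: mP_def)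
lemma mP_add: "\<lbrakk>mP f; mP g\<rbrakk> \<Longrightarrow> mP (f + g)" by (auto simp: mP_def mm_add)
lemma mP_diff: "\<lbrakk>mP f; mP g\<rbrakk> \<Longrightarrow> mP (f - g)" by (auto simp: mP_def mm_diff)
lemma mP_minus: "mP f \<Longrightarrow> mP (- f)" by (auto simp: mP_def mm_uminus)
lemma mP_mult: "\<lbrakk>mP f; oP g\<rbrakk> \<Longrightarrow> mP (f * g)" by (auto simp: mP_def oP_def coeff_mult intro!: mm_sum mm_mult)
lemma mP_mult2: "\<lbrakk>mP f; oP g\<rbrakk> \<Longrightarrow> mP (g * f)" using mP_mult[of f g] by (simp add: mult.commute)
lemma mP_sum: "(\<And>x. x \<in> A \<Longrightarrow> mP (f x)) \<Longrightarrow> mP (sum f A)"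
  by (induction A rule: infinite_finite_induct) (auto intro: mP_add)
lemma mP_smult: "\<lbrakk>mm c; oP f\<rbrakk> \<Longrightarrow> mP (Polynomial.smult c f)" by (auto simp: mP_def oP_def intro: mm_mult)
lemma mP_const: "mP [:c:] \<longleftrightarrow> mm c" by (auto simp: mP_def coeff_pCons split: nat.splits)

lemma oP_poly: "oP f \<Longrightarrow> x \<in> Oc \<Longrightarrow> poly f x \<in> Oc" by (auto simp: poly_altdef oP_def)
lemma mP_poly: "mP f \<Longrightarrow> x \<in> Oc \<Longrightarrow> mm (poly f x)" by (auto simp: poly_altdef mP_def intro!: mm_sum mm_mult)

lemma oP_divmod: "\<lbrakk>q > 0; oP f\<rbrakk> \<Longrightarrow> oP (f mod Tq q)" "\<lbrakk>q > 0; oP f\<rbrakk> \<Longrightarrow> oP (f div Tq q)"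
  using divmod_Tq_coeffs[of q Oc f] by (auto simp: oP_def)
lemma mP_divmod: "\<lbrakk>q > 0; mP f\<rbrakk> \<Longrightarrow> mP (f mod Tq q)" "\<lbrakk>q > 0; mP f\<rbrakk> \<Longrightarrow> mP (f div Tq q)"
  using divmod_Tq_coeffs[of q "Collect mm" f] by (auto simp: mP_def mm_diff)

lemma pact_O: "\<lbrakk>oP f; \<And>i. w i \<in> Oc\<rbrakk> \<Longrightarrow> pact f w i \<in> Oc"
  by (auto simp: pact_def oP_def)
lemma pact_mm: "\<lbrakk>oP f; \<And>i. mm (w i)\<rbrakk> \<Longrightarrow> mm (pact f w i)"
  by (auto simp: pact_def oP_def intro!: mm_sum mm_mult2)
lemma pact_mP: "\<lbrakk>mP f; \<And>i. w i \<in> Oc\<rbrakk> \<Longrightarrow> mm (pact f w i)"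
  by (auto simp: pact_def mP_def intro!: mm_sum mm_mult)

text \<open>The discarded multiple of T^q - 1 acts through differences of w over one period, and
  these are integral.\<close>

lemma pact_mod_O:
  assumes "q > 0" "oP f" "\<And>i. w (i + int q) - w i \<in> Oc"
  shows "pact (f mod Tq q) w i - pact f w i \<in> Oc"
proof -
  have "pact f w i = pact (f div Tq q * Tq q + f mod Tq q) w i" by simp
  also have "\<dots> = pact (f div Tq q) (pact (Tq q) w) i + pact (f mod Tq q) w i" by (simp only: pact_add pact_mult)
  finally have *: "pact (f mod Tq q) w i - pact f w i = - pact (f div Tq q) (pact (Tq q) w) i" by simp
  have "pact (Tq q) w i \<in> Oc" for i using O_uminus[OF assms(3)[of "i - int q"]] by (simp add: pact_Tq)
  then have "pact (f div Tq q) (pact (Tq q) w) i \<in> Oc" by (rule pact_O[OF oP_divmod(2)[OF assms(1,2)]])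
  then show ?thesis unfolding * by (rule O_uminus)
qed

lemma mP_power_cong:
  assumes "oP f" "oP g" "mP (f - g)" shows "mP (f ^ n - g ^ n)"
proof (induction n)
  case (Suc n)
  have "f ^ Suc n - g ^ Suc n = (f - g) * f ^ n + (f ^ n - g ^ n) * g" by (simp add: algebra_simps)
  then show ?case using mP_add[OF mP_mult[OF assms(3) oP_pow[OF assms(1)]] mP_mult[OF Suc assms(2)]] by simp
qed simp

lemma mP_of_nat_p: "oP f \<Longrightarrow> p dvd k \<Longrightarrow> mP (of_nat k * f)"
proof -
  assume "oP f" "p dvd k"
  then obtain j where "k = p * j" by blast
  then have "of_nat k * f = Polynomial.smult (of_nat p) (of_nat j * f)"
    by (simp add: of_nat_poly mult.assoc)
  moreover have "oP (of_nat j * f)" using \<open>oP f\<close> by (simp add: of_nat_poly)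
  ultimately show ?thesis using mm_p by (auto intro: mP_smult)
qed

text \<open>The inner binomial coefficients are divisible by p, hence vanish modulo p_L; only the
  sign of the constant term needs attention.\<close>

lemma frobenius_step: "oP Y \<Longrightarrow> mP ((Y - 1) ^ p - (Y ^ p - 1))"
proof -
  assume Y: "oP Y"
  have "(Y - 1) ^ p = (\<Sum>k\<le>p. of_nat (p choose k) * Y ^ k * (-1) ^ (p - k))"
    using binomial_ring[of Y "-1" p] by simp
  also have "\<dots> = (\<Sum>k\<in>{0<..<p}. of_nat (p choose k) * Y ^ k * (-1) ^ (p - k)) + Y ^ p + (-1) ^ p"
  proof -
    have "{..p} = insert 0 (insert p {0<..<p})" using p_gt_1 by auto
    then show ?thesis using p_gt_1 by simp
  qed
  finally have eq: "(Y - 1) ^ p - (Y ^ p - 1) =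
      (\<Sum>k\<in>{0<..<p}. of_nat (p choose k) * (Y ^ k * (-1) ^ (p - k))) + ((-1) ^ p + 1)"
    by (simp add: algebra_simps)
  have "mP (\<Sum>k\<in>{0<..<p}. of_nat (p choose k) * (Y ^ k * (-1) ^ (p - k)))"
    using Y p_prime by (intro mP_sum mP_of_nat_p) (auto intro: dvd_choose_prime)
  \<comment> \<open>For odd p this is 0; for p = 2 it is 2, which is p itself.\<close>
  moreover have "mP ((-1) ^ p + 1)"
  proof (cases "p = 2")
    case True
    have "mP (of_nat p * 1)" by (intro mP_of_nat_p) auto
    then show ?thesis using True by simp
  next
    case False
    then have "p > 2" using p_gt_1 by simp
    then have "odd p" using p_prime prime_odd_nat by blast
    then show ?thesis by simp
  qed
  ultimately show ?thesis unfolding eq by (rule mP_add)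
qed

text \<open>Iterated Frobenius. It identifies k[T]/(T^q - 1) with k[X]/(X^q) for q a power of p, the
  reason why all computations can be made in terms of the order in X.\<close>

lemma XX_pow: "mP (XX ^ (p ^ m) - Tq (p ^ m))"
proof (induction m)
  case 0 have "XX = (Tq 1 :: 'l poly)" by (simp add: XX_def Tq_def monom_altdef one_pCons)
  then show ?case by simp
next
  case (Suc m)
  have 1: "mP ((XX ^ (p ^ m)) ^ p - Tq (p ^ m) ^ p)" by (intro mP_power_cong Suc.IH) auto
  have 2: "mP (Tq (p ^ m) ^ p - Tq (p ^ Suc m))"
    using frobenius_step[of "monom 1 (p ^ m)"] by (simp add: Tq_def monom_power mult.commute)
  from mP_add[OF 1 2] show ?case by (simp add: power_mult[symmetric] mult.commute)
qed

lemma oP_synthetic: "oP b \<Longrightarrow> oP (synthetic_div b 1)"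
proof (induction b)
  case (pCons a b)
  then have ob: "oP b" "a \<in> Oc" by (auto simp: oP_def dest: spec[of _ 0] spec[of _ "Suc _"])
  then show ?case using pCons oP_poly[of b 1]
    by (auto simp: oP_def coeff_pCons split: nat.splits)
qed simp

lemma XX_decomp: "oP b \<Longrightarrow> \<exists>b'. oP b' \<and> b = XX * b' + [:poly b 1:]"
  using synthetic_div_correct'[of 1 b] oP_synthetic[of b]
  by (intro exI[of _ "synthetic_div b 1"]) (auto simp: XX_def)

text \<open>The coefficients of X r are differences of consecutive coefficients of r, so those of r
  vanish modulo p_L one after the other, from the constant term up.\<close>

lemma XX_cancel: "\<lbrakk>oP r; mP (XX * r)\<rbrakk> \<Longrightarrow> mP r"
proof -
  assume r: "oP r" "mP (XX * r)"
  have c: "coeff (XX * r) i = (if i = 0 then 0 else coeff r (i - 1)) - coeff r i" for i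
    by (cases i) (auto simp: XX_def)
  have "mm (coeff r i)" for i
  proof (induction i)
    case 0 then show ?case using r(2) c[of 0] mm_uminus[of "- coeff r 0"] by (auto simp: mP_def dest: spec[of _ 0])
  next
    case (Suc i)
    have "mm (coeff r i - coeff r (Suc i))" using r(2) c[of "Suc i"] by (auto simp: mP_def dest: spec[of _ "Suc i"])
    from mm_diff[OF Suc this] show ?case by simp
  qed
  then show ?thesis by (simp add: mP_def)
qed

lemma XX_pow_cancel: "\<lbrakk>oP r; mP (XX ^ k * r)\<rbrakk> \<Longrightarrow> mP r"
proof (induction k)
  case (Suc k)
  then show ?case using XX_cancel[of "XX ^ k * r"] by (simp add: mult.assoc)
qed simp

text \<open>Membership in the ideal \<open>(X^e)\<close> of \<open>k[T]\<close>, where \<open>X = T - 1\<close>.\<close>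

definition inX where "inX e f \<longleftrightarrow> (\<exists>b. oP b \<and> mP (f - XX ^ e * b))"

text \<open>Extracts the exact X-order e together with a cofactor g whose value at X = 0, that is at
  T = 1, is nonzero in k.\<close>

lemma not_inX: "\<lbrakk>oP f; \<not> inX a f\<rbrakk> \<Longrightarrow> \<exists>e<a. \<exists>g. oP g \<and> \<not> mm (poly g 1) \<and> mP (f - XX ^ e * g)"
proof (induction a)
  case 0 then show ?case by (auto simp: inX_def dest: spec[of _ f])
next
  case (Suc a)
  show ?case
  proof (cases "inX a f")
    case False then show ?thesis using Suc by (metis less_Suc_eq)
  next
    case True
    then obtain b where b: "oP b" "mP (f - XX ^ a * b)" by (auto simp: inX_def)
    \<comment> \<open>If b vanished at T = 1 modulo p_L, another factor X could be split
      off.\<close>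
    have "\<not> mm (poly b 1)"
    proof
      assume m: "mm (poly b 1)"
      obtain b' where b': "oP b'" "b = XX * b' + [:poly b 1:]" using XX_decomp[OF b(1)] by blast
      have "mP (XX ^ a * [:poly b 1:])" using m by (intro mP_mult2) (auto simp: mP_const)
      from mP_add[OF b(2) this] have "mP (f - XX ^ a * (b - [:poly b 1:]))" by (simp add: algebra_simps)
      moreover have "XX ^ a * (b - [:poly b 1:]) = XX ^ Suc a * b'" by (subst b'(2)) (simp add: mult.assoc power_commutes)
      ultimately have "inX (Suc a) f" using b'(1) by (auto simp: inX_def)
      then show False using Suc by simp
    qed
    then show ?thesis using b by blast
  qed
qed

text \<open>Orders in X add up. With f = X^d f' and g = X^e g', cancelling X^(d+e) leaves at least
  one factor X in front of c; evaluation at T = 1 then contradicts that f' and g' are nonzero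
  there.\<close>

lemma inX_mult:
  assumes "oP f" "oP g" "\<not> inX a f" "\<not> inX b g" shows "\<not> inX (a + b) (f * g)"
proof
  assume "inX (a + b) (f * g)"
  then obtain c where c: "oP c" "mP (f * g - XX ^ (a + b) * c)" by (auto simp: inX_def)
  obtain d f' where f': "d < a" "oP f'" "\<not> mm (poly f' 1)" "mP (f - XX ^ d * f')" using not_inX assms by blast
  obtain e g' where g': "e < b" "oP g'" "\<not> mm (poly g' 1)" "mP (g - XX ^ e * g')" using not_inX assms by blast
  obtain k where k: "a + b = d + e + Suc k" using f'(1) g'(1) by (metis add.assoc add_less_mono less_iff_Suc_add add_Suc_right)
  define r where "r = f' * g' - XX ^ Suc k * c"
  have or: "oP r" using f' g' c by (simp add: r_def)
  have "mP ((f * g - XX ^ (a + b) * c) - ((f - XX ^ d * f') * g + (g - XX ^ e * g') * (XX ^ d * f')))"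
    by (rule mP_diff[OF c(2) mP_add[OF mP_mult[OF f'(4) assms(2)] mP_mult[OF g'(4)]]]) (use f' in auto)
  also have "(f * g - XX ^ (a + b) * c) - ((f - XX ^ d * f') * g + (g - XX ^ e * g') * (XX ^ d * f')) = XX ^ (d + e) * r"
    unfolding k r_def by (simp add: algebra_simps power_add)
  finally have "mP r" using XX_pow_cancel or by blast
  then have "mm (poly r 1)" by (intro mP_poly) auto
  moreover have "poly r 1 = poly f' 1 * poly g' 1" by (simp add: r_def XX_def)
  ultimately show False using mm_prime[of "poly f' 1" "poly g' 1"] oP_poly f' g' by auto
qed

lemma XX_kernel:
  assumes w: "\<And>i. mm (pact XX w i)" shows "mm (w i - w 0)"
proof (induction i rule: int_induct[where k=0])
  case base then show ?case by simp
next
  case (step1 i)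
  have "mm (w i - w (i + 1))" using w[of "i + 1"] by (simp add: pact_XX)
  from mm_diff[OF step1(2) this] show ?case by simp
next
  case (step2 i)
  have "mm (w (i - 1) - w i)" using w[of i] by (simp add: pact_XX)
  from mm_add[OF this step2(2)] show ?case by simp
qed

text \<open>\<open>X = T - 1\<close> acts on functions \<open>\<int> \<rightarrow> k\<close> with one-dimensional kernel, the constants. Hence the functions killed by
  a power of \<open>X\<close> form a uniserial module, and one that is killed by no smaller power than all others generates the others.\<close>

lemma uniserial:
  assumes c0: "\<And>i. c0 i \<in> Oc" "\<And>i. mm (pact (XX ^ Suc e) c0 i)" "\<not> (\<forall>i. mm (pact (XX ^ e) c0 i))"
  shows "\<lbrakk>f \<le> Suc e; \<And>i. c i \<in> Oc; \<And>i. mm (pact (XX ^ f) c i)\<rbrakk> \<Longrightarrow>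
    \<exists>\<mu>. oP \<mu> \<and> (\<forall>i. mm (c i - pact \<mu> c0 i))"
proof (induction f arbitrary: c)
  case 0 then show ?case by (intro exI[of _ 0]) auto
next
  case (Suc f)
  let ?u = "pact (XX ^ f) c" and ?v = "pact (XX ^ e) c0"
  have uO: "?u i \<in> Oc" and vO: "?v i \<in> Oc" for i using Suc.prems c0 by (auto intro: pact_O)
  have u: "mm (?u i - ?u 0)" for i
    using Suc.prems(3) by (intro XX_kernel) (simp add: pact_mult[symmetric])
  have v: "mm (?v i - ?v 0)" for i
    using c0(2) by (intro XX_kernel) (simp add: pact_mult[symmetric])
  \<comment> \<open>Modulo p_L the function \<open>?v\<close> is a constant and not zero, so this
    constant is invertible.\<close>
  have "\<not> mm (?v 0)"
  proof
    assume "mm (?v 0)"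
    then have "mm (?v i)" for i using mm_add[OF v[of i] \<open>mm (?v 0)\<close>] by simp
    then show False using c0(3) by simp
  qed
  then obtain b where b: "b \<in> Oc" "mm (?v 0 * b - 1)" using mm_maximal vO by blast
  \<comment> \<open>k is the quotient of the constants to which X^f c and X^e c0 reduce. Subtracting
    k X^(e-f) c0 from c gives a function killed by X^f, one power less.\<close>
  define k where "k = ?u 0 * b"
  have kO: "k \<in> Oc" using uO b by (simp add: k_def)
  define \<nu> where "\<nu> = Polynomial.smult k (XX ^ (e - f))"
  have o\<nu>: "oP \<nu>" using kO by (simp add: \<nu>_def)
  define c' where "c' i = c i - pact \<nu> c0 i" for i
  have "c' i \<in> Oc" for i using Suc.prems c0 o\<nu> by (auto simp: c'_def intro!: O_diff pact_O)
  moreover have "mm (pact (XX ^ f) c' i)" for i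
  proof -
    have "pact (XX ^ f) c' i = ?u i - pact (XX ^ f) (pact \<nu> c0) i"
      unfolding c'_def by (rule pact_fun_diff)
    also have "pact (XX ^ f) (pact \<nu> c0) i = k * ?v i"
      using Suc.prems(1) by (simp add: \<nu>_def pact_mult[symmetric] mult_smult_right power_add[symmetric] pact_smult)
    also have "?u i - k * ?v i = (?u i - ?u 0) - k * (?v i - ?v 0) - ?u 0 * (?v 0 * b - 1)"
      by (simp add: k_def algebra_simps)
    also have "mm \<dots>" by (rule mm_diff[OF mm_diff[OF u mm_mult2[OF v kO]] mm_mult2[OF b(2) uO]])
    finally show ?thesis .
  qed
  ultimately obtain \<mu> where \<mu>: "oP \<mu>" "\<And>i. mm (c' i - pact \<mu> c0 i)" using Suc.IH[of c'] Suc.prems(1) by auto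
  then show ?case using o\<nu>
    by (intro exI[of _ "\<mu> + \<nu>"]) (auto simp: c'_def pact_add algebra_simps)
qed

text \<open>Modulo the uniformizer, a relation is found one coordinate at a time: the function of highest order in the
  coordinate \<open>l\<close> eliminates the others. That some coefficient does not vanish at \<open>T = 1\<close> is the form of nontriviality
  that is compatible with the transition maps between the levels.\<close>

lemma linear_dependence:
  assumes q: "q = p ^ M" and "finite L" "finite A" "card L < card A"
    and w: "\<And>j l i. w j l i \<in> Oc" "\<And>j l i. mm (w j l (i + int q) - w j l i)"
  shows "\<exists>lam. (\<forall>j. oP (lam j)) \<and> (\<exists>j\<in>A. \<not> mm (poly (lam j) 1)) \<and>
     (\<forall>l\<in>L. \<forall>i. mm (\<Sum>j\<in>A. pact (lam j) (w j l) i))"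
  using assms(2-)
proof (induction L arbitrary: A w rule: finite_induct)
  case empty
  then obtain j where "j \<in> A" by (metis card.empty less_irrefl ex_in_conv)
  then show ?case using mm_one by (intro exI[of _ "\<lambda>_. 1"]) auto
next
  case (insert l L)
  \<comment> \<open>X^q agrees with T^q - 1 modulo p_L, and the latter kills q-periodic
    functions.\<close>
  have nil: "mm (pact (XX ^ q) (w j l) i)" for j i
  proof -
    have "mm (pact (XX ^ q - Tq q) (w j l) i)" using XX_pow[of M] insert.prems by (intro pact_mP) (auto simp: q)
    moreover have "mm (pact (Tq q) (w j l) i)"
      using mm_uminus[OF insert.prems(4)[of j l "i - int q"]] by (simp add: pact_Tq)
    ultimately show ?thesis using mm_add by (fastforce simp: pact_diff)
  qed
  define od where "od j = (LEAST e. \<forall>i. mm (pact (XX ^ e) (w j l) i))" for j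
  have od: "mm (pact (XX ^ od j) (w j l) i)" for j i
    unfolding od_def using LeastI_ex[of "\<lambda>e. \<forall>i. mm (pact (XX ^ e) (w j l) i)"] nil by blast
  have od_min: "\<not> (\<forall>i. mm (pact (XX ^ e) (w j l) i))" if "e < od j" for e j
    using not_less_Least[OF that[unfolded od_def]] .
  have "A \<noteq> {}" using insert by auto
  \<comment> \<open>The function of largest order in coordinate l generates all the others there, by
    \<open>uniserial\<close>.\<close>
  then obtain j0 where j0: "j0 \<in> A" "\<And>j. j \<in> A \<Longrightarrow> od j \<le> od j0"
    using insert.prems(1) ex_has_greatest_nat[of "\<lambda>j. j \<in> A" _ od "Max (od ` A) + 1"]
    by (metis Max_ge all_not_in_conv finite_imageI imageI le_imp_less_Suc Suc_eq_plus1)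
  have "\<exists>\<mu>. oP \<mu> \<and> (\<forall>i. mm (w j l i - pact \<mu> (w j0 l) i))" if "j \<in> A" for j
  proof (cases "od j0")
    case 0
    then have "od j = 0" using j0 that by (metis le_zero_eq)
    then show ?thesis using od[of j] by (intro exI[of _ 0]) auto
  next
    case (Suc e)
    show ?thesis
      using uniserial[of "w j0 l" e "od j" "w j l"] insert.prems od[of j0] od_min[of e j0] j0(2)[OF that] od[of j]
      by (auto simp: Suc simp del: power_Suc)
  qed
  then obtain \<mu> where \<mu>: "\<And>j. j \<in> A \<Longrightarrow> oP (\<mu> j)" "\<And>j i. j \<in> A \<Longrightarrow> mm (w j l i - pact (\<mu> j) (w j0 l) i)" by metis
  define \<mu>' where "\<mu>' j = (if j \<in> A then \<mu> j else 0)" for j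
  have \<mu>': "oP (\<mu>' j)" for j using \<mu> by (simp add: \<mu>'_def)
  \<comment> \<open>Coordinate l now vanishes modulo p_L; the other coordinates change too but
    remain integral and periodic, so induction applies to L with one function fewer.\<close>
  define w' where "w' j l' i = w j l' i - pact (\<mu>' j) (w j0 l') i" for j l' i
  let ?A = "A - {j0}"
  have "finite ?A" "card L < card ?A" using insert j0 by auto
  moreover have "w' j l' i \<in> Oc" for j l' i using insert.prems \<mu>' by (auto simp: w'_def intro!: O_diff pact_O)
  moreover have "mm (w' j l' (i + int q) - w' j l' i)" for j l' i
  proof -
    have "mm (pact (\<mu>' j) (\<lambda>i. w j0 l' (i + int q) - w j0 l' i) i)" using insert.prems \<mu>' by (intro pact_mm) auto
    then have "mm (pact (\<mu>' j) (w j0 l') (i + int q) - pact (\<mu>' j) (w j0 l') i)"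
      by (simp add: pact_fun_diff pact_shift)
    from mm_diff[OF insert.prems(4)[of j l' i] this] show ?thesis by (simp add: w'_def algebra_simps)
  qed
  ultimately obtain lam where lam: "\<And>j. oP (lam j)" "\<exists>j\<in>?A. \<not> mm (poly (lam j) 1)"
    "\<And>l' i. l' \<in> L \<Longrightarrow> mm (\<Sum>j\<in>?A. pact (lam j) (w' j l') i)"
    using insert.IH[of ?A w'] by blast
  \<comment> \<open>The coefficient of \<open>j0\<close> collects what was subtracted from the
    others. The coefficient that is nonzero at T = 1 sits at an index other than \<open>j0\<close>
    and is left unchanged.\<close>
  define lam' where "lam' = lam(j0 := - (\<Sum>j\<in>?A. lam j * \<mu>' j))"
  have eq: "(\<Sum>j\<in>A. pact (lam' j) (w j l') i) = (\<Sum>j\<in>?A. pact (lam j) (w' j l') i)" for l' i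
  proof -
    have "(\<Sum>j\<in>A. pact (lam' j) (w j l') i) = pact (lam' j0) (w j0 l') i + (\<Sum>j\<in>?A. pact (lam' j) (w j l') i)"
      using insert.prems(1) j0(1) by (simp add: sum.remove)
    also have "\<dots> = (\<Sum>j\<in>?A. pact (lam j) (w j l') i - pact (lam j) (pact (\<mu>' j) (w j0 l')) i)"
      by (simp add: lam'_def pact_minus pact_sum pact_mult sum_subtractf)
    also have "\<dots> = (\<Sum>j\<in>?A. pact (lam j) (w' j l') i)"
      unfolding w'_def by (simp only: pact_fun_diff)
    finally show ?thesis .
  qed
  have "mm (\<Sum>j\<in>A. pact (lam' j) (w j l') i)" if "l' \<in> insert l L" for l' i
  proof (cases "l' = l")
    case True
    show ?thesis unfolding eq True using lam \<mu>
      by (intro mm_sum pact_mm) (auto simp: w'_def \<mu>'_def)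
  next
    case False then show ?thesis using that lam eq by auto
  qed
  moreover have "oP (lam' j)" for j using lam \<mu>' by (auto simp: lam'_def intro!: oP_simps oP_sum)
  moreover have "\<exists>j\<in>A. \<not> mm (poly (lam' j) 1)" using lam(2) by (auto simp: lam'_def)
  ultimately show ?case by blast
qed

end

context int_ext begin

interpretation V: vector_space "\<lambda>c y. emb c * y"
  by unfold_locales (auto simp: algebra_simps)

text \<open>Finiteness of the residue field: lifts of elements that are independent over \<open>\<int>/p\<close> are independent over \<open>\<rat>\<^sub>p\<close>.\<close>

definition p_indep :: "'l set \<Rightarrow> bool" where
  "p_indep E \<longleftrightarrow> finite E \<and> E \<subseteq> Oc \<and>
     (\<forall>c. mm (\<Sum>e\<in>E. of_int (c e) * e) \<longrightarrow> (\<forall>e\<in>E. int p dvd c e))"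

lemma p_indep_independent:
  assumes "p_indep E" shows "V.independent E"
proof
  have fin: "finite E" and EO: "E \<subseteq> Oc" using assms by (auto simp: p_indep_def)
  assume "V.dependent E"
  then obtain u v where u: "(\<Sum>e\<in>E. emb (u e) * e) = 0" "v \<in> E" "u v \<noteq> 0"
    using V.dependent_finite[OF fin] by auto
  define N where "N = Max ((\<lambda>e. nrm (u e)) ` E)"
  have "N \<in> (\<lambda>e. nrm (u e)) ` E" unfolding N_def using fin u(2) by (intro Max_in) auto
  then obtain w where w: "w \<in> E" "nrm (u w) = N" by auto
  have le: "nrm (u e) \<le> nrm (u w)" if "e \<in> E" for e
    unfolding w(2) N_def using fin that by (intro Max_ge) auto
  have "u w \<noteq> 0" using le[OF u(2)] u(3) by (metis nrm_0 nrm_pos not_le)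
  \<comment> \<open>Division by the coefficient of largest norm makes all coefficients integral and
    the one at w equal to 1.\<close>
  define u' where "u' e = u e / u w" for e
  have u'Z: "u' e \<in> Zp nrm" if "e \<in> E" for e
    using le[OF that] \<open>u w \<noteq> 0\<close> by (simp add: u'_def Zp_iff nrm_divide)
  have "(\<Sum>e\<in>E. emb (u' e) * e) = emb (inverse (u w)) * (\<Sum>e\<in>E. emb (u e) * e)"
    unfolding sum_distrib_left by (intro sum.cong refl) (simp add: u'_def divide_inverse mult_ac)
  then have sum0: "(\<Sum>e\<in>E. emb (u' e) * e) = 0" using u(1) by simp
  \<comment> \<open>Replacing the coefficients by integers modulo p changes the relation by an
    element of (p_L). Independence then forces p to divide the integer at w, although it is
    congruent to 1.\<close>
  have "\<exists>i::nat. nrm (u' e - of_nat i) \<le> (1 / real p) ^ 1" if "e \<in> E" for e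
    using Zp_approx[OF u'Z[OF that], of 1] by blast
  then obtain c where c: "\<And>e. e \<in> E \<Longrightarrow> nrm (u' e - of_nat (c e)) \<le> (1 / real p) ^ 1" by metis
  have mm_c: "mm (emb (u' e - of_nat (c e)))" if e: "e \<in> E" for e
  proof -
    obtain z where "z \<in> Zp nrm" "u' e - of_nat (c e) = of_nat p ^ 1 * z" using c[OF e] unfolding ball_iff by blast
    then have "emb (u' e - of_nat (c e)) = of_nat p * emb z" by simp
    then show ?thesis using mm_mult[OF mm_p emb_Zp[OF \<open>z \<in> Zp nrm\<close>]] by simp
  qed
  have "(\<Sum>e\<in>E. of_int (int (c e)) * e) = - (\<Sum>e\<in>E. emb (u' e - of_nat (c e)) * e)"
    using sum0 by (simp add: algebra_simps sum_subtractf)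
  moreover have "mm (\<Sum>e\<in>E. emb (u' e - of_nat (c e)) * e)"
    using mm_c EO by (intro mm_sum mm_mult) auto
  ultimately have "mm (\<Sum>e\<in>E. of_int (int (c e)) * e)" using mm_uminus by simp
  then have "\<forall>e\<in>E. int p dvd int (c e)" using assms unfolding p_indep_def by (elim conjE allE[of _ "\<lambda>e. int (c e)"]) blast
  then have "int p dvd int (c w)" using w by simp
  then have "nrm (of_int (int (c w))) \<le> (1 / real p) ^ 1" using nrm_of_int_le_iff[of "int (c w)" 1] by simp
  then have "nrm 1 \<le> (1 / real p) ^ 1"
    using nrm_ultra[of "u' w - of_nat (c w)" "of_nat (c w)"] c[OF w(1)] \<open>u w \<noteq> 0\<close> by (simp add: u'_def)
  then show False using p_gt_1 by simp
qed

text \<open>Independent sets over the prime field are bounded by the size of a spanning set of L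
  over \<open>\<rat>\<^sub>p\<close>. A largest one spans \<oo>/(p_L), so its combinations with
  digits below p represent all classes.\<close>

lemma finite_residues: "\<exists>Rep. finite Rep \<and> Rep \<subseteq> Oc \<and> (\<forall>x\<in>Oc. \<exists>r\<in>Rep. mm (x - r))"
proof -
  obtain B :: "'l set" where B: "finite B" "\<And>y. \<exists>c. y = (\<Sum>b\<in>B. emb (c b) * b)"
    using fin_ext unfolding finite_extension_def by blast
  have "y \<in> V.span B" for y
  proof -
    obtain c where "y = (\<Sum>b\<in>B. emb (c b) * b)" using B(2) by blast
    moreover have "(\<Sum>b\<in>B. emb (c b) * b) \<in> V.span B"
      by (intro V.span_sum) (rule V.span_scale[OF V.span_base])
    ultimately show ?thesis by simp
  qed
  then have bound: "card E \<le> card B" if "p_indep E" for E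
    using V.independent_span_bound[OF B(1) p_indep_independent[OF that]] by auto
  define Q where "Q k \<longleftrightarrow> (\<exists>E. p_indep E \<and> card E = k)" for k
  have "Q 0" unfolding Q_def by (intro exI[of _ "{}"]) (auto simp: p_indep_def)
  moreover have "\<forall>k. Q k \<longrightarrow> k \<le> card B" using bound by (auto simp: Q_def)
  ultimately obtain k where k: "Q k" "\<And>j. Q j \<Longrightarrow> j \<le> k"
    using GreatestI_nat[of Q 0 "card B"] Greatest_le_nat[of Q _ "card B"] by blast
  then obtain E where E: "p_indep E" "card E = k" by (auto simp: Q_def)
  have fin: "finite E" and EO: "E \<subseteq> Oc" using E by (auto simp: p_indep_def)
  define Rep where "Rep = (\<lambda>r. \<Sum>e\<in>E. of_int (r e) * e) ` (E \<rightarrow>\<^sub>E {0..<int p})"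
  have "finite Rep" unfolding Rep_def using fin by (intro finite_imageI finite_PiE) auto
  moreover have "Rep \<subseteq> Oc" unfolding Rep_def using EO by (auto intro!: O_sum O_mult)
  moreover have "\<exists>r\<in>Rep. mm (x - r)" if x: "x \<in> Oc" for x
  proof -
    have "\<exists>d. mm (x - (\<Sum>e\<in>E. of_int (d e) * e))"
    proof (cases "x \<in> E")
      case True
      have "(\<Sum>e\<in>E. of_int (if e = x then 1 else 0) * e) = (\<Sum>e\<in>E. if e = x then e else 0)"
        by (intro sum.cong) auto
      also have "\<dots> = x" using True fin by simp
      finally show ?thesis by (intro exI[of _ "\<lambda>e. if e = x then 1 else 0"]) simp
    next
      case False
      \<comment> \<open>E is of maximal size, so x satisfies a relation; its coefficient at x is
        prime to p because E itself is independent.\<close>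
      have "\<not> p_indep (insert x E)"
      proof
        assume "p_indep (insert x E)"
        then have "Q (Suc k)" unfolding Q_def using E False fin by (intro exI[of _ "insert x E"]) auto
        then show False using k(2)[of "Suc k"] by simp
      qed
      then obtain c where c: "mm (\<Sum>e\<in>insert x E. of_int (c e) * e)" "\<exists>e\<in>insert x E. \<not> int p dvd c e"
        using fin EO x unfolding p_indep_def by auto
      have c1: "mm (of_int (c x) * x + (\<Sum>e\<in>E. of_int (c e) * e))" using c(1) False fin by simp
      have "\<not> int p dvd c x"
      proof
        assume "int p dvd c x"
        then obtain q where q: "c x = int p * q" by blast
        have "mm (of_nat p * (of_int q * x))" using x by (intro mm_mult mm_p) auto
        then have "mm (of_int (c x) * x)" by (simp add: q mult.assoc)
        from mm_diff[OF c1 this] have "mm (\<Sum>e\<in>E. of_int (c e) * e)" by simp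
        then have "\<forall>e\<in>E. int p dvd c e" using E(1) by (auto simp: p_indep_def)
        then show False using c(2) \<open>int p dvd c x\<close> by auto
      qed
      then have "coprime (c x) (int p)"
        using p_prime by (metis coprime_commute prime_imp_coprime prime_nat_int_transfer)
      \<comment> \<open>a inverts the coefficient of x modulo p, which solves the relation for
        x.\<close>
      then obtain a v where a: "a * c x + v * int p = 1"
        using bezout_int[of "c x" "int p"] by (auto simp: coprime_iff_gcd_eq_1)
      then have a': "of_int a * of_int (c x) = 1 - of_int v * (of_nat p :: 'l)"
        by (metis add_diff_cancel_right' of_int_1 of_int_add of_int_mult of_int_of_nat_eq)
      have "mm (of_int a * (of_int (c x) * x + (\<Sum>e\<in>E. of_int (c e) * e)) + of_nat p * (of_int v * x))"
        using x by (intro mm_add mm_mult2[OF c1] mm_mult[OF mm_p]) auto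
      also have "of_int a * (of_int (c x) * x + (\<Sum>e\<in>E. of_int (c e) * e)) + of_nat p * (of_int v * x)
          = (of_int a * of_int (c x)) * x + of_nat p * (of_int v * x) - (\<Sum>e\<in>E. of_int (- a * c e) * e)"
        by (simp add: algebra_simps sum_distrib_left sum_negf)
      also have "\<dots> = x - (\<Sum>e\<in>E. of_int (- a * c e) * e)" unfolding a' by (simp add: algebra_simps)
      finally show ?thesis by (intro exI[of _ "\<lambda>e. - a * c e"])
    qed
    then obtain d where d: "mm (x - (\<Sum>e\<in>E. of_int (d e) * e))" by blast
    \<comment> \<open>Multiples of p lie in (p_L), so the integer coefficients may be reduced modulo
      p.\<close>
    define r where "r = (\<lambda>e\<in>E. d e mod int p)"
    have "mm (\<Sum>e\<in>E. of_nat p * (of_int (d e div int p) * e))"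
      using EO by (intro mm_sum mm_mult[OF mm_p]) auto
    also have "(\<Sum>e\<in>E. of_nat p * (of_int (d e div int p) * e)) =
        (\<Sum>e\<in>E. of_int (d e) * e) - (\<Sum>e\<in>E. of_int (r e) * e)"
      unfolding sum_subtractf[symmetric]
    proof (intro sum.cong refl)
      fix e assume "e \<in> E"
      have eq: "(of_int (d e) :: 'l) = of_nat p * of_int (d e div int p) + of_int (d e mod int p)"
        by (metis of_int_add of_int_mult of_int_of_nat_eq mult_div_mod_eq)
      show "of_nat p * (of_int (d e div int p) * e) = of_int (d e) * e - of_int (r e) * e"
        using \<open>e \<in> E\<close> by (subst eq) (simp add: r_def distrib_right mult.assoc)
    qed
    finally have "mm ((x - (\<Sum>e\<in>E. of_int (d e) * e)) + ((\<Sum>e\<in>E. of_int (d e) * e) - (\<Sum>e\<in>E. of_int (r e) * e)))"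
      by (intro mm_add d)
    then have "mm (x - (\<Sum>e\<in>E. of_int (r e) * e))" by simp
    moreover have "r \<in> E \<rightarrow>\<^sub>E {0..<int p}" using p_gt_1 by (auto simp: r_def)
    ultimately show ?thesis by (auto simp: Rep_def)
  qed
  ultimately show ?thesis by blast
qed

text \<open>The finite set of representatives is fixed by the inner choice before an element is
  picked for x, whence \<open>rep\<close> has finite range.\<close>

definition rep :: "'l \<Rightarrow> 'l" where
  "rep x = (SOME r. r \<in> (SOME Rep. finite Rep \<and> Rep \<subseteq> Oc \<and> (\<forall>x\<in>Oc. \<exists>r\<in>Rep. mm (x - r))) \<and> mm (x - r))"

lemma rep:
  "finite (rep ` Oc)" "x \<in> Oc \<Longrightarrow> rep x \<in> Oc" "x \<in> Oc \<Longrightarrow> mm (x - rep x)"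
proof -
  define Rep where "Rep = (SOME Rep. finite Rep \<and> Rep \<subseteq> Oc \<and> (\<forall>x\<in>Oc. \<exists>r\<in>Rep. mm (x - r)))"
  have Rep: "finite Rep \<and> Rep \<subseteq> Oc \<and> (\<forall>x\<in>Oc. \<exists>r\<in>Rep. mm (x - r))"
    unfolding Rep_def by (rule someI_ex[OF finite_residues])
  have r: "rep x \<in> Rep \<and> mm (x - rep x)" if "x \<in> Oc" for x
    unfolding rep_def Rep_def[symmetric] by (rule someI_ex) (use Rep that in blast)
  show "x \<in> Oc \<Longrightarrow> rep x \<in> Oc" "x \<in> Oc \<Longrightarrow> mm (x - rep x)" using r Rep by auto
  show "finite (rep ` Oc)" by (rule finite_subset[of _ Rep]) (use r Rep in auto)
qed

end

section \<open>The tree and the end \<open>\<alpha>\<^sub>0\<close>\<close>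

lemma mat2_nth: "mat2 a b c d $ 1 $ 1 = a" "mat2 a b c d $ 1 $ 2 = b"
  "mat2 a b c d $ 2 $ 1 = c" "mat2 a b c d $ 2 $ 2 = d"
  by (simp_all add: mat2_def)

lemma mat2_vec: "(mat2 a b c d *v v) $ 1 = a * v $ 1 + b * v $ 2" "(mat2 a b c d *v v) $ 2 = c * v $ 1 + d * v $ 2"
  by (simp_all add: matrix_vector_mult_def sum_2 mat2_nth)

lemma mat2_mult: "mat2 a b c d ** mat2 a' b' c' d' =
    mat2 (a * a' + b * c') (a * b' + b * d') (c * a' + d * c') (c * b' + d * d')"
  by (simp add: vec_eq_iff forall_2 matrix_matrix_mult_def sum_2 mat2_nth)

lemma mat2_one: "mat2 1 0 0 1 = mat 1"
  by (simp add: vec_eq_iff forall_2 mat2_nth mat_def)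

lemma mat2_eq_iff: "mat2 a b c d = mat2 a' b' c' d' \<longleftrightarrow> a = a' \<and> b = b' \<and> c = c' \<and> d = d'"
  by (auto simp: vec_eq_iff forall_2 mat2_nth)

lemma matrix_inv_unique:
  fixes A :: "'a::field ^ 2 ^ 2"
  assumes "A ** B = mat 1" "B ** A = mat 1" shows "matrix_inv A = B"
proof -
  have "A ** matrix_inv A = mat 1 \<and> matrix_inv A ** A = mat 1"
    unfolding matrix_inv_def by (rule someI[of _ B]) (use assms in auto)
  then show ?thesis by (metis assms(2) matrix_mul_assoc matrix_mul_lid matrix_mul_rid)
qed

lemma matrix_inv_aff: "a \<noteq> 0 \<Longrightarrow> matrix_inv (mat2 a b 0 1) = mat2 (1 / a) (- b / a) 0 (1 :: 'a::field)"
  by (rule matrix_inv_unique) (simp_all add: mat2_mult mat2_one[symmetric])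

lemma vact_mult: "vact (g ** h) x = vact g (vact h x)"
  by (simp add: vact_def image_image matrix_vector_mul_assoc)
lemma vact_one [simp]: "vact (mat 1) x = x"
  by (simp add: vact_def)
lemma vact_homothety: "vact g (homothety_class A) = homothety_class ((\<lambda>v. g *v v) ` A)"
proof -
  have "(\<lambda>v. g *v v) ` (\<lambda>v. c *s v) ` A = (\<lambda>v. c *s v) ` (\<lambda>v. g *v v) ` A" for c
    by (simp add: image_image vector_scalar_commute)
  then have "vact g (homothety_class A) = {(\<lambda>v. c *s v) ` (\<lambda>v. g *v v) ` A | c. c \<noteq> 0}"
    unfolding vact_def homothety_class_def setcompr_eq_image image_image by simp
  then show ?thesis unfolding homothety_class_def .
qed

lemma homothety_class_eq_iff:
  "homothety_class A = homothety_class B \<longleftrightarrow> (\<exists>c. c \<noteq> 0 \<and> B = (\<lambda>v. c *s v) ` A)"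
proof
  assume "homothety_class A = homothety_class B"
  moreover have "B \<in> homothety_class B" unfolding homothety_class_def by (auto intro!: exI[of _ 1])
  ultimately have "B \<in> homothety_class A" by simp
  then show "\<exists>c. c \<noteq> 0 \<and> B = (\<lambda>v. c *s v) ` A" unfolding homothety_class_def by blast
next
  assume "\<exists>c. c \<noteq> 0 \<and> B = (\<lambda>v. c *s v) ` A"
  then obtain c where c: "c \<noteq> 0" "B = (\<lambda>v. c *s v) ` A" by blast
  have 1: "(\<lambda>v. d *s v) ` B = (\<lambda>v. (d * c) *s v) ` A" for d unfolding c(2) by (simp add: image_image vector_smult_assoc)
  have 2: "(\<lambda>v. d *s v) ` A = (\<lambda>v. (d / c) *s v) ` B" for d unfolding 1 using c(1) by simp
  show "homothety_class A = homothety_class B"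
    unfolding homothety_class_def
  proof (intro equalityI subsetI; elim CollectE exE conjE)
    fix S d assume "S = (\<lambda>v. d *s v) ` A" "d \<noteq> 0"
    then show "S \<in> {(\<lambda>v. c *s v) ` B |c. c \<noteq> 0}" using c(1) 2[of d] by (intro CollectI exI[of _ "d / c"]) auto
  next
    fix S d assume "S = (\<lambda>v. d *s v) ` B" "d \<noteq> 0"
    then show "S \<in> {(\<lambda>v. c *s v) ` A |c. c \<noteq> 0}" using c(1) 1[of d] by (intro CollectI exI[of _ "d * c"]) auto
  qed
qed

lemma mem_scale_iff: "c \<noteq> 0 \<Longrightarrow> v \<in> (\<lambda>v. c *s v) ` A \<longleftrightarrow> (1 / c) *s (v :: 'a::field ^ 'n) \<in> A"
  by (auto simp: image_iff vector_smult_assoc intro!: bexI[of _ "(1 / c) *s v"])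

context qp begin

text \<open>The lattice with basis (a, 0), (b, 1), given by inequalities so that inclusions of
  lattices become estimates of norms.\<close>

definition La where "La a b = {v :: 'q ^ 2. nrm (v $ 2) \<le> 1 \<and> nrm (v $ 1 - b * v $ 2) \<le> nrm a}"
text \<open>Every vertex is \<open>vx a b\<close> for some \<open>a \<noteq> 0\<close>, with \<open>a\<close> determined up to units and \<open>b\<close> modulo \<open>a\<close>; its neighbour in the
  direction of the end \<open>\<alpha>\<^sub>0\<close> is \<open>pa (vx a b) = vx (a/p) b\<close>.\<close>

definition vx where "vx a b = vact (mat2 a b 0 1) (xplus nrm)"

lemma vx_La: "a \<noteq> 0 \<Longrightarrow> vx a b = homothety_class (La a b)"
proof -
  assume a: "a \<noteq> 0"
  have "(\<lambda>v. mat2 a b 0 1 *v v) ` {v. \<forall>i. v $ i \<in> Zp nrm} = La a b"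
  proof (intro equalityI subsetI)
    fix w assume "w \<in> (\<lambda>v. mat2 a b 0 1 *v v) ` {v. \<forall>i. v $ i \<in> Zp nrm}"
    then obtain v where "w = mat2 a b 0 1 *v v" "nrm (v $ 1) \<le> 1" "nrm (v $ 2) \<le> 1" by (auto simp: Zp_iff)
    then show "w \<in> La a b" by (simp add: La_def mat2_vec nrm_mult mult_left_le)
  next
    fix w assume w: "w \<in> La a b"
    let ?v = "vector [(w $ 1 - b * w $ 2) / a, w $ 2] :: 'q ^ 2"
    have "w = mat2 a b 0 1 *v ?v" using a by (simp add: vec_eq_iff forall_2 mat2_vec)
    moreover have "\<forall>i. ?v $ i \<in> Zp nrm" using w a by (simp add: forall_2 Zp_iff La_def nrm_divide)
    ultimately show "w \<in> (\<lambda>v. mat2 a b 0 1 *v v) ` {v. \<forall>i. v $ i \<in> Zp nrm}" by blast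
  qed
  then show ?thesis by (simp add: vx_def xplus_def vact_homothety)
qed

lemma La_eqI:
  assumes "nrm a = nrm a'" "nrm (b - b') \<le> nrm a" shows "La a b = La a' b'"
proof -
  have *: "nrm (x - b' * y) \<le> nrm a" if "nrm y \<le> 1" "nrm (x - b * y) \<le> nrm a" "nrm (b - b') \<le> nrm a" for x y b b'
  proof -
    have "nrm ((b - b') * y) \<le> nrm a" using that mult_mono[of "nrm (b - b')" "nrm a" "nrm y" 1] by (simp add: nrm_mult)
    then show ?thesis using nrm_ultra[of "x - b * y" "(b - b') * y"] that by (simp add: algebra_simps)
  qed
  show ?thesis
  proof (intro equalityI subsetI)
    fix v assume "v \<in> La a b" then show "v \<in> La a' b'" using assms *[of "v $ 2" "v $ 1" b b'] by (auto simp: La_def)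
  next
    fix v assume "v \<in> La a' b'" then show "v \<in> La a b"
      using assms *[of "v $ 2" "v $ 1" b' b] nrm_minus_commute[of b b'] by (auto simp: La_def)
  qed
qed

lemma mem_scale_La:
  "c \<noteq> 0 \<Longrightarrow> v \<in> (\<lambda>v. c *s v) ` La a b \<longleftrightarrow> nrm (v $ 2) \<le> nrm c \<and> nrm (v $ 1 - b * v $ 2) \<le> nrm (c * a)"
proof -
  assume c: "c \<noteq> 0"
  have "1 / c * v $ 1 - b * (1 / c * v $ 2) = (v $ 1 - b * v $ 2) / c" by (simp add: diff_divide_distrib)
  then show ?thesis using c nrm_pos[OF c]
    by (simp add: mem_scale_iff La_def nrm_mult nrm_divide divide_le_eq mult.commute)
qed

text \<open>Two such lattices are homothetic only by a factor of norm 1, as the second coordinates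
  of both have largest norm 1. Then the lattices coincide, and test vectors compare a and b.\<close>

lemma vx_eq_iff:
  assumes a: "a \<noteq> 0" "a' \<noteq> 0"
  shows "vx a b = vx a' b' \<longleftrightarrow> nrm a = nrm a' \<and> nrm (b - b') \<le> nrm a"
proof
  assume "nrm a = nrm a' \<and> nrm (b - b') \<le> nrm a"
  then show "vx a b = vx a' b'" using La_eqI[of a a' b b'] a by (simp add: vx_La)
next
  assume "vx a b = vx a' b'"
  then obtain c where c: "c \<noteq> 0" "La a' b' = (\<lambda>v. c *s v) ` La a b"
    using a by (auto simp: vx_La homothety_class_eq_iff)
  have mem: "nrm y \<le> 1 \<and> nrm (x - b' * y) \<le> nrm a' \<longleftrightarrow> nrm y \<le> nrm c \<and> nrm (x - b * y) \<le> nrm c * nrm a" for x y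
    using mem_scale_La[OF c(1), of "vector [x, y]" a b] c(2)[symmetric] by (simp add: La_def nrm_mult)
  \<comment> \<open>The test vectors are (b', 1) from the second lattice and (b c, c) from the
    scaled first one.\<close>
  have "nrm c = 1"
    using mem[of 1 b'] mem[of c "b * c"] by (auto simp: antisym)
  have "nrm a' \<le> nrm a" using mem[of 0 a'] \<open>nrm c = 1\<close> by simp
  moreover have "nrm a \<le> nrm a'" using mem[of 0 a] \<open>nrm c = 1\<close> by simp
  moreover have "nrm (b - b') \<le> nrm a'" using mem[of 1 b] \<open>nrm c = 1\<close> by simp
  ultimately show "nrm a = nrm a' \<and> nrm (b - b') \<le> nrm a" by simp
qed

lemma vact_vx: "vact (mat2 a b 0 1) (vx a' b') = vx (a * a') (a * b' + b)"
  by (simp add: vx_def vact_mult[symmetric] mat2_mult)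

lemma xplus_vx: "xplus nrm = vx 1 0"
  by (simp add: vx_def mat2_one)

lemma lattice_La: "a \<noteq> 0 \<Longrightarrow> is_lattice nrm (La a b)"
proof -
  assume a: "a \<noteq> 0"
  let ?u = "vector [a, 0] :: 'q ^ 2" and ?v = "vector [b, 1] :: 'q ^ 2"
  have "La a b = {s *s ?u + t *s ?v | s t. s \<in> Zp nrm \<and> t \<in> Zp nrm}"
  proof (intro equalityI subsetI)
    fix w assume w: "w \<in> La a b"
    have "w = ((w $ 1 - b * w $ 2) / a) *s ?u + (w $ 2) *s ?v" using a by (simp add: vec_eq_iff forall_2)
    moreover have "(w $ 1 - b * w $ 2) / a \<in> Zp nrm" "w $ 2 \<in> Zp nrm"
      using w a by (auto simp: La_def Zp_iff nrm_divide)
    ultimately show "w \<in> {s *s ?u + t *s ?v | s t. s \<in> Zp nrm \<and> t \<in> Zp nrm}" by blast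
  next
    fix w assume "w \<in> {s *s ?u + t *s ?v | s t. s \<in> Zp nrm \<and> t \<in> Zp nrm}"
    then obtain s t where "w = s *s ?u + t *s ?v" "nrm s \<le> 1" "nrm t \<le> 1" by (auto simp: Zp_iff)
    then show "w \<in> La a b" by (simp add: La_def nrm_mult mult_left_le mult_left_le_one_le algebra_simps)
  qed
  moreover have "\<forall>s t. s *s ?u + t *s ?v = 0 \<longrightarrow> s = 0 \<and> t = 0" using a by (simp add: vec_eq_iff forall_2)
  ultimately show ?thesis unfolding is_lattice_def by blast
qed

text \<open>Column reduction: the basis vector with the larger second coordinate is scaled to (b, 1)
  and clears the second coordinate of the other one.\<close>

lemma lattice_normal_form:
  assumes "is_lattice nrm A" shows "\<exists>a b c. a \<noteq> 0 \<and> c \<noteq> 0 \<and> A = (\<lambda>v. c *s v) ` La a b"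
proof -
  obtain u v where ind: "\<forall>a b. a *s u + b *s v = 0 \<longrightarrow> a = 0 \<and> b = 0"
    and A: "A = {a *s u + b *s v | a b. a \<in> Zp nrm \<and> b \<in> Zp nrm}" using assms unfolding is_lattice_def by blast
  have "\<exists>u v. (\<forall>a b. a *s u + b *s v = 0 \<longrightarrow> a = 0 \<and> b = 0) \<and>
    A = {a *s u + b *s v | a b. a \<in> Zp nrm \<and> b \<in> Zp nrm} \<and> nrm (u $ 2) \<le> nrm (v $ 2)"
  proof (cases "nrm (u $ 2) \<le> nrm (v $ 2)")
    case True then show ?thesis using ind A by blast
  next
    case False
    have "A = {a *s v + b *s u | a b. a \<in> Zp nrm \<and> b \<in> Zp nrm}" unfolding A by (auto; metis add.commute)
    moreover have "\<forall>a b. a *s v + b *s u = 0 \<longrightarrow> a = 0 \<and> b = 0" using ind by (metis add.commute)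
    moreover have "nrm (v $ 2) \<le> nrm (u $ 2)" using False by simp
    ultimately show ?thesis by blast
  qed
  then obtain u v where ind: "\<And>a b. a *s u + b *s v = 0 \<Longrightarrow> a = 0 \<and> b = 0"
    and A: "A = {a *s u + b *s v | a b. a \<in> Zp nrm \<and> b \<in> Zp nrm}" and le: "nrm (u $ 2) \<le> nrm (v $ 2)" by blast
  have v2: "v $ 2 \<noteq> 0"
  proof
    assume v2: "v $ 2 = 0"
    then have "u $ 2 = 0" using le by (metis nrm_0 nrm_pos not_le)
    then have "v $ 1 *s u + (- u $ 1) *s v = 0" using v2 by (simp add: vec_eq_iff forall_2)
    from ind[OF this] have "v $ 1 = 0" by simp
    then have "0 *s u + 1 *s v = 0" using v2 by (simp add: vec_eq_iff forall_2)
    from ind[OF this] show False by simp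
  qed
  \<comment> \<open>Integral because v was chosen to have the larger second coordinate; u - k v has
    second coordinate 0.\<close>
  define k where "k = u $ 2 / v $ 2"
  have kZ: "k \<in> Zp nrm" using le v2 by (simp add: k_def Zp_iff nrm_divide)
  define u1 where "u1 = u $ 1 - k * v $ 1"
  have u1: "u1 \<noteq> 0"
  proof
    assume "u1 = 0"
    then have "1 *s u + (- k) *s v = 0" using v2 by (simp add: vec_eq_iff forall_2 u1_def k_def)
    from ind[OF this] show False by simp
  qed
  define a where "a = u1 / v $ 2"
  define b where "b = v $ 1 / v $ 2"
  have "A = (\<lambda>w. v $ 2 *s w) ` La a b"
  proof (intro equalityI subsetI)
    fix w assume "w \<in> A"
    then obtain s t where st: "w = s *s u + t *s v" "s \<in> Zp nrm" "t \<in> Zp nrm" unfolding A by blast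
    have "t + s * k \<in> Zp nrm" using st kZ by simp
    moreover have "w $ 2 = v $ 2 * (t + s * k)" using v2 by (simp add: st k_def field_simps)
    moreover have "w $ 1 - b * w $ 2 = v $ 2 * a * s" using v2 by (simp add: st b_def a_def u1_def k_def field_simps)
    ultimately show "w \<in> (\<lambda>w. v $ 2 *s w) ` La a b"
      using st v2 by (simp add: mem_scale_La nrm_mult Zp_iff mult_left_le)
  next
    fix w assume "w \<in> (\<lambda>w. v $ 2 *s w) ` La a b"
    then have w: "nrm (w $ 2) \<le> nrm (v $ 2)" "nrm (w $ 1 - b * w $ 2) \<le> nrm u1"
      using v2 by (simp_all add: mem_scale_La a_def)
    define s where "s = (w $ 1 - b * w $ 2) / u1"
    define t where "t = w $ 2 / v $ 2 - s * k"
    have sZ: "s \<in> Zp nrm" using w u1 by (simp add: s_def Zp_iff nrm_divide)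
    have "w $ 2 / v $ 2 \<in> Zp nrm" using w v2 by (simp add: Zp_iff nrm_divide)
    then have tZ: "t \<in> Zp nrm" using sZ kZ by (simp add: t_def)
    have "w $ 2 = s * u $ 2 + t * v $ 2" using v2 by (simp add: t_def k_def field_simps)
    moreover have "w $ 1 = s * u $ 1 + t * v $ 1"
    proof -
      have "w $ 1 = s * u1 + b * w $ 2" using u1 by (simp add: s_def)
      also have "\<dots> = s * u $ 1 + t * v $ 1" using v2 by (simp add: u1_def t_def b_def field_simps)
      finally show ?thesis .
    qed
    ultimately have "w = s *s u + t *s v" by (simp add: vec_eq_iff forall_2)
    then show "w \<in> A" unfolding A using sZ tZ by blast
  qed
  then show ?thesis using u1 v2 by (intro exI[of _ a] exI[of _ b] exI[of _ "v $ 2"]) (auto simp: a_def)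
qed

lemma homothety_scale: "c \<noteq> 0 \<Longrightarrow> homothety_class ((\<lambda>v. c *s v) ` A) = homothety_class A"
  by (subst eq_commute, subst homothety_class_eq_iff) blast

lemma X0_vx: "X0 nrm = {vx a b | a b. a \<noteq> 0}"
proof (intro equalityI subsetI)
  fix x assume "x \<in> X0 nrm"
  then obtain A where A: "x = homothety_class A" "is_lattice nrm A" by (auto simp: X0_def)
  from lattice_normal_form[OF A(2)] obtain a b c where "a \<noteq> 0" "c \<noteq> 0" "A = (\<lambda>v. c *s v) ` La a b" by blast
  then have "x = vx a b" using A by (simp add: homothety_scale vx_La)
  then show "x \<in> {vx a b | a b. a \<noteq> 0}" using \<open>a \<noteq> 0\<close> by blast
next
  fix x assume "x \<in> {vx a b | a b. a \<noteq> 0}"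
  then show "x \<in> X0 nrm" using lattice_La by (auto simp: X0_def vx_La)
qed

lemma nrm_between:
  assumes "x \<noteq> 0" "1 / real p \<le> nrm x" "nrm x \<le> 1" shows "nrm x = 1 / real p \<or> nrm x = 1"
proof -
  obtain k where k: "nrm x = real p powi k" using nrm_value assms by blast
  have p: "real p > 1" using p_gt_1 by simp
  have "k \<le> 0" using assms(3) p unfolding k by (metis less_le_not_le linorder_not_le one_less_power_int)
  moreover have "k \<ge> -1"
  proof (rule ccontr)
    assume "\<not> k \<ge> -1"
    then have "real p powi k \<le> real p powi (-2)" using p by (intro power_int_increasing) auto
    also have "\<dots> < real p powi (-1)" using p by (intro power_int_strict_increasing) auto
    finally show False using assms(2) k by (simp add: power_int_minus inverse_eq_divide)
  qed
  ultimately have "k = 0 \<or> k = -1" by auto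
  then show ?thesis unfolding k by (auto simp: power_int_minus inverse_eq_divide)
qed

text \<open>A lattice strictly between p A and A is compared with A through the two diagonal entries
  of their normal forms. Each ratio has norm 1 or 1/p; two of the four combinations are excluded by
  strictness, and the other two are the two orientations of an edge.\<close>

lemma X1_vx: "X1 p nrm = {{vx a b, vx (a / of_nat p) b} | a b. a \<noteq> 0}"
proof (intro equalityI subsetI)
  fix s assume "s \<in> {{vx a b, vx (a / of_nat p) b} | a b. a \<noteq> 0}"
  then obtain a b where s: "s = {vx a b, vx (a / of_nat p) b}" "a \<noteq> 0" by blast
  let ?A = "La (a / of_nat p) b" and ?B = "La a b"
  have p: "real p > 1" using p_gt_1 by simp
  have na: "nrm (a / of_nat p) = real p * nrm a" by (simp add: nrm_divide nrm_p)
  have pos: "nrm a > 0" using s by simp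
  have pA: "v \<in> (\<lambda>v. of_nat p *s v) ` ?A \<longleftrightarrow> nrm (v $ 2) \<le> 1 / real p \<and> nrm (v $ 1 - b * v $ 2) \<le> nrm a" for v
    using s p by (subst mem_scale_La) (auto simp: nrm_p)
  have "(\<lambda>v. of_nat p *s v) ` ?A \<subset> ?B"
  proof
    show "(\<lambda>v. of_nat p *s v) ` ?A \<subseteq> ?B"
    proof
      fix v assume "v \<in> (\<lambda>v. of_nat p *s v) ` ?A"
      then have "nrm (v $ 2) \<le> 1 / real p" "nrm (v $ 1 - b * v $ 2) \<le> nrm a" unfolding pA by auto
      moreover have "1 / real p \<le> 1" using p by simp
      ultimately show "v \<in> ?B" by (simp add: La_def)
    qed
    have "vector [b, 1] \<in> ?B" by (simp add: La_def)
    moreover have "vector [b, 1] \<notin> (\<lambda>v. of_nat p *s v) ` ?A" unfolding pA using p by simp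
    ultimately show "(\<lambda>v. of_nat p *s v) ` ?A \<noteq> ?B" by blast
  qed
  moreover have "?B \<subset> ?A"
  proof
    show "?B \<subseteq> ?A" unfolding La_def na using p pos by (auto intro: order_trans[of _ "nrm a"])
    have "vector [a / of_nat p, 0] \<in> ?A" by (simp add: La_def)
    moreover have "vector [a / of_nat p, 0] \<notin> ?B" using p pos by (simp add: La_def na)
    ultimately show "?B \<noteq> ?A" by blast
  qed
  moreover have "s = {homothety_class ?A, homothety_class ?B}"
    using s p by (simp add: vx_La insert_commute)
  moreover have "is_lattice nrm ?A" "is_lattice nrm ?B" using s p by (auto intro!: lattice_La)
  ultimately show "s \<in> X1 p nrm" unfolding X1_def by blast
next
  fix s assume "s \<in> X1 p nrm"
  then obtain A B where s: "s = {homothety_class A, homothety_class B}" "is_lattice nrm A" "is_lattice nrm B"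
    and sub: "(\<lambda>v. of_nat p *s v) ` A \<subset> B" "B \<subset> A" by (auto simp: X1_def)
  obtain a b c where A: "a \<noteq> 0" "c \<noteq> 0" "A = (\<lambda>v. c *s v) ` La a b" using lattice_normal_form s by blast
  obtain a1 b1 c1 where B: "a1 \<noteq> 0" "c1 \<noteq> 0" "B = (\<lambda>v. c1 *s v) ` La a1 b1" using lattice_normal_form s by blast
  have sv: "s = {vx a b, vx a1 b1}" using s A B by (simp add: homothety_scale vx_La)
  have p: "real p > 1" using p_gt_1 by simp
  \<comment> \<open>Both lattices are divided by c, so that the larger one becomes
    \<open>La a b\<close> itself.\<close>
  define d where "d = c1 / c"
  have d: "d \<noteq> 0" "c1 = c * d" using A B by (auto simp: d_def)
  let ?L = "La a b" and ?L1 = "(\<lambda>v. d *s v) ` La a1 b1"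
  have inj: "inj (\<lambda>v :: 'q ^ 2. c *s v)" using A(2) by (auto simp: inj_def)
  have B': "B = (\<lambda>v. c *s v) ` ?L1" unfolding B(3) d(2) by (simp add: image_image vector_smult_assoc)
  have pA': "(\<lambda>v. of_nat p *s v) ` A = (\<lambda>v. c *s v) ` (\<lambda>v. of_nat p *s v) ` ?L"
    unfolding A(3) by (simp add: image_image vector_smult_assoc mult.commute)
  have sub1: "(\<lambda>v. of_nat p *s v) ` ?L \<subset> ?L1" "?L1 \<subset> ?L"
    using sub unfolding B' pA' unfolding A(3)
    by (simp_all add: inj_image_subset_iff[OF inj] inj_image_eq_iff[OF inj] psubset_eq)
  have mL: "v \<in> ?L \<longleftrightarrow> nrm (v $ 2) \<le> 1 \<and> nrm (v $ 1 - b * v $ 2) \<le> nrm a" for v by (simp add: La_def)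
  have mL1: "v \<in> ?L1 \<longleftrightarrow> nrm (v $ 2) \<le> nrm d \<and> nrm (v $ 1 - b1 * v $ 2) \<le> nrm d * nrm a1" for v
    using mem_scale_La[OF d(1)] by (simp add: nrm_mult)
  have mpL: "v \<in> (\<lambda>v. of_nat p *s v) ` ?L \<longleftrightarrow> nrm (v $ 2) \<le> 1 / real p \<and> nrm (v $ 1 - b * v $ 2) \<le> nrm a / real p" for v
    using p by (subst mem_scale_La) (auto simp: nrm_p nrm_mult)
  \<comment> \<open>These and the following inequalities come from testing the basis vectors of a
    smaller lattice for membership in the larger one.\<close>
  have 1: "nrm d \<le> 1" "nrm (d * (b1 - b)) \<le> nrm a"
  proof -
    have "vector [d * b1, d] \<in> ?L1" unfolding mL1 using A(1) by simp
    then have "vector [d * b1, d] \<in> ?L" using sub1 by blast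
    then show "nrm d \<le> 1" "nrm (d * (b1 - b)) \<le> nrm a" unfolding mL by (simp_all add: algebra_simps)
  qed
  have 2: "nrm (d * a1) \<le> nrm a"
  proof -
    have "vector [d * a1, 0] \<in> ?L1" unfolding mL1 by (simp add: nrm_mult)
    then have "vector [d * a1, 0] \<in> ?L" using sub1 by blast
    then show ?thesis unfolding mL by simp
  qed
  have 3: "1 / real p \<le> nrm d" "nrm (b - b1) / real p \<le> nrm (d * a1)"
  proof -
    have "vector [of_nat p * b, of_nat p] \<in> (\<lambda>v. of_nat p *s v) ` ?L" unfolding mpL by (simp add: nrm_p)
    then have "vector [of_nat p * b, of_nat p] \<in> ?L1" using sub1 by blast
    then have "1 / real p \<le> nrm d" "nrm (of_nat p * (b - b1)) \<le> nrm (d * a1)"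
      unfolding mL1 by (auto simp: nrm_p nrm_mult[of d a1] right_diff_distrib mult.commute[of b1])
    then show "1 / real p \<le> nrm d" "nrm (b - b1) / real p \<le> nrm (d * a1)" by (simp_all add: nrm_mult[of "of_nat p"] nrm_p)
  qed
  have 4: "nrm a / real p \<le> nrm (d * a1)"
  proof -
    have "vector [of_nat p * a, 0] \<in> (\<lambda>v. of_nat p *s v) ` ?L" unfolding mpL using p by (simp add: nrm_p nrm_mult)
    then have "vector [of_nat p * a, 0] \<in> ?L1" using sub1 by blast
    then show ?thesis unfolding mL1 by (simp add: nrm_p nrm_mult)
  qed
  have na: "nrm a > 0" using A by simp
  have dd: "nrm d = 1 / real p \<or> nrm d = 1" using nrm_between d 1 3 by blast
  have "nrm (d * a1 / a) = 1 / real p \<or> nrm (d * a1 / a) = 1"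
    using 2 4 na d A B by (intro nrm_between) (auto simp: nrm_divide divide_le_eq le_divide_eq)
  then have aa: "nrm (d * a1) = nrm a / real p \<or> nrm (d * a1) = nrm a"
    using A(1) by (auto simp: nrm_divide divide_eq_eq)
  \<comment> \<open>Equal ratios 1 and 1 give the lattice itself, 1/p and 1/p give p times it; in
    the mixed cases one vertex is the neighbour of the other towards the end.\<close>
  show "s \<in> {{vx a b, vx (a / of_nat p) b} | a b. a \<noteq> 0}"
  proof (cases "nrm d = 1")
    case d1: True
    show ?thesis
    proof (cases "nrm (d * a1) = nrm a")
      case True
      then have "nrm a1 = nrm a" "nrm (b1 - b) \<le> nrm a1" using d1 1 by (auto simp: nrm_mult)
      from La_eqI[OF this] have "?L1 = ?L"
        using mem_scale_La[OF d(1), of _ a b] d1 by (auto simp: La_def nrm_mult)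
      then show ?thesis using sub1 by (metis psubset_eq)
    next
      case False
      then have "nrm a1 = nrm a / real p" using aa d1 by (simp add: nrm_mult)
      then have "vx (a1 / of_nat p) b1 = vx a b"
        using A B 1 d1 p by (subst vx_eq_iff) (auto simp: nrm_divide nrm_p nrm_mult)
      then have "s = {vx a1 b1, vx (a1 / of_nat p) b1}" using sv by (simp add: insert_commute)
      then show ?thesis using B(1) by blast
    qed
  next
    case False
    then have dp: "nrm d = 1 / real p" using dd by simp
    show ?thesis
    proof (cases "nrm (d * a1) = nrm a")
      case True
      then have "nrm a1 = real p * nrm a" using dp p by (simp add: nrm_mult field_simps)
      moreover have "nrm (b - b1) \<le> real p * nrm a" using 3(2) True p by (simp add: field_simps)
      ultimately have "vx a1 b1 = vx (a / of_nat p) b"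
        using A(1) B(1) p_gt_1 nrm_minus_commute[of b b1] by (subst vx_eq_iff) (auto simp: nrm_divide nrm_p mult.commute)
      then have "s = {vx a b, vx (a / of_nat p) b}" using sv by simp
      then show ?thesis using A(1) by blast
    next
      case False
      then have h: "nrm (d * a1) = nrm a / real p" using aa by simp
      then have "nrm a1 = nrm a" using dp p by (simp add: nrm_mult)
      moreover have "nrm (b - b1) \<le> nrm a" using 3(2) h p by (simp add: field_simps)
      ultimately have "La a1 b1 = La a b" using nrm_minus_commute[of b b1] by (intro La_eqI) auto
      then have "?L1 = (\<lambda>v. of_nat p *s v) ` ?L"
        using mem_scale_La[OF d(1), of _ a b] mem_scale_La[of "of_nat p" _ a b] p_gt_1
        by (intro equalityI subsetI) (auto simp: dp nrm_p nrm_mult)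
      then show ?thesis using sub1 by (metis psubset_eq)
    qed
  qed
qed

definition pa where "pa x = (let (a, b) = (SOME (a, b). a \<noteq> 0 \<and> x = vx a b) in vx (a / of_nat p) b)"
text \<open>The height of a vertex with respect to the end \<alpha>0: each step towards the end
  multiplies it by p.\<close>

definition sz where "sz x = nrm (fst (SOME (a, b). a \<noteq> 0 \<and> x = vx a b))"

lemma pa_sz_vx:
  assumes "a \<noteq> 0" shows "pa (vx a b) = vx (a / of_nat p) b" "sz (vx a b) = nrm a"
proof -
  obtain a' b' where ab: "(SOME (a', b'). a' \<noteq> 0 \<and> vx a b = vx a' b') = (a', b')" by force
  have "case (SOME (a', b'). a' \<noteq> 0 \<and> vx a b = vx a' b') of (a', b') \<Rightarrow> a' \<noteq> 0 \<and> vx a b = vx a' b'"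
    by (rule someI[of _ "(a, b)"]) (use assms in auto)
  then have *: "a' \<noteq> 0" "vx a b = vx a' b'" unfolding ab by auto
  then have n: "nrm a = nrm a'" "nrm (b - b') \<le> nrm a" using vx_eq_iff assms by auto
  show "sz (vx a b) = nrm a" using n by (simp add: sz_def ab)
  have "nrm a' \<le> nrm a' * real p" using p_gt_1 mult_left_mono[of 1 "real p" "nrm a'"] by simp
  from order_trans[OF n(2)[unfolded n(1) nrm_minus_commute[of b]] this] have "vx (a' / of_nat p) b' = vx (a / of_nat p) b"
    using assms * n nrm_minus_commute[of b b'] p_gt_1 by (subst vx_eq_iff) (auto simp: nrm_divide nrm_p)
  then show "pa (vx a b) = vx (a / of_nat p) b" by (simp add: pa_def ab)
qed

lemma vx_X0 [simp]: "a \<noteq> 0 \<Longrightarrow> vx a b \<in> X0 nrm"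
  by (auto simp: X0_vx)

lemma X0_cases: assumes "x \<in> X0 nrm" obtains a b where "a \<noteq> 0" "x = vx a b"
  using assms by (auto simp: X0_vx)

lemma pa_X0 [simp]: "x \<in> X0 nrm \<Longrightarrow> pa x \<in> X0 nrm"
  using p_gt_1 by (elim X0_cases) (simp add: pa_sz_vx)

lemma sz_pa: "x \<in> X0 nrm \<Longrightarrow> sz (pa x) = real p * sz x"
  using p_gt_1 by (elim X0_cases) (simp add: pa_sz_vx nrm_divide nrm_p)

lemma sz_pos: "x \<in> X0 nrm \<Longrightarrow> sz x > 0"
  by (elim X0_cases) (simp add: pa_sz_vx)

lemma pa_ne: "x \<in> X0 nrm \<Longrightarrow> pa x \<noteq> x"
  using sz_pa[of x] sz_pos[of x] p_gt_1 by auto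

lemma X1_pa: "X1 p nrm = {{x, pa x} | x. x \<in> X0 nrm}"
  unfolding X1_vx
proof (intro equalityI subsetI; elim CollectE exE conjE)
  fix s a b assume "s = {vx a b, vx (a / of_nat p) b}" "a \<noteq> 0"
  then show "s \<in> {{x, pa x} | x. x \<in> X0 nrm}" by (intro CollectI exI[of _ "vx a b"]) (auto simp: pa_sz_vx)
next
  fix s x assume "s = {x, pa x}" "x \<in> X0 nrm"
  then show "s \<in> {{vx a b, vx (a / of_nat p) b} | a b. a \<noteq> 0}" by (elim X0_cases) (auto simp: pa_sz_vx)
qed

lemma edge_pa: "x \<in> X0 nrm \<Longrightarrow> {x, pa x} \<in> X1 p nrm"
  by (auto simp: X1_pa)

lemma X1_iff: "{x, y} \<in> X1 p nrm \<longleftrightarrow> x \<in> X0 nrm \<and> y \<in> X0 nrm \<and> (y = pa x \<or> x = pa y)"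
  by (auto simp: X1_pa doubleton_eq_iff)

lemma pa_pow_X0: "x \<in> X0 nrm \<Longrightarrow> (pa ^^ i) x \<in> X0 nrm"
  by (induction i) auto

lemma sz_pa_pow: "x \<in> X0 nrm \<Longrightarrow> sz ((pa ^^ i) x) = real p ^ i * sz x"
  by (induction i) (auto simp: sz_pa pa_pow_X0)

lemma pa_pow_vx: "a \<noteq> 0 \<Longrightarrow> (pa ^^ i) (vx a b) = vx (a / of_nat p ^ i) b"
  using p_gt_1 by (induction i) (auto simp: pa_sz_vx mult.commute)

lemma end_seq_vx: "end_seq p nrm m = vx (1 / of_nat p ^ m) 0"
proof (induction m)
  case 0 then show ?case by (simp add: end_seq_def xplus_vx)
next
  case (Suc m)
  then show ?case using p_gt_1 by (simp add: end_seq_def matrix_inv_aff vact_vx)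
qed

text \<open>A ray that once steps away from the end must continue to do so, since the only way back
  is the vertex just left. Its heights stay bounded, while those of t^(-m) x_+ grow like p^m.
  Conversely, far enough towards the end the offset b is absorbed and the ancestors of z join the
  sequence.\<close>

lemma end_ray_eq:
  assumes z: "z \<in> X0 nrm" shows "end_ray p nrm z = range (\<lambda>i. (pa ^^ i) z)"
proof
  let ?r = "\<lambda>i. (pa ^^ i) z"
  have p: "real p > 1" using p_gt_1 by simp
  have szz: "sz z > 0" using z by (rule sz_pos)
  have "finite {m. end_seq p nrm m \<notin> range ?r}"
  proof -
    obtain a b where ab: "a \<noteq> 0" "z = vx a b" using z by (rule X0_cases)
    obtain k where k: "nrm a = real p powi k" using nrm_value ab by blast
    \<comment> \<open>From the ancestor of index i0 on, b is smaller than the first entry and can be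
      replaced by 0.\<close>
    obtain i0 where i0: "nrm b / nrm a < real p ^ i0" using real_arch_pow[OF p] by blast
    have "end_seq p nrm m \<in> range ?r" if m: "m \<ge> nat \<bar>k\<bar> + i0" for m
    proof -
      define i where "i = nat (int m - k)"
      have i: "int i = int m - k" "i \<ge> i0" using m by (auto simp: i_def)
      have ni: "real p ^ m = real p ^ i * nrm a"
      proof -
        have "real p ^ i * nrm a = real p powi (int i) * real p powi k" by (simp add: k)
        also have "\<dots> = real p powi (int i + k)" using p by (subst power_int_add) auto
        also have "\<dots> = real p ^ m" by (simp add: i)
        finally show ?thesis by simp
      qed
      have "nrm b \<le> nrm a * real p ^ i"
      proof -
        have "nrm b < real p ^ i0 * nrm a" using i0 ab(1) by (simp add: divide_less_eq)
        also have "\<dots> \<le> real p ^ i * nrm a" using p i(2) by (intro mult_right_mono power_increasing) auto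
        finally show ?thesis by (simp add: mult.commute)
      qed
      then have "vx (1 / of_nat p ^ m) 0 = vx (a / of_nat p ^ i) b"
        using ab(1) p_gt_1 ni by (subst vx_eq_iff) (auto simp: nrm_divide nrm_p_power power_one_over field_simps)
      then show ?thesis using ab by (simp add: end_seq_vx pa_pow_vx image_iff exI[of _ i])
    qed
    then have "{m. end_seq p nrm m \<notin> range ?r} \<subseteq> {..<nat \<bar>k\<bar> + i0}" by (auto simp: not_le[symmetric])
    then show ?thesis by (rule finite_subset) simp
  qed
  moreover have "inj ?r"
  proof (rule injI)
    fix i j assume "?r i = ?r j"
    then have "real p ^ i * sz z = real p ^ j * sz z" using sz_pa_pow[OF z] by metis
    then show "i = j" using szz p by (auto simp: power_inject_exp)
  qed
  moreover have "{?r i, ?r (Suc i)} \<in> X1 p nrm" for i using edge_pa[OF pa_pow_X0[OF z]] by simp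
  ultimately show "range ?r \<subseteq> end_ray p nrm z"
    unfolding end_ray_def by (intro Union_upper CollectI exI[of _ ?r]) auto
  show "end_ray p nrm z \<subseteq> range ?r"
  proof
    fix x assume "x \<in> end_ray p nrm z"
    then obtain r :: "nat \<Rightarrow> _" where r: "x \<in> range r" "r 0 = z" "inj r" "\<And>i. {r i, r (Suc i)} \<in> X1 p nrm"
      "finite {m. end_seq p nrm m \<notin> range r}" unfolding end_ray_def by blast
    have rX: "r i \<in> X0 nrm" for i using r(4)[of i] by (simp add: X1_iff)
    have up: "r (Suc i) = pa (r i)" for i
    proof (rule ccontr)
      assume "r (Suc i) \<noteq> pa (r i)"
      then have down: "r i = pa (r (Suc i))" using r(4)[of i] by (simp add: X1_iff)
      \<comment> \<open>A step back towards the end would return to the previous vertex, against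
        injectivity.\<close>
      have downs: "r (i + j) = pa (r (Suc (i + j)))" for j
      proof (induction j)
        case (Suc j)
        have "r (Suc (Suc (i + j))) \<noteq> r (i + j)" using r(3) by (auto dest: injD)
        then show ?case using Suc r(4)[of "Suc (i + j)"] by (auto simp: X1_iff)
      qed (use down in simp)
      have szd: "sz (r (i + j)) \<le> sz (r i)" for j
      proof (induction j)
        case (Suc j)
        have "sz (r (i + j)) = real p * sz (r (i + Suc j))" using downs[of j] sz_pa[OF rX, of "Suc (i + j)"] by simp
        moreover have "sz (r (i + Suc j)) > 0" using sz_pos rX by blast
        ultimately have "sz (r (i + Suc j)) \<le> sz (r (i + j))" using p by simp
        then show ?case using Suc by simp
      qed simp
      define Bd where "Bd = Max ((\<lambda>j. sz (r j)) ` {..i})"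
      have bd: "sz (r j) \<le> Bd" for j
      proof (cases "j \<le> i")
        case True then show ?thesis unfolding Bd_def by (intro Max_ge) auto
      next
        case False
        then have "sz (r j) \<le> sz (r i)" using szd[of "j - i"] by simp
        also have "\<dots> \<le> Bd" unfolding Bd_def by (intro Max_ge) auto
        finally show ?thesis .
      qed
      obtain m0 where m0: "Bd < real p ^ m0" using real_arch_pow[OF p] by blast
      have "m \<in> {m. end_seq p nrm m \<notin> range r}" if "m \<ge> m0" for m
      proof
        show "end_seq p nrm m \<notin> range r"
        proof
          assume "end_seq p nrm m \<in> range r"
          then obtain j where "end_seq p nrm m = r j" by blast
          then have "sz (r j) = real p ^ m"
            using pa_sz_vx(2)[of "1 / of_nat p ^ m" 0] p_gt_1 by (simp add: end_seq_vx nrm_divide nrm_p_power power_one_over)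
          moreover have "real p ^ m0 \<le> real p ^ m" using that p by (intro power_increasing) auto
          ultimately show False using bd[of j] m0 by simp
        qed
      qed
      then have "{m0..} \<subseteq> {m. end_seq p nrm m \<notin> range r}" by auto
      then show False using r(5) infinite_Ici finite_subset by blast
    qed
    have "r i = (pa ^^ i) z" for i by (induction i) (auto simp: r(2) up)
    then show "x \<in> range ?r" using r(1) by auto
  qed
qed

lemma self_end_ray: "z \<in> X0 nrm \<Longrightarrow> z \<in> end_ray p nrm z"
  by (auto simp: end_ray_eq intro: range_eqI[of _ _ 0])

text \<open>The end farther from \<alpha>0 is singled out by heights: all vertices on the ray from
  \<open>pa x\<close> are strictly higher than x.\<close>

lemma edge_plus_pa: "x \<in> X0 nrm \<Longrightarrow> edge_plus p nrm {x, pa x} = x"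
  unfolding edge_plus_def
proof (rule the_equality)
  assume x: "x \<in> X0 nrm"
  show "x \<in> {x, pa x} \<and> (\<exists>y. y \<noteq> x \<and> {x, pa x} = {x, y} \<and> y \<in> end_ray p nrm x)"
  proof (intro conjI exI[of _ "pa x"])
    show "pa x \<in> end_ray p nrm x"
      unfolding end_ray_eq[OF x] using rangeI[of "\<lambda>i. (pa ^^ i) x" 1] by simp
  qed (use pa_ne[OF x] in simp_all)
  fix z assume z: "z \<in> {x, pa x} \<and> (\<exists>y. y \<noteq> z \<and> {x, pa x} = {z, y} \<and> y \<in> end_ray p nrm z)"
  show "z = x"
  proof (rule ccontr)
    assume "z \<noteq> x"
    then have zp: "z = pa x" using z by blast
    obtain y where y: "y \<noteq> z" "{x, pa x} = {z, y}" "y \<in> end_ray p nrm z"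
      using conjunct2[OF z] by (elim exE conjE)
    have "y = x" using y(1,2) zp by (metis doubleton_eq_iff)
    then have "x \<in> end_ray p nrm (pa x)" using y(3) zp by metis
    then obtain i where "x = (pa ^^ i) (pa x)" unfolding end_ray_eq[OF pa_X0[OF x]] by blast
    then have "sz x = real p ^ i * (real p * sz x)" using sz_pa_pow[of "pa x" i] sz_pa[OF x] x by simp
    then have "real p ^ Suc i = 1" using sz_pos[OF x] by (simp add: mult.commute)
    then show False using p_gt_1 one_less_power[of "real p" "Suc i"] by (simp del: power_Suc)
  qed
qed

lemma Zplus_0: "x \<in> X0 nrm \<Longrightarrow> Zplus p nrm 0 x = {x}"
proof (intro equalityI subsetI)
  assume x: "x \<in> X0 nrm"
  let ?E = "{(z, w). {z, w} \<in> X1 p nrm}"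
  {
    fix z assume "z \<in> {x}"
    moreover have "tree_dist p nrm x x = 0" unfolding tree_dist_def by (intro Least_eq_0) auto
    ultimately show "z \<in> Zplus p nrm 0 x" using x self_end_ray by (auto simp: Zplus_def)
  next
    fix z assume z: "z \<in> Zplus p nrm 0 x"
    then have zX: "z \<in> X0 nrm" and d: "tree_dist p nrm x z = 0" and "x \<in> end_ray p nrm z" by (auto simp: Zplus_def)
    then obtain i where i: "x = (pa ^^ i) z" by (auto simp: end_ray_eq)
    \<comment> \<open>The distance is a least path length and carries information only if some path
      exists; the chain of ancestors supplies one.\<close>
    have "((pa ^^ i) z, z) \<in> ?E ^^ i"
    proof (induction i)
      case (Suc i)
      have "(pa ((pa ^^ i) z), (pa ^^ i) z) \<in> ?E" using pa_pow_X0[OF zX] by (auto simp: X1_iff)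
      then have "((pa ^^ Suc i) z, z) \<in> ?E O ?E ^^ i" using Suc by auto
      then show ?case by (simp only: relpow_commute relpow.simps)
    qed simp
    then have "(x, z) \<in> ?E ^^ (LEAST n. (x, z) \<in> ?E ^^ n)" using i by (intro LeastI) auto
    then show "z \<in> {x}" using d by (simp add: tree_dist_def)
  }
qed

lemma Nstab_vx: "a \<noteq> 0 \<Longrightarrow> Nstab p nrm (vx a b) = {mat2 1 c 0 1 | c. nrm c \<le> nrm a}"
proof -
  assume a: "a \<noteq> 0"
  have "vact (mat2 1 c 0 1) (vx a b) = vx a b \<longleftrightarrow> nrm c \<le> nrm a" for c
    using vx_eq_iff[OF a a, of "b + c" b] by (simp add: vact_vx add.commute)
  then show ?thesis using a unfolding Nstab_def Zplus_0[OF vx_X0[OF a]] Ngrp_def by blast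
qed

lemma X0plus_vx: "X0plus nrm = {vx a b | a b. a \<noteq> 0 \<and> a \<in> Zp nrm \<and> b \<in> Zp nrm}"
proof (intro equalityI subsetI)
  fix x assume "x \<in> X0plus nrm"
  then obtain a b where "a \<noteq> 0" "a \<in> Zp nrm" "b \<in> Zp nrm" "x = vact (mat2 a b 0 1) (xplus nrm)"
    by (auto simp: X0plus_def Pstar_def)
  then show "x \<in> {vx a b | a b. a \<noteq> 0 \<and> a \<in> Zp nrm \<and> b \<in> Zp nrm}"
    unfolding vx_def by blast
next
  fix x assume "x \<in> {vx a b | a b. a \<noteq> 0 \<and> a \<in> Zp nrm \<and> b \<in> Zp nrm}"
  then show "x \<in> X0plus nrm" unfolding X0plus_def Pstar_def vx_def by blast
qed

lemma X0plus_X0: "X0plus nrm \<subseteq> X0 nrm"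
  by (auto simp: X0plus_vx)

text \<open>The N0-orbit of t^m x_+. Natural numbers suffice as translations, because b counts only
  modulo p^m.\<close>

definition lev :: "nat \<Rightarrow> 'q vertex set" where
  "lev m = {vx (of_nat p ^ m) (of_nat i) | i. True}"

lemma lev_X0plus: "x \<in> lev m \<Longrightarrow> x \<in> X0plus nrm"
proof -
  assume "x \<in> lev m"
  then obtain i where "x = vx (of_nat p ^ m) (of_nat i)" by (auto simp: lev_def)
  moreover have "(of_nat p ^ m :: 'q) \<in> Zp nrm" "(of_nat p ^ m :: 'q) \<noteq> 0"
    using Zp_closed(8)[of "p ^ m"] p_gt_1 by auto
  ultimately show ?thesis unfolding X0plus_vx using Zp_closed(8) by blast
qed

lemma lev_mem:
  assumes "a \<noteq> 0" "nrm a = (1 / real p) ^ m" "b \<in> Zp nrm" shows "vx a b \<in> lev m"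
proof -
  obtain i where "nrm (b - of_nat i) \<le> (1 / real p) ^ m" using Zp_approx[OF assms(3)] by blast
  then have "vx a b = vx (of_nat p ^ m) (of_nat i)"
    using assms p_gt_1 by (subst vx_eq_iff) (auto simp: nrm_p_power)
  then show ?thesis by (auto simp: lev_def)
qed

lemma X0plus_lev: "x \<in> X0plus nrm \<Longrightarrow> \<exists>m. x \<in> lev m"
proof -
  assume "x \<in> X0plus nrm"
  then obtain a b where ab: "x = vx a b" "a \<noteq> 0" "nrm a \<le> 1" "b \<in> Zp nrm" by (auto simp: X0plus_vx Zp_iff)
  obtain k where k: "nrm a = real p powi k" using nrm_value ab by blast
  have "k \<le> 0" using ab(3) p_gt_1 unfolding k
    by (metis less_le_not_le linorder_not_le of_nat_1 of_nat_less_iff one_less_power_int)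
  then have "nrm a = (1 / real p) ^ nat (- k)" unfolding k by (simp add: power_int_def inverse_eq_divide)
  then show ?thesis using lev_mem ab by blast
qed

text \<open>The vertex w is taken from the whole tree: moving away from \<alpha>0 never leaves X_+,
  so the summands in (Hyp 2) at a vertex of X_+ come from edges of X_+.\<close>

lemma lev_child:
  assumes "y \<in> lev m" "w \<in> X0 nrm" "pa w = y" shows "w \<in> lev (Suc m)"
proof -
  obtain i where y: "y = vx (of_nat p ^ m) (of_nat i)" using assms(1) by (auto simp: lev_def)
  obtain a b where w: "a \<noteq> 0" "w = vx a b" using assms(2) by (rule X0_cases)
  have p: "real p > 1" using p_gt_1 by simp
  have "vx (a / of_nat p) b = vx (of_nat p ^ m) (of_nat i)" using assms(3) w y by (simp add: pa_sz_vx)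
  then have *: "nrm a * real p = (1 / real p) ^ m" "nrm (b - of_nat i) \<le> (1 / real p) ^ m"
    using w p_gt_1 by (auto simp: vx_eq_iff nrm_divide nrm_p nrm_p_power)
  have "b \<in> Zp nrm"
  proof -
    have "(1 / real p) ^ m \<le> 1" using p by (simp add: power_le_one)
    then have "b - of_nat i \<in> Zp nrm" using *(2) by (simp add: Zp_iff)
    from Zp_closed(3)[OF this Zp_closed(8)[of i]] show ?thesis by simp
  qed
  moreover have "nrm a = (1 / real p) ^ Suc m" using *(1) p by (simp add: field_simps)
  ultimately show ?thesis using lev_mem w by blast
qed

text \<open>Identifies the index set of (Hyp 2) with the edges to the neighbours of y away from the
  end.\<close>

lemma other_edges:
  assumes y: "y \<in> X0 nrm" and s: "s \<in> X1 p nrm" "{y, pa y} \<inter> s = {y}"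
  shows "\<exists>w. w \<in> X0 nrm \<and> s = {w, pa w} \<and> pa w = y"
proof -
  obtain w where w: "w \<in> X0 nrm" "s = {w, pa w}" using s by (auto simp: X1_pa)
  have "y \<in> s" "pa y \<notin> s" using s pa_ne[OF y] by auto
  then show ?thesis using w by (intro exI[of _ w]) auto
qed

end

section \<open>The Iwasawa algebra\<close>

lemma monom_mod_Tq:
  assumes "q > 0" shows "monom c e mod (Tq q :: 'l::field poly) = monom c (e mod q)"
proof -
  have "monom 1 q mod (Tq q :: 'l poly) = (1 + Tq q) mod Tq q" by (simp add: Tq_def)
  also have "\<dots> = 1 mod Tq q" by simp
  finally have 1: "monom 1 q mod (Tq q :: 'l poly) = 1 mod Tq q" .
  have "monom c e = monom c (e mod q) * monom 1 q ^ (e div q)"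
    by (simp add: monom_power mult_monom)
  also have "\<dots> mod Tq q = (monom c (e mod q) * ((monom 1 q mod Tq q) ^ (e div q) mod Tq q)) mod Tq q"
    by (simp only: power_mod mod_mult_right_eq)
  also have "\<dots> = monom c (e mod q) mod Tq q"
    unfolding 1 by (simp only: power_mod power_one mod_mult_right_eq mult_1_right)
  also have "\<dots> = monom c (e mod q)"
  proof (rule mod_poly_less)
    have "e mod q < q" using assms by simp
    then show "degree (monom c (e mod q)) < degree (Tq q :: 'l poly)"
      using degree_monom_le[of c "e mod q"] assms by (metis degree_Tq order_le_less_trans)
  qed
  finally show ?thesis .
qed

lemma sum_mod_poly: "(\<Sum>x\<in>A. f x) mod (g :: 'l::field poly) = (\<Sum>x\<in>A. f x mod g)"
  by (induction A rule: infinite_finite_induct) (auto simp: poly_mod_add_left)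

lemma mod_poly_small: "degree f < q \<Longrightarrow> f mod (Tq q :: 'l::field poly) = f"
  by (intro mod_poly_less) (simp add: degree_Tq)

text \<open>The value at T = 1 is the augmentation, which is the same at all levels.\<close>

lemma poly_mod_Tq_1: "poly (f mod Tq q) 1 = poly (f :: 'l::field poly) 1"
proof -
  have "poly f 1 = poly (f div Tq q * Tq q + f mod Tq q) 1" by simp
  also have "\<dots> = poly (f mod Tq q) 1" by (simp only: poly_add poly_mult) (simp add: Tq_def poly_monom)
  finally show ?thesis by simp
qed

text \<open>T^q - 1 divides T^(qk) - 1, so reduction may pass through intermediate levels.\<close>

lemma mod_mod_Tq:
  "(f mod (Tq (q * k) :: 'l::field poly)) mod Tq q = f mod Tq q"
proof (rule mod_mod_cancel)
  have "monom 1 q - 1 dvd (monom 1 q :: 'l poly) ^ k - 1"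
    using dvdI[OF power_diff_1_eq] by blast
  then show "(Tq q :: 'l poly) dvd Tq (q * k)" by (simp add: Tq_def monom_power mult.commute)
qed

definition un :: "'q::field \<Rightarrow> 'q ^ 2 ^ 2" where "un b = mat2 1 b 0 1"

lemma un_mult: "un b ** un c = un (b + c)" by (simp add: un_def mat2_mult add.commute)
lemma un_0: "un 0 = mat 1" by (simp add: un_def mat2_one)
lemma un_eq_iff [simp]: "un b = un c \<longleftrightarrow> b = c" by (simp add: un_def mat2_eq_iff)
lemma un_inv: "matrix_inv (un b) = un (- b)" by (simp add: un_def matrix_inv_aff)

context qp begin

abbreviation NG where "NG \<equiv> N0_grp nrm"
abbreviation NU where "NU m \<equiv> N0_sub p nrm m"

lemma NG_simps [simp]: "carrier NG = un ` Zp nrm" "monoid.mult NG = (**)" "\<one>\<^bsub>NG\<^esub> = un 0"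
  by (auto simp: N0_grp_def N0_def un_def mat2_one)

lemma NU_eq: "NU m = {un b | b. nrm b \<le> (1 / real p) ^ m}"
  by (auto simp: N0_sub_def un_def ball_iff)

lemma small_Zp: "nrm b \<le> (1 / real p) ^ m \<Longrightarrow> b \<in> Zp nrm"
proof -
  assume "nrm b \<le> (1 / real p) ^ m"
  moreover have "(1 / real p) ^ m \<le> 1" using p_gt_1 by (simp add: power_le_one)
  ultimately show ?thesis by (simp add: Zp_iff)
qed

lemma small_add: "\<lbrakk>nrm b \<le> e; nrm c \<le> e\<rbrakk> \<Longrightarrow> nrm (b + c) \<le> e"
  using nrm_ultra[of b c] by simp

lemma comm_group_NG: "comm_group NG"
proof (rule comm_groupI)
  fix x assume "x \<in> carrier NG"
  then obtain b where b: "x = un b" "b \<in> Zp nrm" by auto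
  then show "\<exists>y\<in>carrier NG. y \<otimes>\<^bsub>NG\<^esub> x = \<one>\<^bsub>NG\<^esub>" by (auto simp: un_mult intro!: bexI[of _ "- b"])
qed (auto simp: un_mult add_ac)

lemma subgroup_NU: "subgroup (NU m) NG"
proof (rule group.subgroupI)
  show "group NG" using comm_group_NG comm_group.axioms by blast
  show "NU m \<subseteq> carrier NG" by (auto simp: NU_eq intro: small_Zp)
  show "NU m \<noteq> {}" by (auto simp: NU_eq intro!: exI[of _ 0])
  fix x assume "x \<in> NU m"
  then obtain b where b: "x = un b" "nrm b \<le> (1 / real p) ^ m" by (auto simp: NU_eq)
  have "inv\<^bsub>NG\<^esub> x = un (- b)"
    by (rule comm_monoid.comm_inv_char[OF comm_group.axioms(1)[OF comm_group_NG]]) (use b small_Zp in \<open>auto simp: un_mult\<close>)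
  then show "inv\<^bsub>NG\<^esub> x \<in> NU m" using b by (auto simp: NU_eq)
  fix y assume "y \<in> NU m"
  then show "x \<otimes>\<^bsub>NG\<^esub> y \<in> NU m" using b by (auto simp: NU_eq un_mult intro!: small_add)
qed

definition cc :: "nat \<Rightarrow> 'q \<Rightarrow> ('q ^ 2 ^ 2) set" where "cc m b = {un c | c. nrm (c - b) \<le> (1 / real p) ^ m}"

lemma rcos_cc: "NU m #>\<^bsub>NG\<^esub> un b = cc m b"
proof (intro equalityI subsetI)
  fix x assume "x \<in> NU m #>\<^bsub>NG\<^esub> un b"
  then show "x \<in> cc m b" by (auto simp: r_coset_def NU_eq cc_def un_mult)
next
  fix x assume "x \<in> cc m b"
  then obtain c where "x = un c" "nrm (c - b) \<le> (1 / real p) ^ m" by (auto simp: cc_def)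
  then show "x \<in> NU m #>\<^bsub>NG\<^esub> un b" by (auto simp: r_coset_def NU_eq un_mult intro!: exI[of _ "un (c - b)"])
qed

lemma cc_eq_iff: "cc m b = cc m c \<longleftrightarrow> nrm (b - c) \<le> (1 / real p) ^ m"
proof
  assume "cc m b = cc m c"
  moreover have "un b \<in> cc m b" by (auto simp: cc_def)
  ultimately show "nrm (b - c) \<le> (1 / real p) ^ m" by (auto simp: cc_def)
next
  assume *: "nrm (b - c) \<le> (1 / real p) ^ m"
  have "nrm (d - b) \<le> (1 / real p) ^ m \<longleftrightarrow> nrm (d - c) \<le> (1 / real p) ^ m" for d
    using small_add[of "d - b" _ "b - c"] small_add[of "d - c" _ "c - b"] * by (auto simp: nrm_minus_commute)
  then show "cc m b = cc m c" by (simp add: cc_def)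
qed

lemma cc_subset_iff: "cc (Suc m) c \<subseteq> cc m b \<longleftrightarrow> nrm (c - b) \<le> (1 / real p) ^ m"
proof
  assume "cc (Suc m) c \<subseteq> cc m b"
  moreover have "un c \<in> cc (Suc m) c" by (auto simp: cc_def)
  ultimately have "un c \<in> cc m b" by blast
  then show "nrm (c - b) \<le> (1 / real p) ^ m" by (auto simp: cc_def)
next
  assume *: "nrm (c - b) \<le> (1 / real p) ^ m"
  have "(1 / real p) ^ Suc m \<le> (1 / real p) ^ m" using p_gt_1 by (intro power_decreasing) auto
  then have "nrm (d - b) \<le> (1 / real p) ^ m" if "nrm (d - c) \<le> (1 / real p) ^ Suc m" for d
    using small_add[of "d - c" _ "c - b"] * that by force
  then show "cc (Suc m) c \<subseteq> cc m b" by (auto simp: cc_def)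
qed

text \<open>Integers represent all cosets, and in this numbering the quotient of N0 is the additive
  group of integers modulo p^m.\<close>

definition ci :: "nat \<Rightarrow> int \<Rightarrow> ('q ^ 2 ^ 2) set" where "ci m i = cc m (of_int i)"

lemma ci_eq_iff: "ci m i = ci m j \<longleftrightarrow> int p ^ m dvd i - j"
  unfolding ci_def cc_eq_iff of_int_diff[symmetric] by (rule nrm_of_int_le_iff)

lemma ci_eq_mod: "ci m i = ci m j \<longleftrightarrow> i mod (int p ^ m) = j mod (int p ^ m)"
  by (simp add: ci_eq_iff mod_eq_dvd_iff)

lemma ci_subset_iff: "ci (Suc m) i \<subseteq> ci m j \<longleftrightarrow> i mod (int p ^ m) = j mod (int p ^ m)"
  unfolding ci_def cc_subset_iff of_int_diff[symmetric] nrm_of_int_le_iff by (simp add: mod_eq_dvd_iff)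

lemma ci_mod: "ci m (i mod (int p ^ m)) = ci m i" by (simp add: ci_eq_mod)

lemma ci_inj: "inj_on (\<lambda>i. ci m (int i)) {..<p ^ m}"
proof (rule inj_onI)
  fix i j assume "i \<in> {..<p ^ m}" "j \<in> {..<p ^ m}" "ci m (int i) = ci m (int j)"
  then have "i < p ^ m" "j < p ^ m" "int (i mod p ^ m) = int (j mod p ^ m)"
    unfolding ci_eq_mod zmod_int by simp_all
  then show "i = j" by simp
qed

abbreviation GmU where "GmU m \<equiv> NG Mod NU m"

lemma GmU_carrier: "carrier (GmU m) = (\<lambda>i. ci m (int i)) ` {..<p ^ m}"
proof -
  have "carrier (GmU m) = cc m ` Zp nrm"
    by (auto simp: FactGroup_def RCOSETS_def rcos_cc simp del: NG_simps(2))
  also have "\<dots> = (\<lambda>i. ci m (int i)) ` {..<p ^ m}"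
  proof (intro equalityI subsetI)
    fix x assume "x \<in> cc m ` Zp nrm"
    then obtain b where b: "x = cc m b" "b \<in> Zp nrm" by auto
    obtain i where "i < p ^ m" "nrm (b - of_nat i) \<le> (1 / real p) ^ m" using Zp_approx[OF b(2)] by blast
    then show "x \<in> (\<lambda>i. ci m (int i)) ` {..<p ^ m}" by (auto simp: b ci_def cc_eq_iff intro!: image_eqI[of _ _ i])
  qed (auto simp: ci_def)
  finally show ?thesis .
qed

lemma ci_mem [simp]: "ci m i \<in> carrier (GmU m)"
proof -
  have "p ^ m > 0" using p_gt_1 by simp
  then have "int (nat (i mod int p ^ m)) = i mod int p ^ m" "nat (i mod int p ^ m) < p ^ m"
    by (auto simp: nat_less_iff)
  then show ?thesis unfolding GmU_carrier
    by (intro image_eqI[of _ _ "nat (i mod int p ^ m)"]) (auto simp: ci_mod)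
qed

lemma GmU_cases: assumes "C \<in> carrier (GmU m)" obtains i where "i < p ^ m" "C = ci m (int i)"
  using assms by (auto simp: GmU_carrier)

lemma GmU_mult: "ci m i \<otimes>\<^bsub>GmU m\<^esub> ci m j = ci m (i + j)"
proof -
  interpret N: normal "NU m" NG
    using comm_group.normal_iff_subgroup[OF comm_group_NG] subgroup_NU by blast
  have "ci m i \<otimes>\<^bsub>GmU m\<^esub> ci m j = (NU m #>\<^bsub>NG\<^esub> un (of_int i)) <#>\<^bsub>NG\<^esub> (NU m #>\<^bsub>NG\<^esub> un (of_int j))"
    by (simp add: FactGroup_def rcos_cc ci_def)
  also have "\<dots> = NU m #>\<^bsub>NG\<^esub> (un (of_int i) \<otimes>\<^bsub>NG\<^esub> un (of_int j))"
    by (rule N.rcos_sum) auto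
  also have "\<dots> = ci m (i + j)" by (simp add: un_mult rcos_cc ci_def)
  finally show ?thesis .
qed

lemma NU_ci: "ci m 0 = NU m" by (auto simp: NU_eq cc_def ci_def)

lemma GmU_one: "\<one>\<^bsub>GmU m\<^esub> = ci m 0"
proof -
  have "\<one>\<^bsub>GmU m\<^esub> = NU m" by (simp add: FactGroup_def)
  also have "\<dots> = ci m 0" by (auto simp: NU_eq cc_def ci_def)
  finally show ?thesis .
qed

lemma comm_group_GmU: "comm_group (GmU m)"
  using comm_group.abelian_FactGroup[OF comm_group_NG subgroup_NU] .

lemma GmU_inv: "inv\<^bsub>GmU m\<^esub> ci m i = ci m (- i)"
proof (rule comm_monoid.comm_inv_char[OF comm_group.axioms(1)[OF comm_group_GmU]])
  show "ci m i \<otimes>\<^bsub>GmU m\<^esub> ci m (- i) = \<one>\<^bsub>GmU m\<^esub>" unfolding GmU_mult GmU_one by simp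
qed (rule ci_mem)+

end

section \<open>The completed group ring as a limit of truncated polynomial rings\<close>

context int_ext begin

abbreviation Lam where "Lam \<equiv> iwasawa p nrm emb"
abbreviation GR where "GR m \<equiv> group_ring \<O> (GmU m)"

lemma p_pos [simp]: "p > 0" using p_gt_1 by simp
lemma q_pos [simp]: "p ^ m > 0" by simp

text \<open>The group ring of \<open>N\<^sub>0/N\<^sub>0^q\<close>, \<open>q = p^m\<close>, is \<open>\<oo>[T]/(T^q - 1)\<close>. So \<open>\<oo>[[N\<^sub>0]]\<close> is described by the sequences \<open>LP l m\<close> of reduced
  polynomials, and the ring laws are transferred along this description.\<close>

definition lc :: "((('q ^ 2 ^ 2) set) \<Rightarrow> 'l) \<Rightarrow> nat \<Rightarrow> 'l poly" where
  "lc f m = (\<Sum>i<p ^ m. monom (f (ci m (int i))) i)"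

definition LP :: "(nat \<Rightarrow> ('q ^ 2 ^ 2) set \<Rightarrow> 'l) \<Rightarrow> nat \<Rightarrow> 'l poly" where
  "LP l m = lc (l m) m"

lemma coeff_lc: "coeff (lc f m) i = (if i < p ^ m then f (ci m (int i)) else 0)"
  by (auto simp: lc_def coeff_sum)

lemma degree_lc: "degree (lc f m) < p ^ m"
proof -
  have "degree (lc f m) \<le> p ^ m - 1" by (rule degree_le) (auto simp: coeff_lc)
  then show ?thesis using q_pos[of m] by linarith
qed

lemma degree_LP: "degree (LP l m) < p ^ m" by (simp add: LP_def degree_lc)

lemma finite_GmU: "finite (carrier (GmU m))" by (simp add: GmU_carrier)

lemma GR_carrier: "carrier (GR m) = carrier (GmU m) \<rightarrow>\<^sub>E Oc"
  using finite_GmU by (auto simp: group_ring_def)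

lemma finsum_O: "finite A \<Longrightarrow> (\<And>x. x \<in> A \<Longrightarrow> f x \<in> Oc) \<Longrightarrow> (\<Oplus>\<^bsub>\<O>\<^esub>x\<in>A. f x) = sum f A"
proof (induction A rule: finite_induct)
  case (insert x A)
  interpret cring \<O> by (rule cring_O)
  show ?case using insert by (subst finsum_insert) auto
next
  case empty
  interpret cring \<O> by (rule cring_O)
  show ?case by simp
qed

lemma sum_GmU: "sum h (carrier (GmU m)) = (\<Sum>i<p ^ m. h (ci m (int i)))"
  unfolding GmU_carrier by (simp add: sum.reindex[OF ci_inj])

lemma lc_inj: "\<lbrakk>f \<in> carrier (GR m); g \<in> carrier (GR m); lc f m = lc g m\<rbrakk> \<Longrightarrow> f = g"
proof (rule PiE_ext)
  fix C assume fg: "lc f m = lc g m" and "C \<in> carrier (GmU m)"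
  then obtain i where "i < p ^ m" "C = ci m (int i)" by (auto simp: GmU_carrier)
  then show "f C = g C" using arg_cong[OF fg, of "\<lambda>P. coeff P i"] by (simp add: coeff_lc)
qed (simp_all add: GR_carrier)

text \<open>Reduction modulo T^q - 1 folds the exponents modulo q. This is summation over cosets, so
  it yields both the convolution product and the transition maps.\<close>

lemma coeff_mod_Tq:
  assumes "q > 0" "degree f < n" "k < q"
  shows "coeff (f mod Tq q :: 'l poly) k = (\<Sum>e\<in>{e. e < n \<and> e mod q = k}. coeff f e)"
proof -
  have "f = (\<Sum>e<n. monom (coeff f e) e)"
    using poly_as_sum_of_monoms'[of f "n - 1"] assms(2) by (simp add: lessThan_Suc_atMost[symmetric])
  then have "f mod Tq q = (\<Sum>e<n. monom (coeff f e) e) mod Tq q" by simp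
  also have "\<dots> = (\<Sum>e<n. monom (coeff f e) (e mod q))"
    using assms by (simp add: sum_mod_poly monom_mod_Tq)
  also have "coeff \<dots> k = (\<Sum>e<n. if e mod q = k then coeff f e else 0)"
    by (simp add: coeff_sum)
  also have "\<dots> = (\<Sum>e\<in>{e. e < n \<and> e mod q = k}. coeff f e)"
    by (subst sum.If_cases) (auto intro: sum.cong)
  finally show ?thesis .
qed

lemma GR_mult:
  assumes "f \<in> carrier (GR m)" "g \<in> carrier (GR m)"
  shows "(f \<otimes>\<^bsub>GR m\<^esub> g) (ci m k) = (\<Sum>i<p ^ m. f (ci m (int i)) * g (ci m (k - int i)))"
proof -
  have O: "C \<in> carrier (GmU m) \<Longrightarrow> f C \<in> Oc" "C \<in> carrier (GmU m) \<Longrightarrow> g C \<in> Oc" for C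
    using assms by (auto simp: GR_carrier)
  interpret G: comm_group "GmU m" by (rule comm_group_GmU)
  have "(f \<otimes>\<^bsub>GR m\<^esub> g) (ci m k) =
      (\<Oplus>\<^bsub>\<O>\<^esub>y\<in>{y \<in> carrier (GmU m). f y \<noteq> 0}. f y * g (inv\<^bsub>GmU m\<^esub> y \<otimes>\<^bsub>GmU m\<^esub> ci m k))"
    by (simp add: group_ring_def)
  also have "\<dots> = (\<Sum>y\<in>{y \<in> carrier (GmU m). f y \<noteq> 0}. f y * g (inv\<^bsub>GmU m\<^esub> y \<otimes>\<^bsub>GmU m\<^esub> ci m k))"
  proof (intro finsum_O O_mult O)
    fix y assume "y \<in> {y \<in> carrier (GmU m). f y \<noteq> 0}"
    then show "y \<in> carrier (GmU m)" "inv\<^bsub>GmU m\<^esub> y \<otimes>\<^bsub>GmU m\<^esub> ci m k \<in> carrier (GmU m)"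
      using G.m_closed G.inv_closed ci_mem by simp_all
  qed (simp add: finite_GmU)
  also have "\<dots> = (\<Sum>y\<in>carrier (GmU m). f y * g (inv\<^bsub>GmU m\<^esub> y \<otimes>\<^bsub>GmU m\<^esub> ci m k))"
    using finite_GmU by (intro sum.mono_neutral_left) auto
  also have "\<dots> = (\<Sum>i<p ^ m. f (ci m (int i)) * g (ci m (k - int i)))"
  proof -
    have "inv\<^bsub>GmU m\<^esub> ci m (int i) \<otimes>\<^bsub>GmU m\<^esub> ci m k = ci m (k - int i)" for i
      unfolding GmU_inv GmU_mult by (simp add: algebra_simps)
    then show ?thesis unfolding sum_GmU by simp
  qed
  finally show ?thesis .
qed

lemma lc_mult:
  assumes f: "f \<in> carrier (GR m)" and g: "g \<in> carrier (GR m)"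
  shows "lc (f \<otimes>\<^bsub>GR m\<^esub> g) m = (lc f m * lc g m) mod Tq (p ^ m)"
proof (rule poly_eqI)
  let ?q = "p ^ m"
  fix k
  show "coeff (lc (f \<otimes>\<^bsub>GR m\<^esub> g) m) k = coeff ((lc f m * lc g m) mod Tq ?q) k"
  proof (cases "k < ?q")
    case False
    then have "coeff ((lc f m * lc g m) mod Tq ?q) k = 0"
      using degree_mod_Tq[OF q_pos, of "lc f m * lc g m" m] by (intro coeff_eq_0) linarith
    then show ?thesis using False by (simp add: coeff_lc)
  next
    case True
    have "lc f m * lc g m = (\<Sum>i<?q. \<Sum>j<?q. monom (f (ci m (int i)) * g (ci m (int j))) (i + j))"
      unfolding lc_def by (simp add: sum_product mult_monom)
    then have "coeff ((lc f m * lc g m) mod Tq ?q) k =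
        (\<Sum>i<?q. \<Sum>j<?q. if (i + j) mod ?q = k then f (ci m (int i)) * g (ci m (int j)) else 0)"
      by (simp add: sum_mod_poly monom_mod_Tq coeff_sum)
    also have "\<dots> = (\<Sum>i<?q. f (ci m (int i)) * g (ci m (int k - int i)))"
    proof (rule sum.cong[OF refl])
      fix i assume i: "i \<in> {..<?q}"
      \<comment> \<open>For fixed i exactly one exponent below q completes it to k modulo q.\<close>
      define j0 where "j0 = nat ((int k - int i) mod int ?q)"
      have qi: "int ?q > 0" by simp
      then have j0: "int j0 = (int k - int i) mod int ?q" "j0 < ?q"
        unfolding j0_def by (simp, metis Euclidean_Rings.pos_mod_bound Euclidean_Rings.pos_mod_sign nat_less_iff)
      have iff: "(i + j) mod ?q = k \<longleftrightarrow> j = j0" if "j < ?q" for j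
      proof -
        have "(i + j) mod ?q = k \<longleftrightarrow> int (i + j) mod int ?q = int k mod int ?q"
          unfolding zmod_int[symmetric] of_nat_eq_iff using True by simp
        also have "\<dots> \<longleftrightarrow> int j mod int ?q = (int k - int i) mod int ?q"
          by (simp add: mod_eq_dvd_iff algebra_simps)
        also have "\<dots> \<longleftrightarrow> j = j0"
          unfolding j0(1)[symmetric] zmod_int[symmetric] of_nat_eq_iff using that by simp
        finally show ?thesis .
      qed
      have "(\<Sum>j<?q. if (i + j) mod ?q = k then f (ci m (int i)) * g (ci m (int j)) else 0) =
          (\<Sum>j<?q. if j = j0 then f (ci m (int i)) * g (ci m (int j)) else 0)"
        by (intro sum.cong refl) (simp add: iff)
      also have "\<dots> = f (ci m (int i)) * g (ci m (int j0))" using j0(2) by simp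
      also have "ci m (int j0) = ci m (int k - int i)"
        unfolding j0(1) using ci_mod[of m "int k - int i"] by simp
      finally show "(\<Sum>j<?q. if (i + j) mod ?q = k then f (ci m (int i)) * g (ci m (int j)) else 0) =
        f (ci m (int i)) * g (ci m (int k - int i))" .
    qed
    also have "\<dots> = coeff (lc (f \<otimes>\<^bsub>GR m\<^esub> g) m) k"
      using True GR_mult[OF f g] by (simp add: coeff_lc)
    finally show ?thesis by simp
  qed
qed

lemma ci_eq_NU: "i < p ^ m \<Longrightarrow> ci m (int i) = NU m \<longleftrightarrow> i = 0"
proof
  assume i: "i < p ^ m" "ci m (int i) = NU m"
  then have "(\<lambda>i. ci m (int i)) i = (\<lambda>i. ci m (int i)) 0" by (simp add: NU_ci)
  then show "i = 0" by (rule inj_onD[OF ci_inj]) (use i in simp_all)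
qed (simp add: NU_ci)

lemma lc_one: "lc \<one>\<^bsub>GR m\<^esub> m = 1" and lc_zero: "lc \<zero>\<^bsub>GR m\<^esub> m = 0"
  and lc_add: "lc (f \<oplus>\<^bsub>GR m\<^esub> g) m = lc f m + lc g m"
proof -
  show "lc \<one>\<^bsub>GR m\<^esub> m = 1"
  proof (rule poly_eqI)
    fix i
    have "coeff (lc \<one>\<^bsub>GR m\<^esub> m) i = (if i < p ^ m then if ci m (int i) = NU m then 1 else 0 else 0)"
      unfolding coeff_lc group_ring_def by simp
    also have "\<dots> = coeff 1 i"
      using ci_eq_NU[of i m] q_pos[of m] by (cases i) (simp_all del: q_pos of_nat_Suc)
    finally show "coeff (lc \<one>\<^bsub>GR m\<^esub> m) i = coeff 1 i" .
  qed
  show "lc \<zero>\<^bsub>GR m\<^esub> m = 0" by (rule poly_eqI) (simp add: coeff_lc group_ring_def)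
  show "lc (f \<oplus>\<^bsub>GR m\<^esub> g) m = lc f m + lc g m" by (rule poly_eqI) (simp add: coeff_lc group_ring_def)
qed

lemma oP_lc: "f \<in> carrier (GR m) \<Longrightarrow> oP (lc f m)"
  by (auto simp: oP_def coeff_lc GR_carrier)

lemma GR_closed:
  "\<lbrakk>f \<in> carrier (GR m); g \<in> carrier (GR m)\<rbrakk> \<Longrightarrow> f \<oplus>\<^bsub>GR m\<^esub> g \<in> carrier (GR m)"
  "\<lbrakk>f \<in> carrier (GR m); g \<in> carrier (GR m)\<rbrakk> \<Longrightarrow> f \<otimes>\<^bsub>GR m\<^esub> g \<in> carrier (GR m)"
  "\<one>\<^bsub>GR m\<^esub> \<in> carrier (GR m)" "\<zero>\<^bsub>GR m\<^esub> \<in> carrier (GR m)"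
proof -
  assume fg: "f \<in> carrier (GR m)" "g \<in> carrier (GR m)"
  show "f \<oplus>\<^bsub>GR m\<^esub> g \<in> carrier (GR m)"
    using fg unfolding GR_carrier by (auto simp: group_ring_def intro!: O_add)
  have "(f \<otimes>\<^bsub>GR m\<^esub> g) C \<in> Oc" if "C \<in> carrier (GmU m)" for C
  proof -
    obtain k where C: "C = ci m (int k)" using GmU_cases[OF \<open>C \<in> carrier (GmU m)\<close>] by blast
    show ?thesis unfolding C GR_mult[OF fg] using fg by (auto simp: GR_carrier intro!: O_sum O_mult)
  qed
  moreover have "f \<otimes>\<^bsub>GR m\<^esub> g \<in> extensional (carrier (GmU m))" by (simp add: group_ring_def)
  ultimately show "f \<otimes>\<^bsub>GR m\<^esub> g \<in> carrier (GR m)" unfolding GR_carrier by (auto simp: PiE_def)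
next
  show "\<one>\<^bsub>GR m\<^esub> \<in> carrier (GR m)" "\<zero>\<^bsub>GR m\<^esub> \<in> carrier (GR m)"
    unfolding GR_carrier by (auto simp: group_ring_def)
qed

lemma iw_simps:
  "(l \<oplus>\<^bsub>Lam\<^esub> l') m = l m \<oplus>\<^bsub>GR m\<^esub> l' m" "(l \<otimes>\<^bsub>Lam\<^esub> l') m = l m \<otimes>\<^bsub>GR m\<^esub> l' m"
  "\<one>\<^bsub>Lam\<^esub> m = \<one>\<^bsub>GR m\<^esub>" "\<zero>\<^bsub>Lam\<^esub> m = \<zero>\<^bsub>GR m\<^esub>"
  by (simp_all add: iwasawa_def completed_group_ring_def)

lemma LP_simps:
  "LP (l \<oplus>\<^bsub>Lam\<^esub> l') m = LP l m + LP l' m" "LP \<one>\<^bsub>Lam\<^esub> m = 1" "LP \<zero>\<^bsub>Lam\<^esub> m = 0"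
  by (simp_all add: LP_def iw_simps lc_add lc_one lc_zero)

lemma lc_trans:
  assumes f: "f \<in> carrier (GR (Suc m))" and k: "k < p ^ m"
  shows "(\<Oplus>\<^bsub>\<O>\<^esub>C'\<in>{C' \<in> carrier (GmU (Suc m)). C' \<subseteq> ci m (int k)}. f C') = coeff (lc f (Suc m) mod Tq (p ^ m)) k"
proof -
  have set: "{C' \<in> carrier (GmU (Suc m)). C' \<subseteq> ci m (int k)} = (\<lambda>i. ci (Suc m) (int i)) ` {e. e < p ^ Suc m \<and> e mod p ^ m = k}"
  proof -
    have "int i mod int p ^ m = int k mod int p ^ m \<longleftrightarrow> i mod p ^ m = k" for i
    proof -
      have "int i mod int (p ^ m) = int k mod int (p ^ m) \<longleftrightarrow> i mod p ^ m = k mod p ^ m" by (simp only: zmod_int[symmetric] of_nat_eq_iff)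
      then show ?thesis using k by simp
    qed
    then have "ci (Suc m) (int i) \<subseteq> ci m (int k) \<longleftrightarrow> i mod p ^ m = k" for i by (simp only: ci_subset_iff)
    then show ?thesis unfolding GmU_carrier by blast
  qed
  have inj: "inj_on (\<lambda>i. ci (Suc m) (int i)) {e. e < p ^ Suc m \<and> e mod p ^ m = k}"
    by (rule inj_on_subset[OF ci_inj]) auto
  have "(\<Oplus>\<^bsub>\<O>\<^esub>C'\<in>{C' \<in> carrier (GmU (Suc m)). C' \<subseteq> ci m (int k)}. f C')
      = (\<Sum>C'\<in>{C' \<in> carrier (GmU (Suc m)). C' \<subseteq> ci m (int k)}. f C')"
    using f finite_GmU by (intro finsum_O) (auto simp: GR_carrier)
  also have "\<dots> = (\<Sum>e\<in>{e. e < p ^ Suc m \<and> e mod p ^ m = k}. f (ci (Suc m) (int e)))"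
    unfolding set using inj by (simp add: sum.reindex)
  also have "\<dots> = (\<Sum>e\<in>{e. e < p ^ Suc m \<and> e mod p ^ m = k}. coeff (lc f (Suc m)) e)"
    by (intro sum.cong refl) (simp add: coeff_lc)
  also have "\<dots> = coeff (lc f (Suc m) mod Tq (p ^ m)) k"
    using coeff_mod_Tq[OF q_pos degree_lc k] by simp
  finally show ?thesis .
qed

lemma iw_iff: "l \<in> carrier Lam \<longleftrightarrow> (\<forall>m. l m \<in> carrier (GR m)) \<and> (\<forall>m. LP l (Suc m) mod Tq (p ^ m) = LP l m)"
proof -
  have "(\<forall>C\<in>carrier (GmU m). l m C = (\<Oplus>\<^bsub>\<O>\<^esub>C'\<in>{C' \<in> carrier (GmU (Suc m)). C' \<subseteq> C}. l (Suc m) C'))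
      \<longleftrightarrow> LP l (Suc m) mod Tq (p ^ m) = LP l m" (is "?L \<longleftrightarrow> ?R") if l: "l (Suc m) \<in> carrier (GR (Suc m))" for m
  proof -
    have "?L \<longleftrightarrow> (\<forall>k\<in>{..<p ^ m}. l m (ci m (int k)) =
        (\<Oplus>\<^bsub>\<O>\<^esub>C'\<in>{C' \<in> carrier (GmU (Suc m)). C' \<subseteq> ci m (int k)}. l (Suc m) C'))"
      unfolding GmU_carrier[of m] by (rule ball_simps(9))
    also have "\<dots> \<longleftrightarrow> (\<forall>k\<in>{..<p ^ m}. coeff (LP l m) k = coeff (LP l (Suc m) mod Tq (p ^ m)) k)"
      unfolding LP_def by (intro ball_cong refl) (simp add: lc_trans[OF l] coeff_lc)
    also have "\<dots> \<longleftrightarrow> (\<forall>k<p ^ m. coeff (LP l m) k = coeff (LP l (Suc m) mod Tq (p ^ m)) k)"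
      by (simp only: Ball_def lessThan_iff)
    also have "\<dots> \<longleftrightarrow> ?R"
    proof
      assume *: "\<forall>k<p ^ m. coeff (LP l m) k = coeff (LP l (Suc m) mod Tq (p ^ m)) k"
      show ?R
      proof (rule poly_eqI)
        fix k show "coeff (LP l (Suc m) mod Tq (p ^ m)) k = coeff (LP l m) k"
          using * degree_LP[of l m] degree_mod_Tq[OF q_pos, of "LP l (Suc m)" m]
          by (cases "k < p ^ m") (auto simp: coeff_eq_0)
      qed
    qed simp
    finally show ?thesis .
  qed
  then show ?thesis by (auto simp: iwasawa_def completed_group_ring_def)
qed

lemma LP_mult: "\<lbrakk>l \<in> carrier Lam; l' \<in> carrier Lam\<rbrakk> \<Longrightarrow> LP (l \<otimes>\<^bsub>Lam\<^esub> l') m = (LP l m * LP l' m) mod Tq (p ^ m)"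
  by (simp add: LP_def iw_simps iw_iff lc_mult)

lemma LP_inj: "\<lbrakk>l \<in> carrier Lam; l' \<in> carrier Lam; \<And>m. LP l m = LP l' m\<rbrakk> \<Longrightarrow> l = l'"
  by (rule ext) (auto simp: iw_iff LP_def intro: lc_inj)

lemma oP_LP: "l \<in> carrier Lam \<Longrightarrow> oP (LP l m)" by (simp add: iw_iff LP_def oP_lc)

lemma LP_Suc: "l \<in> carrier Lam \<Longrightarrow> LP l (Suc m) mod Tq (p ^ m) = LP l m" by (simp add: iw_iff)

definition mkL :: "(nat \<Rightarrow> 'l poly) \<Rightarrow> nat \<Rightarrow> ('q ^ 2 ^ 2) set \<Rightarrow> 'l" where
  "mkL P m = (\<lambda>C\<in>carrier (GmU m). coeff (P m) (the_inv_into {..<p ^ m} (\<lambda>i. ci m (int i)) C))"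

text \<open>Builds elements of the limit from coherent polynomials. It is used for negatives, for
  division by p_L and for the limit of the relations.\<close>

lemma mkL:
  assumes "\<And>m. oP (P m)" "\<And>m. degree (P m) < p ^ m" "\<And>m. P (Suc m) mod Tq (p ^ m) = P m"
  shows "mkL P \<in> carrier Lam" "LP (mkL P) m = P m"
proof -
  have LP: "LP (mkL P) m = P m" for m
  proof (rule poly_eqI)
    fix k show "coeff (LP (mkL P) m) k = coeff (P m) k"
      using assms(2)[of m] the_inv_into_f_f[OF ci_inj[of m], of k]
      by (cases "k < p ^ m") (auto simp: LP_def coeff_lc mkL_def coeff_eq_0)
  qed
  moreover have "mkL P m \<in> carrier (GR m)" for m
    using assms(1) by (auto simp: GR_carrier mkL_def oP_def)
  ultimately show "mkL P \<in> carrier Lam" unfolding iw_iff using assms by simp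
  show "LP (mkL P) m = P m" by (rule LP)
qed

lemma mod_Tq_Suc: "(f mod Tq (p ^ Suc m)) mod Tq (p ^ m) = (f mod Tq (p ^ m) :: 'l poly)"
  using mod_mod_Tq[of f "p ^ m" p] by (simp add: mult.commute)

lemma iw_closed:
  "\<lbrakk>l \<in> carrier Lam; l' \<in> carrier Lam\<rbrakk> \<Longrightarrow> l \<oplus>\<^bsub>Lam\<^esub> l' \<in> carrier Lam"
  "\<lbrakk>l \<in> carrier Lam; l' \<in> carrier Lam\<rbrakk> \<Longrightarrow> l \<otimes>\<^bsub>Lam\<^esub> l' \<in> carrier Lam"
  "\<one>\<^bsub>Lam\<^esub> \<in> carrier Lam" "\<zero>\<^bsub>Lam\<^esub> \<in> carrier Lam"
proof -
  assume l: "l \<in> carrier Lam" "l' \<in> carrier Lam"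
  then show "l \<oplus>\<^bsub>Lam\<^esub> l' \<in> carrier Lam"
    using iw_iff[of "l \<oplus>\<^bsub>Lam\<^esub> l'"] iw_iff[of l] iw_iff[of l'] by (simp add: LP_simps iw_simps GR_closed poly_mod_add_left)
  have "LP (l \<otimes>\<^bsub>Lam\<^esub> l') (Suc m) mod Tq (p ^ m) = LP (l \<otimes>\<^bsub>Lam\<^esub> l') m" for m
    unfolding LP_mult[OF l] mod_Tq_Suc using LP_Suc[OF l(1), of m] LP_Suc[OF l(2), of m] by (metis mod_mult_eq)
  then show "l \<otimes>\<^bsub>Lam\<^esub> l' \<in> carrier Lam"
    using l iw_iff[of "l \<otimes>\<^bsub>Lam\<^esub> l'"] by (simp add: iw_simps GR_closed iw_iff)
next
  show "\<one>\<^bsub>Lam\<^esub> \<in> carrier Lam" "\<zero>\<^bsub>Lam\<^esub> \<in> carrier Lam"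
    unfolding iw_iff using mod_poly_small[of 1 "p ^ m" for m] by (auto simp: LP_simps iw_simps GR_closed)
qed

lemma cring_Lam: "cring Lam"
proof (rule cringI)
  show "abelian_group Lam"
  proof (rule abelian_groupI)
    fix x assume x: "x \<in> carrier Lam"
    let ?y = "mkL (\<lambda>m. - LP x m)"
    have y: "?y \<in> carrier Lam" "LP ?y m = - LP x m" for m
      using mkL[of "\<lambda>m. - LP x m"] oP_LP[OF x] degree_LP[of x] LP_Suc[OF x] by (simp_all add: poly_mod_minus_left)
    have "?y \<oplus>\<^bsub>Lam\<^esub> x = \<zero>\<^bsub>Lam\<^esub>" by (rule LP_inj) (use x y in \<open>auto simp: LP_simps iw_closed\<close>)
    then show "\<exists>y\<in>carrier Lam. y \<oplus>\<^bsub>Lam\<^esub> x = \<zero>\<^bsub>Lam\<^esub>" using y by blast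
  qed (auto intro!: LP_inj iw_closed simp: LP_simps add_ac)
  show "Group.comm_monoid Lam"
  proof (rule comm_monoidI)
    fix x y z assume xyz: "x \<in> carrier Lam" "y \<in> carrier Lam" "z \<in> carrier Lam"
    show "(x \<otimes>\<^bsub>Lam\<^esub> y) \<otimes>\<^bsub>Lam\<^esub> z = x \<otimes>\<^bsub>Lam\<^esub> (y \<otimes>\<^bsub>Lam\<^esub> z)"
      by (rule LP_inj) (use xyz in \<open>simp_all add: iw_closed LP_mult mod_mult_left_eq mod_mult_right_eq mult.assoc\<close>)
  next
    fix x assume "x \<in> carrier Lam"
    then show "\<one>\<^bsub>Lam\<^esub> \<otimes>\<^bsub>Lam\<^esub> x = x"
      by (intro LP_inj) (simp_all add: iw_closed LP_mult LP_simps mod_poly_small degree_LP)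
  qed (auto intro!: LP_inj iw_closed simp: LP_mult mult.commute)
  fix x y z assume xyz: "x \<in> carrier Lam" "y \<in> carrier Lam" "z \<in> carrier Lam"
  show "(x \<oplus>\<^bsub>Lam\<^esub> y) \<otimes>\<^bsub>Lam\<^esub> z = x \<otimes>\<^bsub>Lam\<^esub> z \<oplus>\<^bsub>Lam\<^esub> y \<otimes>\<^bsub>Lam\<^esub> z"
    by (rule LP_inj) (use xyz in \<open>simp_all add: iw_closed LP_mult LP_simps distrib_right poly_mod_add_left\<close>)
qed

definition sc :: "'l \<Rightarrow> nat \<Rightarrow> ('q ^ 2 ^ 2) set \<Rightarrow> 'l" where "sc = cgr_scalar \<O> NG NU"

lemma LP_sc: "LP (sc c) m = [:c:]"
proof (rule poly_eqI)
  fix i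
  have "coeff (LP (sc c) m) i = (if i < p ^ m then if ci m (int i) = NU m then c else 0 else 0)"
    unfolding LP_def coeff_lc sc_def cgr_scalar_def by simp
  also have "\<dots> = coeff [:c:] i"
    using ci_eq_NU[of i m] q_pos[of m] by (cases i) (simp_all del: q_pos of_nat_Suc)
  finally show "coeff (LP (sc c) m) i = coeff [:c:] i" .
qed

lemma sc_carrier: "c \<in> Oc \<Longrightarrow> sc c \<in> carrier Lam"
  unfolding iw_iff
proof (intro conjI allI)
  fix m assume c: "c \<in> Oc"
  have "(if C = \<one>\<^bsub>GmU m\<^esub> then c else \<zero>\<^bsub>\<O>\<^esub>) \<in> Oc" for C using c by simp
  then show "sc c m \<in> carrier (GR m)" unfolding GR_carrier sc_def cgr_scalar_def by (intro restrict_PiE_iff[THEN iffD2] ballI)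
  show "LP (sc c) (Suc m) mod Tq (p ^ m) = LP (sc c) m"
    unfolding LP_sc by (rule mod_poly_small) (simp only: degree_pCons_0 q_pos)
qed

abbreviation SS where "SS \<equiv> OE_loc p nrm emb pL"

lemma LP_sc_mult: "\<lbrakk>c \<in> Oc; l \<in> carrier Lam\<rbrakk> \<Longrightarrow> LP (sc c \<otimes>\<^bsub>Lam\<^esub> l) m = Polynomial.smult c (LP l m)"
  by (simp add: LP_mult sc_carrier LP_sc mod_smult_left mod_poly_small degree_LP)

text \<open>Divisibility by p_L can be tested level by level: the quotients are computed in the
  field L, so they are unique and inherit coherence.\<close>

lemma PIdl_sc_iff: "l \<in> PIdl\<^bsub>Lam\<^esub> (sc pL) \<longleftrightarrow> l \<in> carrier Lam \<and> (\<forall>m. mP (LP l m))"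
proof
  assume "l \<in> PIdl\<^bsub>Lam\<^esub> (sc pL)"
  then obtain x where x: "x \<in> carrier Lam" "l = x \<otimes>\<^bsub>Lam\<^esub> sc pL" by (auto simp: cgenideal_def)
  interpret L: cring Lam by (rule cring_Lam)
  have l: "l = sc pL \<otimes>\<^bsub>Lam\<^esub> x" using x sc_carrier by (simp add: L.m_comm)
  have "mP (LP l m)" for m
    unfolding l LP_sc_mult[OF pL_O x(1)] using oP_LP[OF x(1)] by (intro mP_smult) (use mm_pL[of 1] in auto)
  then show "l \<in> carrier Lam \<and> (\<forall>m. mP (LP l m))" using x sc_carrier by simp
next
  assume l: "l \<in> carrier Lam \<and> (\<forall>m. mP (LP l m))"
  interpret L: cring Lam by (rule cring_Lam)
  let ?P = "\<lambda>m. Polynomial.smult (1 / pL) (LP l m)"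
  have "oP (?P m)" for m
    unfolding oP_def
  proof
    fix i
    obtain c where "c \<in> Oc" "coeff (LP l m) i = pL * c" using l by (auto simp: mP_def mm_def)
    then show "coeff (?P m) i \<in> Oc" using pL_nz by simp
  qed
  then have x: "mkL ?P \<in> carrier Lam" "LP (mkL ?P) m = ?P m" for m
    using mkL[of ?P] l degree_LP[of l] LP_Suc[of l] pL_nz by (simp_all add: mod_smult_left)
  have "l = sc pL \<otimes>\<^bsub>Lam\<^esub> mkL ?P"
    using l pL_nz x by (intro LP_inj) (simp_all add: sc_carrier LP_sc_mult)
  also have "\<dots> = mkL ?P \<otimes>\<^bsub>Lam\<^esub> sc pL" using x sc_carrier by (simp add: L.m_comm)
  finally show "l \<in> PIdl\<^bsub>Lam\<^esub> (sc pL)" using x by (auto simp: cgenideal_def)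
qed

lemma SS_iff: "l \<in> SS \<longleftrightarrow> l \<in> carrier Lam \<and> (\<exists>m. \<not> mP (LP l m))"
  unfolding OE_loc_def sc_def[symmetric] using PIdl_sc_iff by blast

lemma cover_S: "\<lbrakk>l \<in> carrier Lam; l \<notin> SS\<rbrakk> \<Longrightarrow> \<exists>x\<in>carrier Lam. l = x \<otimes>\<^bsub>Lam\<^esub> sc pL"
  using PIdl_sc_iff[of l] by (auto simp: SS_iff cgenideal_def)

end

context int_ext begin

text \<open>The complement of \<open>(p\<^sub>L)\<close> is multiplicative since \<open>k[[N\<^sub>0]]\<close> is a domain: at level \<open>m\<close> it is \<open>k[X]/(X^q)\<close>, and
  the orders in \<open>X\<close> of two nonzero elements stabilize while \<open>q = p^m\<close> grows.\<close>

lemma inX_mono: "\<lbrakk>inX b f; a \<le> b\<rbrakk> \<Longrightarrow> inX a f"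
proof -
  assume "inX b f" "a \<le> b"
  then obtain c where "oP c" "mP (f - XX ^ b * c)" by (auto simp: inX_def)
  then show "inX a f" unfolding inX_def using \<open>a \<le> b\<close>
    by (intro exI[of _ "XX ^ (b - a) * c"]) (auto simp: mult.assoc[symmetric] power_add[symmetric])
qed

lemma LP_le: "\<lbrakk>l \<in> carrier Lam; m \<le> M\<rbrakk> \<Longrightarrow> LP l M mod Tq (p ^ m) = LP l m"
proof (induction M)
  case 0 then show ?case using mod_poly_small[OF degree_LP[of l 0]] by simp
next
  case (Suc M)
  show ?case
  proof (cases "m = Suc M")
    case True then show ?thesis using mod_poly_small[OF degree_LP] by blast
  next
    case False
    then have mM: "m \<le> M" using Suc.prems by simp
    then have "p ^ M = p ^ m * p ^ (M - m)" by (simp add: power_add[symmetric])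
    then have "LP l (Suc M) mod Tq (p ^ m) = (LP l (Suc M) mod Tq (p ^ M)) mod Tq (p ^ m)"
      by (simp only: mod_mod_Tq)
    then show ?thesis using Suc mM LP_Suc by simp
  qed
qed

text \<open>An element that is nonzero modulo p_L at level m keeps an X-order below p^m at all
  higher levels: otherwise T^(p^m) - 1 would divide it modulo p_L, and its reduction to level m
  would vanish.\<close>

lemma SS_not_inX:
  assumes "l \<in> carrier Lam" "\<not> mP (LP l m)" "m \<le> M" shows "\<not> inX (p ^ m) (LP l M)"
proof
  assume "inX (p ^ m) (LP l M)"
  then obtain c where c: "oP c" "mP (LP l M - XX ^ (p ^ m) * c)" by (auto simp: inX_def)
  have "mP (XX ^ (p ^ m) * c - Tq (p ^ m) * c)"
    using mP_mult[OF XX_pow[of m] c(1)] by (simp add: left_diff_distrib)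
  from mP_add[OF c(2) this] have "mP (LP l M - Tq (p ^ m) * c)" by simp
  then have "mP ((LP l M - Tq (p ^ m) * c) mod Tq (p ^ m))" by (intro mP_divmod) simp
  also have "(LP l M - Tq (p ^ m) * c) mod Tq (p ^ m) = LP l m"
    using LP_le[OF assms(1,3)] by (simp add: poly_mod_diff_left)
  finally show False using assms(2) by simp
qed

lemma inX_of_mod:
  assumes "oP f" "mP (f mod Tq (p ^ M))" shows "inX (p ^ M) f"
proof -
  have "mP (XX ^ (p ^ M) * (f div Tq (p ^ M)) - Tq (p ^ M) * (f div Tq (p ^ M)))"
    using mP_mult[OF XX_pow[of M] oP_divmod(2)[OF q_pos assms(1), of M]] by (simp add: left_diff_distrib)
  from mP_diff[OF assms(2) this] have "mP ((Tq (p ^ M) * (f div Tq (p ^ M)) + f mod Tq (p ^ M)) - XX ^ (p ^ M) * (f div Tq (p ^ M)))"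
    by (simp only: algebra_simps)
  then have "mP (f - XX ^ (p ^ M) * (f div Tq (p ^ M)))" by (simp only: mult_div_mod_eq)
  then show ?thesis unfolding inX_def using oP_divmod(2)[OF q_pos assms(1), of M] by blast
qed

lemma mult_subset_SS: "mult_subset Lam SS"
proof -
  interpret L: cring Lam by (rule cring_Lam)
  show ?thesis
  proof
    show "SS \<subseteq> carrier Lam" by (auto simp: SS_iff)
    have "\<not> mP 1" using mm_one by (auto simp: mP_def intro!: exI[of _ 0])
    then show "\<one>\<^bsub>Lam\<^esub> \<in> SS" by (simp add: SS_iff LP_simps)
    fix s t assume "s \<in> SS" "t \<in> SS"
    then obtain m m' where s: "s \<in> carrier Lam" "\<not> mP (LP s m)" and t: "t \<in> carrier Lam" "\<not> mP (LP t m')"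
      by (auto simp: SS_iff)
    \<comment> \<open>The extra 1 makes room for both orders: p^m + p^m' is at most 2 p^(m+m'),
      hence at most p^M.\<close>
    define M where "M = m + m' + 1"
    have "p ^ m \<le> p ^ (m + m')" "p ^ m' \<le> p ^ (m + m')" using p_gt_1 by (auto intro!: power_increasing)
    moreover have "2 * p ^ (m + m') \<le> p ^ M" using p_gt_1 by (simp add: M_def)
    ultimately have le: "p ^ m + p ^ m' \<le> p ^ M" by linarith
    have "\<not> inX (p ^ m + p ^ m') (LP s M * LP t M)"
      using s t by (intro inX_mult SS_not_inX oP_LP) (auto simp: M_def)
    then have "\<not> inX (p ^ M) (LP s M * LP t M)" using inX_mono le by blast
    then have "\<not> mP ((LP s M * LP t M) mod Tq (p ^ M))" using inX_of_mod s t oP_LP by auto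
    then have "\<not> mP (LP (s \<otimes>\<^bsub>Lam\<^esub> t) M)" using s t by (simp add: LP_mult)
    then show "s \<otimes>\<^bsub>Lam\<^esub> t \<in> SS" using s t by (auto simp: SS_iff)
  qed
qed

section \<open>The module L/\<oo> and computations with lifts to L\<close>

abbreviation Q where "Q \<equiv> L_mod_o \<O>"

definition lq :: "'l \<Rightarrow> 'l set" where "lq y = {x. x - y \<in> Oc}"

lemma lq_eq_iff: "lq x = lq y \<longleftrightarrow> x - y \<in> Oc"
proof
  assume "lq x = lq y"
  moreover have "x \<in> lq x" by (simp add: lq_def)
  ultimately show "x - y \<in> Oc" by (simp add: lq_def)
next
  assume *: "x - y \<in> Oc"
  have "z - x \<in> Oc \<longleftrightarrow> z - y \<in> Oc" for z
    using O_add[OF _ *, of "z - x"] O_diff[OF _ *, of "z - y"] by (auto simp: algebra_simps)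
  then show "lq x = lq y" by (simp add: lq_def)
qed

lemma lq_cos: "Oc +>\<^bsub>\<lparr>carrier = UNIV, monoid.mult = (*), monoid.one = 1, ring.zero = 0, ring.add = (+), smult = (*)\<rparr>\<^esub> y = lq y"
  unfolding a_r_coset_def r_coset_def lq_def by (auto intro: bexI[of _ "x - y" for x])

lemma Q_carrier: "carrier Q = range lq"
  unfolding L_mod_o_def quot_module_def by (auto simp: A_RCOSETS_def' lq_cos)

lemma Q_zero: "\<zero>\<^bsub>Q\<^esub> = lq 0" by (simp add: L_mod_o_def quot_module_def lq_def)

lemma lq_zero_iff: "lq x = \<zero>\<^bsub>Q\<^esub> \<longleftrightarrow> x \<in> Oc" by (simp add: Q_zero lq_eq_iff)

lemma Q_add: "lq x \<oplus>\<^bsub>Q\<^esub> lq y = lq (x + y)"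
proof -
  have "lq x \<oplus>\<^bsub>Q\<^esub> lq y = (\<Union>a\<in>lq x. \<Union>b\<in>lq y. {a + b})"
    by (simp add: L_mod_o_def quot_module_def set_add_def set_mult_def)
  also have "\<dots> = lq (x + y)"
  proof (intro equalityI subsetI)
    fix z assume "z \<in> (\<Union>a\<in>lq x. \<Union>b\<in>lq y. {a + b})"
    then obtain a b where "z = a + b" "a - x \<in> Oc" "b - y \<in> Oc" by (auto simp: lq_def)
    then show "z \<in> lq (x + y)" using O_add[of "a - x" "b - y"] by (simp add: lq_def algebra_simps)
  next
    fix z assume "z \<in> lq (x + y)"
    then have "z - x \<in> lq y" "z = x + (z - x)" "x \<in> lq x" by (simp_all add: lq_def algebra_simps)
    then show "z \<in> (\<Union>a\<in>lq x. \<Union>b\<in>lq y. {a + b})" by blast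
  qed
  finally show ?thesis .
qed

lemma Q_smult: "r \<in> Oc \<Longrightarrow> r \<odot>\<^bsub>Q\<^esub> lq y = lq (r * y)"
proof -
  assume r: "r \<in> Oc"
  have "r \<odot>\<^bsub>Q\<^esub> lq y = (\<Union>v\<in>lq y. lq (r * v))"
    by (simp add: L_mod_o_def quot_module_def lq_cos)
  moreover have "lq (r * v) = lq (r * y)" if "v \<in> lq y" for v
    using O_mult[OF r, of "v - y"] that by (simp add: lq_eq_iff) (simp add: lq_def algebra_simps)
  moreover have "y \<in> lq y" by (simp add: lq_def)
  ultimately show ?thesis by blast
qed

lemma module_Q: "Module.module \<O> Q"
proof (rule moduleI)
  show "cring \<O>" by (rule cring_O)
  show "abelian_group Q"
  proof (rule abelian_groupI)
    fix x assume "x \<in> carrier Q"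
    then obtain y where "x = lq y" by (auto simp: Q_carrier)
    then show "\<exists>y\<in>carrier Q. y \<oplus>\<^bsub>Q\<^esub> x = \<zero>\<^bsub>Q\<^esub>" by (auto simp: Q_carrier Q_add Q_zero intro: exI[of _ "- y"])
  qed (auto simp: Q_carrier Q_add Q_zero add_ac)
qed (auto simp: Q_carrier Q_smult Q_add algebra_simps)

lemma finsum_Q: "finite A \<Longrightarrow> (\<Oplus>\<^bsub>Q\<^esub>x\<in>A. lq (f x)) = lq (sum f A)"
proof (induction A rule: finite_induct)
  case empty
  interpret Module.module \<O> Q by (rule module_Q)
  show ?case by (simp add: Q_zero)
next
  case (insert x A)
  interpret Module.module \<O> Q by (rule module_Q)
  show ?case using insert by (subst finsum_insert) (auto simp: Q_carrier Q_add)
qed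

lemma pact_cong_O:
  assumes "oP f" "\<And>i. w i - v i \<in> Oc" shows "pact f w i - pact f v i \<in> Oc"
  using pact_O[OF assms(1), of "\<lambda>i. w i - v i" i] assms(2) by (simp add: pact_fun_diff)

text \<open>On functions with values in p_L^(-1) \<oo> a polynomial acts, modulo \<oo>, only through
  its reduction modulo p_L. This is why relations between torsion elements can be sought over
  k.\<close>

lemma pact_mP_tors:
  assumes "mP f" "\<And>i. pL * w i \<in> Oc" shows "pact f w i \<in> Oc"
proof -
  have "coeff f e * w j \<in> Oc" for e j
  proof -
    obtain c where "c \<in> Oc" "coeff f e = pL * c" using assms(1) by (auto simp: mP_def mm_def)
    then show ?thesis using O_mult[OF _ assms(2)[of j], of c] by (simp add: mult_ac)
  qed
  then show ?thesis unfolding pact_def by (intro O_sum) auto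
qed

end

section \<open>Duals of smooth \<open>N\<^sub>0\<close>-modules\<close>

text \<open>What is used of \<open>H\<^sub>0(X\<^sub>+, F)\<close>: an increasing exhaustion by the submodules \<open>gen m\<close>, generated over \<open>N\<^sub>0\<close> by the image
  under \<open>\<kappa> m\<close> of the fixed module \<open>V\<close>, where \<open>N\<^sub>0^(p^m)\<close> acts trivially on \<open>gen m\<close>.\<close>

locale smooth_action = int_ext p nrm emb pL + H: Module.module "int_ring nrm emb" H + V: Module.module "int_ring nrm emb" V
  for p :: nat and nrm :: "'q::field_char_0 \<Rightarrow> real" and emb :: "'q \<Rightarrow> 'l::field" and pL :: 'l
    and H :: "('l, 'h, 'c) module_scheme" and V :: "('l, 'v, 'd) module_scheme" +
  fixes \<alpha> :: "'q ^ 2 ^ 2 \<Rightarrow> 'h \<Rightarrow> 'h" and \<kappa> :: "nat \<Rightarrow> 'v \<Rightarrow> 'h"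
  assumes \<alpha>_closed [simp]: "\<lbrakk>b \<in> Zp nrm; h \<in> carrier H\<rbrakk> \<Longrightarrow> \<alpha> (un b) h \<in> carrier H"
    and \<alpha>_add: "\<lbrakk>b \<in> Zp nrm; h \<in> carrier H; h' \<in> carrier H\<rbrakk> \<Longrightarrow> \<alpha> (un b) (h \<oplus>\<^bsub>H\<^esub> h') = \<alpha> (un b) h \<oplus>\<^bsub>H\<^esub> \<alpha> (un b) h'"
    and \<alpha>_smult: "\<lbrakk>b \<in> Zp nrm; r \<in> Oc; h \<in> carrier H\<rbrakk> \<Longrightarrow> \<alpha> (un b) (r \<odot>\<^bsub>H\<^esub> h) = r \<odot>\<^bsub>H\<^esub> \<alpha> (un b) h"
    and \<alpha>_comp: "\<lbrakk>b \<in> Zp nrm; c \<in> Zp nrm; h \<in> carrier H\<rbrakk> \<Longrightarrow> \<alpha> (un b) (\<alpha> (un c) h) = \<alpha> (un (b + c)) h"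
    and \<alpha>_0: "h \<in> carrier H \<Longrightarrow> \<alpha> (un 0) h = h"
    and \<kappa>_hom: "\<kappa> m \<in> module_hom \<O> V H"
    and \<kappa>_fixed: "\<lbrakk>v \<in> carrier V; u \<in> NU m\<rbrakk> \<Longrightarrow> \<alpha> u (\<kappa> m v) = \<kappa> m v"
    and \<kappa>_Suc: "v \<in> carrier V \<Longrightarrow> \<kappa> m v \<in> rspan \<O> H {\<alpha> (un (of_int i)) (\<kappa> (Suc m) w) | i w. w \<in> carrier V}"
begin

definition gen where "gen m = rspan \<O> H {\<alpha> (un (of_int i)) (\<kappa> m w) | i w. w \<in> carrier V}"

lemma \<kappa>_closed [simp]: "v \<in> carrier V \<Longrightarrow> \<kappa> m v \<in> carrier H"
  using \<kappa>_hom[of m] by (auto simp: module_hom_def)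

lemma gen_closed: "h \<in> gen m \<Longrightarrow> h \<in> carrier H"
  unfolding gen_def by (rule H.rspan_closed[rotated]) auto

lemma gen_induct [consumes 1, case_names zero base add smult]:
  assumes "h \<in> gen m" "P \<zero>\<^bsub>H\<^esub>" "\<And>i w. w \<in> carrier V \<Longrightarrow> P (\<alpha> (un (of_int i)) (\<kappa> m w))"
    "\<And>x y. \<lbrakk>x \<in> carrier H; y \<in> carrier H; P x; P y\<rbrakk> \<Longrightarrow> P (x \<oplus>\<^bsub>H\<^esub> y)"
    "\<And>c x. \<lbrakk>c \<in> Oc; x \<in> carrier H; P x\<rbrakk> \<Longrightarrow> P (c \<odot>\<^bsub>H\<^esub> x)"
  shows "P h"
  using assms(1) unfolding gen_def
proof (induction rule: rspan.induct)
  case (add x y) then show ?case using assms(4) gen_closed unfolding gen_def by blast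
next
  case (smult r x) then show ?case using assms(5) gen_closed unfolding gen_def by blast
qed (use assms(2,3) in auto)

lemma \<alpha>_zero: "b \<in> Zp nrm \<Longrightarrow> \<alpha> (un b) \<zero>\<^bsub>H\<^esub> = \<zero>\<^bsub>H\<^esub>"
  using \<alpha>_smult[of b 0 "\<zero>\<^bsub>H\<^esub>"] H.smult_l_null[of "\<zero>\<^bsub>H\<^esub>"] H.smult_l_null[of "\<alpha> (un b) \<zero>\<^bsub>H\<^esub>"] by simp

lemma gen_fixed: "\<lbrakk>h \<in> gen m; u \<in> NU m\<rbrakk> \<Longrightarrow> \<alpha> u h = h"
proof (induction rule: gen_induct)
  case zero then show ?case using small_Zp by (auto simp: NU_eq \<alpha>_zero)
next
  case (base i w)
  then obtain b where b: "u = un b" "b \<in> Zp nrm" using small_Zp by (auto simp: NU_eq)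
  then show ?case using base \<kappa>_fixed[of w u m] by (metis \<alpha>_comp \<kappa>_closed add.commute Zp_closed(7))
next
  case (add x y) then show ?case using small_Zp by (auto simp: NU_eq \<alpha>_add)
next
  case (smult c x) then show ?case using small_Zp by (auto simp: NU_eq \<alpha>_smult)
qed

lemma gen_\<alpha>: "h \<in> gen m \<Longrightarrow> \<alpha> (un (of_int i)) h \<in> gen m"
proof (induction rule: gen_induct)
  case zero then show ?case by (simp add: \<alpha>_zero gen_def rspan.zero)
next
  case (base j w)
  have "\<alpha> (un (of_int i)) (\<alpha> (un (of_int j)) (\<kappa> m w)) = \<alpha> (un (of_int (i + j))) (\<kappa> m w)"
    using base by (simp add: \<alpha>_comp)
  then show ?case unfolding gen_def using base by (intro rspan.incl CollectI exI[of _ "i + j"] exI[of _ w]) simp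
next
  case (add x y) then show ?case by (simp add: \<alpha>_add gen_def rspan.add)
next
  case (smult c x) then show ?case by (simp add: \<alpha>_smult gen_def rspan.smult)
qed

lemma gen_Suc: "h \<in> gen m \<Longrightarrow> h \<in> gen (Suc m)"
proof (induction rule: gen_induct)
  case zero then show ?case by (simp add: gen_def rspan.zero)
next
  case (base i w)
  then have "\<kappa> m w \<in> gen (Suc m)" unfolding gen_def by (rule \<kappa>_Suc)
  then show ?case by (rule gen_\<alpha>)
next
  case (add x y) then show ?case by (simp add: gen_def rspan.add)
next
  case (smult c x) then show ?case by (simp add: gen_def rspan.smult)
qed

lemma gen_mono: "\<lbrakk>h \<in> gen m; m \<le> M\<rbrakk> \<Longrightarrow> h \<in> gen M"
  by (induction M) (auto intro: gen_Suc elim: le_SucE)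

end

locale smooth_module = smooth_action p nrm emb pL H V \<alpha> \<kappa>
  for p :: nat and nrm :: "'q::field_char_0 \<Rightarrow> real" and emb :: "'q \<Rightarrow> 'l::field" and pL :: 'l
    and H :: "('l, 'h, 'c) module_scheme" and V :: "('l, 'v, 'd) module_scheme"
    and \<alpha> :: "'q ^ 2 ^ 2 \<Rightarrow> 'h \<Rightarrow> 'h" and \<kappa> :: "nat \<Rightarrow> 'v \<Rightarrow> 'h" +
  assumes gen_ex: "h \<in> carrier H \<Longrightarrow> \<exists>m. h \<in> gen m"
begin

definition fixed where "fixed m h \<longleftrightarrow> h \<in> carrier H \<and> (\<forall>u\<in>NU m. \<alpha> u h = h)"

lemma gen_fixed': "h \<in> gen m \<Longrightarrow> fixed m h" by (simp add: fixed_def gen_closed gen_fixed)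

lemma fixed_mono: "\<lbrakk>fixed m h; m \<le> M\<rbrakk> \<Longrightarrow> fixed M h"
proof -
  assume "m \<le> M"
  then have "(1 / real p) ^ M \<le> (1 / real p) ^ m" using p_gt_1 by (intro power_decreasing) auto
  then have "NU M \<subseteq> NU m" by (force simp: NU_eq)
  then show "fixed m h \<Longrightarrow> fixed M h" by (auto simp: fixed_def)
qed

lemma fixed_ex: "h \<in> carrier H \<Longrightarrow> \<exists>m. fixed m h" using gen_ex gen_fixed' by blast

lemma fixed_ex2: "\<lbrakk>h \<in> carrier H; h' \<in> carrier H\<rbrakk> \<Longrightarrow> \<exists>m. fixed m h \<and> fixed m h'"
  by (metis fixed_ex fixed_mono max.cobounded1 max.cobounded2)

lemma fixed_add: "\<lbrakk>fixed m h; fixed m h'\<rbrakk> \<Longrightarrow> fixed m (h \<oplus>\<^bsub>H\<^esub> h')"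
  unfolding fixed_def using small_Zp by (auto simp: NU_eq \<alpha>_add)

lemma fixed_smult: "\<lbrakk>fixed m h; c \<in> Oc\<rbrakk> \<Longrightarrow> fixed m (c \<odot>\<^bsub>H\<^esub> h)"
  unfolding fixed_def using small_Zp by (auto simp: NU_eq \<alpha>_smult)

lemma fixed_\<alpha>: "\<lbrakk>fixed m h; b \<in> Zp nrm\<rbrakk> \<Longrightarrow> fixed m (\<alpha> (un b) h)"
proof -
  assume h: "fixed m h" and b: "b \<in> Zp nrm"
  have "\<alpha> (un c) (\<alpha> (un b) h) = \<alpha> (un b) h" if "nrm c \<le> (1 / real p) ^ m" for c
  proof -
    have "\<alpha> (un c) (\<alpha> (un b) h) = \<alpha> (un b) (\<alpha> (un c) h)"
      using h b small_Zp[OF that] by (simp add: fixed_def \<alpha>_comp add.commute)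
    then show ?thesis using h that by (auto simp: fixed_def NU_eq)
  qed
  then show ?thesis using h b by (auto simp: fixed_def NU_eq)
qed

lemma fixed_cong: "\<lbrakk>fixed m h; b \<in> Zp nrm; nrm (b - c) \<le> (1 / real p) ^ m\<rbrakk> \<Longrightarrow> \<alpha> (un b) h = \<alpha> (un c) h"
proof -
  assume h: "fixed m h" and b: "b \<in> Zp nrm" and bc: "nrm (b - c) \<le> (1 / real p) ^ m"
  have "\<alpha> (un c) h = \<alpha> (un b) (\<alpha> (un (c - b)) h)"
    using h b small_Zp[of "c - b" m] bc by (simp add: fixed_def \<alpha>_comp nrm_minus_commute)
  also have "\<alpha> (un (c - b)) h = h" using h bc by (auto simp: fixed_def NU_eq nrm_minus_commute)
  finally show ?thesis by simp
qed

end

section \<open>The module structure of the dual over the completed group ring\<close>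

context smooth_module begin

text \<open>The shape repeats that of \<open>Ddual\<close> literally, so that the two agree by
  unfolding once H is specialised.\<close>

definition DM :: "(nat \<Rightarrow> ('q ^ 2 ^ 2) set \<Rightarrow> 'l, 'h \<Rightarrow> 'l set) module" where
  "DM = \<lparr>carrier = module_hom \<O> H Q \<inter> extensional (carrier H),
         monoid.mult = undefined, monoid.one = undefined,
         ring.zero = (\<lambda>v\<in>carrier H. \<zero>\<^bsub>Q\<^esub>),
         ring.add = (\<lambda>f f'. \<lambda>v\<in>carrier H. f v \<oplus>\<^bsub>Q\<^esub> f' v),
         smult = (\<lambda>l f. \<lambda>v\<in>carrier H.
           let m = (LEAST m. \<forall>u\<in>NU m. \<alpha> u v = v)
           in \<Oplus>\<^bsub>Q\<^esub>C\<in>carrier (GmU m). l m C \<odot>\<^bsub>Q\<^esub> f (\<alpha> (matrix_inv (SOME g. g \<in> C)) v))\<rparr>"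

text \<open>\<open>W f h\<close> is a lift to \<open>L\<close> of the function \<open>i \<mapsto> f (u^i h)\<close>, \<open>u\<close> the generator of \<open>N\<^sub>0\<close>; on such lifts
  \<open>\<oo>[[N\<^sub>0]]\<close> acts through \<open>pact\<close>.\<close>

definition rl :: "('h \<Rightarrow> 'l set) \<Rightarrow> 'h \<Rightarrow> 'l" where "rl f h = (SOME y. f h = lq y)"
definition W :: "('h \<Rightarrow> 'l set) \<Rightarrow> 'h \<Rightarrow> int \<Rightarrow> 'l" where "W f h i = rl f (\<alpha> (un (of_int i)) h)"

lemma DM_carrier: "f \<in> carrier DM \<longleftrightarrow> f \<in> extensional (carrier H) \<and> (\<forall>h\<in>carrier H. f h \<in> carrier Q) \<and>
  (\<forall>h\<in>carrier H. \<forall>h'\<in>carrier H. f (h \<oplus>\<^bsub>H\<^esub> h') = f h \<oplus>\<^bsub>Q\<^esub> f h') \<and>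
  (\<forall>c\<in>Oc. \<forall>h\<in>carrier H. f (c \<odot>\<^bsub>H\<^esub> h) = c \<odot>\<^bsub>Q\<^esub> f h)"
  by (auto simp: DM_def module_hom_def)

lemma rl: "\<lbrakk>f \<in> carrier DM; h \<in> carrier H\<rbrakk> \<Longrightarrow> f h = lq (rl f h)"
  unfolding rl_def DM_carrier Q_carrier by (rule someI_ex) blast

lemma rl_add:
  "\<lbrakk>f \<in> carrier DM; h \<in> carrier H; h' \<in> carrier H\<rbrakk> \<Longrightarrow> rl f (h \<oplus>\<^bsub>H\<^esub> h') - (rl f h + rl f h') \<in> Oc"
  unfolding lq_eq_iff[symmetric] Q_add[symmetric] by (simp add: rl[symmetric]) (simp add: DM_carrier)

lemma rl_smult:
  "\<lbrakk>f \<in> carrier DM; c \<in> Oc; h \<in> carrier H\<rbrakk> \<Longrightarrow> rl f (c \<odot>\<^bsub>H\<^esub> h) - c * rl f h \<in> Oc"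
  unfolding lq_eq_iff[symmetric] by (simp add: Q_smult[symmetric] rl[symmetric]) (simp add: DM_carrier)

lemma W_add:
  "\<lbrakk>f \<in> carrier DM; h \<in> carrier H; h' \<in> carrier H\<rbrakk> \<Longrightarrow> W f (h \<oplus>\<^bsub>H\<^esub> h') i - (W f h i + W f h' i) \<in> Oc"
  by (simp add: W_def \<alpha>_add rl_add)

lemma W_smult:
  "\<lbrakk>f \<in> carrier DM; c \<in> Oc; h \<in> carrier H\<rbrakk> \<Longrightarrow> W f (c \<odot>\<^bsub>H\<^esub> h) i - c * W f h i \<in> Oc"
  by (simp add: W_def \<alpha>_smult rl_smult)

lemma W_\<alpha>: "h \<in> carrier H \<Longrightarrow> W f (\<alpha> (un (of_int j)) h) i = W f h (i + j)"
  by (simp add: W_def \<alpha>_comp)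

lemma W_periodic: "fixed m h \<Longrightarrow> W f h (i + int (p ^ m)) = W f h i"
proof -
  assume h: "fixed m h"
  have "\<alpha> (un (of_int (i + int (p ^ m)))) h = \<alpha> (un (of_int i)) h"
    by (rule fixed_cong[OF h Zp_closed(7)]) (simp add: nrm_p_power)
  then show ?thesis by (simp only: W_def)
qed

lemma pact_W_mod:
  "\<lbrakk>oP P; fixed m h\<rbrakk> \<Longrightarrow> pact (P mod Tq (p ^ m)) (W f h) i - pact P (W f h) i \<in> Oc"
  by (rule pact_mod_O) (simp_all add: W_periodic del: of_nat_power)

text \<open>The definition uses the least level m fixing h. Any fixing level M gives the same value,
  since the polynomials at M reduce to those at m and \<open>W f h\<close> has period p^m; so one
  level can serve several vectors at once.\<close>

lemma DM_smult:
  assumes f: "f \<in> carrier DM" and l: "l \<in> carrier Lam" and h: "fixed M h"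
  shows "(l \<odot>\<^bsub>DM\<^esub> f) h = lq (pact (LP l M) (W f h) 0)"
proof -
  define m where "m = (LEAST m. \<forall>u\<in>NU m. \<alpha> u h = h)"
  have hH: "h \<in> carrier H" and hM: "\<forall>u\<in>NU M. \<alpha> u h = h" using h by (auto simp: fixed_def)
  have mM: "m \<le> M" unfolding m_def by (rule Least_le) (rule hM)
  have hm: "fixed m h" unfolding fixed_def m_def using hH LeastI[of "\<lambda>m. \<forall>u\<in>NU m. \<alpha> u h = h", OF hM] by blast
  have tm: "l m (ci m (int i)) \<odot>\<^bsub>Q\<^esub> f (\<alpha> (matrix_inv (SOME g. g \<in> ci m (int i))) h)
      = lq (coeff (LP l m) i * W f h (- int i))" if "i < p ^ m" for i
  proof -
    \<comment> \<open>The chosen representative of the coset is some c near i, which acts on h as i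
      does. Its inverse produces the index -i, the shift that occurs in \<open>pact\<close> at
      0.\<close>
    have "(SOME g. g \<in> ci m (int i)) \<in> ci m (int i)"
      by (rule someI[of _ "un (of_int (int i))"]) (auto simp: ci_def cc_def)
    then obtain c where c: "(SOME g. g \<in> ci m (int i)) = un c" "nrm (c - of_nat i) \<le> (1 / real p) ^ m"
      by (auto simp: ci_def cc_def)
    have cZ: "c \<in> Zp nrm" using Zp_closed(3)[OF small_Zp[OF c(2)] Zp_closed(8)[of i]] by simp
    have "\<alpha> (un (- c)) h = \<alpha> (un (of_int (- int i))) h"
      using c cZ nrm_minus_commute[of c "of_nat i"] by (intro fixed_cong[OF hm]) auto
    then have "f (\<alpha> (matrix_inv (SOME g. g \<in> ci m (int i))) h) = lq (W f h (- int i))"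
      unfolding c(1) un_inv W_def using rl[OF f, of "\<alpha> (un (of_int (- int i))) h"] hH by simp
    moreover have "l m (ci m (int i)) = coeff (LP l m) i" using that by (simp add: LP_def coeff_lc)
    moreover have "coeff (LP l m) i \<in> Oc" using oP_LP[OF l] by (simp add: oP_def)
    ultimately show ?thesis by (simp add: Q_smult)
  qed
  have "(l \<odot>\<^bsub>DM\<^esub> f) h = (\<Oplus>\<^bsub>Q\<^esub>C\<in>carrier (GmU m). l m C \<odot>\<^bsub>Q\<^esub> f (\<alpha> (matrix_inv (SOME g. g \<in> C)) h))"
    using hH by (simp add: DM_def m_def Let_def)
  also have "\<dots> = (\<Oplus>\<^bsub>Q\<^esub>i\<in>{..<p ^ m}. l m (ci m (int i)) \<odot>\<^bsub>Q\<^esub> f (\<alpha> (matrix_inv (SOME g. g \<in> ci m (int i))) h))"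
  proof -
    interpret Q: Module.module \<O> Q by (rule module_Q)
    show ?thesis unfolding GmU_carrier
      by (rule Q.finsum_reindex[OF _ ci_inj]) (use tm in \<open>auto simp: Q_carrier\<close>)
  qed
  also have "\<dots> = (\<Oplus>\<^bsub>Q\<^esub>i\<in>{..<p ^ m}. lq (coeff (LP l m) i * W f h (- int i)))"
  proof -
    interpret Q: Module.module \<O> Q by (rule module_Q)
    show ?thesis by (rule Q.finsum_cong') (use tm in \<open>auto simp: Q_carrier\<close>)
  qed
  also have "\<dots> = lq (\<Sum>i<p ^ m. coeff (LP l m) i * W f h (- int i))" by (simp add: finsum_Q)
  also have "(\<Sum>i<p ^ m. coeff (LP l m) i * W f h (- int i)) = pact (LP l m) (W f h) 0"
  proof -
    have "degree (LP l m) \<le> p ^ m - 1" using degree_LP[of l m] by simp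
    moreover have "{..p ^ m - 1} = {..<p ^ m}" using Suc_diff_1[OF q_pos[of m]] lessThan_Suc_atMost by metis
    ultimately show ?thesis by (simp add: pact_alt)
  qed
  also have "lq \<dots> = lq (pact (LP l M) (W f h) 0)"
    using pact_W_mod[OF oP_LP[OF l] hm, of M f 0] LP_le[OF l mM] by (simp add: lq_eq_iff)
  finally show ?thesis .
qed

lemma DM_eqI:
  assumes "f \<in> extensional (carrier H)" "g \<in> extensional (carrier H)"
    and "\<And>h M. fixed M h \<Longrightarrow> f h = g h" shows "f = g"
proof (rule extensionalityI[OF assms(1,2)])
  fix h assume "h \<in> carrier H" then show "f h = g h" using fixed_ex assms(3) by blast
qed

lemma smult_closed: assumes f: "f \<in> carrier DM" and l: "l \<in> carrier Lam" shows "l \<odot>\<^bsub>DM\<^esub> f \<in> carrier DM"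
  unfolding DM_carrier
proof (intro conjI ballI)
  show "l \<odot>\<^bsub>DM\<^esub> f \<in> extensional (carrier H)" by (simp add: DM_def)
  note oP = oP_LP[OF l]
  fix h assume h: "h \<in> carrier H"
  show "(l \<odot>\<^bsub>DM\<^esub> f) h \<in> carrier Q" using fixed_ex[OF h] DM_smult[OF f l] by (auto simp: Q_carrier)
  {
    fix h' assume h': "h' \<in> carrier H"
    obtain M where M: "fixed M h" "fixed M h'" using fixed_ex2 h h' by blast
    have "pact (LP l M) (W f (h \<oplus>\<^bsub>H\<^esub> h')) 0 - pact (LP l M) (\<lambda>i. W f h i + W f h' i) 0 \<in> Oc"
      by (rule pact_cong_O[OF oP]) (rule W_add[OF f h h'])
    then show "(l \<odot>\<^bsub>DM\<^esub> f) (h \<oplus>\<^bsub>H\<^esub> h') = (l \<odot>\<^bsub>DM\<^esub> f) h \<oplus>\<^bsub>Q\<^esub> (l \<odot>\<^bsub>DM\<^esub> f) h'"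
      using M fixed_add[OF M] by (simp add: DM_smult[OF f l] Q_add lq_eq_iff pact_fun_add)
  }
  {
    fix c assume c: "c \<in> Oc"
    obtain M where M: "fixed M h" using fixed_ex h by blast
    have "pact (LP l M) (W f (c \<odot>\<^bsub>H\<^esub> h)) 0 - pact (LP l M) (\<lambda>i. c * W f h i) 0 \<in> Oc"
      by (rule pact_cong_O[OF oP]) (rule W_smult[OF f c h])
    then show "(l \<odot>\<^bsub>DM\<^esub> f) (c \<odot>\<^bsub>H\<^esub> h) = c \<odot>\<^bsub>Q\<^esub> (l \<odot>\<^bsub>DM\<^esub> f) h"
      using M c fixed_smult[OF M c] by (simp add: DM_smult[OF f l] Q_smult lq_eq_iff pact_fun_mult)
  }
qed

lemma DM_add: "h \<in> carrier H \<Longrightarrow> (f \<oplus>\<^bsub>DM\<^esub> g) h = f h \<oplus>\<^bsub>Q\<^esub> g h"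
  and DM_zero: "h \<in> carrier H \<Longrightarrow> \<zero>\<^bsub>DM\<^esub> h = \<zero>\<^bsub>Q\<^esub>"
  by (simp_all add: DM_def)

lemma DM_ext: "f \<in> carrier DM \<Longrightarrow> f \<in> extensional (carrier H)" "f \<oplus>\<^bsub>DM\<^esub> g \<in> extensional (carrier H)"
  "\<zero>\<^bsub>DM\<^esub> \<in> extensional (carrier H)"
  by (auto simp: DM_def)

lemma abelian_group_DM: "abelian_group DM"
proof -
  interpret Q: Module.module \<O> Q by (rule module_Q)
  have Qc: "\<lbrakk>f \<in> carrier DM; h \<in> carrier H\<rbrakk> \<Longrightarrow> f h \<in> carrier Q" for f h by (simp add: DM_carrier)
  show ?thesis
  proof (rule abelian_groupI)
    fix x y assume x: "x \<in> carrier DM" and y: "y \<in> carrier DM"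
    show "x \<oplus>\<^bsub>DM\<^esub> y \<in> carrier DM"
      unfolding DM_carrier using x y DM_ext(2)[of x y]
      by (auto simp: DM_add DM_carrier Q.smult_r_distr Q.a_ac)
    show "x \<oplus>\<^bsub>DM\<^esub> y = y \<oplus>\<^bsub>DM\<^esub> x"
      by (rule extensionalityI[OF DM_ext(2) DM_ext(2)]) (use x y Qc in \<open>auto simp: DM_add Q.a_comm\<close>)
    fix z assume z: "z \<in> carrier DM"
    show "x \<oplus>\<^bsub>DM\<^esub> y \<oplus>\<^bsub>DM\<^esub> z = x \<oplus>\<^bsub>DM\<^esub> (y \<oplus>\<^bsub>DM\<^esub> z)"
      by (rule extensionalityI[OF DM_ext(2) DM_ext(2)]) (use x y z Qc in \<open>auto simp: DM_add Q.a_assoc\<close>)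
  next
    show "\<zero>\<^bsub>DM\<^esub> \<in> carrier DM"
      unfolding DM_carrier using DM_ext(3) by (auto simp: DM_zero)
  next
    fix x assume x: "x \<in> carrier DM"
    show "\<zero>\<^bsub>DM\<^esub> \<oplus>\<^bsub>DM\<^esub> x = x"
      by (rule extensionalityI[OF DM_ext(2) DM_ext(1)[OF x]]) (use x Qc in \<open>auto simp: DM_add DM_zero\<close>)
    let ?y = "\<lambda>h\<in>carrier H. \<ominus>\<^bsub>Q\<^esub> x h"
    have "?y \<in> carrier DM" unfolding DM_carrier
      using x by (auto simp: DM_carrier Q.minus_add Q.smult_r_minus)
    moreover have "?y \<oplus>\<^bsub>DM\<^esub> x = \<zero>\<^bsub>DM\<^esub>"
      by (rule extensionalityI[OF DM_ext(2) DM_ext(3)]) (use x Qc in \<open>auto simp: DM_add DM_zero Q.l_neg\<close>)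
    ultimately show "\<exists>y\<in>carrier DM. y \<oplus>\<^bsub>DM\<^esub> x = \<zero>\<^bsub>DM\<^esub>" by blast
  qed
qed

lemma rl_fun_add: "\<lbrakk>f \<in> carrier DM; g \<in> carrier DM; h \<in> carrier H\<rbrakk> \<Longrightarrow> rl (f \<oplus>\<^bsub>DM\<^esub> g) h - (rl f h + rl g h) \<in> Oc"
proof -
  assume fgh: "f \<in> carrier DM" "g \<in> carrier DM" "h \<in> carrier H"
  have "f \<oplus>\<^bsub>DM\<^esub> g \<in> carrier DM"
    using abelian_groupE(1)[OF abelian_group_DM] fgh by blast
  then have "lq (rl (f \<oplus>\<^bsub>DM\<^esub> g) h) = lq (rl f h + rl g h)"
    using fgh by (simp add: rl[symmetric] Q_add[symmetric] DM_add)
  then show ?thesis by (simp add: lq_eq_iff)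
qed

lemma module_DM: "Module.module Lam DM"
proof (rule moduleI)
  show "cring Lam" by (rule cring_Lam)
  interpret L: cring Lam by (rule cring_Lam)
  show "abelian_group DM" by (rule abelian_group_DM)
  interpret D: abelian_group DM by (rule abelian_group_DM)
  have ext: "a \<odot>\<^bsub>DM\<^esub> x \<in> extensional (carrier H)" for a x by (simp add: DM_def)
  fix a x assume a: "a \<in> carrier Lam" and x: "x \<in> carrier DM"
  show "a \<odot>\<^bsub>DM\<^esub> x \<in> carrier DM" using smult_closed a x by blast
  {
    fix b assume b: "b \<in> carrier Lam"
    show "(a \<oplus>\<^bsub>Lam\<^esub> b) \<odot>\<^bsub>DM\<^esub> x = a \<odot>\<^bsub>DM\<^esub> x \<oplus>\<^bsub>DM\<^esub> b \<odot>\<^bsub>DM\<^esub> x"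
    proof (rule DM_eqI[OF ext DM_ext(2)])
      fix h M assume h: "fixed M h"
      then have "h \<in> carrier H" by (simp add: fixed_def)
      then show "((a \<oplus>\<^bsub>Lam\<^esub> b) \<odot>\<^bsub>DM\<^esub> x) h = (a \<odot>\<^bsub>DM\<^esub> x \<oplus>\<^bsub>DM\<^esub> b \<odot>\<^bsub>DM\<^esub> x) h"
        using a b x h by (simp add: DM_add DM_smult LP_simps pact_add Q_add)
    qed
    show "(a \<otimes>\<^bsub>Lam\<^esub> b) \<odot>\<^bsub>DM\<^esub> x = a \<odot>\<^bsub>DM\<^esub> (b \<odot>\<^bsub>DM\<^esub> x)"
    proof (rule DM_eqI[OF ext ext])
      fix h M assume h: "fixed M h"
      then have hH: "h \<in> carrier H" by (simp add: fixed_def)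
      \<comment> \<open>Modulo \<oo> the function attached to b x arises from that of x by the
        polynomial of b. Hence composition of actions is multiplication of polynomials, and
        reduction modulo T^q - 1 is harmless by periodicity.\<close>
      have W: "W (b \<odot>\<^bsub>DM\<^esub> x) h i - pact (LP b M) (W x h) i \<in> Oc" for i
      proof -
        have "lq (W (b \<odot>\<^bsub>DM\<^esub> x) h i) = (b \<odot>\<^bsub>DM\<^esub> x) (\<alpha> (un (of_int i)) h)"
          unfolding W_def using smult_closed[OF x b] hH by (simp add: rl[symmetric])
        also have "\<dots> = lq (pact (LP b M) (W x (\<alpha> (un (of_int i)) h)) 0)"
          using DM_smult[OF x b] fixed_\<alpha>[OF h] by simp
        also have "pact (LP b M) (W x (\<alpha> (un (of_int i)) h)) 0 = pact (LP b M) (W x h) i"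
        proof -
          have "W x (\<alpha> (un (of_int i)) h) = (\<lambda>j. W x h (j + i))" by (rule HOL.ext) (simp add: W_\<alpha> hH)
          then show ?thesis using pact_shift[of "LP b M" "W x h" i 0] by simp
        qed
        finally show ?thesis by (simp add: lq_eq_iff)
      qed
      have "(a \<odot>\<^bsub>DM\<^esub> (b \<odot>\<^bsub>DM\<^esub> x)) h = lq (pact (LP a M) (W (b \<odot>\<^bsub>DM\<^esub> x) h) 0)"
        using smult_closed[OF x b] a h by (simp add: DM_smult)
      also have "\<dots> = lq (pact (LP a M) (pact (LP b M) (W x h)) 0)"
        unfolding lq_eq_iff by (rule pact_cong_O[OF oP_LP[OF a] W])
      also have "\<dots> = lq (pact (LP a M * LP b M) (W x h) 0)" by (simp add: pact_mult)
      also have "\<dots> = lq (pact ((LP a M * LP b M) mod Tq (p ^ M)) (W x h) 0)"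
        using pact_W_mod[OF _ h, of "LP a M * LP b M" x 0] oP_LP a b by (simp add: lq_eq_iff[symmetric])
      also have "\<dots> = ((a \<otimes>\<^bsub>Lam\<^esub> b) \<odot>\<^bsub>DM\<^esub> x) h"
        using a b x h by (simp add: DM_smult LP_mult)
      finally show "((a \<otimes>\<^bsub>Lam\<^esub> b) \<odot>\<^bsub>DM\<^esub> x) h = (a \<odot>\<^bsub>DM\<^esub> (b \<odot>\<^bsub>DM\<^esub> x)) h" by simp
    qed
  }
  {
    fix y assume y: "y \<in> carrier DM"
    show "a \<odot>\<^bsub>DM\<^esub> (x \<oplus>\<^bsub>DM\<^esub> y) = a \<odot>\<^bsub>DM\<^esub> x \<oplus>\<^bsub>DM\<^esub> a \<odot>\<^bsub>DM\<^esub> y"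
    proof (rule DM_eqI[OF ext DM_ext(2)])
      fix h M assume h: "fixed M h"
      then have hH: "h \<in> carrier H" by (simp add: fixed_def)
      have "(a \<odot>\<^bsub>DM\<^esub> (x \<oplus>\<^bsub>DM\<^esub> y)) h = lq (pact (LP a M) (W (x \<oplus>\<^bsub>DM\<^esub> y) h) 0)"
        using a x y h by (simp add: DM_smult)
      also have "\<dots> = lq (pact (LP a M) (\<lambda>i. W x h i + W y h i) 0)"
        unfolding lq_eq_iff by (rule pact_cong_O[OF oP_LP[OF a]]) (use x y hH in \<open>simp add: W_def rl_fun_add\<close>)
      also have "\<dots> = (a \<odot>\<^bsub>DM\<^esub> x \<oplus>\<^bsub>DM\<^esub> a \<odot>\<^bsub>DM\<^esub> y) h"
        using a x y h hH by (simp add: DM_smult DM_add Q_add pact_fun_add)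
      finally show "(a \<odot>\<^bsub>DM\<^esub> (x \<oplus>\<^bsub>DM\<^esub> y)) h = (a \<odot>\<^bsub>DM\<^esub> x \<oplus>\<^bsub>DM\<^esub> a \<odot>\<^bsub>DM\<^esub> y) h" .
    qed
  }
next
  fix x assume x: "x \<in> carrier DM"
  have ext: "a \<odot>\<^bsub>DM\<^esub> x \<in> extensional (carrier H)" for a by (simp add: DM_def)
  show "\<one>\<^bsub>Lam\<^esub> \<odot>\<^bsub>DM\<^esub> x = x"
  proof (rule DM_eqI[OF ext DM_ext(1)[OF x]])
    fix h M assume h: "fixed M h"
    then have hH: "h \<in> carrier H" by (simp add: fixed_def)
    then show "(\<one>\<^bsub>Lam\<^esub> \<odot>\<^bsub>DM\<^esub> x) h = x h"
      using x h rl[OF x hH] \<alpha>_0[OF hH] by (simp add: DM_smult iw_closed LP_simps W_def)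
  qed
qed

lemma sc_smult: "\<lbrakk>c \<in> Oc; f \<in> carrier DM; h \<in> carrier H\<rbrakk> \<Longrightarrow> (sc c \<odot>\<^bsub>DM\<^esub> f) h = c \<odot>\<^bsub>Q\<^esub> f h"
proof -
  assume c: "c \<in> Oc" and f: "f \<in> carrier DM" and h: "h \<in> carrier H"
  obtain M where "fixed M h" using fixed_ex[OF h] by blast
  then have "(sc c \<odot>\<^bsub>DM\<^esub> f) h = lq (c * rl f h)"
    using c f \<alpha>_0[OF h] by (simp add: DM_smult sc_carrier LP_sc pact_pCons W_def)
  then show ?thesis using c rl[OF f h] by (simp add: Q_smult)
qed

end

section \<open>Finite systems of representatives for truncated polynomials over k\<close>

context int_ext begin

definition rd :: "nat \<Rightarrow> 'l poly \<Rightarrow> 'l poly" where "rd q P = (\<Sum>i<q. monom (rep (coeff P i)) i)"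

text \<open>Represents the classes modulo p_L of polynomials of degree below q; finiteness of these
  sets is what the compactness argument consumes.\<close>

definition small_polys :: "nat \<Rightarrow> 'l poly set" where
  "small_polys q = {P. degree P < q \<and> (\<forall>i<q. coeff P i \<in> rep ` Oc)}"

lemma coeff_rd: "coeff (rd q P) i = (if i < q then rep (coeff P i) else 0)"
  by (auto simp: rd_def coeff_sum)

lemma oP_small: "P \<in> small_polys q \<Longrightarrow> oP P"
  unfolding oP_def
proof
  fix i assume P: "P \<in> small_polys q"
  show "coeff P i \<in> Oc"
  proof (cases "i < q")
    case True
    then obtain y where "y \<in> Oc" "coeff P i = rep y" using P by (auto simp: small_polys_def)
    then show ?thesis using rep(2) by simp
  next
    case False
    then have "coeff P i = 0" using P by (intro coeff_eq_0) (auto simp: small_polys_def)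
    then show ?thesis by simp
  qed
qed

lemma rd_small: "\<lbrakk>q > 0; oP P\<rbrakk> \<Longrightarrow> rd q P \<in> small_polys q"
proof -
  assume q: "q > 0" and P: "oP P"
  have "degree (rd q P) \<le> q - 1" by (rule degree_le) (auto simp: coeff_rd)
  then show ?thesis using q P by (auto simp: small_polys_def coeff_rd oP_def)
qed

lemma mP_rd: "\<lbrakk>oP P; degree P < q\<rbrakk> \<Longrightarrow> mP (P - rd q P)"
  unfolding mP_def
proof
  fix i assume "oP P" "degree P < q"
  then show "mm (coeff (P - rd q P) i)" using rep(3)[of "coeff P i"] by (auto simp: coeff_rd oP_def coeff_eq_0)
qed

lemma finite_small: "finite (small_polys q)"
proof (rule finite_subset)
  show "small_polys q \<subseteq> (\<lambda>f. \<Sum>i<q. monom (f i) i) ` ({..<q} \<rightarrow>\<^sub>E rep ` Oc)"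
  proof
    fix P assume P: "P \<in> small_polys q"
    have "P = (\<Sum>i<q. monom (coeff P i) i)"
      by (rule poly_eqI) (use P in \<open>auto simp: coeff_sum small_polys_def coeff_eq_0\<close>)
    also have "\<dots> = (\<Sum>i<q. monom (restrict (coeff P) {..<q} i) i)" by simp
    finally show "P \<in> (\<lambda>f. \<Sum>i<q. monom (f i) i) ` ({..<q} \<rightarrow>\<^sub>E rep ` Oc)"
      using P by (intro image_eqI[of _ _ "restrict (coeff P) {..<q}"]) (auto simp: small_polys_def)
  qed
  show "finite ((\<lambda>f. \<Sum>i<q. monom (f i :: 'l) i) ` ({..<q} \<rightarrow>\<^sub>E rep ` Oc))"
    by (intro finite_imageI finite_PiE finite_lessThan rep(1))
qed

end

section \<open>Relations between torsion elements of the dual\<close>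

context smooth_module begin

definition tor where "tor d \<longleftrightarrow> d \<in> carrier DM \<and> sc pL \<odot>\<^bsub>DM\<^esub> d = \<zero>\<^bsub>DM\<^esub>"

lemma tor_W: "\<lbrakk>tor d; h \<in> carrier H\<rbrakk> \<Longrightarrow> pL * W d h i \<in> Oc"
proof -
  assume d: "tor d" and h: "h \<in> carrier H"
  let ?h = "\<alpha> (un (of_int i)) h"
  have "pL \<odot>\<^bsub>Q\<^esub> d ?h = \<zero>\<^bsub>Q\<^esub>"
    using d h sc_smult[of pL d ?h] by (auto simp: tor_def DM_zero)
  then show ?thesis using d h rl[of d ?h] by (simp add: tor_def W_def Q_smult lq_zero_iff)
qed

text \<open>\<open>Ph A x h\<close> lifts the value at \<open>h\<close> of the combination of the elements of \<open>A\<close> with coefficients \<open>x\<close>.\<close>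

definition Ph :: "('h \<Rightarrow> 'l set) set \<Rightarrow> (('h \<Rightarrow> 'l set) \<Rightarrow> 'l poly) \<Rightarrow> 'h \<Rightarrow> 'l" where
  "Ph A x h = (\<Sum>d\<in>A. pact (x d) (W d h) 0)"

lemma O_sum_diff: "(\<And>x. x \<in> A \<Longrightarrow> f x - g x \<in> Oc) \<Longrightarrow> sum f A - sum g A \<in> Oc"
  by (simp add: sum_subtractf[symmetric])

lemma O_cong: "x - y \<in> Oc \<Longrightarrow> x \<in> Oc \<longleftrightarrow> y \<in> Oc"
  using O_add[of "x - y" y] O_diff[of x "x - y"] by auto

context
  fixes A assumes finA: "finite A" and torA: "\<And>d. d \<in> A \<Longrightarrow> tor d"
begin

lemma AD: "d \<in> A \<Longrightarrow> d \<in> carrier DM" using torA by (simp add: tor_def)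

lemma Ph_add:
  assumes "\<And>d. d \<in> A \<Longrightarrow> oP (x d)" "h \<in> carrier H" "h' \<in> carrier H"
  shows "Ph A x (h \<oplus>\<^bsub>H\<^esub> h') - (Ph A x h + Ph A x h') \<in> Oc"
  unfolding Ph_def sum.distrib[symmetric]
proof (rule O_sum_diff)
  fix d assume d: "d \<in> A"
  show "pact (x d) (W d (h \<oplus>\<^bsub>H\<^esub> h')) 0 - (pact (x d) (W d h) 0 + pact (x d) (W d h') 0) \<in> Oc"
    unfolding pact_fun_add[symmetric] by (rule pact_cong_O) (use assms d AD W_add in auto)
qed

lemma Ph_smult:
  assumes "\<And>d. d \<in> A \<Longrightarrow> oP (x d)" "h \<in> carrier H" "c \<in> Oc"
  shows "Ph A x (c \<odot>\<^bsub>H\<^esub> h) - c * Ph A x h \<in> Oc"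
  unfolding Ph_def sum_distrib_left
proof (rule O_sum_diff)
  fix d assume d: "d \<in> A"
  show "pact (x d) (W d (c \<odot>\<^bsub>H\<^esub> h)) 0 - c * pact (x d) (W d h) 0 \<in> Oc"
    unfolding pact_fun_mult[symmetric] by (rule pact_cong_O) (use assms d AD W_smult in auto)
qed

lemma Ph_pL:
  assumes "\<And>d. d \<in> A \<Longrightarrow> oP (x d)" "h \<in> carrier H" shows "pL * Ph A x h \<in> Oc"
  unfolding Ph_def sum_distrib_left pact_fun_mult[symmetric]
  by (intro O_sum pact_O) (use assms torA tor_W in auto)

lemma Ph_zero:
  assumes "\<And>d. d \<in> A \<Longrightarrow> oP (x d)" shows "Ph A x \<zero>\<^bsub>H\<^esub> \<in> Oc"
  using Ph_smult[of x "\<zero>\<^bsub>H\<^esub>" 0] assms by simp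

lemma Ph_cong:
  assumes "\<And>d. d \<in> A \<Longrightarrow> mP (x d - y d)" "h \<in> carrier H"
  shows "Ph A x h - Ph A y h \<in> Oc"
  unfolding Ph_def
proof (rule O_sum_diff)
  fix d assume d: "d \<in> A"
  show "pact (x d) (W d h) 0 - pact (y d) (W d h) 0 \<in> Oc"
    unfolding pact_diff[symmetric] by (rule pact_mP_tors) (use assms d torA tor_W in auto)
qed

lemma Ph_mod:
  assumes "\<And>d. d \<in> A \<Longrightarrow> oP (x d)" "fixed m h"
  shows "Ph A (\<lambda>d. x d mod Tq (p ^ m)) h - Ph A x h \<in> Oc"
  unfolding Ph_def by (rule O_sum_diff) (use assms pact_W_mod in auto)

lemma Ph_gen:
  assumes x: "\<And>d. d \<in> A \<Longrightarrow> oP (x d)"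
    and base: "\<And>i v. v \<in> carrier V \<Longrightarrow> Ph A x (\<alpha> (un (of_int i)) (\<kappa> m v)) \<in> Oc"
    and h: "h \<in> gen m"
  shows "Ph A x h \<in> Oc"
  using h
proof (induction rule: gen_induct)
  case zero then show ?case using Ph_zero x by blast
next
  case (base i w) then show ?case by (rule assms(2))
next
  case (add h h') then show ?case using O_cong[OF Ph_add[of x h h', OF x]] by (simp add: O_add)
next
  case (smult c h) then show ?case using O_cong[OF Ph_smult[of x h c, OF x]] by (simp add: O_mult)
qed

text \<open>On \<open>gen m\<close> a torsion element is determined by the functions attached to
  \<kappa> m v for v in X. Multiplied by p_L these are integral and have period p^m, so
  \<open>linear_dependence\<close> applies with X as set of coordinates.\<close>

lemma dependence_at_level:
  assumes X: "finite X" "X \<subseteq> carrier V" "card X < card A"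
    and gens: "\<And>v. v \<in> carrier V \<Longrightarrow> \<exists>s\<in>Oc. \<not> mm s \<and> s \<odot>\<^bsub>V\<^esub> v \<in> rspan \<O> V X"
  shows "\<exists>x. (\<forall>d\<in>A. oP (x d)) \<and> (\<exists>d\<in>A. \<not> mm (poly (x d) 1)) \<and> (\<forall>h\<in>gen m. Ph A x h \<in> Oc)"
proof -
  define w where "w d v i = (if d \<in> A \<and> v \<in> X then pL * W d (\<kappa> m v) i else 0)" for d v i
  have fx: "v \<in> carrier V \<Longrightarrow> fixed m (\<kappa> m v)" for v using \<kappa>_fixed by (simp add: fixed_def)
  have wO: "w d v i \<in> Oc" for d v i using X torA tor_W by (auto simp: w_def)
  have per: "mm (w d v (i + int (p ^ m)) - w d v i)" for d v i
    using X fx W_periodic[of m "\<kappa> m v" d i] by (auto simp: w_def simp del: of_nat_power)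
  obtain x where x: "\<And>d. oP (x d)" "\<exists>d\<in>A. \<not> mm (poly (x d) 1)"
    and dep: "\<And>v i. v \<in> X \<Longrightarrow> mm (\<Sum>d\<in>A. pact (x d) (w d v) i)"
    using linear_dependence[OF refl X(1) finA X(3), of w m] wO per by blast
  have "Ph A x (\<alpha> (un (of_int i)) (\<kappa> m v)) \<in> Oc" if v: "v \<in> carrier V" for i v
  proof -
    let ?f = "\<lambda>v. Ph A x (\<alpha> (un (of_int i)) (\<kappa> m v))"
    have add: "\<kappa> m (v \<oplus>\<^bsub>V\<^esub> v') = \<kappa> m v \<oplus>\<^bsub>H\<^esub> \<kappa> m v'" if "v \<in> carrier V" "v' \<in> carrier V" for v v'
      using \<kappa>_hom[of m] that by (simp add: module_hom_def)
    have smult: "\<kappa> m (c \<odot>\<^bsub>V\<^esub> v) = c \<odot>\<^bsub>H\<^esub> \<kappa> m v" if "v \<in> carrier V" "c \<in> Oc" for v c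
      using \<kappa>_hom[of m] that by (simp add: module_hom_def)
    have fX: "?f v \<in> Oc" if "v \<in> X" for v
    proof -
      have vV: "v \<in> carrier V" using that X by auto
      have "W d (\<alpha> (un (of_int i)) (\<kappa> m v)) = (\<lambda>j. W d (\<kappa> m v) (j + i))" for d
        by (rule ext) (simp add: W_\<alpha> vV)
      then have "?f v = (\<Sum>d\<in>A. pact (x d) (W d (\<kappa> m v)) i)"
        unfolding Ph_def using pact_shift[of _ "W _ (\<kappa> m v)" i 0] by simp
      moreover have "mm (pL * (\<Sum>d\<in>A. pact (x d) (W d (\<kappa> m v)) i))"
      proof -
        have "pL * (\<Sum>d\<in>A. pact (x d) (W d (\<kappa> m v)) i) = (\<Sum>d\<in>A. pact (x d) (w d v) i)"
          unfolding sum_distrib_left pact_fun_mult[symmetric] using that by (intro sum.cong refl) (simp add: w_def[abs_def])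
        then show ?thesis using dep[OF that] by simp
      qed
      ultimately show ?thesis using pL_nz by (auto simp: mm_def)
    qed
    have span: "?f v \<in> Oc \<and> v \<in> carrier V" if "v \<in> rspan \<O> V X" for v
      using that
    proof (induction rule: rspan.induct)
      case zero
      have "\<kappa> m \<zero>\<^bsub>V\<^esub> = \<zero>\<^bsub>H\<^esub>" using smult[of "\<zero>\<^bsub>V\<^esub>" 0] V.smult_l_null[of "\<zero>\<^bsub>V\<^esub>"] H.smult_l_null[of "\<kappa> m \<zero>\<^bsub>V\<^esub>"] by simp
      then show ?case using Ph_zero x by (simp add: \<alpha>_zero)
    next
      case (incl g) then show ?case using fX X by auto
    next
      case (add v v')
      then have "?f (v \<oplus>\<^bsub>V\<^esub> v') - (?f v + ?f v') \<in> Oc"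
        using Ph_add[of x "\<alpha> (un (of_int i)) (\<kappa> m v)" "\<alpha> (un (of_int i)) (\<kappa> m v')"] x
        by (simp add: \<open>\<And>v v'. \<lbrakk>v \<in> carrier V; v' \<in> carrier V\<rbrakk> \<Longrightarrow> \<kappa> m (v \<oplus>\<^bsub>V\<^esub> v') = \<kappa> m v \<oplus>\<^bsub>H\<^esub> \<kappa> m v'\<close> \<alpha>_add)
      from O_cong[OF this] show ?case using add.IH by (simp add: O_add)
    next
      case (smult c v)
      then have "?f (c \<odot>\<^bsub>V\<^esub> v) - c * ?f v \<in> Oc"
        using Ph_smult[of x "\<alpha> (un (of_int i)) (\<kappa> m v)" c] x
        by (simp add: \<open>\<And>v c. \<lbrakk>v \<in> carrier V; c \<in> Oc\<rbrakk> \<Longrightarrow> \<kappa> m (c \<odot>\<^bsub>V\<^esub> v) = c \<odot>\<^bsub>H\<^esub> \<kappa> m v\<close> \<alpha>_smult)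
      from O_cong[OF this] show ?case using smult by (simp add: O_mult)
    qed
    obtain s where s: "s \<in> Oc" "\<not> mm s" "s \<odot>\<^bsub>V\<^esub> v \<in> rspan \<O> V X" using gens[OF v] by blast
    \<comment> \<open>X spans only a multiple s v, so a priori only s f(v) is integral. But p_L f(v)
      is integral too, and s is invertible modulo p_L, whence f(v) is integral.\<close>
    have "?f (s \<odot>\<^bsub>V\<^esub> v) - s * ?f v \<in> Oc"
      using Ph_smult[of x "\<alpha> (un (of_int i)) (\<kappa> m v)" s] x s v by (simp add: smult \<alpha>_smult)
    from O_cong[OF this] have sO: "s * ?f v \<in> Oc" using span[OF s(3)] by blast
    obtain b where b: "b \<in> Oc" "mm (s * b - 1)" using mm_maximal s by blast
    then obtain c where c: "c \<in> Oc" "s * b - 1 = pL * c" by (auto simp: mm_def)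
    have pO: "pL * ?f v \<in> Oc" using Ph_pL[of x] x v by simp
    have "?f v = b * (s * ?f v) - c * (pL * ?f v)"
      using arg_cong[OF c(2), of "\<lambda>z. z * ?f v"] by (simp add: algebra_simps)
    then show ?thesis using O_diff[OF O_mult[OF b(1) sO] O_mult[OF c(1) pO]] by simp
  qed
  then show ?thesis using x Ph_gen[of x m] by blast
qed

text \<open>A relation holds at each level \<open>m\<close> on \<open>gen m\<close>. The coefficients modulo \<open>p\<^sub>L\<close> range over finite sets, so by Koenig's lemma
  compatible ones can be chosen; these are then corrected to an honest element of the inverse limit.\<close>

lemma dependence:
  assumes X: "finite X" "X \<subseteq> carrier V" "card X < card A"
    and gens: "\<And>v. v \<in> carrier V \<Longrightarrow> \<exists>s\<in>Oc. \<not> mm s \<and> s \<odot>\<^bsub>V\<^esub> v \<in> rspan \<O> V X"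
  shows "\<exists>l. (\<forall>d\<in>A. l d \<in> carrier Lam) \<and> (\<exists>d\<in>A. l d \<in> SS) \<and>
    (\<forall>h m. h \<in> gen m \<longrightarrow> Ph A (\<lambda>d. LP (l d) m) h \<in> Oc)"
proof -
  \<comment> \<open>Normalised relations on \<open>gen m\<close> with coefficients in the finite set
    of representatives; \<open>rr\<close> is the transition map, reduction to level m followed by
    the choice of representatives.\<close>
  define S where "S m = {x \<in> A \<rightarrow>\<^sub>E small_polys (p ^ m). (\<exists>d\<in>A. \<not> mm (poly (x d) 1)) \<and> (\<forall>h\<in>gen m. Ph A x h \<in> Oc)}" for m
  define rr where "rr m x = (\<lambda>d\<in>A. rd (p ^ m) (x d mod Tq (p ^ m)))" for m and x :: "('h \<Rightarrow> 'l set) \<Rightarrow> 'l poly"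
  have rr: "rr m x \<in> S m" if x: "\<forall>d\<in>A. oP (x d)" "\<exists>d\<in>A. \<not> mm (poly (x d) 1)" "\<forall>h\<in>gen m. Ph A x h \<in> Oc" for m x
  proof -
    have m1: "mP (x d mod Tq (p ^ m) - rr m x d)" if "d \<in> A" for d
      using x(1) that oP_divmod(1)[OF q_pos] degree_mod_Tq[OF q_pos] by (auto simp: rr_def intro!: mP_rd)
    have "rr m x \<in> A \<rightarrow>\<^sub>E small_polys (p ^ m)"
      using x(1) oP_divmod(1)[OF q_pos] rd_small[OF q_pos] by (auto simp: rr_def)
    moreover have "\<exists>d\<in>A. \<not> mm (poly (rr m x d) 1)"
    proof -
      obtain d where d: "d \<in> A" "\<not> mm (poly (x d) 1)" using x by blast
      have "mm (poly (x d mod Tq (p ^ m) - rr m x d) 1)" by (rule mP_poly[OF m1]) (use d in auto)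
      then have "mm (poly (x d) 1 - poly (rr m x d) 1)" by (simp add: poly_mod_Tq_1)
      then have "\<not> mm (poly (rr m x d) 1)" using d(2) mm_add[of "poly (x d) 1 - poly (rr m x d) 1" "poly (rr m x d) 1"] by auto
      then show ?thesis using d(1) by blast
    qed
    moreover have "Ph A (rr m x) h \<in> Oc" if h: "h \<in> gen m" for h
    proof -
      have "Ph A (\<lambda>d. x d mod Tq (p ^ m)) h \<in> Oc"
        using O_cong[OF Ph_mod[of x m h]] x h gen_fixed'[OF h] by blast
      then show ?thesis using O_cong[OF Ph_cong[of "\<lambda>d. x d mod Tq (p ^ m)" "rr m x" h]] m1 gen_closed[OF h] by blast
    qed
    ultimately show ?thesis by (simp add: S_def)
  qed
  have "finite (S m)" for m
    using finite_subset[of "S m" "A \<rightarrow>\<^sub>E small_polys (p ^ m)"] finite_PiE[OF finA, of "\<lambda>_. small_polys (p ^ m)"] finite_small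
    by (auto simp: S_def)
  moreover have "S m \<noteq> {}" for m
    using dependence_at_level[OF X gens, of m] rr by blast
  moreover have "rr m x \<in> S m" if "x \<in> S (Suc m)" for m x
    using that gen_Suc by (intro rr) (auto simp: S_def intro: oP_small)
  ultimately obtain s where s: "\<And>m. s m \<in> S m" "\<And>m. rr m (s (Suc m)) = s m"
    using koenig[of S rr] by blast
  have so: "d \<in> A \<Longrightarrow> oP (s m d)" "d \<in> A \<Longrightarrow> degree (s m d) < p ^ m" for d m
    using s(1)[of m] by (auto simp: S_def small_polys_def intro!: oP_small[of _ "p ^ m"])
  \<comment> \<open>The chosen polynomials are coherent only modulo p_L. Subtracting the defect of
    the reduction makes level m + 1 reduce exactly to level m; the defect is divisible by p_L, so
    the relations persist.\<close>
  define P where "P d = rec_nat (s 0 d) (\<lambda>m Pm. s (Suc m) d - (s (Suc m) d mod Tq (p ^ m) - Pm))" for d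
  have P0: "P d 0 = s 0 d" and PS: "P d (Suc m) = s (Suc m) d - (s (Suc m) d mod Tq (p ^ m) - P d m)" for d m
    by (simp_all add: P_def)
  have P: "oP (P d m) \<and> degree (P d m) < p ^ m \<and> mP (P d m - s m d)" if d: "d \<in> A" for d m
  proof (induction m)
    case 0 then show ?case using so(1)[OF d, of 0] so(2)[OF d, of 0] by (simp add: P0)
  next
    case (Suc m)
    let ?E = "s (Suc m) d mod Tq (p ^ m) - P d m"
    have o1: "oP (s (Suc m) d mod Tq (p ^ m))" by (rule oP_divmod(1)[OF q_pos so(1)[OF d]])
    have "degree ?E < p ^ m" using degree_mod_Tq[OF q_pos, of "s (Suc m) d"] Suc by (intro degree_diff_less) auto
    also have "p ^ m < p ^ Suc m" using p_gt_1 by simp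
    finally have dE: "degree ?E < p ^ Suc m" .
    have "s m d = rd (p ^ m) (s (Suc m) d mod Tq (p ^ m))" using s(2)[of m, symmetric] d by (simp add: rr_def)
    then have "mP (s (Suc m) d mod Tq (p ^ m) - s m d)" using mP_rd[OF o1 degree_mod_Tq[OF q_pos]] by simp
    from mP_diff[OF this conjunct2[OF conjunct2[OF Suc]]] have mE: "mP ?E" by simp
    show ?case unfolding PS
      using so[OF d] o1 Suc dE mP_minus[OF mE] degree_diff_less[OF so(2)[OF d, of "Suc m"] dE] by auto
  qed
  have Pmod: "P d (Suc m) mod Tq (p ^ m) = P d m" if "d \<in> A" for d m
    unfolding PS using P[OF that, of m] by (simp add: poly_mod_diff_left mod_poly_small)
  define l where "l d = mkL (P d)" for d
  have l: "l d \<in> carrier Lam" "LP (l d) m = P d m" if "d \<in> A" for d m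
    unfolding l_def using mkL[of "P d"] P[OF that] Pmod[OF that] by blast+
  have "\<exists>d\<in>A. l d \<in> SS"
  proof -
    \<comment> \<open>Nontriviality of the limit is read off at level 0, where the normalisation at
      T = 1 is still available.\<close>
    obtain d where d: "d \<in> A" "\<not> mm (poly (s 0 d) 1)" using s(1)[of 0] by (auto simp: S_def)
    then have "\<not> mP (LP (l d) 0)" using l[OF d(1)] mP_poly[of "s 0 d" 1] by (auto simp: P0)
    then show ?thesis using d l by (auto simp: SS_iff)
  qed
  moreover have "Ph A (\<lambda>d. LP (l d) m) h \<in> Oc" if h: "h \<in> gen m" for h m
  proof -
    have "Ph A (s m) h \<in> Oc" using s(1)[of m] h by (auto simp: S_def)
    moreover have "Ph A (\<lambda>d. LP (l d) m) h - Ph A (s m) h \<in> Oc"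
      by (rule Ph_cong) (use l P gen_closed[OF h] in auto)
    ultimately show ?thesis using O_cong by blast
  qed
  ultimately show ?thesis using l by blast
qed

end

text \<open>By \<open>dependence\<close> an independent set of torsion elements has at most
  \<open>card X\<close> members. A largest one closes up to the whole torsion, and
  \<open>generators_from_torsion\<close> turns it into generators of the dual up to S.\<close>

theorem generators_DM:
  assumes X: "finite X" "X \<subseteq> carrier V"
    and gens: "\<And>v. v \<in> carrier V \<Longrightarrow> \<exists>s\<in>Oc. \<not> mm s \<and> s \<odot>\<^bsub>V\<^esub> v \<in> rspan \<O> V X"
    and ann: "s0 \<in> Oc" "\<not> mm s0" "\<And>h. h \<in> carrier H \<Longrightarrow> (s0 * pL ^ k) \<odot>\<^bsub>H\<^esub> h = \<zero>\<^bsub>H\<^esub>"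
  shows "\<exists>G\<subseteq>carrier DM. finite G \<and> card G \<le> card X \<and> (\<forall>d\<in>carrier DM. \<exists>s\<in>SS. s \<odot>\<^bsub>DM\<^esub> d \<in> rspan Lam DM G)"
proof -
  interpret L: cring Lam by (rule cring_Lam)
  interpret DM: Module.module Lam DM by (rule module_DM)
  interpret MS: mult_subset Lam SS by (rule mult_subset_SS)
  interpret S: module_sat Lam DM SS "sc pL"
    by unfold_locales (use sc_carrier cover_S in auto)
  have tors: "d \<in> S.tors \<longleftrightarrow> tor d" for d by (simp add: S.tors_def tor_def)
  have card_indep: "card A \<le> card X" if ind: "S.indep A" for A
  proof (rule ccontr)
    assume "\<not> card A \<le> card X"
    then have card: "card X < card A" by simp
    have A: "finite A" "\<And>d. d \<in> A \<Longrightarrow> tor d" using ind tors by (auto simp: S.indep_def)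
    obtain l where l: "\<And>d. d \<in> A \<Longrightarrow> l d \<in> carrier Lam" "\<exists>d\<in>A. l d \<in> SS"
      "\<And>h m. h \<in> gen m \<Longrightarrow> Ph A (\<lambda>d. LP (l d) m) h \<in> Oc"
      using dependence[OF A X card gens] by blast
    have AD: "A \<subseteq> carrier DM" using A by (auto simp: tor_def)
    then have lD: "l d \<odot>\<^bsub>DM\<^esub> d \<in> carrier DM" if "d \<in> A" for d using l that by auto
    have fs: "(\<Oplus>\<^bsub>DM\<^esub>d\<in>B. l d \<odot>\<^bsub>DM\<^esub> d) h = lq (Ph B (\<lambda>d. LP (l d) m) h)"
      if "B \<subseteq> A" "h \<in> gen m" for B h m
      using finite_subset[OF that(1) A(1)] that
    proof (induction B rule: finite_induct)
      case empty then show ?case using gen_closed[of h m] by (simp add: DM_zero Ph_def Q_zero)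
    next
      case (insert b B)
      have "(\<Oplus>\<^bsub>DM\<^esub>d\<in>insert b B. l d \<odot>\<^bsub>DM\<^esub> d) = l b \<odot>\<^bsub>DM\<^esub> b \<oplus>\<^bsub>DM\<^esub> (\<Oplus>\<^bsub>DM\<^esub>d\<in>B. l d \<odot>\<^bsub>DM\<^esub> d)"
        using insert lD by (intro DM.finsum_insert) auto
      then show ?case
        using insert gen_closed[of h m] DM_smult[of b "l b" m h] gen_fixed'[of h m] AD l
        by (auto simp: DM_add Ph_def Q_add)
    qed
    have zero: "(\<Oplus>\<^bsub>DM\<^esub>d\<in>A. l d \<odot>\<^bsub>DM\<^esub> d) = \<zero>\<^bsub>DM\<^esub>"
    proof (rule extensionalityI[OF DM_ext(1) DM_ext(3)])
      show "(\<Oplus>\<^bsub>DM\<^esub>d\<in>A. l d \<odot>\<^bsub>DM\<^esub> d) \<in> carrier DM" using lD by (intro DM.finsum_closed) auto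
      fix h assume h: "h \<in> carrier H"
      then obtain m where m: "h \<in> gen m" using gen_ex by blast
      show "(\<Oplus>\<^bsub>DM\<^esub>d\<in>A. l d \<odot>\<^bsub>DM\<^esub> d) h = \<zero>\<^bsub>DM\<^esub> h"
        using fs[OF order.refl m] l(3)[OF m] h by (simp add: DM_zero lq_zero_iff)
    qed
    obtain d where d: "d \<in> A" "l d \<in> SS" using l by blast
    let ?B = "A - {d}"
    let ?y = "\<Oplus>\<^bsub>DM\<^esub>d\<in>?B. l d \<odot>\<^bsub>DM\<^esub> d"
    have yc: "?y \<in> carrier DM" using lD by (intro DM.finsum_closed) auto
    have "(\<Oplus>\<^bsub>DM\<^esub>d\<in>insert d ?B. l d \<odot>\<^bsub>DM\<^esub> d) = l d \<odot>\<^bsub>DM\<^esub> d \<oplus>\<^bsub>DM\<^esub> ?y"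
      using A(1) lD d by (intro DM.finsum_insert) auto
    then have "l d \<odot>\<^bsub>DM\<^esub> d \<oplus>\<^bsub>DM\<^esub> ?y = \<zero>\<^bsub>DM\<^esub>" using zero d by (simp add: insert_absorb)
    then have eq: "l d \<odot>\<^bsub>DM\<^esub> d = (\<ominus>\<^bsub>Lam\<^esub> \<one>\<^bsub>Lam\<^esub>) \<odot>\<^bsub>DM\<^esub> ?y"
      using yc lD d DM.minus_equality[of "l d \<odot>\<^bsub>DM\<^esub> d" ?y] by (simp add: DM.smult_l_minus)
    have "(\<Oplus>\<^bsub>DM\<^esub>d\<in>C. l d \<odot>\<^bsub>DM\<^esub> d) \<in> rspan Lam DM ?B" if "C \<subseteq> ?B" for C
      using finite_subset[OF that] A(1) that
    proof (induction C rule: infinite_finite_induct)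
      case (insert c C)
      then have "(\<Oplus>\<^bsub>DM\<^esub>d\<in>insert c C. l d \<odot>\<^bsub>DM\<^esub> d) = l c \<odot>\<^bsub>DM\<^esub> c \<oplus>\<^bsub>DM\<^esub> (\<Oplus>\<^bsub>DM\<^esub>d\<in>C. l d \<odot>\<^bsub>DM\<^esub> d)"
        using lD by (intro DM.finsum_insert) auto
      moreover have "l c \<odot>\<^bsub>DM\<^esub> c \<in> rspan Lam DM ?B" using insert.prems l by (intro rspan.smult rspan.incl) auto
      moreover have "(\<Oplus>\<^bsub>DM\<^esub>d\<in>C. l d \<odot>\<^bsub>DM\<^esub> d) \<in> rspan Lam DM ?B" using insert by blast
      ultimately show ?case by (simp only: rspan.add)
    qed (simp_all add: rspan.zero)
    then have "l d \<odot>\<^bsub>DM\<^esub> d \<in> rspan Lam DM ?B" unfolding eq by (intro rspan.smult) auto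
    \<comment> \<open>The relation solved for the element d whose coefficient lies in S puts d into
      the closure of the others.\<close>
    then have "d \<in> S.cl ?B" using d AD by (intro S.cl_I[of d "l d"]) auto
    then show False using ind d by (auto simp: S.indep_def)
  qed
  obtain E where E: "S.indep E" "\<And>B. S.indep B \<Longrightarrow> card B \<le> card E"
  proof -
    have "S.indep {}" by (simp add: S.indep_def)
    then show ?thesis using that ex_has_greatest_nat[of S.indep "{}" card "card X + 1"] card_indep
      by (metis Suc_eq_plus1 le_imp_less_Suc)
  qed
  have tE: "S.tors \<subseteq> S.cl E"
  proof (rule subsetI, rule ccontr)
    fix x assume x: "x \<in> S.tors" "x \<notin> S.cl E"
    then have ins: "S.indep (insert x E)" using E by (intro S.indep_insert) auto
    have ED: "E \<subseteq> S.tors" "finite E" using E by (auto simp: S.indep_def)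
    have "x \<notin> E" using x S.cl_incl[of E x] ED S.tors_carrier by blast
    then show False using E(2)[OF ins] ED by simp
  qed
  have pw: "sc pL [^]\<^bsub>Lam\<^esub> j = sc (pL ^ j)" for j :: nat
  proof (induction j)
    case 0 show ?case by (rule LP_inj) (auto simp: sc_carrier LP_sc LP_simps iw_closed one_pCons)
  next
    case (Suc j)
    then have "sc pL [^]\<^bsub>Lam\<^esub> Suc j = sc pL \<otimes>\<^bsub>Lam\<^esub> sc (pL ^ j)"
      using sc_carrier[of pL] sc_carrier[of "pL ^ j"] by (simp add: L.m_comm)
    also have "\<dots> = sc (pL ^ Suc j)"
      using sc_carrier by (intro LP_inj) (auto simp: LP_sc_mult LP_sc iw_closed)
    finally show ?case .
  qed
  have s0: "sc s0 \<in> SS" using ann(1,2) by (auto simp: SS_iff sc_carrier LP_sc mP_const)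
  \<comment> \<open>By linearity a scalar that kills H kills every homomorphism on H.\<close>
  have "sc s0 \<odot>\<^bsub>DM\<^esub> (sc pL [^]\<^bsub>Lam\<^esub> k \<odot>\<^bsub>DM\<^esub> d) = \<zero>\<^bsub>DM\<^esub>" if d: "d \<in> carrier DM" for d
  proof (rule extensionalityI[OF DM_ext(1) DM_ext(3)])
    have d': "sc (pL ^ k) \<odot>\<^bsub>DM\<^esub> d \<in> carrier DM" using d sc_carrier by simp
    then show "sc s0 \<odot>\<^bsub>DM\<^esub> (sc pL [^]\<^bsub>Lam\<^esub> k \<odot>\<^bsub>DM\<^esub> d) \<in> carrier DM" unfolding pw using ann sc_carrier by simp
    fix h assume h: "h \<in> carrier H"
    have "(sc s0 \<odot>\<^bsub>DM\<^esub> (sc (pL ^ k) \<odot>\<^bsub>DM\<^esub> d)) h = lq (s0 * pL ^ k * rl d h)"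
      using d d' h ann(1) rl[OF d h] by (simp add: sc_smult Q_smult mult.assoc)
    also have "\<dots> = d ((s0 * pL ^ k) \<odot>\<^bsub>H\<^esub> h)"
      using d h ann(1) rl[OF d h] by (simp add: DM_carrier Q_smult)
    also have "\<dots> = d (0 \<odot>\<^bsub>H\<^esub> h)" using ann(3)[OF h] H.smult_l_null[OF h] by simp
    also have "\<dots> = \<zero>\<^bsub>Q\<^esub>" using d h rl[OF d h] O_zero by (auto simp: DM_carrier Q_smult Q_zero simp del: O_zero)
    finally show "(sc s0 \<odot>\<^bsub>DM\<^esub> (sc pL [^]\<^bsub>Lam\<^esub> k \<odot>\<^bsub>DM\<^esub> d)) h = \<zero>\<^bsub>DM\<^esub> h" using h by (simp add: pw DM_zero)
  qed
  moreover have "S.submod (carrier DM)" by (simp add: S.submod_def)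
  moreover have "finite E" "E \<subseteq> S.tors" using E by (auto simp: S.indep_def)
  ultimately obtain G where "G \<subseteq> carrier DM" "finite G" "card G \<le> card E" "carrier DM \<subseteq> S.cl G"
    using S.generators_from_torsion[of "carrier DM" "sc s0" k E] s0 tE by blast
  then show ?thesis using card_indep[OF E(1)] by (intro exI[of _ G]) (auto simp: S.cl_def)
qed

end

section \<open>Direct sums and quotients of modules\<close>

lemma (in Module.module) smult_minus_one: "v \<in> carrier M \<Longrightarrow> (\<ominus> \<one>) \<odot>\<^bsub>M\<^esub> v = \<ominus>\<^bsub>M\<^esub> v"
  by (simp add: smult_l_minus)

locale module_family = cring R for R :: "('a, 'c) ring_scheme" (structure) +
  fixes I :: "'i set" and M :: "'i \<Rightarrow> ('a, 'm, 'd) module_scheme"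
  assumes fam: "i \<in> I \<Longrightarrow> Module.module R (M i)"
begin

abbreviation DS where "DS \<equiv> dsum_module I M"
definition single :: "'i \<Rightarrow> 'm \<Rightarrow> 'i \<Rightarrow> 'm" where
  "single x v = (\<lambda>i\<in>I. if i = x then v else \<zero>\<^bsub>M i\<^esub>)"

lemma fam_simps:
  assumes "i \<in> I"
  shows "\<zero>\<^bsub>M i\<^esub> \<in> carrier (M i)"
    "\<lbrakk>v \<in> carrier (M i); w \<in> carrier (M i)\<rbrakk> \<Longrightarrow> v \<oplus>\<^bsub>M i\<^esub> w \<in> carrier (M i)"
    "v \<in> carrier (M i) \<Longrightarrow> \<zero>\<^bsub>M i\<^esub> \<oplus>\<^bsub>M i\<^esub> v = v" "v \<in> carrier (M i) \<Longrightarrow> v \<oplus>\<^bsub>M i\<^esub> \<zero>\<^bsub>M i\<^esub> = v"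
    "v \<in> carrier (M i) \<Longrightarrow> \<ominus>\<^bsub>M i\<^esub> v \<in> carrier (M i)" "v \<in> carrier (M i) \<Longrightarrow> \<ominus>\<^bsub>M i\<^esub> v \<oplus>\<^bsub>M i\<^esub> v = \<zero>\<^bsub>M i\<^esub>"
    "\<lbrakk>r \<in> carrier R; v \<in> carrier (M i)\<rbrakk> \<Longrightarrow> r \<odot>\<^bsub>M i\<^esub> v \<in> carrier (M i)"
    "r \<in> carrier R \<Longrightarrow> r \<odot>\<^bsub>M i\<^esub> \<zero>\<^bsub>M i\<^esub> = \<zero>\<^bsub>M i\<^esub>"
    "\<ominus>\<^bsub>M i\<^esub> \<zero>\<^bsub>M i\<^esub> = \<zero>\<^bsub>M i\<^esub>"
proof -
  interpret Module.module R "M i" using fam assms by blast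
  show "\<zero>\<^bsub>M i\<^esub> \<in> carrier (M i)" "\<ominus>\<^bsub>M i\<^esub> \<zero>\<^bsub>M i\<^esub> = \<zero>\<^bsub>M i\<^esub>"
    "\<lbrakk>v \<in> carrier (M i); w \<in> carrier (M i)\<rbrakk> \<Longrightarrow> v \<oplus>\<^bsub>M i\<^esub> w \<in> carrier (M i)"
    "v \<in> carrier (M i) \<Longrightarrow> \<zero>\<^bsub>M i\<^esub> \<oplus>\<^bsub>M i\<^esub> v = v" "v \<in> carrier (M i) \<Longrightarrow> v \<oplus>\<^bsub>M i\<^esub> \<zero>\<^bsub>M i\<^esub> = v"
    "v \<in> carrier (M i) \<Longrightarrow> \<ominus>\<^bsub>M i\<^esub> v \<in> carrier (M i)" "v \<in> carrier (M i) \<Longrightarrow> \<ominus>\<^bsub>M i\<^esub> v \<oplus>\<^bsub>M i\<^esub> v = \<zero>\<^bsub>M i\<^esub>"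
    "\<lbrakk>r \<in> carrier R; v \<in> carrier (M i)\<rbrakk> \<Longrightarrow> r \<odot>\<^bsub>M i\<^esub> v \<in> carrier (M i)"
    "r \<in> carrier R \<Longrightarrow> r \<odot>\<^bsub>M i\<^esub> \<zero>\<^bsub>M i\<^esub> = \<zero>\<^bsub>M i\<^esub>"
    by (simp_all add: M.l_neg)
qed

lemma fam_ac:
  assumes "i \<in> I"
  shows "\<lbrakk>v \<in> carrier (M i); w \<in> carrier (M i)\<rbrakk> \<Longrightarrow> v \<oplus>\<^bsub>M i\<^esub> w = w \<oplus>\<^bsub>M i\<^esub> v"
    "\<lbrakk>v \<in> carrier (M i); w \<in> carrier (M i); u \<in> carrier (M i)\<rbrakk> \<Longrightarrow> v \<oplus>\<^bsub>M i\<^esub> w \<oplus>\<^bsub>M i\<^esub> u = v \<oplus>\<^bsub>M i\<^esub> (w \<oplus>\<^bsub>M i\<^esub> u)"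
proof -
  interpret Module.module R "M i" using fam assms by blast
  show "\<lbrakk>v \<in> carrier (M i); w \<in> carrier (M i)\<rbrakk> \<Longrightarrow> v \<oplus>\<^bsub>M i\<^esub> w = w \<oplus>\<^bsub>M i\<^esub> v" by (rule M.a_comm)
  show "\<lbrakk>v \<in> carrier (M i); w \<in> carrier (M i); u \<in> carrier (M i)\<rbrakk> \<Longrightarrow> v \<oplus>\<^bsub>M i\<^esub> w \<oplus>\<^bsub>M i\<^esub> u = v \<oplus>\<^bsub>M i\<^esub> (w \<oplus>\<^bsub>M i\<^esub> u)"
    by (rule M.a_assoc)
qed

lemma DS_carrier: "f \<in> carrier DS \<longleftrightarrow> f \<in> extensional I \<and> (\<forall>i\<in>I. f i \<in> carrier (M i)) \<and> finite {i \<in> I. f i \<noteq> \<zero>\<^bsub>M i\<^esub>}"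
  by (auto simp: dsum_module_def PiE_def)

lemma DS_simps: "i \<in> I \<Longrightarrow> (f \<oplus>\<^bsub>DS\<^esub> g) i = f i \<oplus>\<^bsub>M i\<^esub> g i" "i \<in> I \<Longrightarrow> (r \<odot>\<^bsub>DS\<^esub> f) i = r \<odot>\<^bsub>M i\<^esub> f i"
  "i \<in> I \<Longrightarrow> \<zero>\<^bsub>DS\<^esub> i = \<zero>\<^bsub>M i\<^esub>"
  "f \<oplus>\<^bsub>DS\<^esub> g \<in> extensional I" "r \<odot>\<^bsub>DS\<^esub> f \<in> extensional I" "\<zero>\<^bsub>DS\<^esub> \<in> extensional I"
  by (simp_all add: dsum_module_def)

lemma DS_support:
  assumes "finite {i \<in> I. f i \<noteq> \<zero>\<^bsub>M i\<^esub>}" "finite {i \<in> I. g i \<noteq> \<zero>\<^bsub>M i\<^esub>}"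
    and "\<And>i. \<lbrakk>i \<in> I; f i = \<zero>\<^bsub>M i\<^esub>; g i = \<zero>\<^bsub>M i\<^esub>\<rbrakk> \<Longrightarrow> h i = \<zero>\<^bsub>M i\<^esub>"
  shows "finite {i \<in> I. h i \<noteq> \<zero>\<^bsub>M i\<^esub>}"
  by (rule finite_subset[OF _ finite_UnI[OF assms(1,2)]]) (use assms(3) in blast)

lemma module_dsum: "Module.module R DS"
proof (rule moduleI)
  show "cring R" by unfold_locales
  show "abelian_group DS"
  proof (rule abelian_groupI)
    fix f g assume f: "f \<in> carrier DS" and g: "g \<in> carrier DS"
    have "finite {i \<in> I. (f \<oplus>\<^bsub>DS\<^esub> g) i \<noteq> \<zero>\<^bsub>M i\<^esub>}"
      by (rule DS_support[of f g]) (use f g in \<open>auto simp: DS_carrier DS_simps fam_simps\<close>)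
    then show "f \<oplus>\<^bsub>DS\<^esub> g \<in> carrier DS" using f g by (auto simp: DS_carrier DS_simps fam_simps)
    show "f \<oplus>\<^bsub>DS\<^esub> g = g \<oplus>\<^bsub>DS\<^esub> f"
      by (rule extensionalityI[of _ I]) (use f g in \<open>auto simp: DS_carrier DS_simps fam_ac(1)\<close>)
    fix h assume h: "h \<in> carrier DS"
    show "f \<oplus>\<^bsub>DS\<^esub> g \<oplus>\<^bsub>DS\<^esub> h = f \<oplus>\<^bsub>DS\<^esub> (g \<oplus>\<^bsub>DS\<^esub> h)"
      by (rule extensionalityI[of _ I]) (use f g h in \<open>auto simp: DS_carrier DS_simps fam_ac(2)\<close>)
  next
    show "\<zero>\<^bsub>DS\<^esub> \<in> carrier DS" unfolding DS_carrier by (simp add: DS_simps fam_simps cong: conj_cong)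
    fix f assume f: "f \<in> carrier DS"
    show "\<zero>\<^bsub>DS\<^esub> \<oplus>\<^bsub>DS\<^esub> f = f"
      by (rule extensionalityI[of _ I]) (use f in \<open>auto simp: DS_carrier DS_simps fam_simps\<close>)
    let ?g = "\<lambda>i\<in>I. \<ominus>\<^bsub>M i\<^esub> f i"
    have "finite {i \<in> I. ?g i \<noteq> \<zero>\<^bsub>M i\<^esub>}"
      by (rule DS_support[of f f]) (use f in \<open>auto simp: DS_carrier fam_simps\<close>)
    then have "?g \<in> carrier DS" using f by (auto simp: DS_carrier fam_simps)
    moreover have "?g \<oplus>\<^bsub>DS\<^esub> f = \<zero>\<^bsub>DS\<^esub>"
      by (rule extensionalityI[of _ I]) (use f in \<open>auto simp: DS_carrier DS_simps fam_simps\<close>)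
    ultimately show "\<exists>g\<in>carrier DS. g \<oplus>\<^bsub>DS\<^esub> f = \<zero>\<^bsub>DS\<^esub>" by blast
  qed
next
  fix r f assume r: "r \<in> carrier R" and f: "f \<in> carrier DS"
  have "finite {i \<in> I. (r \<odot>\<^bsub>DS\<^esub> f) i \<noteq> \<zero>\<^bsub>M i\<^esub>}"
    by (rule DS_support[of f f]) (use f r in \<open>auto simp: DS_carrier DS_simps fam_simps\<close>)
  then show "r \<odot>\<^bsub>DS\<^esub> f \<in> carrier DS" using f r by (auto simp: DS_carrier DS_simps fam_simps)
  fix s assume s: "s \<in> carrier R"
  show "(r \<oplus> s) \<odot>\<^bsub>DS\<^esub> f = r \<odot>\<^bsub>DS\<^esub> f \<oplus>\<^bsub>DS\<^esub> s \<odot>\<^bsub>DS\<^esub> f"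
    by (rule extensionalityI[of _ I])
      (use f r s in \<open>auto simp: DS_carrier DS_simps module.smult_l_distr[OF fam]\<close>)
  show "(r \<otimes> s) \<odot>\<^bsub>DS\<^esub> f = r \<odot>\<^bsub>DS\<^esub> (s \<odot>\<^bsub>DS\<^esub> f)"
    by (rule extensionalityI[of _ I])
      (use f r s in \<open>auto simp: DS_carrier DS_simps module.smult_assoc1[OF fam]\<close>)
next
  fix r f g assume "r \<in> carrier R" "f \<in> carrier DS" "g \<in> carrier DS"
  then show "r \<odot>\<^bsub>DS\<^esub> (f \<oplus>\<^bsub>DS\<^esub> g) = r \<odot>\<^bsub>DS\<^esub> f \<oplus>\<^bsub>DS\<^esub> r \<odot>\<^bsub>DS\<^esub> g"
    by (intro extensionalityI[of _ I]) (auto simp: DS_carrier DS_simps module.smult_r_distr[OF fam])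
next
  fix f assume "f \<in> carrier DS"
  then show "\<one> \<odot>\<^bsub>DS\<^esub> f = f"
    by (intro extensionalityI[of _ I]) (auto simp: DS_carrier DS_simps module.smult_one[OF fam])
qed

lemma single_closed: "\<lbrakk>x \<in> I; v \<in> carrier (M x)\<rbrakk> \<Longrightarrow> single x v \<in> carrier DS"
proof -
  assume x: "x \<in> I" "v \<in> carrier (M x)"
  have "{i \<in> I. single x v i \<noteq> \<zero>\<^bsub>M i\<^esub>} \<subseteq> {x}" by (auto simp: single_def)
  then have "finite {i \<in> I. single x v i \<noteq> \<zero>\<^bsub>M i\<^esub>}" by (rule finite_subset) simp
  then show ?thesis using x unfolding DS_carrier by (simp add: single_def fam_simps(1))
qed

lemma single_add: "\<lbrakk>x \<in> I; v \<in> carrier (M x); w \<in> carrier (M x)\<rbrakk> \<Longrightarrow>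
    single x (v \<oplus>\<^bsub>M x\<^esub> w) = single x v \<oplus>\<^bsub>DS\<^esub> single x w"
  by (rule extensionalityI[of _ I]) (auto simp: single_def DS_simps fam_simps)

lemma single_smult: "\<lbrakk>x \<in> I; r \<in> carrier R; v \<in> carrier (M x)\<rbrakk> \<Longrightarrow>
    single x (r \<odot>\<^bsub>M x\<^esub> v) = r \<odot>\<^bsub>DS\<^esub> single x v"
  by (rule extensionalityI[of _ I]) (auto simp: single_def DS_simps fam_simps)

lemma DS_induct [consumes 1, case_names zero single add]:
  assumes "f \<in> carrier DS" and zero: "P \<zero>\<^bsub>DS\<^esub>" and sg: "\<And>x v. \<lbrakk>x \<in> I; v \<in> carrier (M x)\<rbrakk> \<Longrightarrow> P (single x v)"
    and add: "\<And>f g. \<lbrakk>f \<in> carrier DS; g \<in> carrier DS; P f; P g\<rbrakk> \<Longrightarrow> P (f \<oplus>\<^bsub>DS\<^esub> g)"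
  shows "P f"
proof -
  have "finite B \<Longrightarrow> f \<in> carrier DS \<Longrightarrow> {i \<in> I. f i \<noteq> \<zero>\<^bsub>M i\<^esub>} \<subseteq> B \<Longrightarrow> P f" for B f
  proof (induction B arbitrary: f rule: finite_induct)
    case empty
    then have "f = \<zero>\<^bsub>DS\<^esub>" by (intro extensionalityI[of _ I]) (auto simp: DS_carrier DS_simps)
    then show ?case using zero by simp
  next
    case (insert b B)
    show ?case
    proof (cases "b \<in> I")
      case False then show ?thesis using insert by auto
    next
      case True
      define g where "g = (\<lambda>i\<in>I. if i = b then \<zero>\<^bsub>M i\<^esub> else f i)"
      have "finite {i \<in> I. g i \<noteq> \<zero>\<^bsub>M i\<^esub>}"
        by (rule DS_support[of f f]) (use insert in \<open>auto simp: DS_carrier g_def\<close>)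
      then have g: "g \<in> carrier DS" using insert.prems by (auto simp: DS_carrier g_def fam_simps)
      have fb: "f b \<in> carrier (M b)" using True insert by (auto simp: DS_carrier)
      have "f = single b (f b) \<oplus>\<^bsub>DS\<^esub> g"
        by (rule extensionalityI[of _ I])
          (use insert.prems True in \<open>auto simp: DS_carrier DS_simps g_def single_def fam_simps\<close>)
      moreover have "P g" using insert.prems by (intro insert.IH g) (auto simp: g_def)
      ultimately show ?thesis using add[OF single_closed[OF True fb] g sg[OF True fb]] by simp
    qed
  qed
  then show ?thesis using assms(1) unfolding DS_carrier by blast
qed

end

locale quotient_by = Module.module R M for R :: "('a, 'c) ring_scheme" (structure) and M :: "('a, 'm, 'd) module_scheme" +
  fixes K assumes K_sub: "K \<subseteq> carrier M" and K_zero: "\<zero>\<^bsub>M\<^esub> \<in> K"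
    and K_add: "\<lbrakk>x \<in> K; y \<in> K\<rbrakk> \<Longrightarrow> x \<oplus>\<^bsub>M\<^esub> y \<in> K" and K_smult: "\<lbrakk>r \<in> carrier R; x \<in> K\<rbrakk> \<Longrightarrow> r \<odot>\<^bsub>M\<^esub> x \<in> K"
begin

abbreviation QM where "QM \<equiv> quot_module M K"
abbreviation cs where "cs v \<equiv> K +>\<^bsub>M\<^esub> v"

lemma K_minus: "x \<in> K \<Longrightarrow> \<ominus>\<^bsub>M\<^esub> x \<in> K"
proof -
  assume x: "x \<in> K"
  then have "(\<ominus> \<one>) \<odot>\<^bsub>M\<^esub> x \<in> K" by (intro K_smult) simp
  then show ?thesis using smult_minus_one x K_sub by (metis subsetD)
qed

sublocale K: abelian_subgroup K M
proof (rule abelian_subgroupI3)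
  show "additive_subgroup K M"
  proof (rule additive_subgroup.intro)
    show "subgroup K (add_monoid M)"
    proof (rule group.subgroupI[OF M.a_group])
      show "K \<noteq> {}" using K_zero by blast
      fix a assume "a \<in> K"
      then show "inv\<^bsub>add_monoid M\<^esub> a \<in> K" using K_minus by (simp add: a_inv_def)
      fix b assume "b \<in> K"
      then show "a \<otimes>\<^bsub>add_monoid M\<^esub> b \<in> K" using K_add \<open>a \<in> K\<close> by simp
    qed (use K_sub in simp)
  qed
  show "abelian_group M" by unfold_locales
qed

lemma cs_eq_iff: "\<lbrakk>v \<in> carrier M; w \<in> carrier M\<rbrakk> \<Longrightarrow> cs v = cs w \<longleftrightarrow> v \<ominus>\<^bsub>M\<^esub> w \<in> K"
proof
  assume vw: "v \<in> carrier M" "w \<in> carrier M"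
  { assume "cs v = cs w"
    then have "v \<in> cs w" using K.a_rcos_self[OF vw(1)] by simp
    then show "v \<ominus>\<^bsub>M\<^esub> w \<in> K" using K.a_rcos_module[OF vw(2,1)] by (simp add: a_minus_def) }
  { assume "v \<ominus>\<^bsub>M\<^esub> w \<in> K"
    then have "v \<in> cs w" using K.a_rcos_module[OF vw(2,1)] by (simp add: a_minus_def)
    then show "cs v = cs w" using K.a_repr_independence'[OF _ vw(2)] by simp }
qed

lemma QM_carrier: "carrier QM = cs ` carrier M"
  by (auto simp: quot_module_def A_RCOSETS_def')

lemma QM_zero: "\<zero>\<^bsub>QM\<^esub> = cs \<zero>\<^bsub>M\<^esub>"
  using K_sub by (simp add: quot_module_def)

lemma QM_add: "\<lbrakk>v \<in> carrier M; w \<in> carrier M\<rbrakk> \<Longrightarrow> cs v \<oplus>\<^bsub>QM\<^esub> cs w = cs (v \<oplus>\<^bsub>M\<^esub> w)"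
  using K.a_rcos_sum by (simp add: quot_module_def)

lemma QM_smult: "\<lbrakk>r \<in> carrier R; v \<in> carrier M\<rbrakk> \<Longrightarrow> r \<odot>\<^bsub>QM\<^esub> cs v = cs (r \<odot>\<^bsub>M\<^esub> v)"
proof -
  assume r: "r \<in> carrier R" and v: "v \<in> carrier M"
  have "cs (r \<odot>\<^bsub>M\<^esub> w) = cs (r \<odot>\<^bsub>M\<^esub> v)" if w: "w \<in> cs v" for w
  proof -
    have wc: "w \<in> carrier M" using w K.a_elemrcos_carrier[OF v] by blast
    have "w \<ominus>\<^bsub>M\<^esub> v \<in> K" using w K.a_rcos_module[OF v wc] by (simp add: a_minus_def)
    then have "r \<odot>\<^bsub>M\<^esub> (w \<ominus>\<^bsub>M\<^esub> v) \<in> K" using K_smult r by blast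
    then show ?thesis using r v wc by (simp add: cs_eq_iff a_minus_def smult_r_distr smult_r_minus)
  qed
  moreover have "v \<in> cs v" using K.a_rcos_self[OF v] .
  ultimately have "(\<Union>w\<in>cs v. cs (r \<odot>\<^bsub>M\<^esub> w)) = cs (r \<odot>\<^bsub>M\<^esub> v)" by blast
  then show ?thesis by (simp add: quot_module_def)
qed

lemma module_QM: "Module.module R QM"
proof (rule moduleI)
  show "cring R" by unfold_locales
  show "abelian_group QM"
  proof (rule abelian_groupI)
    fix x assume "x \<in> carrier QM"
    then obtain v where "v \<in> carrier M" "x = cs v" by (auto simp: QM_carrier)
    then show "\<exists>y\<in>carrier QM. y \<oplus>\<^bsub>QM\<^esub> x = \<zero>\<^bsub>QM\<^esub>"
      by (intro bexI[of _ "cs (\<ominus>\<^bsub>M\<^esub> v)"]) (auto simp: QM_carrier QM_add QM_zero M.l_neg)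
  qed (auto simp: QM_carrier QM_add QM_zero M.a_ac)
qed (auto simp: QM_carrier QM_smult QM_add smult_l_distr smult_r_distr smult_assoc1)

end

lemma restrict_scalars_simps [simp]:
  "carrier (restrict_scalars h M) = carrier M" "\<zero>\<^bsub>restrict_scalars h M\<^esub> = \<zero>\<^bsub>M\<^esub>"
  "x \<oplus>\<^bsub>restrict_scalars h M\<^esub> y = x \<oplus>\<^bsub>M\<^esub> y" "r \<odot>\<^bsub>restrict_scalars h M\<^esub> x = h r \<odot>\<^bsub>M\<^esub> x"
  by (simp_all add: restrict_scalars_def)

lemma module_restrict_scalars:
  assumes "cring S" "Module.module R M" "h \<in> ring_hom S R" shows "Module.module S (restrict_scalars h M)"
proof -
  interpret Module.module R M by (rule assms)
  interpret S: cring S by (rule assms)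
  note h = ring_hom_closed[OF assms(3)] ring_hom_add[OF assms(3)] ring_hom_mult[OF assms(3)] ring_hom_one[OF assms(3)]
  show ?thesis
  proof (rule moduleI)
    show "abelian_group (restrict_scalars h M)"
    proof (rule abelian_groupI)
      fix x assume "x \<in> carrier (restrict_scalars h M)"
      then show "\<exists>y\<in>carrier (restrict_scalars h M). y \<oplus>\<^bsub>restrict_scalars h M\<^esub> x = \<zero>\<^bsub>restrict_scalars h M\<^esub>"
        using M.l_neg by auto
    qed (auto simp: M.a_ac)
  qed (auto simp: h smult_l_distr smult_r_distr smult_assoc1 assms)
qed

section \<open>Homology of coefficient systems\<close>

locale coeff = int_ext p nrm emb pL
  for p :: nat and nrm :: "'q::field_char_0 \<Rightarrow> real" and emb :: "'q \<Rightarrow> 'l::field" and pL :: 'l +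
  fixes J :: "'l set" and F :: "('q, 'l set, 'm) coeff_sys"
  assumes J: "ideal J (int_ring nrm emb)"
    and equiv: "equivariant_coefficient_system p nrm NTgrp (int_ring nrm emb Quot J) F"
    and H2: "Hyp2 p nrm F" and H3: "Hyp3 p nrm F"
begin

abbreviation RJ where "RJ \<equiv> \<O> Quot J"
abbreviation Y where "Y \<equiv> X0plus nrm"
abbreviation EY where "EY \<equiv> edges_on p nrm Y"
abbreviation Fx where "Fx x \<equiv> sec F {x}"

lemma cring_RJ: "cring RJ"
  using ideal.quotient_is_cring[OF J cring_O] .

lemma coeff_sys: "coefficient_system p nrm RJ F"
  using equiv by (simp add: equivariant_coefficient_system_def)

lemma module_vertex: "x \<in> X0 nrm \<Longrightarrow> Module.module RJ (Fx x)"
  using coeff_sys by (auto simp: coefficient_system_def simplices_def)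

lemma module_edge: "s \<in> X1 p nrm \<Longrightarrow> Module.module RJ (sec F s)"
  using coeff_sys by (auto simp: coefficient_system_def simplices_def)

lemma res_hom:
  assumes "s \<in> X1 p nrm" "x \<in> s"
  shows "u \<in> carrier (sec F s) \<Longrightarrow> res F s x u \<in> carrier (Fx x)"
    "\<lbrakk>u \<in> carrier (sec F s); u' \<in> carrier (sec F s)\<rbrakk> \<Longrightarrow> res F s x (u \<oplus>\<^bsub>sec F s\<^esub> u') = res F s x u \<oplus>\<^bsub>Fx x\<^esub> res F s x u'"
    "\<lbrakk>r \<in> carrier RJ; u \<in> carrier (sec F s)\<rbrakk> \<Longrightarrow> res F s x (r \<odot>\<^bsub>sec F s\<^esub> u) = r \<odot>\<^bsub>Fx x\<^esub> res F s x u"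
proof -
  have "res F s x \<in> module_hom RJ (sec F s) (Fx x)"
    using coeff_sys assms unfolding coefficient_system_def by blast
  then show "u \<in> carrier (sec F s) \<Longrightarrow> res F s x u \<in> carrier (Fx x)"
    "\<lbrakk>u \<in> carrier (sec F s); u' \<in> carrier (sec F s)\<rbrakk> \<Longrightarrow> res F s x (u \<oplus>\<^bsub>sec F s\<^esub> u') = res F s x u \<oplus>\<^bsub>Fx x\<^esub> res F s x u'"
    "\<lbrakk>r \<in> carrier RJ; u \<in> carrier (sec F s)\<rbrakk> \<Longrightarrow> res F s x (r \<odot>\<^bsub>sec F s\<^esub> u) = r \<odot>\<^bsub>Fx x\<^esub> res F s x u"
    by (auto simp: module_hom_def)
qed

lemma act_hom:
  assumes "g \<in> NTgrp" "x \<in> X0 nrm"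
  shows "u \<in> carrier (Fx x) \<Longrightarrow> act F g {x} u \<in> carrier (Fx (vact g x))"
    "\<lbrakk>u \<in> carrier (Fx x); u' \<in> carrier (Fx x)\<rbrakk> \<Longrightarrow> act F g {x} (u \<oplus>\<^bsub>Fx x\<^esub> u') = act F g {x} u \<oplus>\<^bsub>Fx (vact g x)\<^esub> act F g {x} u'"
    "\<lbrakk>r \<in> carrier RJ; u \<in> carrier (Fx x)\<rbrakk> \<Longrightarrow> act F g {x} (r \<odot>\<^bsub>Fx x\<^esub> u) = r \<odot>\<^bsub>Fx (vact g x)\<^esub> act F g {x} u"
proof -
  have "{x} \<in> simplices p nrm" using assms by (simp add: simplices_def)
  then have "act F g {x} \<in> module_hom RJ (Fx x) (sec F (sact g {x}))"
    using equiv assms(1) unfolding equivariant_coefficient_system_def by blast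
  then show "u \<in> carrier (Fx x) \<Longrightarrow> act F g {x} u \<in> carrier (Fx (vact g x))"
    "\<lbrakk>u \<in> carrier (Fx x); u' \<in> carrier (Fx x)\<rbrakk> \<Longrightarrow> act F g {x} (u \<oplus>\<^bsub>Fx x\<^esub> u') = act F g {x} u \<oplus>\<^bsub>Fx (vact g x)\<^esub> act F g {x} u'"
    "\<lbrakk>r \<in> carrier RJ; u \<in> carrier (Fx x)\<rbrakk> \<Longrightarrow> act F g {x} (r \<odot>\<^bsub>Fx x\<^esub> u) = r \<odot>\<^bsub>Fx (vact g x)\<^esub> act F g {x} u"
    by (auto simp: module_hom_def sact_def)
qed

lemma act_edge: "\<lbrakk>g \<in> NTgrp; s \<in> X1 p nrm; u \<in> carrier (sec F s)\<rbrakk> \<Longrightarrow> act F g s u \<in> carrier (sec F (sact g s))"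
proof -
  assume a: "g \<in> NTgrp" "s \<in> X1 p nrm" "u \<in> carrier (sec F s)"
  then have "s \<in> simplices p nrm" by (simp add: simplices_def)
  then have "act F g s \<in> module_hom RJ (sec F s) (sec F (sact g s))"
    using equiv a(1) unfolding equivariant_coefficient_system_def by blast
  then show ?thesis using a(3) by (auto simp: module_hom_def)
qed

lemma act_one: "\<lbrakk>x \<in> X0 nrm; u \<in> carrier (Fx x)\<rbrakk> \<Longrightarrow> act F (mat 1) {x} u = u"
  using equiv by (auto simp: equivariant_coefficient_system_def simplices_def)

lemma act_comp: "\<lbrakk>g \<in> NTgrp; h \<in> NTgrp; x \<in> X0 nrm; u \<in> carrier (Fx x)\<rbrakk> \<Longrightarrow>
    act F g {vact h x} (act F h {x} u) = act F (g ** h) {x} u"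
proof -
  assume a: "g \<in> NTgrp" "h \<in> NTgrp" "x \<in> X0 nrm" "u \<in> carrier (Fx x)"
  have "{x} \<in> simplices p nrm" using a by (simp add: simplices_def)
  then have "act F g (sact h {x}) (act F h {x} u) = act F (g ** h) {x} u"
    using equiv a unfolding equivariant_coefficient_system_def by blast
  then show ?thesis by (simp add: sact_def)
qed

lemma act_res: "\<lbrakk>g \<in> NTgrp; s \<in> X1 p nrm; x \<in> s; u \<in> carrier (sec F s)\<rbrakk> \<Longrightarrow>
    act F g {x} (res F s x u) = res F (sact g s) (vact g x) (act F g s u)"
  using equiv unfolding equivariant_coefficient_system_def by blast

lemma aff_NT: "a \<noteq> 0 \<Longrightarrow> mat2 a b 0 1 \<in> NTgrp"
proof -
  assume "a \<noteq> 0"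
  moreover have "mat2 a b 0 1 = mat2 1 b 0 1 ** mat2 a 0 0 1" by (simp add: mat2_mult)
  ultimately show ?thesis unfolding NTgrp_def Ngrp_def Tgrp_def by blast
qed

lemma un_NT: "un b \<in> NTgrp" by (simp add: un_def aff_NT)

lemma vact_un: "vact (un b) (vx a c) = vx a (c + b)" by (simp add: un_def vact_vx)

lemma vact_un_X0: "x \<in> X0 nrm \<Longrightarrow> vact (un b) x \<in> X0 nrm"
  by (elim X0_cases) (simp add: vact_un)

lemma vact_un_un: "vact (un b) (vact (un c) x) = vact (un (b + c)) x"
  by (simp add: vact_mult[symmetric] un_mult)

lemma vact_un_0: "vact (un 0) x = x" by (simp add: un_0)

lemma vact_un_inj: "vact (un b) x = vact (un b) y \<longleftrightarrow> x = y"
  by (metis vact_un_un vact_un_0 add.left_inverse)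

lemma vact_un_Y: "\<lbrakk>b \<in> Zp nrm; x \<in> Y\<rbrakk> \<Longrightarrow> vact (un b) x \<in> Y"
proof -
  assume b: "b \<in> Zp nrm" and "x \<in> Y"
  then obtain a c where "x = vx a c" "a \<noteq> 0" "a \<in> Zp nrm" "c \<in> Zp nrm" by (auto simp: X0plus_vx)
  then have "vact (un b) x = vx a (c + b)" "c + b \<in> Zp nrm" using b by (simp_all add: vact_un)
  then show ?thesis using \<open>a \<noteq> 0\<close> \<open>a \<in> Zp nrm\<close> unfolding X0plus_vx by blast
qed

lemma Y_X0: "x \<in> Y \<Longrightarrow> x \<in> X0 nrm" using X0plus_X0 by blast

lemma EY_X1: "s \<in> EY \<Longrightarrow> s \<in> X1 p nrm" by (simp add: edges_on_def)

lemma sact_un_X1: "s \<in> X1 p nrm \<Longrightarrow> sact (un b) s \<in> X1 p nrm"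
  unfolding X1_vx
proof (elim CollectE exE conjE)
  fix a c assume "s = {vx a c, vx (a / of_nat p) c}" "a \<noteq> 0"
  then show "sact (un b) s \<in> {{vx a b, vx (a / of_nat p) b} | a b. a \<noteq> 0}"
    by (intro CollectI exI[of _ a] exI[of _ "c + b"]) (simp add: sact_def vact_un)
qed

lemma sact_un_EY: "\<lbrakk>b \<in> Zp nrm; s \<in> EY\<rbrakk> \<Longrightarrow> sact (un b) s \<in> EY"
  using sact_un_X1 vact_un_Y by (auto simp: edges_on_def sact_def)

sublocale C0: module_family RJ Y Fx
  by (intro module_family.intro cring_RJ module_family_axioms.intro module_vertex Y_X0)

sublocale C1: module_family RJ EY "sec F"
  by (intro module_family.intro cring_RJ module_family_axioms.intro module_edge EY_X1)

abbreviation bd where "bd \<equiv> boundary p nrm F Y"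

text \<open>The boundary is defined as a sum over the support of the chain. Enlarging the index set
  lets two chains be compared over common edges, as needed for additivity.\<close>

lemma bd_at:
  assumes f: "f \<in> carrier C1.DS" and x: "x \<in> Y" and B: "finite B" "B \<subseteq> {s \<in> EY. x \<in> s}"
    "\<And>s. \<lbrakk>s \<in> EY; x \<in> s; f s \<noteq> \<zero>\<^bsub>sec F s\<^esub>\<rbrakk> \<Longrightarrow> s \<in> B"
  shows "bd f x = (\<Oplus>\<^bsub>Fx x\<^esub>s\<in>B. res F s x (f s))"
proof -
  interpret M: Module.module RJ "Fx x" using module_vertex Y_X0 x by blast
  have fs: "f s \<in> carrier (sec F s)" if "s \<in> EY" for s using f that by (simp add: C1.DS_carrier)
  have zero: "res F s x \<zero>\<^bsub>sec F s\<^esub> = \<zero>\<^bsub>Fx x\<^esub>" if "s \<in> EY" "x \<in> s" for s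
  proof -
    interpret N: Module.module RJ "sec F s" using module_edge EY_X1 that by blast
    show ?thesis using res_hom(3)[OF EY_X1[OF that(1)] that(2), of "\<zero>\<^bsub>RJ\<^esub>" "\<zero>\<^bsub>sec F s\<^esub>"]
        res_hom(1)[OF EY_X1[OF that(1)] that(2), of "\<zero>\<^bsub>sec F s\<^esub>"] by simp
  qed
  have "bd f x = (\<Oplus>\<^bsub>Fx x\<^esub>s\<in>{s \<in> EY. x \<in> s \<and> f s \<noteq> \<zero>\<^bsub>sec F s\<^esub>}. res F s x (f s))"
    using x by (simp add: boundary_def)
  also have "\<dots> = (\<Oplus>\<^bsub>Fx x\<^esub>s\<in>B. res F s x (f s))"
    by (rule M.add.finprod_mono_neutral_cong_left) (use B zero fs res_hom(1) EY_X1 in auto)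
  finally show ?thesis .
qed

lemma finite_supp: "f \<in> carrier C1.DS \<Longrightarrow> finite {s \<in> EY. f s \<noteq> \<zero>\<^bsub>sec F s\<^esub>}"
  by (simp add: C1.DS_carrier)

lemma bd_ext: "bd f \<in> extensional Y" by (simp add: boundary_def)

lemma bd_closed: "f \<in> carrier C1.DS \<Longrightarrow> bd f \<in> carrier C0.DS"
  unfolding C0.DS_carrier
proof (intro conjI ballI)
  assume f: "f \<in> carrier C1.DS"
  let ?S = "{s \<in> EY. f s \<noteq> \<zero>\<^bsub>sec F s\<^esub>}"
  show "bd f \<in> extensional Y" by (rule bd_ext)
  {
    fix x assume x: "x \<in> Y"
    interpret M: Module.module RJ "Fx x" using module_vertex Y_X0 x by blast
    show "bd f x \<in> carrier (Fx x)"
      using x f EY_X1 res_hom(1) by (auto simp: boundary_def C1.DS_carrier intro!: M.finsum_closed)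
  }
  \<comment> \<open>The boundary can be nonzero only at endpoints of edges in the support of
    f.\<close>
  have "{x \<in> Y. bd f x \<noteq> \<zero>\<^bsub>Fx x\<^esub>} \<subseteq> \<Union> ?S"
  proof
    fix x assume x: "x \<in> {x \<in> Y. bd f x \<noteq> \<zero>\<^bsub>Fx x\<^esub>}"
    interpret M: Module.module RJ "Fx x" using module_vertex Y_X0 x by blast
    have "{s \<in> EY. x \<in> s \<and> f s \<noteq> \<zero>\<^bsub>sec F s\<^esub>} \<noteq> {}"
    proof
      assume "{s \<in> EY. x \<in> s \<and> f s \<noteq> \<zero>\<^bsub>sec F s\<^esub>} = {}"
      then have "bd f x = \<zero>\<^bsub>Fx x\<^esub>" using x bd_at[OF f, of x "{}"] by auto
      then show False using x by simp
    qed
    then show "x \<in> \<Union> ?S" by auto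
  qed
  moreover have "finite (\<Union> ?S)"
    using finite_supp[OF f] by (rule finite_Union) (auto dest!: EY_X1 simp: X1_vx)
  ultimately show "finite {x \<in> Y. bd f x \<noteq> \<zero>\<^bsub>Fx x\<^esub>}" by (rule finite_subset)
qed

lemma bd_add: "\<lbrakk>f \<in> carrier C1.DS; g \<in> carrier C1.DS\<rbrakk> \<Longrightarrow> bd (f \<oplus>\<^bsub>C1.DS\<^esub> g) = bd f \<oplus>\<^bsub>C0.DS\<^esub> bd g"
proof (rule extensionalityI[OF bd_ext C0.DS_simps(4)])
  fix x assume f: "f \<in> carrier C1.DS" and g: "g \<in> carrier C1.DS" and x: "x \<in> Y"
  interpret M: Module.module RJ "Fx x" using module_vertex Y_X0 x by blast
  interpret D: Module.module RJ C1.DS by (rule C1.module_dsum)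
  let ?B = "{s \<in> EY. x \<in> s \<and> (f s \<noteq> \<zero>\<^bsub>sec F s\<^esub> \<or> g s \<noteq> \<zero>\<^bsub>sec F s\<^esub>)}"
  have fin: "finite ?B"
    by (rule finite_subset[OF _ finite_UnI[OF finite_supp[OF f] finite_supp[OF g]]]) auto
  have fg: "f \<oplus>\<^bsub>C1.DS\<^esub> g \<in> carrier C1.DS" using f g by simp
  have car: "s \<in> EY \<Longrightarrow> f s \<in> carrier (sec F s) \<and> g s \<in> carrier (sec F s)" for s using f g by (simp add: C1.DS_carrier)
  have rc: "\<lbrakk>s \<in> EY; x \<in> s\<rbrakk> \<Longrightarrow> res F s x (f s) \<in> carrier (Fx x) \<and> res F s x (g s) \<in> carrier (Fx x)" for s
    using res_hom(1)[OF EY_X1] car by blast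
  have "bd (f \<oplus>\<^bsub>C1.DS\<^esub> g) x = (\<Oplus>\<^bsub>Fx x\<^esub>s\<in>?B. res F s x ((f \<oplus>\<^bsub>C1.DS\<^esub> g) s))"
  proof (rule bd_at[OF fg x fin])
    fix s assume s: "s \<in> EY" "x \<in> s" "(f \<oplus>\<^bsub>C1.DS\<^esub> g) s \<noteq> \<zero>\<^bsub>sec F s\<^esub>"
    then show "s \<in> ?B" using C1.fam_simps(1,3)[OF s(1)] by (auto simp: C1.DS_simps)
  qed auto
  also have "\<dots> = (\<Oplus>\<^bsub>Fx x\<^esub>s\<in>?B. res F s x (f s) \<oplus>\<^bsub>Fx x\<^esub> res F s x (g s))"
    by (rule M.finsum_cong') (use car rc res_hom(2)[OF EY_X1] in \<open>auto simp: C1.DS_simps\<close>)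
  also have "\<dots> = (\<Oplus>\<^bsub>Fx x\<^esub>s\<in>?B. res F s x (f s)) \<oplus>\<^bsub>Fx x\<^esub> (\<Oplus>\<^bsub>Fx x\<^esub>s\<in>?B. res F s x (g s))"
    by (rule M.finsum_addf) (use rc in auto)
  also have "\<dots> = (bd f \<oplus>\<^bsub>C0.DS\<^esub> bd g) x"
  proof -
    have "bd f x = (\<Oplus>\<^bsub>Fx x\<^esub>s\<in>?B. res F s x (f s))" by (rule bd_at[OF f x fin]) auto
    moreover have "bd g x = (\<Oplus>\<^bsub>Fx x\<^esub>s\<in>?B. res F s x (g s))" by (rule bd_at[OF g x fin]) auto
    ultimately show ?thesis using x by (simp add: C0.DS_simps)
  qed
  finally show "bd (f \<oplus>\<^bsub>C1.DS\<^esub> g) x = (bd f \<oplus>\<^bsub>C0.DS\<^esub> bd g) x" .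
qed

lemma bd_smult: "\<lbrakk>r \<in> carrier RJ; f \<in> carrier C1.DS\<rbrakk> \<Longrightarrow> bd (r \<odot>\<^bsub>C1.DS\<^esub> f) = r \<odot>\<^bsub>C0.DS\<^esub> bd f"
proof (rule extensionalityI[OF bd_ext C0.DS_simps(5)])
  fix x assume r: "r \<in> carrier RJ" and f: "f \<in> carrier C1.DS" and x: "x \<in> Y"
  interpret M: Module.module RJ "Fx x" using module_vertex Y_X0 x by blast
  interpret D: Module.module RJ C1.DS by (rule C1.module_dsum)
  let ?B = "{s \<in> EY. x \<in> s \<and> f s \<noteq> \<zero>\<^bsub>sec F s\<^esub>}"
  have fin: "finite ?B" by (rule finite_subset[OF _ finite_supp[OF f]]) auto
  have rf: "r \<odot>\<^bsub>C1.DS\<^esub> f \<in> carrier C1.DS" using f r by simp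
  have car: "s \<in> EY \<Longrightarrow> f s \<in> carrier (sec F s)" for s using f by (simp add: C1.DS_carrier)
  have rc: "\<lbrakk>s \<in> EY; x \<in> s\<rbrakk> \<Longrightarrow> res F s x (f s) \<in> carrier (Fx x)" for s
    using res_hom(1)[OF EY_X1] car by blast
  have "bd (r \<odot>\<^bsub>C1.DS\<^esub> f) x = (\<Oplus>\<^bsub>Fx x\<^esub>s\<in>?B. res F s x ((r \<odot>\<^bsub>C1.DS\<^esub> f) s))"
  proof (rule bd_at[OF rf x fin])
    fix s assume s: "s \<in> EY" "x \<in> s" "(r \<odot>\<^bsub>C1.DS\<^esub> f) s \<noteq> \<zero>\<^bsub>sec F s\<^esub>"
    then show "s \<in> ?B" using C1.fam_simps(8)[OF s(1) r] by (auto simp: C1.DS_simps)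
  qed auto
  also have "\<dots> = (\<Oplus>\<^bsub>Fx x\<^esub>s\<in>?B. r \<odot>\<^bsub>Fx x\<^esub> res F s x (f s))"
    by (rule M.finsum_cong') (use car r rc res_hom(3)[OF EY_X1] in \<open>auto simp: C1.DS_simps\<close>)
  also have "\<dots> = r \<odot>\<^bsub>Fx x\<^esub> (\<Oplus>\<^bsub>Fx x\<^esub>s\<in>?B. res F s x (f s))"
    by (rule M.finsum_smult_ldistr[symmetric]) (use rc r fin in auto)
  also have "\<dots> = (r \<odot>\<^bsub>C0.DS\<^esub> bd f) x"
  proof -
    have "bd f x = (\<Oplus>\<^bsub>Fx x\<^esub>s\<in>?B. res F s x (f s))" by (rule bd_at[OF f x fin]) auto
    then show ?thesis using x by (simp add: C0.DS_simps)
  qed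
  finally show "bd (r \<odot>\<^bsub>C1.DS\<^esub> f) x = (r \<odot>\<^bsub>C0.DS\<^esub> bd f) x" .
qed

lemma bd_single:
  assumes s: "s \<in> EY" "s = {w, y}" "w \<noteq> y" and u: "u \<in> carrier (sec F s)"
  shows "bd (C1.single s u) = C0.single w (res F s w u) \<oplus>\<^bsub>C0.DS\<^esub> C0.single y (res F s y u)"
proof (rule extensionalityI[OF bd_ext C0.DS_simps(4)])
  fix x assume x: "x \<in> Y"
  interpret M: Module.module RJ "Fx x" using module_vertex Y_X0 x by blast
  let ?B = "{s} \<inter> {s. x \<in> s}"
  have "bd (C1.single s u) x = (\<Oplus>\<^bsub>Fx x\<^esub>s'\<in>?B. res F s' x (C1.single s u s'))"
    by (rule bd_at[OF C1.single_closed[OF s(1) u] x]) (use s(1) in \<open>auto simp: C1.single_def split: if_splits\<close>)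
  also have "\<dots> = (if x \<in> s then res F s x u else \<zero>\<^bsub>Fx x\<^esub>)"
  proof (cases "x \<in> s")
    case True
    then have "?B = {s}" by auto
    moreover have "res F s x u \<in> carrier (Fx x)" using res_hom(1)[OF EY_X1] s(1) True u by blast
    ultimately show ?thesis using True s(1) M.finsum_insert[of "{}" s "\<lambda>s'. res F s' x (C1.single s u s')"]
      by (simp add: C1.single_def)
  next
    case False
    then have "?B = {}" by auto
    then show ?thesis using False by simp
  qed
  also have "\<dots> = (C0.single w (res F s w u) \<oplus>\<^bsub>C0.DS\<^esub> C0.single y (res F s y u)) x"
  proof -
    have r: "x \<in> s \<Longrightarrow> res F s x u \<in> carrier (Fx x)" using res_hom(1)[OF EY_X1[OF s(1)] _ u] .
    consider "x = w" | "x = y" | "x \<noteq> w" "x \<noteq> y" by blast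
    then show ?thesis
    proof cases
      case 1
      then have "x \<in> s" "x \<noteq> y" using s by auto
      then show ?thesis using x r 1[symmetric] C0.fam_simps(4)[OF x] by (simp add: C0.DS_simps C0.single_def)
    next
      case 2
      then have "x \<in> s" "x \<noteq> w" using s by auto
      then show ?thesis using x r 2[symmetric] C0.fam_simps(3)[OF x] by (simp add: C0.DS_simps C0.single_def)
    next
      case 3
      then have "x \<notin> s" using s by auto
      then show ?thesis using x 3 C0.fam_simps(1,3)[OF x] by (simp add: C0.DS_simps C0.single_def)
    qed
  qed
  finally show "bd (C1.single s u) x = (C0.single w (res F s w u) \<oplus>\<^bsub>C0.DS\<^esub> C0.single y (res F s y u)) x" .
qed

definition BB where "BB = bd ` carrier C1.DS"

sublocale HQ: quotient_by RJ C0.DS BB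
proof (intro quotient_by.intro C0.module_dsum quotient_by_axioms.intro)
  interpret D1: Module.module RJ C1.DS by (rule C1.module_dsum)
  interpret D0: Module.module RJ C0.DS by (rule C0.module_dsum)
  show "BB \<subseteq> carrier C0.DS" by (auto simp: BB_def bd_closed)
  have "bd \<zero>\<^bsub>C1.DS\<^esub> = \<zero>\<^bsub>C0.DS\<^esub>"
    using bd_smult[of "\<zero>\<^bsub>RJ\<^esub>" "\<zero>\<^bsub>C1.DS\<^esub>"] bd_closed[of "\<zero>\<^bsub>C1.DS\<^esub>"] by simp
  then show "\<zero>\<^bsub>C0.DS\<^esub> \<in> BB" unfolding BB_def by (intro image_eqI[of _ _ "\<zero>\<^bsub>C1.DS\<^esub>"]) auto
  show "\<And>x y. \<lbrakk>x \<in> BB; y \<in> BB\<rbrakk> \<Longrightarrow> x \<oplus>\<^bsub>C0.DS\<^esub> y \<in> BB"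
    unfolding BB_def by (auto simp: bd_add[symmetric])
  show "\<And>r x. \<lbrakk>r \<in> carrier RJ; x \<in> BB\<rbrakk> \<Longrightarrow> r \<odot>\<^bsub>C0.DS\<^esub> x \<in> BB"
    unfolding BB_def by (auto simp: bd_smult[symmetric])
qed

abbreviation HH where "HH \<equiv> H0 p nrm F Y"

lemma HH_eq: "HH = HQ.QM" by (simp add: H0_def BB_def)

definition cls where "cls x v = HQ.cs (C0.single x v)"

lemma cls_closed: "\<lbrakk>x \<in> Y; v \<in> carrier (Fx x)\<rbrakk> \<Longrightarrow> cls x v \<in> carrier HH"
  by (simp add: HH_eq HQ.QM_carrier cls_def C0.single_closed)

lemma cls_add: "\<lbrakk>x \<in> Y; v \<in> carrier (Fx x); w \<in> carrier (Fx x)\<rbrakk> \<Longrightarrow> cls x (v \<oplus>\<^bsub>Fx x\<^esub> w) = cls x v \<oplus>\<^bsub>HH\<^esub> cls x w"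
  by (simp add: HH_eq cls_def HQ.QM_add C0.single_add C0.single_closed)

lemma cls_smult: "\<lbrakk>x \<in> Y; r \<in> carrier RJ; v \<in> carrier (Fx x)\<rbrakk> \<Longrightarrow> cls x (r \<odot>\<^bsub>Fx x\<^esub> v) = r \<odot>\<^bsub>HH\<^esub> cls x v"
  by (simp add: HH_eq cls_def HQ.QM_smult C0.single_smult C0.single_closed)

lemma HH_induct [consumes 1, case_names zero cls add]:
  assumes "h \<in> carrier HH" "P \<zero>\<^bsub>HH\<^esub>" "\<And>x v. \<lbrakk>x \<in> Y; v \<in> carrier (Fx x)\<rbrakk> \<Longrightarrow> P (cls x v)"
    "\<And>h h'. \<lbrakk>h \<in> carrier HH; h' \<in> carrier HH; P h; P h'\<rbrakk> \<Longrightarrow> P (h \<oplus>\<^bsub>HH\<^esub> h')"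
  shows "P h"
proof -
  obtain c where c: "c \<in> carrier C0.DS" "h = HQ.cs c" using assms(1) by (auto simp: HH_eq HQ.QM_carrier)
  from c(1) have "P (HQ.cs c)"
  proof (induction rule: C0.DS_induct)
    case zero then show ?case using assms(2) by (simp add: HH_eq HQ.QM_zero)
  next
    case (single x v) then show ?case using assms(3) by (simp add: cls_def)
  next
    case (add f g)
    then show ?case using assms(4)[of "HQ.cs f" "HQ.cs g"] by (simp add: HH_eq HQ.QM_carrier HQ.QM_add)
  qed
  then show ?thesis using c by simp
qed

text \<open>The boundary of a chain on a single edge. In homology it moves a class from one endpoint
  to the other with a change of sign.\<close>

lemma cls_edge:
  assumes s: "{w, y} \<in> EY" "w \<noteq> y" and u: "u \<in> carrier (sec F {w, y})"
  shows "cls w (res F {w, y} w u) \<oplus>\<^bsub>HH\<^esub> cls y (res F {w, y} y u) = \<zero>\<^bsub>HH\<^esub>"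
proof -
  have wy: "w \<in> Y" "y \<in> Y" using s by (auto simp: edges_on_def)
  have r: "res F {w, y} w u \<in> carrier (Fx w)" "res F {w, y} y u \<in> carrier (Fx y)"
    using res_hom(1)[OF EY_X1[OF s(1)]] u by auto
  have "cls w (res F {w, y} w u) \<oplus>\<^bsub>HH\<^esub> cls y (res F {w, y} y u) = HQ.cs (bd (C1.single {w, y} u))"
    using wy r bd_single[OF s(1) refl s(2) u] by (simp add: HH_eq cls_def HQ.QM_add C0.single_closed)
  also have "\<dots> = BB" by (rule HQ.K.a_rcos_const) (use s u in \<open>auto simp: BB_def C1.single_closed\<close>)
  also have "\<dots> = \<zero>\<^bsub>HH\<^esub>" by (simp add: HH_eq quot_module_def)
  finally show ?thesis .
qed

section \<open>The action of N0 on chains and on homology\<close>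

definition ga where "ga b c = (\<lambda>y\<in>Y. act F (un b) {vact (un (- b)) y} (c (vact (un (- b)) y)))"

lemma ga_at:
  assumes "b \<in> Zp nrm" "c \<in> carrier C0.DS" "y \<in> Y"
  shows "ga b c (vact (un b) y) = act F (un b) {y} (c y)"
  using assms vact_un_Y[of b y] by (simp add: ga_def vact_un_un vact_un_0)

lemma Y_vact: "\<lbrakk>b \<in> Zp nrm; y \<in> Y\<rbrakk> \<Longrightarrow> \<exists>x\<in>Y. y = vact (un b) x"
  using vact_un_Y[of "- b" y] by (intro bexI[of _ "vact (un (- b)) y"]) (auto simp: vact_un_un vact_un_0)

lemma act_zero: "\<lbrakk>g \<in> NTgrp; x \<in> X0 nrm; vact g x \<in> X0 nrm\<rbrakk> \<Longrightarrow> act F g {x} \<zero>\<^bsub>Fx x\<^esub> = \<zero>\<^bsub>Fx (vact g x)\<^esub>"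
proof -
  assume a: "g \<in> NTgrp" "x \<in> X0 nrm" "vact g x \<in> X0 nrm"
  interpret M: Module.module RJ "Fx x" using module_vertex a by blast
  interpret N: Module.module RJ "Fx (vact g x)" using module_vertex a by blast
  show ?thesis using act_hom(3)[OF a(1,2), of "\<zero>\<^bsub>RJ\<^esub>" "\<zero>\<^bsub>Fx x\<^esub>"] act_hom(1)[OF a(1,2), of "\<zero>\<^bsub>Fx x\<^esub>"] by simp
qed

text \<open>The translation permutes the vertices of X_+, so equality may be checked at translated
  vertices, where \<open>ga_at\<close> evaluates the action without inverses.\<close>

lemma ga_extI:
  assumes "b \<in> Zp nrm" "f \<in> extensional Y" "g \<in> extensional Y" "\<And>y. y \<in> Y \<Longrightarrow> f (vact (un b) y) = g (vact (un b) y)"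
  shows "f = g"
  by (rule extensionalityI[OF assms(2,3)]) (use Y_vact[OF assms(1)] assms(4) in blast)

lemma ga_ext: "ga b c \<in> extensional Y" by (simp add: ga_def)

lemma ga_closed: "\<lbrakk>b \<in> Zp nrm; c \<in> carrier C0.DS\<rbrakk> \<Longrightarrow> ga b c \<in> carrier C0.DS"
  unfolding C0.DS_carrier[of "ga b c"]
proof (intro conjI ballI)
  assume b: "b \<in> Zp nrm" and c: "c \<in> carrier C0.DS"
  have cy: "c y \<in> carrier (Fx y)" if "y \<in> Y" for y using c that by (simp add: C0.DS_carrier)
  show "ga b c \<in> extensional Y" by (rule ga_ext)
  fix y assume "y \<in> Y"
  then obtain x where x: "x \<in> Y" "y = vact (un b) x" using Y_vact b by blast
  show "ga b c y \<in> carrier (Fx y)" unfolding x(2) ga_at[OF b c x(1)] by (rule act_hom(1)) (use x cy Y_X0 un_NT in auto)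
next
  assume b: "b \<in> Zp nrm" and c: "c \<in> carrier C0.DS"
  have "{y \<in> Y. ga b c y \<noteq> \<zero>\<^bsub>Fx y\<^esub>} \<subseteq> vact (un b) ` {y \<in> Y. c y \<noteq> \<zero>\<^bsub>Fx y\<^esub>}"
  proof
    fix y assume y: "y \<in> {y \<in> Y. ga b c y \<noteq> \<zero>\<^bsub>Fx y\<^esub>}"
    then obtain x where x: "x \<in> Y" "y = vact (un b) x" using Y_vact b by blast
    have "c x \<noteq> \<zero>\<^bsub>Fx x\<^esub>"
    proof
      assume "c x = \<zero>\<^bsub>Fx x\<^esub>"
      then show False using y ga_at[OF b c x(1)] act_zero[of "un b" x] x Y_X0 un_NT vact_un_X0 by auto
    qed
    then show "y \<in> vact (un b) ` {y \<in> Y. c y \<noteq> \<zero>\<^bsub>Fx y\<^esub>}" using x by blast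
  qed
  then show "finite {y \<in> Y. ga b c y \<noteq> \<zero>\<^bsub>Fx y\<^esub>}" by (rule finite_subset) (use c in \<open>simp add: C0.DS_carrier\<close>)
qed

lemma ga_add:
  assumes b: "b \<in> Zp nrm" and c: "c \<in> carrier C0.DS" "d \<in> carrier C0.DS"
  shows "ga b (c \<oplus>\<^bsub>C0.DS\<^esub> d) = ga b c \<oplus>\<^bsub>C0.DS\<^esub> ga b d"
proof (rule ga_extI[OF b ga_ext C0.DS_simps(4)])
  interpret D0: Module.module RJ C0.DS by (rule C0.module_dsum)
  fix y assume y: "y \<in> Y"
  have cd: "c y \<in> carrier (Fx y)" "d y \<in> carrier (Fx y)" "c \<oplus>\<^bsub>C0.DS\<^esub> d \<in> carrier C0.DS"
    using c y by (simp_all add: C0.DS_carrier[of c] C0.DS_carrier[of d])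
  show "ga b (c \<oplus>\<^bsub>C0.DS\<^esub> d) (vact (un b) y) = (ga b c \<oplus>\<^bsub>C0.DS\<^esub> ga b d) (vact (un b) y)"
    using ga_at[OF b _ y] cd c y vact_un_Y[OF b y] act_hom(2)[OF un_NT Y_X0[OF y]] by (simp add: C0.DS_simps)
qed

lemma ga_smult:
  assumes b: "b \<in> Zp nrm" and r: "r \<in> carrier RJ" and c: "c \<in> carrier C0.DS"
  shows "ga b (r \<odot>\<^bsub>C0.DS\<^esub> c) = r \<odot>\<^bsub>C0.DS\<^esub> ga b c"
proof (rule ga_extI[OF b ga_ext C0.DS_simps(5)])
  interpret D0: Module.module RJ C0.DS by (rule C0.module_dsum)
  fix y assume y: "y \<in> Y"
  have cd: "c y \<in> carrier (Fx y)" "r \<odot>\<^bsub>C0.DS\<^esub> c \<in> carrier C0.DS"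
    using c r y by (simp_all add: C0.DS_carrier[of c])
  show "ga b (r \<odot>\<^bsub>C0.DS\<^esub> c) (vact (un b) y) = (r \<odot>\<^bsub>C0.DS\<^esub> ga b c) (vact (un b) y)"
    using ga_at[OF b _ y] cd c r y vact_un_Y[OF b y] act_hom(3)[OF un_NT Y_X0[OF y]] by (simp add: C0.DS_simps)
qed

lemma ga_comp:
  assumes b: "b \<in> Zp nrm" "b' \<in> Zp nrm" and c: "c \<in> carrier C0.DS"
  shows "ga b (ga b' c) = ga (b + b') c"
proof (rule ga_extI[OF Zp_closed(3)[OF b] ga_ext ga_ext])
  fix y assume y: "y \<in> Y"
  have cy: "c y \<in> carrier (Fx y)" using c y by (simp add: C0.DS_carrier)
  have "ga b (ga b' c) (vact (un b) (vact (un b') y)) = act F (un b) {vact (un b') y} (act F (un b') {y} (c y))"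
    using ga_at[OF b(1) ga_closed[OF b(2) c] vact_un_Y[OF b(2) y]] ga_at[OF b(2) c y] by simp
  also have "\<dots> = act F (un (b + b')) {y} (c y)"
    using act_comp[OF un_NT un_NT Y_X0[OF y] cy] by (simp add: un_mult)
  finally show "ga b (ga b' c) (vact (un (b + b')) y) = ga (b + b') c (vact (un (b + b')) y)"
    using ga_at[OF Zp_closed(3)[OF b] c y] by (simp add: vact_un_un)
qed

lemma ga_0: "c \<in> carrier C0.DS \<Longrightarrow> ga 0 c = c"
proof (rule ga_extI[OF Zp_closed(1) ga_ext])
  assume c: "c \<in> carrier C0.DS"
  then show "c \<in> extensional Y" by (simp add: C0.DS_carrier)
  fix y assume y: "y \<in> Y"
  then have "c y \<in> carrier (Fx y)" using c by (simp add: C0.DS_carrier)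
  then show "ga 0 c (vact (un 0) y) = c (vact (un 0) y)"
    using ga_at[OF Zp_closed(1) c y] act_one[OF Y_X0[OF y]] by (simp add: un_0)
qed

lemma ga_single:
  assumes b: "b \<in> Zp nrm" and x: "x \<in> Y" "v \<in> carrier (Fx x)"
  shows "ga b (C0.single x v) = C0.single (vact (un b) x) (act F (un b) {x} v)"
proof (rule ga_extI[OF b ga_ext])
  show "C0.single (vact (un b) x) (act F (un b) {x} v) \<in> extensional Y" by (simp add: C0.single_def)
  fix y assume y: "y \<in> Y"
  have inj: "vact (un b) y = vact (un b) x \<longleftrightarrow> y = x"
    by (rule vact_un_inj)
  show "ga b (C0.single x v) (vact (un b) y) = C0.single (vact (un b) x) (act F (un b) {x} v) (vact (un b) y)"
    using ga_at[OF b C0.single_closed[OF x] y] y vact_un_Y[OF b y] inj act_zero[OF un_NT Y_X0[OF y] vact_un_X0[OF Y_X0[OF y]]]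
    by (simp add: C0.single_def)
qed

text \<open>Boundaries are preserved because the restriction maps are equivariant; chains on a
  single edge suffice by additivity.\<close>

lemma ga_BB:
  assumes b: "b \<in> Zp nrm" and k: "k \<in> BB" shows "ga b k \<in> BB"
proof -
  obtain f where f: "f \<in> carrier C1.DS" "k = bd f" using k by (auto simp: BB_def)
  interpret D0: Module.module RJ C0.DS by (rule C0.module_dsum)
  interpret D1: Module.module RJ C1.DS by (rule C1.module_dsum)
  from f(1) have "ga b (bd f) \<in> BB"
  proof (induction rule: C1.DS_induct)
    case zero
    have bz: "bd \<zero>\<^bsub>C1.DS\<^esub> = \<zero>\<^bsub>C0.DS\<^esub>"
      using bd_smult[of "\<zero>\<^bsub>RJ\<^esub>" "\<zero>\<^bsub>C1.DS\<^esub>"] bd_closed[of "\<zero>\<^bsub>C1.DS\<^esub>"] by simp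
    have "ga b \<zero>\<^bsub>C0.DS\<^esub> = \<zero>\<^bsub>C0.DS\<^esub>"
      using ga_smult[OF b, of "\<zero>\<^bsub>RJ\<^esub>" "\<zero>\<^bsub>C0.DS\<^esub>"] ga_closed[OF b, of "\<zero>\<^bsub>C0.DS\<^esub>"] by simp
    then show ?case using HQ.K_zero by (simp add: bz)
  next
    case (add f g)
    then show ?case using ga_add[OF b bd_closed bd_closed] HQ.K_add by (simp add: bd_add)
  next
    case (single s u)
    obtain w where w: "w \<in> X0 nrm" "s = {w, pa w}" using EY_X1[OF single(1)] by (auto simp: X1_pa)
    have s: "s = {w, pa w}" "w \<noteq> pa w" using w pa_ne[OF w(1)] by auto
    have wY: "w \<in> Y" "pa w \<in> Y" using single(1) w by (auto simp: edges_on_def)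
    have ws: "w \<in> s" "pa w \<in> s" using s by auto
    note X = EY_X1[OF single(1)]
    have gs: "sact (un b) s = {vact (un b) w, vact (un b) (pa w)}" by (simp add: s sact_def)
    have ne: "vact (un b) w \<noteq> vact (un b) (pa w)"
      using s(2) by (simp only: vact_un_inj not_False_eq_True)
    have "ga b (bd (C1.single s u)) = ga b (C0.single w (res F s w u)) \<oplus>\<^bsub>C0.DS\<^esub> ga b (C0.single (pa w) (res F s (pa w) u))"
      unfolding bd_single[OF single(1) s single(2)]
      by (rule ga_add[OF b]) (use wY ws X single res_hom(1) in \<open>auto intro!: C0.single_closed\<close>)
    also have "\<dots> = C0.single (vact (un b) w) (res F (sact (un b) s) (vact (un b) w) (act F (un b) s u)) \<oplus>\<^bsub>C0.DS\<^esub>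
        C0.single (vact (un b) (pa w)) (res F (sact (un b) s) (vact (un b) (pa w)) (act F (un b) s u))"
      using wY ws X single res_hom(1)[OF X] by (simp add: ga_single[OF b] act_res[OF un_NT])
    also have "\<dots> = bd (C1.single (sact (un b) s) (act F (un b) s u))"
      by (rule bd_single[OF sact_un_EY[OF b single(1)] gs ne act_edge[OF un_NT X single(2)], symmetric])
    also have "\<dots> \<in> BB" unfolding BB_def
      by (intro imageI C1.single_closed sact_un_EY[OF b single(1)] act_edge[OF un_NT X single(2)])
    finally show ?case .
  qed
  then show ?thesis using f by simp
qed

abbreviation al where "al \<equiv> H0_act F Y"

lemma al_eq: "al (un b) h = ga b ` h"
  by (simp add: H0_act_def ga_def un_inv Let_def)

text \<open>The action on homology is an elementwise image of a coset. It is a full coset again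
  because translation by -b maps boundaries to boundaries and inverts it.\<close>

lemma al_cs:
  assumes b: "b \<in> Zp nrm" and c: "c \<in> carrier C0.DS"
  shows "al (un b) (HQ.cs c) = HQ.cs (ga b c)"
proof -
  interpret D0: Module.module RJ C0.DS by (rule C0.module_dsum)
  have BBc: "k \<in> BB \<Longrightarrow> k \<in> carrier C0.DS" for k using HQ.K_sub by blast
  have nb: "- b \<in> Zp nrm" using b by simp
  have cs: "HQ.cs c = {k \<oplus>\<^bsub>C0.DS\<^esub> c | k. k \<in> BB}" for c by (auto simp: a_r_coset_def')
  show ?thesis unfolding al_eq cs
  proof (intro equalityI subsetI)
    fix z assume "z \<in> ga b ` {k \<oplus>\<^bsub>C0.DS\<^esub> c | k. k \<in> BB}"
    then obtain k where "k \<in> BB" "z = ga b (k \<oplus>\<^bsub>C0.DS\<^esub> c)" by blast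
    then show "z \<in> {k \<oplus>\<^bsub>C0.DS\<^esub> ga b c | k. k \<in> BB}" using ga_add[OF b BBc c] ga_BB[OF b] by blast
  next
    fix z assume "z \<in> {k \<oplus>\<^bsub>C0.DS\<^esub> ga b c | k. k \<in> BB}"
    then obtain k where k: "k \<in> BB" "z = k \<oplus>\<^bsub>C0.DS\<^esub> ga b c" by blast
    have "k = ga b (ga (- b) k)" using ga_comp[OF b nb BBc[OF k(1)]] ga_0 BBc[OF k(1)] by simp
    then have "z = ga b (ga (- b) k \<oplus>\<^bsub>C0.DS\<^esub> c)"
      using ga_add[OF b BBc[OF ga_BB[OF nb k(1)]] c] k(2) by simp
    then show "z \<in> ga b ` {k \<oplus>\<^bsub>C0.DS\<^esub> c | k. k \<in> BB}" using ga_BB[OF nb k(1)] by blast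
  qed
qed

lemma al_cls: "\<lbrakk>b \<in> Zp nrm; x \<in> Y; v \<in> carrier (Fx x)\<rbrakk> \<Longrightarrow> al (un b) (cls x v) = cls (vact (un b) x) (act F (un b) {x} v)"
  by (simp add: cls_def al_cs C0.single_closed ga_single)

lemma HH_cases: assumes "h \<in> carrier HH" obtains c where "c \<in> carrier C0.DS" "h = HQ.cs c"
  using assms by (auto simp: HH_eq HQ.QM_carrier)

lemma al_props:
  assumes b: "b \<in> Zp nrm" and h: "h \<in> carrier HH"
  shows "al (un b) h \<in> carrier HH"
    and "h' \<in> carrier HH \<Longrightarrow> al (un b) (h \<oplus>\<^bsub>HH\<^esub> h') = al (un b) h \<oplus>\<^bsub>HH\<^esub> al (un b) h'"
    and "r \<in> carrier RJ \<Longrightarrow> al (un b) (r \<odot>\<^bsub>HH\<^esub> h) = r \<odot>\<^bsub>HH\<^esub> al (un b) h"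
    and "b' \<in> Zp nrm \<Longrightarrow> al (un b') (al (un b) h) = al (un (b' + b)) h"
    and "al (un 0) h = h"
proof -
  interpret D0: Module.module RJ C0.DS by (rule C0.module_dsum)
  obtain c where c: "c \<in> carrier C0.DS" "h = HQ.cs c" using h by (rule HH_cases)
  show "al (un b) h \<in> carrier HH" using b c by (simp add: al_cs HH_eq HQ.QM_carrier ga_closed)
  show "r \<in> carrier RJ \<Longrightarrow> al (un b) (r \<odot>\<^bsub>HH\<^esub> h) = r \<odot>\<^bsub>HH\<^esub> al (un b) h"
    using b c by (simp add: HH_eq HQ.QM_smult al_cs ga_smult ga_closed)
  show "al (un 0) h = h" using c by (simp add: al_cs ga_0)
  show "b' \<in> Zp nrm \<Longrightarrow> al (un b') (al (un b) h) = al (un (b' + b)) h"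
    using b c by (simp add: al_cs ga_closed ga_comp)
  assume "h' \<in> carrier HH"
  then obtain c' where "c' \<in> carrier C0.DS" "h' = HQ.cs c'" by (rule HH_cases)
  then show "al (un b) (h \<oplus>\<^bsub>HH\<^esub> h') = al (un b) h \<oplus>\<^bsub>HH\<^esub> al (un b) h'"
    using b c by (simp add: HH_eq HQ.QM_add al_cs ga_add ga_closed)
qed

end

section \<open>The invariants at x_+ and the generation of H_0(X_+, F)\<close>

context coeff begin

abbreviation xp where "xp \<equiv> xplus nrm"
abbreviation cJ where "cJ c \<equiv> J +>\<^bsub>\<O>\<^esub> c"

lemma cJ_hom: "cJ \<in> ring_hom \<O> RJ" using ideal.rcos_ring_hom[OF J] .
lemma cJ_closed [simp]: "c \<in> Oc \<Longrightarrow> cJ c \<in> carrier RJ" by (rule ring_hom_closed[OF cJ_hom])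

lemma cJ_simps: "\<lbrakk>c \<in> Oc; d \<in> Oc\<rbrakk> \<Longrightarrow> cJ (c + d) = cJ c \<oplus>\<^bsub>RJ\<^esub> cJ d"
  "\<lbrakk>c \<in> Oc; d \<in> Oc\<rbrakk> \<Longrightarrow> cJ (c * d) = cJ c \<otimes>\<^bsub>RJ\<^esub> cJ d" "cJ 1 = \<one>\<^bsub>RJ\<^esub>"
  using ring_hom_add[OF cJ_hom] ring_hom_mult[OF cJ_hom] ring_hom_one[OF cJ_hom] by simp_all

lemma RJ_cases: assumes "r \<in> carrier RJ" obtains c where "c \<in> Oc" "r = cJ c"
  using assms by (auto simp: FactRing_def A_RCOSETS_def')

lemma cJ_eq_iff: "\<lbrakk>c \<in> Oc; d \<in> Oc\<rbrakk> \<Longrightarrow> cJ c = cJ d \<longleftrightarrow> c - d \<in> J"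
proof -
  assume cd: "c \<in> Oc" "d \<in> Oc"
  interpret cring \<O> by (rule cring_O)
  have "cJ c = cJ d \<longleftrightarrow> c \<ominus>\<^bsub>\<O>\<^esub> d \<in> J"
    using quotient_eq_iff_same_a_r_cos[OF J cd] by simp
  then show ?thesis using cd by (simp add: O_minus)
qed

lemma xp_vx: "xp = vx 1 0" by (rule xplus_vx)

lemma xp_X0: "xp \<in> X0 nrm" by (simp add: xp_vx)

lemma N0_un: "N0 nrm = un ` Zp nrm" by (auto simp: N0_def un_def)

lemma un_xp: "b \<in> Zp nrm \<Longrightarrow> vact (un b) xp = xp"
  unfolding xp_vx vact_un by (subst vx_eq_iff) (auto simp: Zp_iff)

text \<open>The N0-invariants of F(x_+), with scalars acting through \<oo>/J so that the devissage
  over \<oo> applies.\<close>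

definition VV :: "('l, 'm) module" where
  "VV = \<lparr>carrier = {v \<in> carrier (Fx xp). \<forall>g\<in>N0 nrm. act F g {xp} v = v},
    monoid.mult = undefined, monoid.one = undefined, ring.zero = \<zero>\<^bsub>Fx xp\<^esub>, ring.add = ring.add (Fx xp),
    smult = (\<lambda>c v. cJ c \<odot>\<^bsub>Fx xp\<^esub> v)\<rparr>"

lemma VV_simps: "\<zero>\<^bsub>VV\<^esub> = \<zero>\<^bsub>Fx xp\<^esub>" "v \<oplus>\<^bsub>VV\<^esub> w = v \<oplus>\<^bsub>Fx xp\<^esub> w" "c \<odot>\<^bsub>VV\<^esub> v = cJ c \<odot>\<^bsub>Fx xp\<^esub> v"
  by (simp_all add: VV_def)

lemma VV_carrier: "v \<in> carrier VV \<longleftrightarrow> v \<in> carrier (Fx xp) \<and> (\<forall>b\<in>Zp nrm. act F (un b) {xp} v = v)"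
  by (auto simp: VV_def N0_un)

lemma module_VV: "Module.module \<O> VV"
proof -
  interpret M: Module.module RJ "Fx xp" by (rule module_vertex[OF xp_X0])
  interpret O: cring \<O> by (rule cring_O)
  have smult: "cJ c \<odot>\<^bsub>Fx xp\<^esub> v \<in> carrier VV" if "c \<in> Oc" "v \<in> carrier VV" for c v
    using that act_hom(3)[OF un_NT xp_X0] by (auto simp: VV_carrier un_xp)
  show ?thesis
  proof (rule moduleI)
    show "cring \<O>" by (rule cring_O)
    show "abelian_group VV"
    proof (rule abelian_groupI)
      fix x y assume xy: "x \<in> carrier VV" "y \<in> carrier VV"
      then show "x \<oplus>\<^bsub>VV\<^esub> y \<in> carrier VV"
        using act_hom(2)[OF un_NT xp_X0] by (auto simp: VV_carrier VV_simps un_xp)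
      show "x \<oplus>\<^bsub>VV\<^esub> y = y \<oplus>\<^bsub>VV\<^esub> x" using xy by (simp add: VV_carrier VV_simps M.a_comm)
      fix z assume "z \<in> carrier VV"
      then show "x \<oplus>\<^bsub>VV\<^esub> y \<oplus>\<^bsub>VV\<^esub> z = x \<oplus>\<^bsub>VV\<^esub> (y \<oplus>\<^bsub>VV\<^esub> z)" using xy by (simp add: VV_carrier VV_simps M.a_assoc)
    next
      show "\<zero>\<^bsub>VV\<^esub> \<in> carrier VV"
        using act_zero[OF un_NT xp_X0] xp_X0 by (auto simp: VV_carrier VV_simps un_xp)
    next
      fix x assume x: "x \<in> carrier VV"
      then have xF: "x \<in> carrier (Fx xp)" by (simp add: VV_carrier)
      then show "\<zero>\<^bsub>VV\<^esub> \<oplus>\<^bsub>VV\<^esub> x = x" by (simp add: VV_simps)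
      have "cJ (-1) \<odot>\<^bsub>Fx xp\<^esub> x \<oplus>\<^bsub>Fx xp\<^esub> cJ 1 \<odot>\<^bsub>Fx xp\<^esub> x = cJ (- 1 + 1) \<odot>\<^bsub>Fx xp\<^esub> x"
        using xF M.smult_l_distr[of "cJ (-1)" "cJ 1" x] by (simp only: cJ_simps(1) cJ_closed O_one O_uminus)
      also have "\<dots> = \<zero>\<^bsub>Fx xp\<^esub>"
        using xF ring_hom_zero[OF cJ_hom cring.axioms(1)[OF cring_O] cring.axioms(1)[OF cring_RJ]] by simp
      finally show "\<exists>y\<in>carrier VV. y \<oplus>\<^bsub>VV\<^esub> x = \<zero>\<^bsub>VV\<^esub>"
        using smult[of "-1" x] x xF by (intro bexI[of _ "cJ (-1) \<odot>\<^bsub>Fx xp\<^esub> x"]) (simp_all add: VV_simps cJ_simps(3))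
    qed
  next
    fix a x y assume a: "a \<in> Oc" and xy: "x \<in> carrier VV" "y \<in> carrier VV"
    show "a \<odot>\<^bsub>VV\<^esub> (x \<oplus>\<^bsub>VV\<^esub> y) = a \<odot>\<^bsub>VV\<^esub> x \<oplus>\<^bsub>VV\<^esub> a \<odot>\<^bsub>VV\<^esub> y"
      using a xy by (simp add: VV_simps VV_carrier M.smult_r_distr)
  next
    fix a x assume a: "a \<in> Oc" and x: "x \<in> carrier VV"
    show "a \<odot>\<^bsub>VV\<^esub> x \<in> carrier VV" using smult a x by (simp add: VV_simps)
    fix b assume b: "b \<in> Oc"
    show "(a \<oplus>\<^bsub>\<O>\<^esub> b) \<odot>\<^bsub>VV\<^esub> x = a \<odot>\<^bsub>VV\<^esub> x \<oplus>\<^bsub>VV\<^esub> b \<odot>\<^bsub>VV\<^esub> x"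
      using a b x by (simp add: VV_simps VV_carrier M.smult_l_distr cJ_simps)
    show "(a \<otimes>\<^bsub>\<O>\<^esub> b) \<odot>\<^bsub>VV\<^esub> x = a \<odot>\<^bsub>VV\<^esub> (b \<odot>\<^bsub>VV\<^esub> x)"
      using a b x by (simp add: VV_simps VV_carrier M.smult_assoc1 cJ_simps)
  next
    fix x assume x: "x \<in> carrier VV"
    then show "\<one>\<^bsub>\<O>\<^esub> \<odot>\<^bsub>VV\<^esub> x = x" by (simp add: VV_simps VV_carrier cJ_simps)
  qed
qed

definition HO where "HO = restrict_scalars cJ HH"

lemma module_HH: "Module.module RJ HH" unfolding HH_eq by (rule HQ.module_QM)

lemma module_HO: "Module.module \<O> HO"
  unfolding HO_def by (rule module_restrict_scalars[OF cring_O module_HH cJ_hom])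

lemma HO_simps: "carrier HO = carrier HH" "\<zero>\<^bsub>HO\<^esub> = \<zero>\<^bsub>HH\<^esub>" "x \<oplus>\<^bsub>HO\<^esub> y = x \<oplus>\<^bsub>HH\<^esub> y" "c \<odot>\<^bsub>HO\<^esub> x = cJ c \<odot>\<^bsub>HH\<^esub> x"
  by (simp_all add: HO_def)

definition tm :: "nat \<Rightarrow> 'q ^ 2 ^ 2" where "tm m = mat2 (of_nat p ^ m) 0 0 1"
definition kap where "kap m v = cls (vact (tm m) xp) (act F (tm m) {xp} v)"

lemma tm_NT: "tm m \<in> NTgrp" unfolding tm_def by (rule aff_NT) simp

lemma tm_xp: "vact (tm m) xp = vx (of_nat p ^ m) 0"
  by (simp add: tm_def xp_vx vact_vx)

lemma lev_vx: "vx (of_nat p ^ m) (of_nat i) \<in> lev m" by (auto simp: lev_def)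

lemma tm_xp_lev: "vact (tm m) xp \<in> lev m" using lev_vx[of m 0] by (simp add: tm_xp)

lemma tm_xp_Y: "vact (tm m) xp \<in> Y" using lev_X0plus[OF tm_xp_lev] .

lemma VV_F: "v \<in> carrier VV \<Longrightarrow> v \<in> carrier (Fx xp)" by (simp add: VV_carrier)

lemma kap_closed: "v \<in> carrier VV \<Longrightarrow> kap m v \<in> carrier HH"
  unfolding kap_def by (intro cls_closed tm_xp_Y act_hom(1)[OF tm_NT xp_X0] VV_F)

lemma kap_hom: "kap m \<in> module_hom \<O> VV HO"
  unfolding module_hom_def
  using kap_closed act_hom[OF tm_NT xp_X0] cls_add[OF tm_xp_Y] cls_smult[OF tm_xp_Y]
  by (auto simp: HO_simps VV_simps VV_F) (simp_all add: kap_def VV_F)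

lemma al_un_cls: 
  assumes "b \<in> Zp nrm" "g \<in> NTgrp" "vact g xp \<in> Y" "v \<in> carrier (Fx xp)"
  shows "al (un b) (cls (vact g xp) (act F g {xp} v)) = cls (vact (un b ** g) xp) (act F (un b ** g) {xp} v)"
  using assms al_cls[OF assms(1,3) act_hom(1)[OF assms(2) xp_X0 assms(4)]] act_comp[OF un_NT assms(2) xp_X0 assms(4)]
  by (simp add: vact_mult)

text \<open>Conjugation by t^m carries N0 onto its subgroup N0^(p^m), and v is N0-invariant.\<close>

lemma kap_fixed:
  assumes v: "v \<in> carrier VV" and u: "u \<in> NU m" shows "al u (kap m v) = kap m v"
proof -
  obtain b where b: "u = un b" "nrm b \<le> (1 / real p) ^ m" using u by (auto simp: NU_eq)
  then obtain z where z: "z \<in> Zp nrm" "b = of_nat p ^ m * z" using ball_iff by blast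
  have tz: "un b ** tm m = tm m ** un z" by (simp add: un_def tm_def mat2_mult z)
  have "al u (kap m v) = cls (vact (un b ** tm m) xp) (act F (un b ** tm m) {xp} v)"
    unfolding b(1) kap_def by (rule al_un_cls[OF small_Zp[OF b(2)] tm_NT tm_xp_Y VV_F[OF v]])
  also have "vact (un b ** tm m) xp = vact (tm m) xp"
    unfolding tz vact_mult un_xp[OF z(1)] ..
  also have "act F (un b ** tm m) {xp} v = act F (tm m) {xp} v"
    using act_comp[OF tm_NT un_NT xp_X0 VV_F[OF v], of m z] v z(1) by (simp add: tz un_xp VV_carrier)
  finally show ?thesis by (simp add: kap_def)
qed

text \<open>This is \<open>gen\<close> of the abstract setting, stated beforehand because the
  property \<open>\<kappa>_Suc\<close> of that setting has to be proved about it first.\<close>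

definition genr where "genr m = rspan \<O> HO {al (un (of_int i)) (kap m w) | i w. w \<in> carrier VV}"

text \<open>The affine matrix g carries x_+ to x and conjugates N0 into the stabilizer of x. So the
  translate v of u to x_+ is N0-invariant, and u is recovered from v by t^m followed by a
  translation in N0.\<close>

lemma inv_genr:
  assumes u: "u \<in> carrier (Fx x)" and x: "x = vx (of_nat p ^ m) (of_nat i)"
    and inv: "\<And>g. g \<in> Nstab p nrm x \<Longrightarrow> act F g {x} u = u"
  shows "cls x u \<in> genr m"
proof -
  let ?P = "of_nat p ^ m :: 'q"
  have [simp]: "p \<noteq> 0" using p_gt_1 by simp
  define g g' where "g = mat2 ?P (of_nat i) 0 1" and "g' = mat2 (1 / ?P) (- of_nat i / ?P) 0 1"
  have g: "g \<in> NTgrp" "g' \<in> NTgrp" unfolding g_def g'_def by (rule aff_NT, simp)+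
  have gg: "g ** g' = mat 1" "g' ** g = mat 1" using p_gt_1 by (simp_all add: g_def g'_def mat2_mult mat2_one[symmetric])
  have xX: "x \<in> X0 nrm" by (simp add: x)
  have gx: "vact g' x = xp" by (simp add: x g'_def vact_vx xp_vx)
  have gxp: "vact g xp = x" by (simp add: x g_def vact_vx xp_vx)
  define v where "v = act F g' {x} u"
  have vF: "v \<in> carrier (Fx xp)" using act_hom(1)[OF g(2) xX u] by (simp add: v_def gx)
  have "act F (un b) {xp} v = v" if b: "b \<in> Zp nrm" for b
  proof -
    have nb: "nrm (?P * b) \<le> nrm ?P" using b by (simp add: nrm_mult Zp_iff mult_left_le)
    then have s: "un (?P * b) \<in> Nstab p nrm x" unfolding x by (subst Nstab_vx) (auto simp: un_def)
    have fx: "vact (un (?P * b)) x = x" unfolding x vact_un by (subst vx_eq_iff) (use nb in auto)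
    have c: "un b ** g' = g' ** un (?P * b)" by (simp add: un_def g'_def mat2_mult)
    have "act F (un b) {xp} v = act F (g' ** un (?P * b)) {x} u"
      using act_comp[OF un_NT g(2) xX u, of b] by (simp add: v_def gx c)
    also have "\<dots> = act F g' {x} (act F (un (?P * b)) {x} u)"
      using act_comp[OF g(2) un_NT xX u, of "?P * b"] by (simp add: fx)
    also have "\<dots> = v" using inv[OF s] by (simp add: v_def)
    finally show ?thesis .
  qed
  then have v: "v \<in> carrier VV" using vF by (simp add: VV_carrier)
  have "un (of_int (int i)) ** tm m = g" by (simp add: un_def tm_def g_def mat2_mult)
  then have "al (un (of_int (int i))) (kap m v) = cls x (act F g {xp} v)"
    unfolding kap_def using al_un_cls[OF Zp_closed(7) tm_NT tm_xp_Y vF, of "int i" m] by (simp add: gxp)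
  also have "act F g {xp} v = u"
    using act_comp[OF g xX u] act_one[OF xX u] by (simp add: v_def gx gg)
  finally show ?thesis unfolding genr_def using v by (intro rspan.incl CollectI exI[of _ "int i"] exI[of _ v]) simp
qed

text \<open>(Hyp 3) makes the class of \<open>res u\<close> at \<open>w\<close> one of the generators, and in \<open>H\<^sub>0\<close> it is the negative of the class at \<open>pa w\<close>.\<close>

lemma edge_genr:
  assumes w: "w \<in> lev m" "pa w \<in> Y" and u: "u \<in> carrier (sec F {w, pa w})"
  shows "cls (pa w) (res F {w, pa w} (pa w) u) \<in> genr m"
proof -
  have wY: "w \<in> Y" using lev_X0plus w by blast
  note wX = Y_X0[OF wY]
  note e = edge_pa[OF wX]
  have EY: "{w, pa w} \<in> EY" using e wY w by (simp add: edges_on_def)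
  obtain i where i: "w = vx (of_nat p ^ m) (of_nat i)" using w by (auto simp: lev_def)
  have r: "res F {w, pa w} w u \<in> carrier (Fx w)" "res F {w, pa w} (pa w) u \<in> carrier (Fx (pa w))"
    using res_hom(1)[OF e _ u] by auto
  have "res F {w, pa w} w ` carrier (sec F {w, pa w}) = {v \<in> carrier (Fx w). \<forall>g\<in>Nstab p nrm w. act F g {w} v = v}"
    using bspec[OF H3[unfolded Hyp3_def Let_def] e] unfolding edge_plus_pa[OF wX] .
  then have "\<And>g. g \<in> Nstab p nrm w \<Longrightarrow> act F g {w} (res F {w, pa w} w u) = res F {w, pa w} w u" using u by blast
  then have 1: "cls w (res F {w, pa w} w u) \<in> genr m" by (rule inv_genr[OF r(1) i])
  interpret H: Module.module \<O> HO by (rule module_HO)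
  have c: "cls w (res F {w, pa w} w u) \<in> carrier HO" "cls (pa w) (res F {w, pa w} (pa w) u) \<in> carrier HO"
    using cls_closed[OF wY r(1)] cls_closed[OF w(2) r(2)] by (simp_all add: HO_simps)
  have "cls w (res F {w, pa w} w u) \<oplus>\<^bsub>HO\<^esub> cls (pa w) (res F {w, pa w} (pa w) u) = \<zero>\<^bsub>HO\<^esub>"
    using cls_edge[OF EY pa_ne[OF wX, symmetric] u] by (simp add: HO_simps)
  then have "cls (pa w) (res F {w, pa w} (pa w) u) = \<ominus>\<^bsub>HO\<^esub> cls w (res F {w, pa w} w u)"
    using c H.M.a_comm H.M.minus_equality by metis
  also have "\<dots> = (\<ominus>\<^bsub>\<O>\<^esub> \<one>\<^bsub>\<O>\<^esub>) \<odot>\<^bsub>HO\<^esub> cls w (res F {w, pa w} w u)" using H.smult_minus_one[OF c(1)] by simp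
  also have "\<dots> \<in> genr m" using 1 unfolding genr_def by (intro rspan.smult H.R.a_inv_closed) auto
  finally show ?thesis .
qed

text \<open>By (Hyp 2) chains can be pushed one step away from \<open>\<alpha>\<^sub>0\<close>.\<close>

lemma cls_genr:
  assumes x: "x \<in> lev m" and v: "v \<in> carrier (Fx x)" shows "cls x v \<in> genr (Suc m)"
proof -
  have xY: "x \<in> Y" using lev_X0plus x by blast
  note xX = Y_X0[OF xY]
  interpret M: Module.module RJ "Fx x" by (rule module_vertex[OF xX])
  let ?E = "{s' \<in> X1 p nrm. {x, pa x} \<inter> s' = {x}}"
  have "v \<in> {\<Oplus>\<^bsub>Fx x\<^esub>s'\<in>A. v s' | A v. finite A \<and> A \<subseteq> ?E \<and> (\<forall>s'\<in>A. v s' \<in> res F s' x ` carrier (sec F s'))}"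
    using v bspec[OF H2[unfolded Hyp2_def Let_def] edge_pa[OF xX]] unfolding edge_plus_pa[OF xX] by (rule back_subst[of "\<lambda>S. v \<in> S"])
  then have "\<exists>A w. v = (\<Oplus>\<^bsub>Fx x\<^esub>s'\<in>A. w s') \<and> finite A \<and> A \<subseteq> ?E \<and> (\<forall>s'\<in>A. w s' \<in> res F s' x ` carrier (sec F s'))"
    by (rule CollectD)
  then obtain A w where Aw: "v = (\<Oplus>\<^bsub>Fx x\<^esub>s'\<in>A. w s') \<and> finite A \<and> A \<subseteq> ?E \<and> (\<forall>s'\<in>A. w s' \<in> res F s' x ` carrier (sec F s'))"
    by (elim exE) (rule that)
  note vA = conjunct1[OF Aw] and A = conjunct1[OF conjunct2[OF Aw]] conjunct1[OF conjunct2[OF conjunct2[OF Aw]]]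
    bspec[OF conjunct2[OF conjunct2[OF conjunct2[OF Aw]]]]
  \<comment> \<open>Each edge in \<open>?E\<close> leads to a vertex one level further out, where
    \<open>edge_genr\<close> applies.\<close>
  have each: "w s' \<in> carrier (Fx x) \<and> cls x (w s') \<in> genr (Suc m)" if s': "s' \<in> A" for s'
  proof -
    obtain y where y: "y \<in> X0 nrm" "s' = {y, pa y}" "pa y = x" using other_edges[OF xX] A(2) s' by blast
    obtain u where u: "u \<in> carrier (sec F s')" "w s' = res F s' x u" using A(3)[OF s'] by blast
    have "y \<in> lev (Suc m)" using lev_child[OF x y(1,3)] .
    then have "cls x (w s') \<in> genr (Suc m)" using edge_genr[of y "Suc m" u] y u xY by simp
    moreover have "w s' \<in> carrier (Fx x)" using res_hom(1)[OF _ _ u(1), of x] A(2) s' y u by auto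
    ultimately show ?thesis by blast
  qed
  have "(\<Oplus>\<^bsub>Fx x\<^esub>s'\<in>B. w s') \<in> carrier (Fx x) \<and> cls x (\<Oplus>\<^bsub>Fx x\<^esub>s'\<in>B. w s') \<in> genr (Suc m)" if "finite B" "B \<subseteq> A" for B
    using that
  proof (induction B rule: finite_induct)
    case empty
    interpret H: Module.module RJ HH by (rule module_HH)
    have "cls x \<zero>\<^bsub>Fx x\<^esub> = \<zero>\<^bsub>HH\<^esub>"
      using cls_smult[OF xY, of "\<zero>\<^bsub>RJ\<^esub>" "\<zero>\<^bsub>Fx x\<^esub>"] cls_closed[OF xY, of "\<zero>\<^bsub>Fx x\<^esub>"] by simp
    then show ?case using rspan.zero[of HO] by (simp add: genr_def HO_simps)
  next
    case (insert b B)
    have bw: "w b \<in> carrier (Fx x)" "cls x (w b) \<in> genr (Suc m)" using each insert.prems by auto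
    have eq: "(\<Oplus>\<^bsub>Fx x\<^esub>s'\<in>insert b B. w s') = w b \<oplus>\<^bsub>Fx x\<^esub> (\<Oplus>\<^bsub>Fx x\<^esub>s'\<in>B. w s')"
      using insert each by (intro M.finsum_insert) auto
    have IH: "(\<Oplus>\<^bsub>Fx x\<^esub>s'\<in>B. w s') \<in> carrier (Fx x)" "cls x (\<Oplus>\<^bsub>Fx x\<^esub>s'\<in>B. w s') \<in> genr (Suc m)"
      using insert by auto
    then show ?case unfolding eq using bw cls_add[OF xY bw(1) IH(1)] rspan.add[of "cls x (w b)" \<O> HO]
      by (simp add: genr_def HO_simps)
  qed
  then show ?thesis using A(1) vA by blast
qed

lemma smooth_action: "smooth_action p nrm emb pL HO VV al kap"
proof (intro smooth_action.intro smooth_action_axioms.intro)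
  show "int_ext p nrm emb pL" by unfold_locales
  show "Module.module \<O> HO" "Module.module \<O> VV" by (rule module_HO, rule module_VV)
  fix b h assume "b \<in> Zp nrm" "h \<in> carrier HO"
  then have b: "b \<in> Zp nrm" and h: "h \<in> carrier HH" by (simp_all add: HO_simps)
  show "al (un b) h \<in> carrier HO" using al_props(1)[OF b h] by (simp add: HO_simps)
  show "al (un b) (h \<oplus>\<^bsub>HO\<^esub> h') = al (un b) h \<oplus>\<^bsub>HO\<^esub> al (un b) h'" if "h' \<in> carrier HO" for h'
    using al_props(2)[OF b h] that by (simp add: HO_simps)
  show "al (un b) (r \<odot>\<^bsub>HO\<^esub> h) = r \<odot>\<^bsub>HO\<^esub> al (un b) h" if "r \<in> Oc" for r
    using al_props(3)[OF b h] that by (simp add: HO_simps)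
next
  fix b c h assume "b \<in> Zp nrm" "c \<in> Zp nrm" "h \<in> carrier HO"
  then show "al (un b) (al (un c) h) = al (un (b + c)) h" by (intro al_props(4)) (simp_all add: HO_simps)
next
  fix h assume "h \<in> carrier HO"
  then show "al (un 0) h = h" by (intro al_props(5)[OF Zp_closed(1)]) (simp_all add: HO_simps)
next
  show "kap m \<in> module_hom \<O> VV HO" for m by (rule kap_hom)
  show "al u (kap m v) = kap m v" if "v \<in> carrier VV" "u \<in> NU m" for v u m using that by (rule kap_fixed)
  show "kap m v \<in> rspan \<O> HO {al (un (of_int i)) (kap (Suc m) w) | i w. w \<in> carrier VV}" if v: "v \<in> carrier VV" for v m
    unfolding genr_def[symmetric] kap_def[of m]
    by (rule cls_genr[OF tm_xp_lev act_hom(1)[OF tm_NT xp_X0 VV_F[OF v]]])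
qed

sublocale sm0: smooth_action p nrm emb pL HO VV al kap by (rule smooth_action)

lemma gen_genr: "sm0.gen m = genr m" unfolding sm0.gen_def genr_def ..

text \<open>Homology is spanned by classes at single vertices; each vertex of X_+ lies in some level
  and its classes are reached one level further out. Finitely many classes share a level as
  \<open>gen\<close> increases.\<close>

sublocale sm: smooth_module p nrm emb pL HO VV al kap
proof (unfold_locales)
  fix h assume "h \<in> carrier HO"
  then have "h \<in> carrier HH" by (simp add: HO_simps)
  then show "\<exists>m. h \<in> sm0.gen m"
  proof (induction rule: HH_induct)
    case zero then show ?case using rspan.zero[of HO] by (auto simp: sm0.gen_def HO_simps)
  next
    case (cls x v)
    then obtain m where "x \<in> lev m" using X0plus_lev by blast
    then show ?case using cls_genr cls(2) gen_genr by blast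
  next
    case (add h h')
    then obtain m m' where m: "h \<in> sm0.gen m" "h' \<in> sm0.gen m'" by blast
    then have "h \<in> sm0.gen (max m m')" "h' \<in> sm0.gen (max m m')" using sm0.gen_mono by auto
    then have "h \<oplus>\<^bsub>HO\<^esub> h' \<in> sm0.gen (max m m')" unfolding sm0.gen_def by (rule rspan.add)
    then show ?case by (auto simp: HO_simps)
  qed
qed

lemma Ddual_eq: "Ddual p nrm emb J F = sm.DM"
  unfolding Ddual_def sm.DM_def Let_def HO_def[symmetric] ..

end

section \<open>Passage to \<O>_E and generators of the invariants\<close>

context int_ext begin

abbreviation Rloc where "Rloc \<equiv> localization Lam SS"
abbreviation pRloc where "pRloc \<equiv> [p] \<cdot>\<^bsub>Rloc\<^esub> \<one>\<^bsub>Rloc\<^esub>"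
abbreviation OEr where "OEr \<equiv> OE p nrm emb pL"
abbreviation toOE where "toOE \<equiv> to_OE p nrm emb pL"

lemma OE_facts:
  shows "cring OEr" and "l \<in> carrier Lam \<Longrightarrow> toOE l \<in> carrier OEr"
    and "s \<in> SS \<Longrightarrow> \<exists>u\<in>carrier OEr. toOE s \<otimes>\<^bsub>OEr\<^esub> u = \<one>\<^bsub>OEr\<^esub>"
proof -
  interpret MS: mult_subset Lam SS by (rule mult_subset_SS)
  interpret L: cring Rloc by (rule MS.cring_localization)
  have p: "pRloc \<in> carrier Rloc" by (rule L.add.nat_pow_closed) simp
  have OEr: "OEr = adic_completion Rloc pRloc" by (simp add: OE_def Let_def)
  have to: "toOE l = to_completion Rloc pRloc (loc_frac Lam SS l \<one>\<^bsub>Lam\<^esub>)" for l by (simp add: to_OE_def Let_def)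
  show "cring OEr" unfolding OEr by (rule L.cring_adic_completion[OF p])
  show "l \<in> carrier Lam \<Longrightarrow> toOE l \<in> carrier OEr"
    unfolding OEr to by (rule L.to_completion_closed[OF p]) simp
  assume s: "s \<in> SS"
  let ?u = "to_completion Rloc pRloc (loc_frac Lam SS \<one>\<^bsub>Lam\<^esub> s)"
  have f: "loc_frac Lam SS s \<one>\<^bsub>Lam\<^esub> \<in> carrier Rloc" "loc_frac Lam SS \<one>\<^bsub>Lam\<^esub> s \<in> carrier Rloc" using s by simp_all
  have "?u \<in> carrier OEr" unfolding OEr by (rule L.to_completion_closed[OF p f(2)])
  moreover have "toOE s \<otimes>\<^bsub>OEr\<^esub> ?u = \<one>\<^bsub>OEr\<^esub>"
    unfolding OEr to L.to_completion_mult[OF p f] MS.frac_unit[OF s] by (rule L.to_completion_one[OF p])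
  ultimately show "\<exists>u\<in>carrier OEr. toOE s \<otimes>\<^bsub>OEr\<^esub> u = \<one>\<^bsub>OEr\<^esub>" by blast
qed

text \<open>\<open>Ou\<close> is kept opaque: the simplifier would loop on the unfolded set when it is used as a multiplicative set.\<close>

definition Ou where "Ou = {s \<in> Oc. \<not> mm s}"

lemma mult_subset_Ou: "mult_subset \<O> Ou"
  by (intro mult_subset.intro cring_O mult_subset_axioms.intro) (use mm_one mm_prime in \<open>auto simp: Ou_def\<close>)

text \<open>The devissage applied to \<oo>-modules: as for finite modules over a discrete valuation
  ring, generators of the p_L-torsion bound the number of generators, here up to multipliers outside
  (p_L).\<close>

lemma generators_over_O:
  fixes V :: "('l, 'v, 'd) module_scheme"
  assumes V: "Module.module \<O> V" and s0: "s0 \<in> Oc" "\<not> mm s0"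
    and ann: "\<And>v. v \<in> carrier V \<Longrightarrow> (s0 * pL ^ k) \<odot>\<^bsub>V\<^esub> v = \<zero>\<^bsub>V\<^esub>"
    and A: "finite A" "A \<subseteq> {v \<in> carrier V. pL \<odot>\<^bsub>V\<^esub> v = \<zero>\<^bsub>V\<^esub>}"
      "{v \<in> carrier V. pL \<odot>\<^bsub>V\<^esub> v = \<zero>\<^bsub>V\<^esub>} \<subseteq> rspan \<O> V A"
  shows "\<exists>X\<subseteq>carrier V. finite X \<and> card X \<le> card A \<and>
    (\<forall>v\<in>carrier V. \<exists>s\<in>Oc. \<not> mm s \<and> s \<odot>\<^bsub>V\<^esub> v \<in> rspan \<O> V X)"
proof -
  have S0: "s0 \<in> Ou" using s0 by (simp add: Ou_def)
  interpret SV: module_sat \<O> V Ou pL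
  proof (intro module_sat.intro V mult_subset_Ou module_sat_axioms.intro pL_O)
    fix r assume "r \<in> Oc" "r \<notin> Ou"
    then have "mm r" by (simp add: Ou_def)
    then obtain c where c: "c \<in> Oc" "r = pL * c" unfolding mm_def by blast
    then have "r = c \<otimes>\<^bsub>\<O>\<^esub> pL" by (simp add: mult.commute)
    then show "\<exists>r'\<in>Oc. r = r' \<otimes>\<^bsub>\<O>\<^esub> pL" using c(1) by (rule bexI)
  qed
  have sub: "SV.submod (carrier V)" by (simp add: SV.submod_def)
  have "s0 \<odot>\<^bsub>V\<^esub> (pL [^]\<^bsub>\<O>\<^esub> k \<odot>\<^bsub>V\<^esub> v) = \<zero>\<^bsub>V\<^esub>" if v: "v \<in> carrier V" for v
    using SV.smult_assoc1[OF s0(1) O_power[OF pL_O] v, of k] ann[OF v] by (simp add: O_pow)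
  note gen = SV.generators_from_torsion[OF sub S0 this A(1) A(2)[folded SV.tors_def]]
  have "carrier V \<inter> SV.tors \<subseteq> SV.cl A"
  proof
    fix v assume "v \<in> carrier V \<inter> SV.tors"
    then show "v \<in> SV.cl A" using A(3)[folded SV.tors_def] by (intro SV.sp_cl) auto
  qed
  from gen[OF _ this] obtain X where X: "X \<subseteq> carrier V" "finite X" "card X \<le> card A" "carrier V \<subseteq> SV.cl X" by blast
  have "\<exists>s\<in>Oc. \<not> mm s \<and> s \<odot>\<^bsub>V\<^esub> v \<in> rspan \<O> V X" if "v \<in> carrier V" for v
  proof -
    have "\<exists>s\<in>Ou. s \<odot>\<^bsub>V\<^esub> v \<in> rspan \<O> V X" using subsetD[OF X(4) that] unfolding SV.cl_def by blast
    then show ?thesis unfolding Ou_def by blast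
  qed
  then show ?thesis using X(1-3) by blast
qed

end

context coeff begin

text \<open>The powers of (p_L) become stationary in \<oo>/J, so p_L^n is congruent to c p_L^(n+1)
  for some c. The multiplier s = 1 - c p_L is 1 modulo p_L.\<close>

lemma artinian_annihilator:
  assumes "artinian_ring RJ"
  shows "\<exists>s k. s \<in> Oc \<and> \<not> mm s \<and> s * pL ^ k \<in> J"
proof -
  define I where "I i = PIdl\<^bsub>RJ\<^esub> (cJ (pL ^ i))" for i
  have "ideal (I i) RJ" for i unfolding I_def by (rule C0.cgenideal_ideal) simp
  moreover have "I (Suc i) \<subseteq> I i" for i
    unfolding I_def cgenideal_def
  proof clarify
    fix r assume r: "r \<in> carrier RJ"
    have "cJ (pL ^ Suc i) = cJ pL \<otimes>\<^bsub>RJ\<^esub> cJ (pL ^ i)" by (simp add: cJ_simps)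
    then show "\<exists>x. r \<otimes>\<^bsub>RJ\<^esub> cJ (pL ^ Suc i) = x \<otimes>\<^bsub>RJ\<^esub> cJ (pL ^ i) \<and> x \<in> carrier RJ"
      using r by (intro exI[of _ "r \<otimes>\<^bsub>RJ\<^esub> cJ pL"]) (simp add: C0.m_assoc)
  qed
  ultimately obtain n where n: "\<forall>i\<ge>n. I i = I n" using assms unfolding artinian_ring_def by metis
  have "cJ (pL ^ n) \<in> I n" unfolding I_def by (rule C0.cgenideal_self) simp
  then have "cJ (pL ^ n) \<in> I (Suc n)" using n by (metis le_SucI order_refl)
  then obtain r where r: "r \<in> carrier RJ" "cJ (pL ^ n) = r \<otimes>\<^bsub>RJ\<^esub> cJ (pL ^ Suc n)" by (auto simp: I_def cgenideal_def)
  obtain c where c: "c \<in> Oc" "r = cJ c" using r(1) by (rule RJ_cases)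
  have "cJ (pL ^ n) = cJ (c * pL ^ Suc n)" using c r(2) by (simp only: cJ_simps(2) O_power pL_O)
  then have "pL ^ n - c * pL ^ Suc n \<in> J" using c cJ_eq_iff[of "pL ^ n" "c * pL ^ Suc n"] by simp
  moreover have "pL ^ n - c * pL ^ Suc n = (1 - c * pL) * pL ^ n" by (simp add: algebra_simps)
  moreover have "\<not> mm (1 - c * pL)"
  proof
    assume "mm (1 - c * pL)"
    from mm_add[OF this mm_pL[OF c(1)]] show False using mm_one by (simp add: mult.commute)
  qed
  ultimately show ?thesis using c by (intro exI[of _ "1 - c * pL"] exI[of _ n]) simp
qed

abbreviation KK where "KK \<equiv> residue_field \<O> pL"
abbreviation IV where "IV \<equiv> inv_space nrm emb pL J F"

lemma IV_carrier: "v \<in> carrier IV \<longleftrightarrow> v \<in> carrier VV \<and> pL \<odot>\<^bsub>VV\<^esub> v = \<zero>\<^bsub>VV\<^esub>"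
  by (auto simp: inv_space_def Let_def VV_def)

lemma IV_simps: "\<zero>\<^bsub>IV\<^esub> = \<zero>\<^bsub>VV\<^esub>" "v \<oplus>\<^bsub>IV\<^esub> w = v \<oplus>\<^bsub>VV\<^esub> w"
  "\<kappa> \<odot>\<^bsub>IV\<^esub> v = (SOME c. c \<in> \<kappa>) \<odot>\<^bsub>VV\<^esub> v"
  by (simp_all add: inv_space_def Let_def VV_def)

abbreviation ck where "ck c \<equiv> PIdl\<^bsub>\<O>\<^esub> pL +>\<^bsub>\<O>\<^esub> c"

lemma ideal_pL: "ideal (PIdl\<^bsub>\<O>\<^esub> pL) \<O>" using max_pL by (rule maximalideal.axioms(1))

lemma KK_hom: "ck \<in> ring_hom \<O> KK"
  using ideal.rcos_ring_hom[OF ideal_pL] by (simp add: residue_field_def)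

lemma KK_cases: assumes "r \<in> carrier KK" obtains c where "c \<in> Oc" "r = ck c"
  using assms by (auto simp: residue_field_def FactRing_def A_RCOSETS_def')

text \<open>The scalar is an arbitrary element of the residue class; two choices differ by a
  multiple of p_L, which kills v.\<close>

lemma IV_smult:
  assumes c: "c \<in> Oc" and v: "v \<in> carrier IV" shows "ck c \<odot>\<^bsub>IV\<^esub> v = c \<odot>\<^bsub>VV\<^esub> v"
proof -
  have ckm: "ck c = {x. mm (x - c)}"
  proof (intro equalityI subsetI)
    fix x assume "x \<in> ck c"
    then show "x \<in> {x. mm (x - c)}" by (auto simp: a_r_coset_def' PIdl_mm)
  next
    fix x assume "x \<in> {x. mm (x - c)}"
    then show "x \<in> ck c" by (auto simp: a_r_coset_def' PIdl_mm intro!: exI[of _ "x - c"])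
  qed
  define d where "d = (SOME d. d \<in> ck c)"
  have "c \<in> ck c" by (simp add: ckm)
  then have "d \<in> ck c" unfolding d_def by (rule someI)
  then obtain e where e: "e \<in> Oc" "d - c = pL * e" by (auto simp: ckm mm_def)
  then have d: "d = c + e * pL" by (simp add: algebra_simps)
  have vV: "v \<in> carrier VV" "pL \<odot>\<^bsub>VV\<^esub> v = \<zero>\<^bsub>VV\<^esub>" using v by (simp_all add: IV_carrier)
  have "d \<odot>\<^bsub>VV\<^esub> v = c \<odot>\<^bsub>VV\<^esub> v \<oplus>\<^bsub>VV\<^esub> e \<odot>\<^bsub>VV\<^esub> (pL \<odot>\<^bsub>VV\<^esub> v)"
    using sm0.V.smult_l_distr[of c "e * pL" v] sm0.V.smult_assoc1[of e pL v] c e vV by (simp add: d)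
  also have "\<dots> = c \<odot>\<^bsub>VV\<^esub> v" using vV c e by simp
  finally show ?thesis by (simp add: IV_simps d_def)
qed

lemma vectorspace_IV: "vectorspace KK IV"
proof -
  have field: "field KK" unfolding residue_field_def by (rule maximalideal.quotient_is_field[OF max_pL cring_O])
  have smult: "c \<odot>\<^bsub>VV\<^esub> v \<in> carrier IV" if "c \<in> Oc" "v \<in> carrier IV" for c v
  proof -
    have "pL \<odot>\<^bsub>VV\<^esub> (c \<odot>\<^bsub>VV\<^esub> v) = c \<odot>\<^bsub>VV\<^esub> (pL \<odot>\<^bsub>VV\<^esub> v)"
      using that sm0.V.smult_assoc1[of pL c v] sm0.V.smult_assoc1[of c pL v] by (simp add: IV_carrier mult.commute)
    then show ?thesis using that by (simp add: IV_carrier)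
  qed
  have ring: "\<lbrakk>c \<in> Oc; d \<in> Oc\<rbrakk> \<Longrightarrow> ck c \<oplus>\<^bsub>KK\<^esub> ck d = ck (c + d)"
    "\<lbrakk>c \<in> Oc; d \<in> Oc\<rbrakk> \<Longrightarrow> ck c \<otimes>\<^bsub>KK\<^esub> ck d = ck (c * d)" "\<one>\<^bsub>KK\<^esub> = ck 1" for c d
    using ring_hom_add[OF KK_hom] ring_hom_mult[OF KK_hom] ring_hom_one[OF KK_hom] by simp_all
  have add: "v \<oplus>\<^bsub>IV\<^esub> w \<in> carrier IV" if "v \<in> carrier IV" "w \<in> carrier IV" for v w
    using that by (auto simp: IV_carrier IV_simps sm0.V.smult_r_distr)
  have "Module.module KK IV"
  proof (rule moduleI)
    show "cring KK" by (rule domain.axioms(1)[OF Ring.field.axioms(1)[OF field]])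
    show "abelian_group IV"
    proof (rule abelian_groupI)
      fix x assume x: "x \<in> carrier IV"
      have "(-1) \<odot>\<^bsub>VV\<^esub> x \<oplus>\<^bsub>VV\<^esub> x = \<zero>\<^bsub>VV\<^esub>"
        using sm0.V.smult_l_distr[of "-1" 1 x] sm0.V.smult_one[of x] sm0.V.smult_l_null[of x] x by (simp add: IV_carrier)
      then show "\<exists>y\<in>carrier IV. y \<oplus>\<^bsub>IV\<^esub> x = \<zero>\<^bsub>IV\<^esub>"
        using smult[of "-1" x] x by (auto simp: IV_simps)
    qed (auto simp: IV_carrier IV_simps sm0.V.M.a_ac sm0.V.smult_r_distr)
  next
    fix a x assume "a \<in> carrier KK" and x: "x \<in> carrier IV"
    then obtain c where c: "c \<in> Oc" "a = ck c" using KK_cases by blast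
    show "a \<odot>\<^bsub>IV\<^esub> x \<in> carrier IV" using c x smult by (simp add: IV_smult)
    fix b assume "b \<in> carrier KK"
    then obtain d where d: "d \<in> Oc" "b = ck d" using KK_cases by blast
    have xV: "x \<in> carrier VV" using x by (simp add: IV_carrier)
    show "(a \<oplus>\<^bsub>KK\<^esub> b) \<odot>\<^bsub>IV\<^esub> x = a \<odot>\<^bsub>IV\<^esub> x \<oplus>\<^bsub>IV\<^esub> b \<odot>\<^bsub>IV\<^esub> x"
      using c d x xV sm0.V.smult_l_distr[of c d x] by (simp add: ring IV_smult IV_simps(2))
    show "(a \<otimes>\<^bsub>KK\<^esub> b) \<odot>\<^bsub>IV\<^esub> x = a \<odot>\<^bsub>IV\<^esub> (b \<odot>\<^bsub>IV\<^esub> x)"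
      using c d x xV sm0.V.smult_assoc1[of c d x] smult by (simp add: ring IV_smult)
  next
    fix a x y assume "a \<in> carrier KK" and xy: "x \<in> carrier IV" "y \<in> carrier IV"
    then obtain c where c: "c \<in> Oc" "a = ck c" using KK_cases by blast
    show "a \<odot>\<^bsub>IV\<^esub> (x \<oplus>\<^bsub>IV\<^esub> y) = a \<odot>\<^bsub>IV\<^esub> x \<oplus>\<^bsub>IV\<^esub> a \<odot>\<^bsub>IV\<^esub> y"
      using c xy add[OF xy] sm0.V.smult_r_distr[of c x y] by (simp add: IV_smult) (simp add: IV_simps(2) IV_carrier)
  next
    fix x assume x: "x \<in> carrier IV"
    then show "\<one>\<^bsub>KK\<^esub> \<odot>\<^bsub>IV\<^esub> x = x" using sm0.V.smult_one[of x] by (simp add: ring IV_smult) (simp add: IV_carrier)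
  qed
  then show ?thesis using field by (simp add: vectorspace_def)
qed

text \<open>The action of k is induced from \<oo>, so a spanning set over k also spans over
  \<oo>.\<close>

lemma IV_generators:
  assumes "vectorspace.fin_dim KK IV"
  shows "\<exists>A. finite A \<and> A \<subseteq> carrier IV \<and> card A = vectorspace.dim KK IV \<and> carrier IV \<subseteq> rspan \<O> VV A"
proof -
  interpret K: vectorspace KK IV by (rule vectorspace_IV)
  obtain A0 where "finite A0" "A0 \<subseteq> carrier IV" "K.span A0 = carrier IV" using assms K.fin_dim_def by auto
  \<comment> \<open>\<open>dim\<close> is the least size of a finite spanning set, so this least
    size is attained.\<close>
  then have "\<exists>n A. finite A \<and> card A = n \<and> A \<subseteq> carrier IV \<and> K.span A = carrier IV" by blast
  then have "\<exists>A. finite A \<and> card A = K.dim \<and> A \<subseteq> carrier IV \<and> K.span A = carrier IV"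
    unfolding K.dim_def by (rule LeastI_ex)
  then obtain A where A: "finite A" "card A = K.dim" "A \<subseteq> carrier IV" "K.span A = carrier IV" by blast
  have "v \<in> rspan \<O> VV A" if v: "v \<in> K.span A" for v
  proof -
    obtain a B where B: "finite B" "B \<subseteq> A" "a \<in> B \<rightarrow> carrier KK" "v = K.lincomb a B"
      using v unfolding K.span_def by blast
    have "(\<Oplus>\<^bsub>IV\<^esub>w\<in>B. a w \<odot>\<^bsub>IV\<^esub> w) \<in> rspan \<O> VV A"
      using B(1-3)
    proof (induction B rule: finite_induct)
      case empty then show ?case using rspan.zero[of VV] by (simp add: IV_simps)
    next
      case (insert b B)
      have c: "a w \<odot>\<^bsub>IV\<^esub> w \<in> carrier IV" if "w \<in> insert b B" for w using insert.prems that A(3) by (intro K.smult_closed) auto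
      have "a b \<in> carrier KK" "b \<in> carrier IV" using insert.prems A(3) by auto
      then obtain e where e: "e \<in> Oc" "a b = ck e" using KK_cases by blast
      have "(\<Oplus>\<^bsub>IV\<^esub>w\<in>insert b B. a w \<odot>\<^bsub>IV\<^esub> w) = a b \<odot>\<^bsub>IV\<^esub> b \<oplus>\<^bsub>IV\<^esub> (\<Oplus>\<^bsub>IV\<^esub>w\<in>B. a w \<odot>\<^bsub>IV\<^esub> w)"
        using insert c by (intro K.finsum_insert) auto
      also have "\<dots> = e \<odot>\<^bsub>VV\<^esub> b \<oplus>\<^bsub>VV\<^esub> (\<Oplus>\<^bsub>IV\<^esub>w\<in>B. a w \<odot>\<^bsub>IV\<^esub> w)"
        unfolding e(2) IV_smult[OF e(1) \<open>b \<in> carrier IV\<close>] IV_simps(2) ..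
      also have "\<dots> \<in> rspan \<O> VV A"
        by (rule rspan.add[OF rspan.smult[OF e(1) rspan.incl]]) (use insert in auto)
      finally show ?case .
    qed
    then show ?thesis using B(4) by (simp add: K.lincomb_def)
  qed
  then show ?thesis using A by blast
qed

text \<open>The cardinalities pass down a chain: generators of the base change, of the dual up to S,
  of the invariants up to units modulo p_L, and a k-spanning set of the p_L-torsion of the
  invariants, which has \<open>dim\<close> elements.\<close>

theorem DD_generators:
  assumes art: "artinian_ring RJ" and fd: "vectorspace.fin_dim KK IV"
  shows "\<exists>S. S \<subseteq> carrier (DD p nrm emb pL J F) \<and> finite S \<and> card S \<le> vectorspace.dim KK IV \<and>
    LinearCombinations.module.span OEr (DD p nrm emb pL J F) S = carrier (DD p nrm emb pL J F)"
proof -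
  obtain s0 k where s0: "s0 \<in> Oc" "\<not> mm s0" "s0 * pL ^ k \<in> J" using artinian_annihilator[OF art] by blast
  have pO: "pL ^ k \<in> Oc" "s0 * pL ^ k \<in> Oc" using s0 by simp_all
  have cJ0: "cJ (s0 * pL ^ k) = \<zero>\<^bsub>RJ\<^esub>"
    using cJ_eq_iff[OF pO(2) O_zero] s0(3)
      ring_hom_zero[OF cJ_hom cring.axioms(1)[OF cring_O] cring.axioms(1)[OF cring_RJ]] by simp
  obtain A where A: "finite A" "A \<subseteq> carrier IV" "card A = vectorspace.dim KK IV" "carrier IV \<subseteq> rspan \<O> VV A"
    using IV_generators[OF fd] by blast
  have annV: "(s0 * pL ^ k) \<odot>\<^bsub>VV\<^esub> v = \<zero>\<^bsub>VV\<^esub>" if v: "v \<in> carrier VV" for v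
  proof -
    interpret M: Module.module RJ "Fx xp" by (rule module_vertex[OF xp_X0])
    show ?thesis using cJ0 VV_F[OF v] by (simp add: VV_simps)
  qed
  have tors: "{v \<in> carrier VV. pL \<odot>\<^bsub>VV\<^esub> v = \<zero>\<^bsub>VV\<^esub>} = carrier IV" by (auto simp: IV_carrier)
  obtain X where X: "X \<subseteq> carrier VV" "finite X" "card X \<le> card A"
    and gens: "\<And>v. v \<in> carrier VV \<Longrightarrow> \<exists>s\<in>Oc. \<not> mm s \<and> s \<odot>\<^bsub>VV\<^esub> v \<in> rspan \<O> VV X"
    using generators_over_O[OF module_VV s0(1,2) annV A(1), unfolded tors, OF _ A(2,4)] by blast
  have ann: "(s0 * pL ^ k) \<odot>\<^bsub>HO\<^esub> h = \<zero>\<^bsub>HO\<^esub>" if "h \<in> carrier HO" for h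
  proof -
    interpret M: Module.module RJ HH by (rule module_HH)
    show ?thesis using that cJ0 by (simp add: HO_simps)
  qed
  obtain G where G: "G \<subseteq> carrier sm.DM" "finite G" "card G \<le> card X"
      "\<And>d. d \<in> carrier sm.DM \<Longrightarrow> \<exists>s\<in>SS. s \<odot>\<^bsub>sm.DM\<^esub> d \<in> rspan Lam sm.DM G"
    using sm.generators_DM[OF X(2,1) gens s0(1,2) ann] by blast
  interpret T: tensor OEr Lam sm.DM toOE
    by (intro tensor.intro OE_facts(1) sm.module_DM tensor_axioms.intro OE_facts(2))
  have dense: "\<exists>s\<in>carrier Lam. (\<exists>u\<in>carrier OEr. toOE s \<otimes>\<^bsub>OEr\<^esub> u = \<one>\<^bsub>OEr\<^esub>) \<and> s \<odot>\<^bsub>sm.DM\<^esub> d \<in> rspan Lam sm.DM G"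
    if d: "d \<in> carrier sm.DM" for d
  proof -
    obtain s where s: "s \<in> SS" "s \<odot>\<^bsub>sm.DM\<^esub> d \<in> rspan Lam sm.DM G" using G(4)[OF d] by blast
    then show ?thesis using OE_facts(3)[OF s(1)] by (auto simp: SS_iff)
  qed
  have "\<exists>S. S \<subseteq> carrier (base_change OEr Lam toOE sm.DM) \<and> finite S \<and> card S \<le> card G \<and>
    LinearCombinations.module.span OEr (base_change OEr Lam toOE sm.DM) S = carrier (base_change OEr Lam toOE sm.DM)"
    by (rule T.base_change_span[OF G(2,1)]) (rule dense)
  then obtain S where S: "S \<subseteq> carrier (base_change OEr Lam toOE sm.DM)" "finite S" "card S \<le> card G"
    "LinearCombinations.module.span OEr (base_change OEr Lam toOE sm.DM) S = carrier (base_change OEr Lam toOE sm.DM)"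
    by (elim exE conjE) (rule that)
  have "card S \<le> vectorspace.dim KK IV" using S(3) G(3) X(3) A(3) by linarith
  then show ?thesis unfolding DD_def Ddual_eq using S(1,2,4) by (intro exI[of _ S] conjI)
qed

end

text \<open>A generating set of at most n elements amounts to a generating family of length n, since
  zeros may be added.\<close>

theorem theorem5p11:
  fixes p n :: nat
    and nrm :: "'q::field_char_0 \<Rightarrow> real"
    and emb :: "'q \<Rightarrow> 'l::field"
    and pL :: 'l
    and J :: "'l set"
    and F :: "('q, 'l set, 'm) coeff_sys"
  assumes "is_Qp p nrm"
    and "finite_extension emb"
    and "is_uniformizer (int_ring nrm emb) pL"
    and "ideal J (int_ring nrm emb)"
    and "artinian_ring (int_ring nrm emb Quot J)"
    and "equivariant_coefficient_system p nrm NTgrp (int_ring nrm emb Quot J) F"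
    and "Hyp1 p nrm F"
    and "Hyp2 p nrm F"
    and "Hyp3 p nrm F"
    and "vectorspace.fin_dim (residue_field (int_ring nrm emb) pL) (inv_space nrm emb pL J F)"
    and "vectorspace.dim (residue_field (int_ring nrm emb) pL) (inv_space nrm emb pL J F) = n"
  shows "\<exists>S. S \<subseteq> carrier (DD p nrm emb pL J F) \<and> finite S \<and> card S \<le> n \<and>
    LinearCombinations.module.span (OE p nrm emb pL) (DD p nrm emb pL J F) S = carrier (DD p nrm emb pL J F)"
proof -
  interpret coeff p nrm emb pL J F
    by (intro coeff.intro int_ext.intro qp.intro int_ext_axioms.intro coeff_axioms.intro assms)
  show ?thesis using DD_generators[OF assms(5,10)] assms(11) by simp
qed

end
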